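(* Let $p,k\in\mathbb{N}$, let $\lambda\vdash pk$ with $l(\lambda)\le p$, let $V$ be a finite dimensional complex vector space with $n:=\dim(V)\ge p$, and let $B=TU\subset\mathrm{GL}(V)$ be a Borel subgroup with maximal torus $T\cong(\mathbb{C}^* )^n$ and maximal unipotent subgroup $U$. Put $$T_\lambda:=\{t\in T: t_1^{\lambda_1}\cdots t_n^{\lambda_n}=1\},\qquad A_d:=(S^{dk}(V))^{\otimes p},\qquad B_d:=(A_d^U)^{T_\lambda}\qquad(d\ge 0),$$ and let $\beta:S_p\to\mathrm{Aut}\big(\bigoplus_{d\ge0}B_d\big)$ be the group homomorphism given by permuting the tensor factors, giving rise to representations $\beta_d:S_p\to\mathrm{GL}(B_d)$ for each $d\ge0$. Define $$PK:=\{\sigma\in S_p:\ \forall d\ge0\ \exists c\in\mathbb{C}^*:\ \beta_d(\sigma)=c\cdot\mathrm{id}\}.$$ If $PK=\{1\}$, then for every $\mu\vdash p$ $$\lim_{d\to\infty}\frac{f_\mu(d)}{\dim(B_d)}=\frac{\dim(V_\mu)}{p!},$$ where $f_\mu(d)$ is the multiplicity of $V_\mu$ in $B_d$.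
   Context: $\mathbb{N}$ denotes the positive integers. For a partition $\lambda$, $l(\lambda)$ is its number of nonzero parts, $\lambda\vdash m$ means $\lambda$ is a partition of $m$, and $\lambda$ is padded with zeros to have $n$ entries. $V_\mu$ is the irreducible complex $S_p$-representation (Specht module) corresponding to $\mu\vdash p$. Superscripts $U$ and $T_\lambda$ denote invariants. The direct sum $\bigoplus_{d\ge0}A_d=\bigoplus_{d\ge 0}(S^{dk}(V))^{\otimes p}$ is a commutative graded algebra with factorwise multiplication $(x_1\otimes\dots\otimes x_p)(y_1\otimes\dots\otimes y_p)=x_1y_1\otimes\dots\otimes x_py_p$. $\mathrm{GL}(V)$ acts on it diagonally, and $S_p$ acts on the right by $(x_1\otimes\dots\otimes x_p)\cdot\sigma=x_{\sigma(1)}\otimes\dots\otimes x_{\sigma(p)}$; the corresponding homomorphism is $\beta(\sigma)(x)=x\cdot\sigma^{-1}$. These actions commute and are by graded algebra automorphisms, so $S_p$ acts on the graded subalgebra $\bigoplus_{d\ge0}B_d$. *)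

theory Defs
  imports
    Complex_Main
    "HOL-Library.Function_Algebras"
    "HOL-Library.FuncSet"
    "HOL-Algebra.Sym_Groups"
begin

section \<open>Partitions\<close>

definition partition_of :: "nat \<Rightarrow> nat list \<Rightarrow> bool" where
  "partition_of m la \<longleftrightarrow> sorted_wrt (\<ge>) la \<and> (\<forall>x\<in>set la. 0 < x) \<and> sum_list la = m"

definition part :: "nat list \<Rightarrow> nat \<Rightarrow> nat" where
  "part la i = (if i < length la then la ! i else 0)"


section \<open>Complex vector spaces of functions\<close>

definition cscale :: "complex \<Rightarrow> ('x \<Rightarrow> complex) \<Rightarrow> 'x \<Rightarrow> complex" where
  "cscale c F = (\<lambda>x. c * F x)"

interpretation cfun: vector_space "cscale :: complex \<Rightarrow> ('x \<Rightarrow> complex) \<Rightarrow> 'x \<Rightarrow> complex"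
  by unfold_locales (auto simp: cscale_def fun_eq_iff algebra_simps)


section \<open>The group GL(V) and its Borel subgroups\<close>

text \<open>Throughout, V is the whole type \<open>'v\<close>, made into a complex vector space by \<open>scale\<close>.\<close>

definition GL :: "(complex \<Rightarrow> 'v::ab_group_add \<Rightarrow> 'v) \<Rightarrow> ('v \<Rightarrow> 'v) monoid" where
  "GL scale = \<lparr>carrier = {g. Vector_Spaces.linear scale scale g \<and> bij g}, mult = (\<circ>), one = id\<rparr>"

definition dual_space :: "(complex \<Rightarrow> 'v::ab_group_add \<Rightarrow> 'v) \<Rightarrow> ('v \<Rightarrow> complex) set" where
  "dual_space scale = {\<phi>. Vector_Spaces.linear scale (*) \<phi>}"

text \<open>Polynomials in the matrix coefficients. Since the determinant is invertible on GL(V),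
  allowing its inverse as well would not change the closed subsets of GL(V).\<close>

inductive_set regular_funs ::
    "(complex \<Rightarrow> 'v::ab_group_add \<Rightarrow> 'v) \<Rightarrow> (('v \<Rightarrow> 'v) \<Rightarrow> complex) set"
  for scale :: "complex \<Rightarrow> 'v::ab_group_add \<Rightarrow> 'v" where
  const: "(\<lambda>_. c) \<in> regular_funs scale"
| coeff: "\<phi> \<in> dual_space scale \<Longrightarrow> (\<lambda>g. \<phi> (g v)) \<in> regular_funs scale"
| add: "a \<in> regular_funs scale \<Longrightarrow> b \<in> regular_funs scale \<Longrightarrow> (\<lambda>g. a g + b g) \<in> regular_funs scale"
| mult: "a \<in> regular_funs scale \<Longrightarrow> b \<in> regular_funs scale \<Longrightarrow> (\<lambda>g. a g * b g) \<in> regular_funs scale"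

definition zariski_closed :: "(complex \<Rightarrow> 'v::ab_group_add \<Rightarrow> 'v) \<Rightarrow> ('v \<Rightarrow> 'v) set \<Rightarrow> bool" where
  "zariski_closed scale Z \<longleftrightarrow>
     (\<exists>P \<subseteq> regular_funs scale. Z = {g \<in> carrier (GL scale). \<forall>a\<in>P. a g = 0})"

text \<open>Connectedness of a closed subset: its relatively closed subsets are those closed in GL(V).\<close>

definition zariski_connected :: "(complex \<Rightarrow> 'v::ab_group_add \<Rightarrow> 'v) \<Rightarrow> ('v \<Rightarrow> 'v) set \<Rightarrow> bool" where
  "zariski_connected scale Z \<longleftrightarrow>
     \<not> (\<exists>Z1 Z2. zariski_closed scale Z1 \<and> zariski_closed scale Z2 \<and>
          Z1 \<noteq> {} \<and> Z2 \<noteq> {} \<and> Z1 \<inter> Z2 = {} \<and> Z1 \<union> Z2 = Z)"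

definition conn_closed_subgroup :: "(complex \<Rightarrow> 'v::ab_group_add \<Rightarrow> 'v) \<Rightarrow> ('v \<Rightarrow> 'v) set \<Rightarrow> bool" where
  "conn_closed_subgroup scale H \<longleftrightarrow>
     subgroup H (GL scale) \<and> zariski_closed scale H \<and> zariski_connected scale H"

definition conn_solvable_subgroup :: "(complex \<Rightarrow> 'v::ab_group_add \<Rightarrow> 'v) \<Rightarrow> ('v \<Rightarrow> 'v) set \<Rightarrow> bool" where
  "conn_solvable_subgroup scale H \<longleftrightarrow>
     conn_closed_subgroup scale H \<and> solvable (GL scale\<lparr>carrier := H\<rparr>)"

definition borel_subgroup :: "(complex \<Rightarrow> 'v::ab_group_add \<Rightarrow> 'v) \<Rightarrow> ('v \<Rightarrow> 'v) set \<Rightarrow> bool" where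
  "borel_subgroup scale B \<longleftrightarrow>
     conn_solvable_subgroup scale B \<and> (\<forall>H. conn_solvable_subgroup scale H \<and> B \<subseteq> H \<longrightarrow> H = B)"

definition simultaneously_diagonalizable ::
    "(complex \<Rightarrow> 'v::ab_group_add \<Rightarrow> 'v) \<Rightarrow> ('v \<Rightarrow> 'v) set \<Rightarrow> bool" where
  "simultaneously_diagonalizable scale H \<longleftrightarrow>
     (\<exists>E. \<not> module.dependent scale E \<and> module.span scale E = UNIV \<and>
          (\<forall>h\<in>H. \<forall>v\<in>E. \<exists>c. h v = scale c v))"

definition torus :: "(complex \<Rightarrow> 'v::ab_group_add \<Rightarrow> 'v) \<Rightarrow> ('v \<Rightarrow> 'v) set \<Rightarrow> bool" where
  "torus scale T \<longleftrightarrow> conn_closed_subgroup scale T \<and> simultaneously_diagonalizable scale T"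

definition maximal_torus ::
    "(complex \<Rightarrow> 'v::ab_group_add \<Rightarrow> 'v) \<Rightarrow> ('v \<Rightarrow> 'v) set \<Rightarrow> ('v \<Rightarrow> 'v) set \<Rightarrow> bool" where
  "maximal_torus scale B T \<longleftrightarrow>
     torus scale T \<and> T \<subseteq> B \<and> (\<forall>T'. torus scale T' \<and> T' \<subseteq> B \<and> T \<subseteq> T' \<longrightarrow> T' = T)"

definition unipotent_subgroup :: "(complex \<Rightarrow> 'v::ab_group_add \<Rightarrow> 'v) \<Rightarrow> ('v \<Rightarrow> 'v) set \<Rightarrow> bool" where
  "unipotent_subgroup scale U \<longleftrightarrow>
     subgroup U (GL scale) \<and> (\<forall>u\<in>U. \<exists>m. \<forall>v. ((\<lambda>w. u w - w) ^^ m) v = 0)"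

definition maximal_unipotent_subgroup ::
    "(complex \<Rightarrow> 'v::ab_group_add \<Rightarrow> 'v) \<Rightarrow> ('v \<Rightarrow> 'v) set \<Rightarrow> ('v \<Rightarrow> 'v) set \<Rightarrow> bool" where
  "maximal_unipotent_subgroup scale B U \<longleftrightarrow>
     unipotent_subgroup scale U \<and> U \<subseteq> B \<and>
     (\<forall>U'. unipotent_subgroup scale U' \<and> U' \<subseteq> B \<and> U \<subseteq> U' \<longrightarrow> U' = U)"

text \<open>
  The coordinates on T are the eigenvalues of its elements on a basis \<open>e 0, \<dots>, e (n - 1)\<close> in which
  T is diagonal and B is upper triangular. The triangularity fixes the order of the coordinates:
  it makes the character with exponents \<open>\<lambda>\<close> dominant with respect to B. Such a basis exists for
  every Borel subgroup B and maximal torus T of B, and is unique up to scaling its members.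
\<close>

definition adapted_basis ::
    "(complex \<Rightarrow> 'v::ab_group_add \<Rightarrow> 'v) \<Rightarrow> nat \<Rightarrow> ('v \<Rightarrow> 'v) set \<Rightarrow> ('v \<Rightarrow> 'v) set \<Rightarrow> (nat \<Rightarrow> 'v) \<Rightarrow> bool"
  where
  "adapted_basis scale n B T e \<longleftrightarrow>
     inj_on e {..<n} \<and> \<not> module.dependent scale (e ` {..<n}) \<and>
     module.span scale (e ` {..<n}) = UNIV \<and>
     (\<forall>t\<in>T. \<forall>i<n. \<exists>c. t (e i) = scale c (e i)) \<and>
     (\<forall>b\<in>B. \<forall>i<n. b (e i) \<in> module.span scale (e ` {..i}))"

definition torus_coord :: "(complex \<Rightarrow> 'v \<Rightarrow> 'v) \<Rightarrow> (nat \<Rightarrow> 'v) \<Rightarrow> nat \<Rightarrow> ('v \<Rightarrow> 'v) \<Rightarrow> complex" where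
  "torus_coord scale e i t = (THE c. t (e i) = scale c (e i))"

definition T_kernel ::
    "(complex \<Rightarrow> 'v \<Rightarrow> 'v) \<Rightarrow> nat \<Rightarrow> (nat \<Rightarrow> 'v) \<Rightarrow> ('v \<Rightarrow> 'v) set \<Rightarrow> nat list \<Rightarrow> ('v \<Rightarrow> 'v) set" where
  "T_kernel scale n e T la = {t \<in> T. (\<Prod>i<n. torus_coord scale e i t ^ part la i) = 1}"


section \<open>Symmetric powers and their tensor powers\<close>

text \<open>
  The symmetric power \<open>S\<^sup>m(V)\<close> is realized as the space of homogeneous polynomial functions of
  degree m on the dual space \<open>V\<^sup>*\<close>, which is faithful because the complex numbers are infinite:
  a vector v is the linear function \<open>\<phi> \<mapsto> \<phi>(v)\<close>, and the product \<open>v\<^sub>1 \<cdots> v\<^sub>m\<close> is the pointwise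
  product. Functions are defined on the type \<open>'v \<Rightarrow> complex\<close>; vectors, hence all elements of
  positive degree, vanish outside the dual space. The tensor product of function spaces is realized
  inside the functions of several arguments: \<open>x\<^sub>1 \<otimes> \<cdots> \<otimes> x\<^sub>p\<close> is the function
  \<open>(\<phi>\<^sub>1, \<dots>, \<phi>\<^sub>p) \<mapsto> x\<^sub>1(\<phi>\<^sub>1) \<cdots> x\<^sub>p(\<phi>\<^sub>p)\<close>. Only the arguments with index in \<open>{1..p}\<close> matter.
\<close>

definition vec_fun :: "(complex \<Rightarrow> 'v::ab_group_add \<Rightarrow> 'v) \<Rightarrow> 'v \<Rightarrow> ('v \<Rightarrow> complex) \<Rightarrow> complex" where
  "vec_fun scale v = (\<lambda>\<phi>. if \<phi> \<in> dual_space scale then \<phi> v else 0)"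

definition sym_power ::
    "(complex \<Rightarrow> 'v::ab_group_add \<Rightarrow> 'v) \<Rightarrow> nat \<Rightarrow> (('v \<Rightarrow> complex) \<Rightarrow> complex) set" where
  "sym_power scale m = cfun.span {\<Prod>j<m. vec_fun scale (v j) | v. True}"

definition tensor :: "nat \<Rightarrow> (nat \<Rightarrow> 'y \<Rightarrow> complex) \<Rightarrow> (nat \<Rightarrow> 'y) \<Rightarrow> complex" where
  "tensor p x = (\<lambda>\<phi>. \<Prod>i=1..p. x i (\<phi> i))"

definition tensor_power :: "nat \<Rightarrow> ('y \<Rightarrow> complex) set \<Rightarrow> ((nat \<Rightarrow> 'y) \<Rightarrow> complex) set" where
  "tensor_power p W = cfun.span {tensor p x | x. \<forall>i\<in>{1..p}. x i \<in> W}"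

definition gl_act_sym ::
    "('v \<Rightarrow> 'v) \<Rightarrow> (('v \<Rightarrow> complex) \<Rightarrow> complex) \<Rightarrow> ('v \<Rightarrow> complex) \<Rightarrow> complex" where
  "gl_act_sym g F = (\<lambda>\<phi>. F (\<phi> \<circ> g))"

definition gl_act ::
    "('v \<Rightarrow> 'v) \<Rightarrow> ((nat \<Rightarrow> 'v \<Rightarrow> complex) \<Rightarrow> complex) \<Rightarrow> (nat \<Rightarrow> 'v \<Rightarrow> complex) \<Rightarrow> complex" where
  "gl_act g F = (\<lambda>\<phi>. F (\<lambda>i. \<phi> i \<circ> g))"

definition right_act :: "((nat \<Rightarrow> 'y) \<Rightarrow> complex) \<Rightarrow> (nat \<Rightarrow> nat) \<Rightarrow> (nat \<Rightarrow> 'y) \<Rightarrow> complex" where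
  "right_act F \<sigma> = (\<lambda>\<phi>. F (\<phi> \<circ> inv' \<sigma>))"

definition left_act :: "(nat \<Rightarrow> nat) \<Rightarrow> ((nat \<Rightarrow> 'y) \<Rightarrow> complex) \<Rightarrow> (nat \<Rightarrow> 'y) \<Rightarrow> complex" where
  "left_act \<sigma> F = right_act F (inv' \<sigma>)"

text \<open>The lemmas of this section confirm the expected behaviour on generators.\<close>

lemma vec_fun_add: "vec_fun scale (v + w) = vec_fun scale v + vec_fun scale w"
  by (auto simp: vec_fun_def dual_space_def fun_eq_iff linear_iff_module_hom module_hom.add)

lemma vec_fun_scale: "vec_fun scale (scale c v) = cscale c (vec_fun scale v)"
  by (auto simp: vec_fun_def dual_space_def fun_eq_iff cscale_def linear_iff_module_hom module_hom.scale)

lemma gl_act_sym_vec_fun: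
  assumes g: "g \<in> carrier (GL scale)"
  shows "gl_act_sym g (vec_fun scale v) = vec_fun scale (g v)"
proof -
  have lin: "Vector_Spaces.linear scale scale g" and bij: "bij g"
    using g by (auto simp: GL_def)
  interpret g: Vector_Spaces.linear scale scale g by (rule lin)
  have lin': "Vector_Spaces.linear scale scale (inv' g)"
  proof (unfold_locales, goal_cases)
    case (1 a b)
    have "g (inv' g (a + b)) = g (inv' g a + inv' g b)"
      using bij by (simp add: g.add bij_is_surj surj_f_inv_f)
    then show ?case using bij by (meson bij_is_inj injD)
  next
    case (2 c a)
    have "g (inv' g (scale c a)) = g (scale c (inv' g a))"
      using bij by (simp add: g.scale bij_is_surj surj_f_inv_f)
    then show ?case using bij by (meson bij_is_inj injD)
  qed
  have "\<phi> \<circ> g \<in> dual_space scale \<longleftrightarrow> \<phi> \<in> dual_space scale" for \<phi>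
  proof
    assume "\<phi> \<circ> g \<in> dual_space scale"
    then have "Vector_Spaces.linear scale (*) ((\<phi> \<circ> g) \<circ> inv' g)"
      using Vector_Spaces.linear_compose[OF lin'] by (auto simp: dual_space_def)
    moreover have "(\<phi> \<circ> g) \<circ> inv' g = \<phi>"
      using bij by (simp add: fun_eq_iff bij_is_surj surj_f_inv_f)
    ultimately show "\<phi> \<in> dual_space scale" by (simp add: dual_space_def)
  next
    assume "\<phi> \<in> dual_space scale"
    then show "\<phi> \<circ> g \<in> dual_space scale"
      using Vector_Spaces.linear_compose[OF lin] by (auto simp: dual_space_def)
  qed
  then show ?thesis by (auto simp: gl_act_sym_def vec_fun_def fun_eq_iff)
qed

lemma gl_act_sym_mult: "gl_act_sym g (F * G) = gl_act_sym g F * gl_act_sym g G"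
  by (simp add: gl_act_sym_def fun_eq_iff)

lemma gl_act_tensor: "gl_act g (tensor p x) = tensor p (\<lambda>i. gl_act_sym g (x i))"
  by (simp add: gl_act_def gl_act_sym_def tensor_def)

lemma tensor_mult: "tensor p x * tensor p y = tensor p (\<lambda>i. x i * y i)"
  by (simp add: tensor_def fun_eq_iff prod.distrib)

lemma right_act_tensor:
  assumes "\<sigma> permutes {1..p}"
  shows "right_act (tensor p x) \<sigma> = tensor p (x \<circ> \<sigma>)"
proof
  fix \<phi>
  have "(\<Prod>i=1..p. x i (\<phi> (inv' \<sigma> i))) = (\<Prod>i=1..p. x (\<sigma> i) (\<phi> (inv' \<sigma> (\<sigma> i))))"
    by (rule prod.permute[OF assms, unfolded comp_def])
  then show "right_act (tensor p x) \<sigma> \<phi> = tensor p (x \<circ> \<sigma>) \<phi>"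
    using permutes_inverses(2)[OF assms] by (simp add: right_act_def tensor_def)
qed

lemma left_act_tensor:
  assumes "\<sigma> permutes {1..p}"
  shows "left_act \<sigma> (tensor p x) = tensor p (x \<circ> inv' \<sigma>)"
  unfolding left_act_def by (rule right_act_tensor[OF permutes_inv[OF assms]])

lemma left_act_comp:
  assumes "\<sigma> permutes {1..p}" and "\<tau> permutes {1..p}"
  shows "left_act (\<sigma> \<circ> \<tau>) F = left_act \<sigma> (left_act \<tau> F)"
  using permutes_inv_inv[OF assms(1)] permutes_inv_inv[OF assms(2)]
    permutes_inv_inv[OF permutes_compose[OF assms(2,1)]]
  by (simp add: left_act_def right_act_def comp_assoc)


section \<open>Representations of the symmetric group\<close>

text \<open>Every representation below is a space of functions of sequences, acted upon by
  \<open>left_act\<close>.\<close>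

definition sym_subrep :: "nat \<Rightarrow> ((nat \<Rightarrow> 'y) \<Rightarrow> complex) set \<Rightarrow> bool" where
  "sym_subrep p W \<longleftrightarrow>
     cfun.subspace W \<and> (\<forall>\<sigma>\<in>carrier (sym_group p). \<forall>F\<in>W. left_act \<sigma> F \<in> W)"

definition irreducible_rep :: "nat \<Rightarrow> ((nat \<Rightarrow> 'y) \<Rightarrow> complex) set \<Rightarrow> bool" where
  "irreducible_rep p W \<longleftrightarrow>
     sym_subrep p W \<and> W \<noteq> {0} \<and> (\<forall>X \<subseteq> W. sym_subrep p X \<longrightarrow> X = {0} \<or> X = W)"

definition isomorphic_reps ::
    "nat \<Rightarrow> ((nat \<Rightarrow> 'y) \<Rightarrow> complex) set \<Rightarrow> ((nat \<Rightarrow> 'z) \<Rightarrow> complex) set \<Rightarrow> bool" where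
  "isomorphic_reps p W W' \<longleftrightarrow>
     (\<exists>h. Vector_Spaces.linear cscale cscale h \<and> bij_betw h W W' \<and>
          (\<forall>\<sigma>\<in>carrier (sym_group p). \<forall>F\<in>W. h (left_act \<sigma> F) = left_act \<sigma> (h F)))"

definition irreducible_decomposition ::
    "nat \<Rightarrow> ((nat \<Rightarrow> 'y) \<Rightarrow> complex) set \<Rightarrow> nat \<Rightarrow> (nat \<Rightarrow> ((nat \<Rightarrow> 'y) \<Rightarrow> complex) set) \<Rightarrow> bool" where
  "irreducible_decomposition p W r X \<longleftrightarrow>
     (\<forall>i<r. irreducible_rep p (X i)) \<and>
     bij_betw (\<lambda>w. \<Sum>i<r. w i) (Pi\<^sub>E {..<r} X) W"

definition multiplicity_in ::
    "nat \<Rightarrow> ((nat \<Rightarrow> 'z) \<Rightarrow> complex) set \<Rightarrow> ((nat \<Rightarrow> 'y) \<Rightarrow> complex) set \<Rightarrow> nat" where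
  "multiplicity_in p S W =
     (THE m. \<exists>r X. irreducible_decomposition p W r X \<and> m = card {i. i < r \<and> isomorphic_reps p (X i) S})"

text \<open>
  A tableau of shape \<open>\<mu>\<close> assigns to each entry in \<open>{1..p}\<close> its cell (row, column). A tabloid is
  recorded by the rows of its entries, and the permutation module on the tabloids consists of
  functions of such row assignments; the tabloid itself is an indicator function.
\<close>

definition diagram :: "nat list \<Rightarrow> (nat \<times> nat) set" where
  "diagram mu = {(r, c). r < length mu \<and> c < mu ! r}"

definition is_tableau :: "nat \<Rightarrow> nat list \<Rightarrow> (nat \<Rightarrow> nat \<times> nat) \<Rightarrow> bool" where
  "is_tableau p mu t \<longleftrightarrow> bij_betw t {1..p} (diagram mu)"

definition tabloid :: "nat \<Rightarrow> (nat \<Rightarrow> nat \<times> nat) \<Rightarrow> (nat \<Rightarrow> nat) \<Rightarrow> complex" where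
  "tabloid p t = (\<lambda>\<rho>. if \<rho> = (\<lambda>i. if i \<in> {1..p} then fst (t i) else 0) then 1 else 0)"

definition column_stabilizer :: "nat \<Rightarrow> (nat \<Rightarrow> nat \<times> nat) \<Rightarrow> (nat \<Rightarrow> nat) set" where
  "column_stabilizer p t =
     {\<sigma> \<in> carrier (sym_group p). \<forall>i\<in>{1..p}. snd (t (\<sigma> i)) = snd (t i)}"

definition polytabloid :: "nat \<Rightarrow> (nat \<Rightarrow> nat \<times> nat) \<Rightarrow> (nat \<Rightarrow> nat) \<Rightarrow> complex" where
  "polytabloid p t =
     (\<Sum>\<sigma>\<in>column_stabilizer p t. cscale (of_int (sign \<sigma>)) (left_act \<sigma> (tabloid p t)))"

definition specht :: "nat \<Rightarrow> nat list \<Rightarrow> ((nat \<Rightarrow> nat) \<Rightarrow> complex) set" where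
  "specht p mu = cfun.span {polytabloid p t | t. is_tableau p mu t}"


section \<open>The invariant spaces\<close>

definition A_space ::
    "(complex \<Rightarrow> 'v::ab_group_add \<Rightarrow> 'v) \<Rightarrow> nat \<Rightarrow> nat \<Rightarrow> nat \<Rightarrow> ((nat \<Rightarrow> 'v \<Rightarrow> complex) \<Rightarrow> complex) set"
  where
  "A_space scale p k d = tensor_power p (sym_power scale (d * k))"

definition invariants ::
    "('v \<Rightarrow> 'v) set \<Rightarrow> ((nat \<Rightarrow> 'v \<Rightarrow> complex) \<Rightarrow> complex) set
      \<Rightarrow> ((nat \<Rightarrow> 'v \<Rightarrow> complex) \<Rightarrow> complex) set" where
  "invariants H W = {F \<in> W. \<forall>h\<in>H. gl_act h F = F}"

definition B_space ::
    "(complex \<Rightarrow> 'v::ab_group_add \<Rightarrow> 'v) \<Rightarrow> nat \<Rightarrow> nat \<Rightarrow> ('v \<Rightarrow> 'v) set \<Rightarrow> ('v \<Rightarrow> 'v) set \<Rightarrow> nat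
      \<Rightarrow> ((nat \<Rightarrow> 'v \<Rightarrow> complex) \<Rightarrow> complex) set" where
  "B_space scale p k U Tla d = invariants Tla (invariants U (A_space scale p k d))"

text \<open>The homomorphism \<open>\<beta>\<close> preserves the degree; its degree d component is \<open>left_act\<close> on the
  degree d part \<open>Bd d\<close>.\<close>

definition PK :: "nat \<Rightarrow> (nat \<Rightarrow> ((nat \<Rightarrow> 'y) \<Rightarrow> complex) set) \<Rightarrow> (nat \<Rightarrow> nat) set" where
  "PK p Bd = {\<sigma> \<in> carrier (sym_group p). \<forall>d. \<exists>c. c \<noteq> 0 \<and> (\<forall>F\<in>Bd d. left_act \<sigma> F = cscale c F)}"

end

theory Submission
  imports
    Defs
    "HOL-Computational_Algebra.Polynomial"
    "Jordan_Normal_Form.Determinant"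
begin

text \<open>
  In a basis adapted to B and T, an element of \<open>B\<^sub>d\<close> is a polynomial in the entries of a p x n matrix,
  homogeneous of degree dk in every row, invariant under right multiplication by unitriangular matrices and
  of weight \<open>d\<lambda>\<close>. Order monomials lexicographically. Leading exponents of such polynomials are the
  Gelfand-Tsetlin patterns (read as matrices), and every pattern is the leading exponent of a product of
  minors, so \<open>dim B\<^sub>d\<close> is the number of lattice points of the d-fold dilation of a polytope. Hence
  \<open>dim B\<^sub>d\<^sub>+\<^sub>D / dim B\<^sub>d\<close> tends to 1 for every D. If \<open>\<sigma>\<close> is not scalar on some \<open>B\<^sub>e\<close>, then
  multiplication by suitable products of two eigenvectors with different eigenvalues embeds the eigenspaces of
  \<open>\<sigma>\<close> on \<open>B\<^sub>d\<close> into those on \<open>B\<^sub>d\<^sub>+\<^sub>D\<close> in two ways that differ by a root of unity \<open>w \<noteq> 1\<close>, because the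
  algebra is a domain. So \<open>|w - 1| |tr \<sigma>| \<le> 2 (dim B\<^sub>d\<^sub>+\<^sub>D - dim B\<^sub>d)\<close>, and the normalized character of
  \<open>B\<^sub>d\<close> tends to the character of the regular representation divided by p!.
\<close>

section \<open>Finite-dimensional spaces of functions\<close>

text \<open>Triviality of \<open>PK\<close> only says that each \<sigma> \<noteq> 1 fails to be
  scalar in some degree e. The domain property turns this single failure into a bound on the trace
  in every degree. The factor 2 in the bound comes from using two embeddings, and the increment of
  the dimension appears because all eigenvalues have modulus 1 while multiplicities can only grow
  along an embedding. What remains is the growth over a fixed step D, for which a ratio tending to 1
  suffices; it follows from an elementary count of lattice points, without Hilbert polynomials or
  volumes. The main obstacle is the upper bound for the dimension: that a leading exponent must
  interlace is not visible from its definition and uses invariance under one elementary column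
  operation at a time. The converse needs only that every pattern splits into leading exponents of
  minors. Substituting powers of one variable t whose exponents are powers of a large base turns
  leading exponents into degrees, so all arguments take place in univariate polynomials. Invariance
  under \<open>T_kernel\<close> looks weaker than having weight d\<lambda>, but homogeneity fixes
  the total degree and with it the factor d.\<close>

abbreviation clinear :: "(('x \<Rightarrow> complex) \<Rightarrow> 'y \<Rightarrow> complex) \<Rightarrow> bool" where
  "clinear \<equiv> Vector_Spaces.linear cscale cscale"

abbreviation cfunctional :: "(('x \<Rightarrow> complex) \<Rightarrow> complex) \<Rightarrow> bool" where
  "cfunctional \<equiv> Vector_Spaces.linear cscale (*)"

interpretation cc: vector_space "(*) :: complex \<Rightarrow> complex \<Rightarrow> complex"
  by unfold_locales (auto simp: algebra_simps)

interpretation cpair: vector_space_pair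
  "cscale :: complex \<Rightarrow> ('x \<Rightarrow> complex) \<Rightarrow> 'x \<Rightarrow> complex"
  "cscale :: complex \<Rightarrow> ('y \<Rightarrow> complex) \<Rightarrow> 'y \<Rightarrow> complex"
  by unfold_locales

interpretation cfpair: vector_space_pair
  "cscale :: complex \<Rightarrow> ('x \<Rightarrow> complex) \<Rightarrow> 'x \<Rightarrow> complex" "(*) :: complex \<Rightarrow> complex \<Rightarrow> complex"
  by unfold_locales

lemma clinearI:
  assumes "\<And>x y. f (x + y) = f x + f y" "\<And>c x. f (cscale c x) = cscale c (f x)"
  shows "clinear f"
  using assms by (simp add: Vector_Spaces.linear_iff cfun.vector_space_axioms)

lemma cscale_apply: "cscale c F x = c * F x"
  by (simp add: cscale_def)

lemma sum_fun_apply: "(\<Sum>i\<in>I. F i) x = (\<Sum>i\<in>I. F i x)"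
  by (induction I rule: infinite_finite_induct) auto

text \<open>Coordinate functionals, indexed by the vectors of B and defined on the whole function
  space, so that linearity can be used without membership conditions.\<close>

definition dual_family :: "('x \<Rightarrow> complex) set \<Rightarrow> (('x \<Rightarrow> complex) \<Rightarrow> ('x \<Rightarrow> complex) \<Rightarrow> complex) \<Rightarrow> bool" where
  "dual_family B \<xi> \<longleftrightarrow> (\<forall>b. cfunctional (\<xi> b)) \<and> (\<forall>b\<in>B. \<forall>c\<in>B. \<xi> b c = (if b = c then 1 else 0))"

lemma dual_family_exists:
  assumes "cfun.independent B"
  shows "\<exists>\<xi>. dual_family B \<xi>"
proof -
  have "\<exists>g. cfunctional g \<and> (\<forall>c\<in>B. g c = (if b = c then 1 else 0))" for b
    using cfpair.linear_independent_extend[OF assms, of "\<lambda>c. if b = c then 1 else 0"] by blast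
  then obtain \<xi> where "\<forall>b. cfunctional (\<xi> b) \<and> (\<forall>c\<in>B. \<xi> b c = (if b = c then 1 else 0))"
    by metis
  then show ?thesis by (auto simp: dual_family_def)
qed

lemma dual_family_expand:
  assumes "finite B" "dual_family B \<xi>" "v \<in> cfun.span B"
  shows "v = (\<Sum>b\<in>B. cscale (\<xi> b v) b)"
proof -
  obtain u where v: "v = (\<Sum>b\<in>B. cscale (u b) b)"
    using assms(1,3) by (auto simp: cfun.span_finite)
  have "\<xi> b v = u b" if "b \<in> B" for b
  proof -
    have l: "cfunctional (\<xi> b)" using assms(2) by (simp add: dual_family_def)
    have "\<xi> b v = (\<Sum>c\<in>B. u c * \<xi> b c)"
      unfolding v using cfpair.linear_sum[OF l, of "\<lambda>c. cscale (u c) c" B] cfpair.linear_scale[OF l]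
      by simp
    also have "\<dots> = (\<Sum>c\<in>B. if b = c then u c else 0)"
      using assms(2) that by (intro sum.cong) (auto simp: dual_family_def)
    finally show ?thesis using assms(1) that by simp
  qed
  then show ?thesis using v by simp
qed

lemma dual_family_sum:
  assumes "dual_family B \<xi>"
  shows "\<xi> b (\<Sum>c\<in>A. cscale (u c) (g c)) = (\<Sum>c\<in>A. u c * \<xi> b (g c))"
proof -
  have l: "cfunctional (\<xi> b)" using assms by (simp add: dual_family_def)
  show ?thesis
    using cfpair.linear_sum[OF l, of "\<lambda>c. cscale (u c) (g c)" A] cfpair.linear_scale[OF l] by simp
qed

lemma clinear_expand:
  assumes "clinear f"
  shows "f (\<Sum>c\<in>A. cscale (u c) (g c)) = (\<Sum>c\<in>A. cscale (u c) (f (g c)))"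
  using cpair.linear_sum[OF assms, of "\<lambda>c. cscale (u c) (g c)" A] cpair.linear_scale[OF assms] by simp

definition fin_dim :: "('x \<Rightarrow> complex) set \<Rightarrow> bool" where
  "fin_dim W \<longleftrightarrow> cfun.subspace W \<and> (\<exists>B. finite B \<and> W \<subseteq> cfun.span B)"

definition basis_of :: "('x \<Rightarrow> complex) set \<Rightarrow> ('x \<Rightarrow> complex) set \<Rightarrow> bool" where
  "basis_of W B \<longleftrightarrow> finite B \<and> cfun.independent B \<and> cfun.span B = W"

lemma basis_ofD:
  assumes "basis_of W B"
  shows "finite B" "cfun.independent B" "cfun.span B = W" "B \<subseteq> W" "0 \<notin> B"
  using assms cfun.span_superset[of B] cfun.dependent_zero[of B] by (auto simp: basis_of_def)

lemma fin_dim_basis: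
  assumes "fin_dim W"
  obtains B where "basis_of W B"
proof -
  obtain C where C: "finite C" "W \<subseteq> cfun.span C" and W: "cfun.subspace W"
    using assms by (auto simp: fin_dim_def)
  obtain B where B: "B \<subseteq> W" "cfun.independent B" "W \<subseteq> cfun.span B"
    using cfun.maximal_independent_subset[of W] by metis
  have "finite B"
    using cfun.independent_span_bound[OF C(1) B(2)] B(1) C(2) by blast
  moreover have "cfun.span B = W"
    using B W by (metis cfun.span_subspace)
  ultimately show ?thesis using that B by (auto simp: basis_of_def)
qed

lemma basis_of_card: "basis_of W B \<Longrightarrow> card B = cfun.dim W"
  unfolding basis_of_def by (metis cfun.dim_span_eq_card_independent)

lemma basis_of_fin_dim: "basis_of W B \<Longrightarrow> fin_dim W"
  unfolding basis_of_def fin_dim_def by (metis cfun.subspace_span order_refl)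

lemma fin_dim_subset:
  assumes "fin_dim W" "X \<subseteq> W" "cfun.subspace X"
  shows "fin_dim X"
  using assms unfolding fin_dim_def by blast

lemma fin_dim_span: "finite B \<Longrightarrow> fin_dim (cfun.span B)"
  unfolding fin_dim_def by auto

lemma dim_le_of_inj:
  assumes "fin_dim W" "fin_dim W'" "clinear f" "f ` W \<subseteq> W'" "\<And>x. x \<in> W \<Longrightarrow> f x = 0 \<Longrightarrow> x = 0"
  shows "cfun.dim W \<le> cfun.dim W'"
proof -
  obtain B where B: "basis_of W B" using assms(1) fin_dim_basis by blast
  obtain C where C: "basis_of W' C" using assms(2) fin_dim_basis by blast
  have W: "cfun.span B = W" and ind: "cfun.independent B" using B by (auto simp: basis_of_def)
  have inj: "inj_on f (cfun.span B)"
    using assms(5) cpair.linear_inj_on_iff_eq_0[OF assms(3), of "cfun.span B"] W by auto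
  have i: "cfun.independent (f ` B)"
    using cpair.linear_independent_injective_image[OF assms(3) ind inj] .
  have BW: "B \<subseteq> W" using W cfun.span_superset by blast
  have "finite (f ` B) \<and> card (f ` B) \<le> card C"
    using cfun.independent_span_bound[OF _ i, of C] C assms(4) BW by (auto simp: basis_of_def)
  moreover have "card (f ` B) = card B"
    using inj cfun.span_superset by (metis card_image inj_on_subset)
  ultimately show ?thesis using basis_of_card[OF B] basis_of_card[OF C] by simp
qed

lemma dim_mono_fin_dim:
  assumes "fin_dim W'" "cfun.subspace W" "W \<subseteq> W'"
  shows "cfun.dim W \<le> cfun.dim W'"
  using assms fin_dim_subset[OF assms(1,3,2)]
  by (intro dim_le_of_inj[of W W' id]) (auto intro: clinearI)

lemma fin_dim_dim_eq:
  assumes "fin_dim W'" "cfun.subspace W" "W \<subseteq> W'" "cfun.dim W' \<le> cfun.dim W"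
  shows "W = W'"
proof (rule ccontr)
  assume "W \<noteq> W'"
  then obtain x where x: "x \<in> W'" "x \<notin> W" using assms(3) by auto
  obtain B where B: "basis_of W B" using fin_dim_subset[OF assms(1,3,2)] fin_dim_basis by blast
  obtain C where C: "basis_of W' C" using assms(1) fin_dim_basis by blast
  have "cfun.independent (insert x B)"
    using x(2) B cfun.independent_insertI[of x B] by (auto simp: basis_of_def)
  moreover have "insert x B \<subseteq> cfun.span C"
    using x B C assms(3) cfun.span_superset[of B] by (auto simp: basis_of_def)
  ultimately have "card (insert x B) \<le> card C"
    using cfun.independent_span_bound[of C] C by (auto simp: basis_of_def)
  moreover have "x \<notin> B" using x B cfun.span_superset[of B] by (auto simp: basis_of_def)
  ultimately show False
    using B assms(4) basis_of_card[OF B] basis_of_card[OF C] by (auto simp: basis_of_def)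
qed

section \<open>Traces of operators on finite-dimensional function spaces\<close>

definition trace_on :: "('x \<Rightarrow> complex) set \<Rightarrow> (('x \<Rightarrow> complex) \<Rightarrow> 'x \<Rightarrow> complex) \<Rightarrow> complex" where
  "trace_on W f = (let B = (SOME B. basis_of W B); \<xi> = (SOME \<xi>. dual_family B \<xi>) in \<Sum>b\<in>B. \<xi> b (f b))"

text \<open>Expanding b in C on the left and \<open>f c\<close> in B on the right turns both sides
  into the double sum of \<open>\<zeta> c b * \<xi> b (f c)\<close>.\<close>

lemma trace_basis_independent:
  assumes "basis_of W B" "dual_family B \<xi>" "basis_of W C" "dual_family C \<zeta>"
    and f: "clinear f" "f ` W \<subseteq> W"
  shows "(\<Sum>b\<in>B. \<xi> b (f b)) = (\<Sum>c\<in>C. \<zeta> c (f c))"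
proof -
  have fin: "finite B" "finite C" and sp: "cfun.span B = W" "cfun.span C = W"
    using assms(1,3) by (auto simp: basis_of_def)
  have BW: "B \<subseteq> W" "C \<subseteq> W" using sp cfun.span_superset by blast+
  have "(\<Sum>b\<in>B. \<xi> b (f b)) = (\<Sum>b\<in>B. \<Sum>c\<in>C. \<zeta> c b * \<xi> b (f c))"
  proof (rule sum.cong[OF refl])
    fix b assume b: "b \<in> B"
    have "b = (\<Sum>c\<in>C. cscale (\<zeta> c b) c)"
      using dual_family_expand[OF fin(2) assms(4)] b BW sp by blast
    then have "\<xi> b (f b) = \<xi> b (f (\<Sum>c\<in>C. cscale (\<zeta> c b) c))" by simp
    also have "\<dots> = (\<Sum>c\<in>C. \<zeta> c b * \<xi> b (f c))"
      by (simp add: clinear_expand[OF f(1)] dual_family_sum[OF assms(2)])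
    finally show "\<xi> b (f b) = (\<Sum>c\<in>C. \<zeta> c b * \<xi> b (f c))" .
  qed
  also have "\<dots> = (\<Sum>c\<in>C. \<Sum>b\<in>B. \<xi> b (f c) * \<zeta> c b)"
    by (subst sum.swap) (simp add: mult.commute)
  also have "\<dots> = (\<Sum>c\<in>C. \<zeta> c (f c))"
  proof (rule sum.cong[OF refl])
    fix c assume c: "c \<in> C"
    have "f c = (\<Sum>b\<in>B. cscale (\<xi> b (f c)) b)"
      using dual_family_expand[OF fin(1) assms(2)] c BW sp f(2) by blast
    then have "\<zeta> c (f c) = \<zeta> c (\<Sum>b\<in>B. cscale (\<xi> b (f c)) b)" by simp
    then show "(\<Sum>b\<in>B. \<xi> b (f c) * \<zeta> c b) = \<zeta> c (f c)"
      by (simp add: dual_family_sum[OF assms(4)])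
  qed
  finally show ?thesis .
qed

lemma trace_on_eq:
  assumes "basis_of W B" "dual_family B \<xi>" "clinear f" "f ` W \<subseteq> W"
  shows "trace_on W f = (\<Sum>b\<in>B. \<xi> b (f b))"
proof -
  define C where "C = (SOME B. basis_of W B)"
  define \<zeta> where "\<zeta> = (SOME \<xi>. dual_family C \<xi>)"
  have C: "basis_of W C" unfolding C_def using assms(1) by (rule someI)
  have "\<exists>\<xi>. dual_family C \<xi>" using C by (auto simp: basis_of_def intro: dual_family_exists)
  then have z: "dual_family C \<zeta>" unfolding \<zeta>_def by (rule someI_ex)
  have "trace_on W f = (\<Sum>b\<in>C. \<zeta> b (f b))"
    by (simp add: trace_on_def C_def \<zeta>_def Let_def)
  then show ?thesis using trace_basis_independent[OF C z assms] by simp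
qed

lemma trace_on_basis:
  assumes "fin_dim W"
  obtains B \<xi> where "basis_of W B" "dual_family B \<xi>"
proof -
  obtain B where B: "basis_of W B" using assms fin_dim_basis by blast
  then obtain \<xi> where "dual_family B \<xi>" using dual_family_exists by (auto simp: basis_of_def)
  then show ?thesis using B that by blast
qed

lemma trace_on_scalar:
  assumes "fin_dim W" "clinear f" "\<And>w. w \<in> W \<Longrightarrow> f w = cscale c w"
  shows "trace_on W f = c * of_nat (cfun.dim W)"
proof -
  obtain B \<xi> where B: "basis_of W B" and x: "dual_family B \<xi>"
    using trace_on_basis[OF assms(1)] by blast
  have BW: "B \<subseteq> W" using B cfun.span_superset by (auto simp: basis_of_def)
  have sub: "cfun.subspace W" using assms(1) by (simp add: fin_dim_def)
  have "f ` W \<subseteq> W" using assms(3) cfun.subspace_scale[OF sub] by auto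
  then have "trace_on W f = (\<Sum>b\<in>B. \<xi> b (f b))"
    using trace_on_eq[OF B x assms(2)] by simp
  also have "\<dots> = (\<Sum>b\<in>B. c)"
  proof (rule sum.cong[OF refl])
    fix b assume b: "b \<in> B"
    have "\<xi> b (f b) = \<xi> b (cscale c b)" using assms(3) b BW by auto
    also have "\<dots> = c * \<xi> b b" using x cfpair.linear_scale by (auto simp: dual_family_def)
    finally show "\<xi> b (f b) = c" using x b by (auto simp: dual_family_def)
  qed
  finally show ?thesis using basis_of_card[OF B] by simp
qed

text \<open>A bijective linear map transports bases, so intertwined maps have equal traces.\<close>

lemma trace_on_transport:
  assumes "fin_dim W" and h: "clinear h" "bij_betw h W W'"
    and f: "clinear f" "f ` W \<subseteq> W" and g: "clinear g" and hf: "\<And>w. w \<in> W \<Longrightarrow> h (f w) = g (h w)"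
  shows "trace_on W' g = trace_on W f"
proof -
  obtain B \<xi> where B: "basis_of W B" and x: "dual_family B \<xi>"
    using trace_on_basis[OF assms(1)] by blast
  have W: "cfun.span B = W" and ind: "cfun.independent B" and finB: "finite B"
    using B by (auto simp: basis_of_def)
  have BW: "B \<subseteq> W" using W cfun.span_superset by blast
  have inj: "inj_on h W" using h by (simp add: bij_betw_def)
  have B': "basis_of W' (h ` B)"
    using cpair.linear_independent_injective_image[OF h(1) ind] inj W finB
      cpair.linear_span_image[OF h(1), of B] h(2) by (auto simp: basis_of_def bij_betw_def)
  obtain \<zeta> where z: "dual_family (h ` B) \<zeta>"
    using B' dual_family_exists by (auto simp: basis_of_def)
  have g': "g ` W' \<subseteq> W'" 
  proof -
    have "g (h w) \<in> h ` W" if "w \<in> W" for w using hf[OF that] f(2) that by (metis image_eqI image_subset_iff)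
    then show ?thesis using h(2) unfolding bij_betw_def by blast
  qed
  have injB: "inj_on h B" using inj BW by (rule inj_on_subset)
  have "trace_on W' g = (\<Sum>b\<in>B. \<zeta> (h b) (g (h b)))"
    using trace_on_eq[OF B' z g g'] injB by (simp add: sum.reindex)
  also have "\<dots> = (\<Sum>b\<in>B. \<xi> b (f b))"
  proof (rule sum.cong[OF refl])
    fix b assume b: "b \<in> B"
    have fb: "f b = (\<Sum>c\<in>B. cscale (\<xi> c (f b)) c)"
      using dual_family_expand[OF finB x] f(2) b BW W by blast
    have "g (h b) = h (\<Sum>c\<in>B. cscale (\<xi> c (f b)) c)" using hf b BW fb by (metis subsetD)
    then have "\<zeta> (h b) (g (h b)) = (\<Sum>c\<in>B. \<xi> c (f b) * \<zeta> (h b) (h c))"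
      by (simp add: clinear_expand[OF h(1)] dual_family_sum[OF z])
    also have "\<dots> = (\<Sum>c\<in>B. if b = c then \<xi> c (f b) else 0)"
      using z b injB by (intro sum.cong) (auto simp: dual_family_def inj_on_def)
    finally show "\<zeta> (h b) (g (h b)) = \<xi> b (f b)" using finB b by simp
  qed
  finally show ?thesis using trace_on_eq[OF B x f] by simp
qed

section \<open>Additivity of trace and dimension\<close>

definition direct_sum :: "'i set \<Rightarrow> ('i \<Rightarrow> ('x \<Rightarrow> complex) set) \<Rightarrow> ('x \<Rightarrow> complex) set \<Rightarrow> bool" where
  "direct_sum I X W \<longleftrightarrow> finite I \<and> cfun.subspace W \<and> (\<forall>i\<in>I. cfun.subspace (X i) \<and> X i \<subseteq> W) \<and>
     (\<forall>w\<in>W. \<exists>x. (\<forall>i\<in>I. x i \<in> X i) \<and> w = (\<Sum>i\<in>I. x i)) \<and>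
     (\<forall>x. (\<forall>i\<in>I. x i \<in> X i) \<and> (\<Sum>i\<in>I. x i) = 0 \<longrightarrow> (\<forall>i\<in>I. x i = 0))"

lemma direct_sum_summand:
  assumes "direct_sum I X W" "i \<in> I"
  shows "cfun.subspace (X i)" "X i \<subseteq> W"
  using assms by (simp_all add: direct_sum_def)

lemma trace_on_direct_sum:
  assumes ds: "direct_sum I X W" and fd: "fin_dim W"
    and f: "clinear f" "\<And>i. i \<in> I \<Longrightarrow> f ` X i \<subseteq> X i"
  shows "trace_on W f = (\<Sum>i\<in>I. trace_on (X i) f)"
proof -
  note d = ds[unfolded direct_sum_def]
  note finI = conjunct1[OF d] and subW = conjunct1[OF conjunct2[OF d]]
  note sub = direct_sum_summand[OF ds]
  note ex = bspec[OF conjunct1[OF conjunct2[OF conjunct2[OF conjunct2[OF d]]]]]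
  note un' = conjunct2[OF conjunct2[OF conjunct2[OF conjunct2[OF d]]]]
  have un: "\<forall>i\<in>I. x i = 0" if "\<forall>i\<in>I. x i \<in> X i" "(\<Sum>i\<in>I. x i) = 0" for x
    using spec[OF un', of x] that by (rule mp[OF _ conjI])
  define B where "B = (\<lambda>i. SOME B. basis_of (X i) B)"
  have B: "basis_of (X i) (B i)" if i: "i \<in> I" for i
  proof -
    obtain B' where "basis_of (X i) B'"
      using fin_dim_basis[OF fin_dim_subset[OF fd sub(2)[OF i] sub(1)[OF i]]] .
    then show ?thesis unfolding B_def by (rule someI)
  qed
  note BX = basis_ofD(4)[OF B] and fin = basis_ofD(1)[OF B] and nz = basis_ofD(5)[OF B]
  have disj: "B i \<inter> B j = {}" if ij: "i \<in> I" "j \<in> I" "i \<noteq> j" for i j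
  proof (rule ccontr)
    assume "B i \<inter> B j \<noteq> {}"
    then obtain b where b: "b \<in> B i" "b \<in> B j" by blast
    \<comment> \<open>A vector b common to two of the bases would give a zero sum whose summands b
      and -b are not zero.\<close>
    define x where "x = (\<lambda>l. if l = i then b else if l = j then - b else 0)"
    have bi: "b \<in> X i" using b(1) BX[OF ij(1)] by (rule subsetD[rotated])
    have bj: "- b \<in> X j"
      by (rule cfun.subspace_neg[OF sub(1)[OF ij(2)] subsetD[OF BX[OF ij(2)] b(2)]])
    have 1: "\<forall>l\<in>I. x l \<in> X l"
    proof
      fix l assume l: "l \<in> I"
      show "x l \<in> X l"
        using bi bj cfun.subspace_0[OF sub(1)[OF l]] by (cases "l = i"; cases "l = j") (simp_all add: x_def)
    qed
    have "(\<Sum>l\<in>I. x l) = (\<Sum>l\<in>{i, j}. x l)"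
      by (rule sum.mono_neutral_right[OF finI]) (use ij in \<open>simp_all add: x_def\<close>)
    also have "\<dots> = x i + x j" using ij(3) by simp
    also have "\<dots> = 0" using ij(3) by (simp add: x_def)
    finally have "x i = 0" by (rule bspec[OF un[OF 1] ij(1)])
    moreover have "x i = b" by (simp add: x_def)
    ultimately show False using b(1) nz[OF ij(1)] by metis
  qed
  define C where "C = (\<Union>i\<in>I. B i)"
  have finC: "finite C" using finI fin by (auto simp: C_def)
  have sumC: "(\<Sum>b\<in>C. F b) = (\<Sum>i\<in>I. \<Sum>b\<in>B i. F b)" for F :: "_ \<Rightarrow> 'x \<Rightarrow> complex"
    unfolding C_def using finI fin disj by (intro sum.UNION_disjoint) auto
  have sumC': "(\<Sum>b\<in>C. F b) = (\<Sum>i\<in>I. \<Sum>b\<in>B i. F b)" for F :: "_ \<Rightarrow> complex"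
    unfolding C_def using finI fin disj by (intro sum.UNION_disjoint) auto
  have "cfun.independent C"
    unfolding cfun.dependent_finite[OF finC]
  proof (intro notI, elim exE conjE bexE)
    fix u b assume u: "(\<Sum>v\<in>C. cscale (u v) v) = 0" and b: "b \<in> C" "u b \<noteq> 0"
    define x where "x = (\<lambda>i. \<Sum>v\<in>B i. cscale (u v) v)"
    have "\<forall>i\<in>I. x i \<in> X i"
      unfolding x_def using BX sub
      by (auto intro!: cfun.subspace_sum cfun.subspace_scale)
    moreover have "(\<Sum>i\<in>I. x i) = 0" using u by (simp add: sumC x_def)
    ultimately have x0: "\<forall>i\<in>I. x i = 0" by (rule un)
    obtain i where i: "i \<in> I" "b \<in> B i" using b by (auto simp: C_def)
    have "cfun.dependent (B i)"
      unfolding cfun.dependent_finite[OF fin[OF i(1)]] using x0 i b(2) by (auto simp: x_def)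
    then show False using B[OF i(1)] by (simp add: basis_of_def)
  qed
  moreover have "cfun.span C = W"
  proof
    have "C \<subseteq> W" unfolding C_def using BX sub by blast
    then show "cfun.span C \<subseteq> W" using subW by (rule cfun.span_minimal)
    show "W \<subseteq> cfun.span C"
    proof
      fix w assume "w \<in> W"
      then obtain x where x: "\<forall>i\<in>I. x i \<in> X i" "w = (\<Sum>i\<in>I. x i)" using ex by blast
      have "x i \<in> cfun.span C" if "i \<in> I" for i
      proof -
        have "x i \<in> cfun.span (B i)" using x(1) B that by (auto simp: basis_of_def)
        moreover have "B i \<subseteq> C" using that by (auto simp: C_def)
        ultimately show ?thesis using cfun.span_mono by blast
      qed
      then show "w \<in> cfun.span C" unfolding x(2) by (rule cfun.span_sum)
    qed
  qed
  ultimately have CW: "basis_of W C" using finC by (simp add: basis_of_def)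
  obtain \<xi> where x: "dual_family C \<xi>" using dual_family_exists CW by (auto simp: basis_of_def)
  have xi: "dual_family (B i) \<xi>" if "i \<in> I" for i
    using x that by (auto simp: dual_family_def C_def)
  have fW: "f ` W \<subseteq> W"
  proof
    fix y assume "y \<in> f ` W"
    then obtain w where w: "w \<in> W" "y = f w" by auto
    then obtain x where x: "\<forall>i\<in>I. x i \<in> X i" "w = (\<Sum>i\<in>I. x i)" using ex by blast
    have "f w = (\<Sum>i\<in>I. f (x i))" unfolding x(2) by (rule cpair.linear_sum[OF f(1)])
    also have "\<dots> \<in> W"
    proof (rule cfun.subspace_sum[OF subW])
      fix i assume i: "i \<in> I"
      have "f (x i) \<in> X i" using f(2)[OF i] x(1) i by (simp add: image_subset_iff)
      then show "f (x i) \<in> W" using sub(2)[OF i] by (rule subsetD[rotated])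
    qed
    finally show "y \<in> W" using w by simp
  qed
  have "trace_on W f = (\<Sum>i\<in>I. \<Sum>b\<in>B i. \<xi> b (f b))"
    using trace_on_eq[OF CW x f(1) fW] sumC' by simp
  also have "\<dots> = (\<Sum>i\<in>I. trace_on (X i) f)"
    by (rule sum.cong[OF refl], rule trace_on_eq[OF B xi f(1) f(2), symmetric])
  finally show ?thesis .
qed

text \<open>The dimension is the trace of the identity, and the natural numbers embed into the
  complex numbers.\<close>

lemma dim_direct_sum:
  assumes ds: "direct_sum I X (W :: ('a \<Rightarrow> complex) set)" and fd: "fin_dim W"
  shows "cfun.dim W = (\<Sum>i\<in>I. cfun.dim (X i))"
proof -
  have id: "clinear (\<lambda>x. x)" by (rule clinearI) (rule refl)+
  have fx: "fin_dim (X i)" if "i \<in> I" for i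
    by (rule fin_dim_subset[OF fd direct_sum_summand(2)[OF ds that] direct_sum_summand(1)[OF ds that]])
  have t: "trace_on Y (\<lambda>x. x) = of_nat (cfun.dim Y)" if "fin_dim Y" for Y :: "('a \<Rightarrow> complex) set"
  proof -
    have e: "(\<lambda>x. x) w = cscale 1 w" for w :: "'a \<Rightarrow> complex" by (simp add: cscale_def)
    show ?thesis using trace_on_scalar[OF that id e] by (simp only: mult_1)
  qed
  have "trace_on W (\<lambda>x. x) = (\<Sum>i\<in>I. trace_on (X i) (\<lambda>x. x))"
    by (rule trace_on_direct_sum[OF ds fd id]) auto
  also have "\<dots> = of_nat (\<Sum>i\<in>I. cfun.dim (X i))" unfolding of_nat_sum by (rule sum.cong[OF refl t[OF fx]])
  finally have "(of_nat (cfun.dim W) :: complex) = of_nat (\<Sum>i\<in>I. cfun.dim (X i))"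
    by (simp only: t[OF fd])
  then show ?thesis by (simp only: of_nat_eq_iff)
qed

section \<open>Characters of the symmetric group\<close>

lemma left_act_apply:
  assumes "\<sigma> \<in> carrier (sym_group p)"
  shows "left_act \<sigma> F \<phi> = F (\<phi> \<circ> \<sigma>)"
  using assms by (simp add: left_act_def right_act_def sym_group_carrier permutes_inv_inv)

lemma clinear_left_act: "clinear (left_act \<sigma>)"
  by (intro clinearI) (auto simp: left_act_def right_act_def cscale_def)

lemma finite_sym_group: "finite (carrier (sym_group p))"
  by (simp add: sym_group_def finite_permutations)

lemma card_sym_group: "card (carrier (sym_group p)) = fact p"
  by (simp add: sym_group_def card_permutations)

lemma left_act_id: "left_act id F = F"
  by (simp add: left_act_def right_act_def)

lemma left_act_compose:
  assumes "\<sigma> \<in> carrier (sym_group p)" "\<tau> \<in> carrier (sym_group p)"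
  shows "left_act \<sigma> (left_act \<tau> F) = left_act (\<sigma> \<circ> \<tau>) F"
  using left_act_comp[of \<sigma> p \<tau> F] assms by (simp add: sym_group_carrier)

lemma sym_group_compose:
  "\<sigma> \<in> carrier (sym_group p) \<Longrightarrow> \<tau> \<in> carrier (sym_group p) \<Longrightarrow> \<sigma> \<circ> \<tau> \<in> carrier (sym_group p)"
  by (simp add: sym_group_carrier permutes_compose)

lemma left_act_inv:
  assumes "\<sigma> \<in> carrier (sym_group p)"
  shows "left_act (inv' \<sigma>) (left_act \<sigma> F) = F" "left_act \<sigma> (left_act (inv' \<sigma>) F) = F"
  using left_act_compose[OF sym_group_inv_closed[OF assms] assms]
    left_act_compose[OF assms sym_group_inv_closed[OF assms]] assms
  by (simp_all add: sym_group_carrier permutes_inv_o left_act_id)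

lemma sum_sym_group_translate:
  assumes "\<tau> \<in> carrier (sym_group p)"
  shows "(\<Sum>\<sigma>\<in>carrier (sym_group p). F (\<tau> \<circ> \<sigma>)) = (\<Sum>\<sigma>\<in>carrier (sym_group p). F \<sigma>)"
proof (rule sum.reindex_bij_witness[where i = "\<lambda>\<sigma>. inv' \<tau> \<circ> \<sigma>" and j = "\<lambda>\<sigma>. \<tau> \<circ> \<sigma>"])
  have t: "\<tau> \<circ> inv' \<tau> = id" "inv' \<tau> \<circ> \<tau> = id"
    using assms by (simp_all add: sym_group_carrier permutes_inv_o)
  fix \<sigma> :: "nat \<Rightarrow> nat"
  show "inv' \<tau> \<circ> (\<tau> \<circ> \<sigma>) = \<sigma>" "\<tau> \<circ> (inv' \<tau> \<circ> \<sigma>) = \<sigma>"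
    by (simp_all only: o_assoc t id_o)
  show "inv' \<tau> \<circ> \<sigma> \<in> carrier (sym_group p)" if "\<sigma> \<in> carrier (sym_group p)"
    using that assms by (intro sym_group_compose sym_group_inv_closed)
  show "\<tau> \<circ> \<sigma> \<in> carrier (sym_group p)" if "\<sigma> \<in> carrier (sym_group p)"
    using that assms by (intro sym_group_compose)
qed auto

section \<open>Schur's lemma\<close>

definition intertwines ::
    "nat \<Rightarrow> ((nat \<Rightarrow> 'y) \<Rightarrow> complex) set \<Rightarrow> (((nat \<Rightarrow> 'y) \<Rightarrow> complex) \<Rightarrow> (nat \<Rightarrow> 'z) \<Rightarrow> complex) \<Rightarrow> bool" where
  "intertwines p W f \<longleftrightarrow>
     clinear f \<and> (\<forall>\<sigma>\<in>carrier (sym_group p). \<forall>F\<in>W. f (left_act \<sigma> F) = left_act \<sigma> (f F))"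

lemma sym_subrepD:
  assumes "sym_subrep p W"
  shows "cfun.subspace W" "\<And>\<sigma> F. \<sigma> \<in> carrier (sym_group p) \<Longrightarrow> F \<in> W \<Longrightarrow> left_act \<sigma> F \<in> W"
  using assms by (auto simp: sym_subrep_def)

text \<open>The kernel is a subrepresentation of X, hence zero or everything; if it is zero, the
  image is a nonzero subrepresentation of S. The part of Schur's lemma about scalars is the separate
  condition \<open>scalar_endomorphisms\<close>.\<close>

lemma schur:
  assumes X: "irreducible_rep p X" and S: "irreducible_rep p S"
    and f: "intertwines p X f" "f ` X \<subseteq> S"
  shows "(\<forall>v\<in>X. f v = 0) \<or> bij_betw f X S"
proof -
  have lin: "clinear f" and com: "\<And>\<sigma> F. \<sigma> \<in> carrier (sym_group p) \<Longrightarrow> F \<in> X \<Longrightarrow> f (left_act \<sigma> F) = left_act \<sigma> (f F)"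
    using f(1) by (auto simp: intertwines_def)
  have subX: "sym_subrep p X" and irrX: "\<And>Y. Y \<subseteq> X \<Longrightarrow> sym_subrep p Y \<Longrightarrow> Y = {0} \<or> Y = X"
    using X by (simp_all add: irreducible_rep_def)
  have irrS: "\<And>Y. Y \<subseteq> S \<Longrightarrow> sym_subrep p Y \<Longrightarrow> Y = {0} \<or> Y = S"
    using S by (simp add: irreducible_rep_def)
  define K where "K = {v \<in> X. f v = 0}"
  have l0: "left_act \<sigma> (0 :: (nat \<Rightarrow> 'c) \<Rightarrow> complex) = 0" for \<sigma>
    by (rule cpair.linear_0[OF clinear_left_act])
  have "sym_subrep p K"
    unfolding sym_subrep_def K_def
  proof (intro conjI ballI cfun.subspaceI)
    show "0 \<in> {v \<in> X. f v = 0}"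
      using cfun.subspace_0[OF sym_subrepD(1)[OF subX]] cpair.linear_0[OF lin] by simp
  next
    fix x y assume "x \<in> {v \<in> X. f v = 0}" "y \<in> {v \<in> X. f v = 0}"
    then show "x + y \<in> {v \<in> X. f v = 0}"
      using cfun.subspace_add[OF sym_subrepD(1)[OF subX]] cpair.linear_add[OF lin] by simp
  next
    fix c x assume "x \<in> {v \<in> X. f v = 0}"
    then show "cscale c x \<in> {v \<in> X. f v = 0}"
      using cfun.subspace_scale[OF sym_subrepD(1)[OF subX]] cpair.linear_scale[OF lin] by simp
  next
    fix \<sigma> F assume "\<sigma> \<in> carrier (sym_group p)" "F \<in> {v \<in> X. f v = 0}"
    then show "left_act \<sigma> F \<in> {v \<in> X. f v = 0}"
      using sym_subrepD(2)[OF subX] com l0 by simp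
  qed
  then have "K = {0} \<or> K = X" by (intro irrX) (auto simp: K_def)
  moreover have "\<forall>v\<in>X. f v = 0" if "K = X" using that by (auto simp: K_def)
  moreover have "(\<forall>v\<in>X. f v = 0) \<or> bij_betw f X S" if K0: "K = {0}"
  proof -
    have "sym_subrep p (f ` X)"
      unfolding sym_subrep_def
    proof (intro conjI ballI)
      show "cfun.subspace (f ` X)" by (rule cpair.linear_subspace_image[OF lin sym_subrepD(1)[OF subX]])
      fix \<sigma> F assume s: "\<sigma> \<in> carrier (sym_group p)" "F \<in> f ` X"
      then obtain v where v: "v \<in> X" "F = f v" by blast
      then have "left_act \<sigma> F = f (left_act \<sigma> v)" using com s by simp
      then show "left_act \<sigma> F \<in> f ` X" using sym_subrepD(2)[OF subX s(1) v(1)] by (rule image_eqI)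
    qed
    then have "f ` X = {0} \<or> f ` X = S" by (rule irrS[OF f(2)])
    moreover have "inj_on f X"
      using cpair.linear_inj_on_iff_eq_0[OF lin sym_subrepD(1)[OF subX]] K0 by (auto simp: K_def)
    ultimately show ?thesis by (auto simp: bij_betw_def)
  qed
  ultimately show ?thesis by blast
qed

text \<open>The sum over the group of the conjugates of the rank one map \<open>v \<mapsto> \<zeta> v \<cdot> b\<close>.\<close>

definition averaged_rank_one ::
    "nat \<Rightarrow> (((nat \<Rightarrow> 'y) \<Rightarrow> complex) \<Rightarrow> complex) \<Rightarrow> ((nat \<Rightarrow> 'z) \<Rightarrow> complex)
      \<Rightarrow> ((nat \<Rightarrow> 'y) \<Rightarrow> complex) \<Rightarrow> (nat \<Rightarrow> 'z) \<Rightarrow> complex" where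
  "averaged_rank_one p \<zeta> b v =
     (\<Sum>\<sigma>\<in>carrier (sym_group p). cscale (\<zeta> (left_act (inv' \<sigma>) v)) (left_act \<sigma> b))"

lemma clinear_averaged_rank_one:
  assumes "cfunctional \<zeta>"
  shows "clinear (averaged_rank_one p \<zeta> b)"
proof (rule clinearI)
  note l = cpair.linear_add[OF clinear_left_act] cfpair.linear_add[OF assms]
    cpair.linear_scale[OF clinear_left_act] cfpair.linear_scale[OF assms]
  fix x y c
  show "averaged_rank_one p \<zeta> b (x + y) = averaged_rank_one p \<zeta> b x + averaged_rank_one p \<zeta> b y"
    by (simp add: averaged_rank_one_def l cfun.scale_left_distrib sum.distrib)
  show "averaged_rank_one p \<zeta> b (cscale c x) = cscale c (averaged_rank_one p \<zeta> b x)"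
    by (simp add: averaged_rank_one_def l cfun.scale_sum_right)
qed

lemma averaged_rank_one_left_act:
  assumes t: "\<tau> \<in> carrier (sym_group p)"
  shows "averaged_rank_one p \<zeta> b (left_act \<tau> v) = left_act \<tau> (averaged_rank_one p \<zeta> b v)"
proof -
  have "averaged_rank_one p \<zeta> b (left_act \<tau> v) =
      (\<Sum>\<sigma>\<in>carrier (sym_group p). cscale (\<zeta> (left_act (inv' (\<tau> \<circ> \<sigma>)) (left_act \<tau> v))) (left_act (\<tau> \<circ> \<sigma>) b))"
    unfolding averaged_rank_one_def
    by (rule sum_sym_group_translate[OF t, symmetric])
  also have "\<dots> = (\<Sum>\<sigma>\<in>carrier (sym_group p). cscale (\<zeta> (left_act (inv' \<sigma>) v)) (left_act \<tau> (left_act \<sigma> b)))"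
  proof (rule sum.cong[OF refl])
    fix \<sigma> assume s: "\<sigma> \<in> carrier (sym_group p)"
    have "inv' (\<tau> \<circ> \<sigma>) = inv' \<sigma> \<circ> inv' \<tau>"
      using s t by (intro o_inv_distrib) (auto simp: sym_group_carrier permutes_bij)
    then have "left_act (inv' (\<tau> \<circ> \<sigma>)) (left_act \<tau> v) = left_act (inv' \<sigma>) (left_act (inv' \<tau>) (left_act \<tau> v))"
      by (simp add: left_act_compose[OF sym_group_inv_closed[OF s] sym_group_inv_closed[OF t]])
    then show "cscale (\<zeta> (left_act (inv' (\<tau> \<circ> \<sigma>)) (left_act \<tau> v))) (left_act (\<tau> \<circ> \<sigma>) b) =
        cscale (\<zeta> (left_act (inv' \<sigma>) v)) (left_act \<tau> (left_act \<sigma> b))"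
      by (simp add: left_act_inv(1)[OF t] left_act_compose[OF t s])
  qed
  also have "\<dots> = left_act \<tau> (averaged_rank_one p \<zeta> b v)"
    by (simp add: averaged_rank_one_def clinear_expand[OF clinear_left_act])
  finally show ?thesis .
qed

lemma averaged_rank_one_in:
  assumes "sym_subrep p S" "b \<in> S"
  shows "averaged_rank_one p \<zeta> b v \<in> S"
  unfolding averaged_rank_one_def
  by (intro cfun.subspace_sum cfun.subspace_scale sym_subrepD[OF assms(1)] assms(2))

section \<open>Orthogonality of characters\<close>

definition character :: "((nat \<Rightarrow> 'y) \<Rightarrow> complex) set \<Rightarrow> (nat \<Rightarrow> nat) \<Rightarrow> complex" where
  "character W \<sigma> = trace_on W (left_act \<sigma>)"

text \<open>The inner product of characters, with \<open>inv' \<sigma>\<close> taking the place of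
  complex conjugation.\<close>

definition character_product ::
    "nat \<Rightarrow> ((nat \<Rightarrow> 'z) \<Rightarrow> complex) set \<Rightarrow> ((nat \<Rightarrow> 'y) \<Rightarrow> complex) set \<Rightarrow> complex" where
  "character_product p S W = (\<Sum>\<sigma>\<in>carrier (sym_group p). character S \<sigma> * character W (inv' \<sigma>)) / fact p"

lemma character_eq:
  assumes "sym_subrep p W" "basis_of W B" "dual_family B \<xi>" "\<sigma> \<in> carrier (sym_group p)"
  shows "character W \<sigma> = (\<Sum>b\<in>B. \<xi> b (left_act \<sigma> b))"
  unfolding character_def
  by (rule trace_on_eq[OF assms(2,3) clinear_left_act]) (use sym_subrepD(2)[OF assms(1,4)] in blast)

text \<open>Rewrites a product of traces as matrix coefficients of averaged rank one maps, which are
  intertwiners and therefore subject to Schur's lemma.\<close>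

lemma character_product_eq:
  assumes S: "sym_subrep p S" "basis_of S B" "dual_family B \<xi>"
    and X: "sym_subrep p X" "basis_of X C" "dual_family C \<zeta>"
  shows "character_product p S X = (\<Sum>b\<in>B. \<Sum>c\<in>C. \<xi> b (averaged_rank_one p (\<zeta> c) b c)) / fact p"
proof -
  have "(\<Sum>\<sigma>\<in>carrier (sym_group p). character S \<sigma> * character X (inv' \<sigma>)) =
     (\<Sum>\<sigma>\<in>carrier (sym_group p). \<Sum>b\<in>B. \<Sum>c\<in>C. \<xi> b (left_act \<sigma> b) * \<zeta> c (left_act (inv' \<sigma>) c))"
    by (intro sum.cong) (simp_all add: character_eq[OF S] character_eq[OF X] sym_group_inv_closed sum_product)
  also have "\<dots> = (\<Sum>b\<in>B. \<Sum>\<sigma>\<in>carrier (sym_group p). \<Sum>c\<in>C. \<xi> b (left_act \<sigma> b) * \<zeta> c (left_act (inv' \<sigma>) c))"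
    by (rule sum.swap)
  also have "\<dots> = (\<Sum>b\<in>B. \<Sum>c\<in>C. \<Sum>\<sigma>\<in>carrier (sym_group p). \<xi> b (left_act \<sigma> b) * \<zeta> c (left_act (inv' \<sigma>) c))"
    by (intro sum.cong refl sum.swap)
  also have "\<dots> = (\<Sum>b\<in>B. \<Sum>c\<in>C. \<xi> b (averaged_rank_one p (\<zeta> c) b c))"
    by (simp add: averaged_rank_one_def dual_family_sum[OF S(3)] mult.commute)
  finally show ?thesis by (simp add: character_product_def)
qed

text \<open>The half of Schur's lemma that is usually drawn from eigenvalues. For Specht modules it
  follows directly from the action of a column antisymmetrizer.\<close>

definition scalar_endomorphisms :: "nat \<Rightarrow> ((nat \<Rightarrow> 'z) \<Rightarrow> complex) set \<Rightarrow> bool" where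
  "scalar_endomorphisms p S \<longleftrightarrow>
     (\<forall>f. intertwines p S f \<and> f ` S \<subseteq> S \<longrightarrow> (\<exists>c. \<forall>v\<in>S. f v = cscale c v))"

text \<open>Each averaged map is a scalar s on S. Conjugation does not change the trace
  \<open>\<xi> c b\<close> of the rank one map, so comparing traces gives
  \<open>s * card B = fact p * \<xi> c b\<close>.\<close>

lemma character_product_self:
  assumes S: "irreducible_rep p S" and fd: "fin_dim S" and scal: "scalar_endomorphisms p S"
  shows "character_product p S S = 1"
proof -
  have rep: "sym_subrep p S" and S0: "S \<noteq> {0}" using S by (auto simp: irreducible_rep_def)
  obtain B \<xi> where B: "basis_of S B" and x: "dual_family B \<xi>" using trace_on_basis[OF fd] by blast
  note BD = basis_ofD[OF B]
  have dS: "cfun.dim S = card B" using basis_of_card[OF B] by simp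
  have "B \<noteq> {}" using S0 BD(3) by auto
  then have pos: "card B > 0" using BD(1) by (simp add: card_gt_0_iff)
  have fx: "cfunctional (\<xi> c)" for c using x by (simp add: dual_family_def)
  have key: "\<xi> b (averaged_rank_one p (\<xi> c) b c) = (if b = c then fact p / of_nat (card B) else 0)"
    if b: "b \<in> B" and c: "c \<in> B" for b c
  proof -
    define T where "T = averaged_rank_one p (\<xi> c) b"
    have lin: "clinear T" unfolding T_def by (rule clinear_averaged_rank_one[OF fx])
    have im: "T ` S \<subseteq> S"
      unfolding T_def using averaged_rank_one_in[OF rep] BD(4) b by blast
    have "intertwines p S T"
      unfolding intertwines_def using lin averaged_rank_one_left_act by (auto simp: T_def)
    then obtain s where s: "\<And>v. v \<in> S \<Longrightarrow> T v = cscale s v"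
      using scal im unfolding scalar_endomorphisms_def by blast
    have "s * of_nat (card B) = trace_on S T"
      using trace_on_scalar[OF fd lin s] dS by simp
    also have "\<dots> = (\<Sum>a\<in>B. \<xi> a (T a))" by (rule trace_on_eq[OF B x lin im])
    also have "\<dots> = (\<Sum>a\<in>B. \<Sum>\<sigma>\<in>carrier (sym_group p). \<xi> c (left_act (inv' \<sigma>) a) * \<xi> a (left_act \<sigma> b))"
      by (simp add: T_def averaged_rank_one_def dual_family_sum[OF x])
    also have "\<dots> = (\<Sum>\<sigma>\<in>carrier (sym_group p). \<Sum>a\<in>B. \<xi> a (left_act \<sigma> b) * \<xi> c (left_act (inv' \<sigma>) a))"
      by (subst sum.swap) (simp add: mult.commute)
    also have "\<dots> = (\<Sum>\<sigma>\<in>carrier (sym_group p). if b = c then 1 else 0)"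
    proof (rule sum.cong[OF refl])
      fix \<sigma> assume g: "\<sigma> \<in> carrier (sym_group p)"
      have "left_act \<sigma> b \<in> S" using sym_subrepD(2)[OF rep g] BD(4) b by blast
      then have e: "left_act \<sigma> b = (\<Sum>a\<in>B. cscale (\<xi> a (left_act \<sigma> b)) a)"
        using dual_family_expand[OF BD(1) x] BD(3) by blast
      have "(\<Sum>a\<in>B. \<xi> a (left_act \<sigma> b) * \<xi> c (left_act (inv' \<sigma>) a)) =
          \<xi> c (left_act (inv' \<sigma>) (\<Sum>a\<in>B. cscale (\<xi> a (left_act \<sigma> b)) a))"
        by (simp only: clinear_expand[OF clinear_left_act] dual_family_sum[OF x])
      also have "\<dots> = \<xi> c b" unfolding e[symmetric] left_act_inv(1)[OF g] ..
      also have "\<dots> = (if b = c then 1 else 0)" using x b c by (auto simp: dual_family_def)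
      finally show "(\<Sum>a\<in>B. \<xi> a (left_act \<sigma> b) * \<xi> c (left_act (inv' \<sigma>) a)) = (if b = c then 1 else 0)" .
    qed
    also have "\<dots> = (if b = c then fact p else 0)" by (simp add: card_sym_group)
    finally have "s = (if b = c then fact p / of_nat (card B) else 0)"
      using pos by (auto simp: field_simps)
    moreover have "\<xi> b (T c) = s * \<xi> b c"
      using s c BD(4) cfpair.linear_scale[OF fx] by auto
    ultimately show ?thesis using x b c by (auto simp: dual_family_def T_def)
  qed
  have "character_product p S S = (\<Sum>b\<in>B. \<Sum>c\<in>B. if b = c then fact p / of_nat (card B) else 0) / fact p"
    unfolding character_product_eq[OF rep B x rep B x] using key by simp
  also have "\<dots> = 1" using pos BD(1) \<open>B \<noteq> {}\<close> by simp
  finally show ?thesis .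
qed

text \<open>Isomorphic representations have equal characters; between non-isomorphic ones Schur's
  lemma makes every averaged rank one map vanish.\<close>

lemma character_product_irreducible:
  assumes S: "irreducible_rep p S" and fd: "fin_dim S" and scal: "scalar_endomorphisms p S"
    and X: "irreducible_rep p X" and fdX: "fin_dim X"
  shows "character_product p S X = (if isomorphic_reps p X S then 1 else 0)"
proof -
  have rep: "sym_subrep p S" and repX: "sym_subrep p X" using S X by (auto simp: irreducible_rep_def)
  show ?thesis
  proof (cases "isomorphic_reps p X S")
    case True
    then obtain h where h: "clinear h" "bij_betw h X S"
      "\<And>\<sigma> F. \<sigma> \<in> carrier (sym_group p) \<Longrightarrow> F \<in> X \<Longrightarrow> h (left_act \<sigma> F) = left_act \<sigma> (h F)"
      by (auto simp: isomorphic_reps_def)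
    have "character S \<sigma> = character X \<sigma>" if g: "\<sigma> \<in> carrier (sym_group p)" for \<sigma>
    proof -
      have X: "left_act \<sigma> ` X \<subseteq> X" using sym_subrepD(2)[OF repX g] by blast
      show ?thesis
        unfolding character_def
        by (rule trace_on_transport[where f = "left_act \<sigma>" and g = "left_act \<sigma>", OF fdX h(1,2) clinear_left_act X clinear_left_act h(3)[OF g]])
    qed
    then have "character_product p S X = character_product p S S"
      by (simp add: character_product_def sym_group_inv_closed)
    then show ?thesis using True character_product_self[OF S fd scal] by simp
  next
    case False
    obtain B \<xi> where B: "basis_of S B" and x: "dual_family B \<xi>" using trace_on_basis[OF fd] by blast
    obtain C \<zeta> where C: "basis_of X C" and z: "dual_family C \<zeta>" using trace_on_basis[OF fdX] by blast
    have "averaged_rank_one p (\<zeta> c) b c = 0" if b: "b \<in> B" and c: "c \<in> C" for b c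
    proof -
      have lin: "clinear (averaged_rank_one p (\<zeta> c) b)"
        using z by (intro clinear_averaged_rank_one) (simp add: dual_family_def)
      have t: "intertwines p X (averaged_rank_one p (\<zeta> c) b)"
        unfolding intertwines_def using lin averaged_rank_one_left_act by auto
      have im: "averaged_rank_one p (\<zeta> c) b ` X \<subseteq> S"
        using averaged_rank_one_in[OF rep] basis_ofD(4)[OF B] b by blast
      have "\<not> bij_betw (averaged_rank_one p (\<zeta> c) b) X S"
        using False t unfolding isomorphic_reps_def intertwines_def by blast
      then show ?thesis using schur[OF X S t im] basis_ofD(4)[OF C] c by blast
    qed
    then have "character_product p S X = (\<Sum>b\<in>B. \<Sum>c\<in>C. \<xi> b 0) / fact p"
      unfolding character_product_eq[OF rep B x repX C z] by simp
    also have "\<dots> = 0"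
    proof -
      have "\<xi> b 0 = 0" for b using x by (intro cfpair.linear_0) (simp add: dual_family_def)
      then show ?thesis by simp
    qed
    finally show ?thesis using False by simp
  qed
qed

lemma irreducible_decomposition_direct_sum:
  assumes d: "irreducible_decomposition p W r X" and W: "cfun.subspace W"
  shows "direct_sum {..<r} X W"
proof -
  have sX: "cfun.subspace (X i)" if "i < r" for i
    using d that by (auto simp: irreducible_decomposition_def irreducible_rep_def sym_subrep_def)
  have bij: "bij_betw (\<lambda>w. \<Sum>i<r. w i) (Pi\<^sub>E {..<r} X) W"
    using d by (simp add: irreducible_decomposition_def)
  have XW: "X i \<subseteq> W" if i: "i < r" for i
  proof
    fix v assume v: "v \<in> X i"
    define w where "w = (\<lambda>j\<in>{..<r}. if j = i then v else 0)"
    have "w \<in> Pi\<^sub>E {..<r} X"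
      using v cfun.subspace_0[OF sX] by (simp add: w_def)
    then have "(\<Sum>j<r. w j) \<in> W" using bij_betwE[OF bij] by blast
    moreover have "(\<Sum>j<r. w j) = (\<Sum>j<r. if j = i then v else 0)"
      by (rule sum.cong) (simp_all add: w_def)
    ultimately show "v \<in> W" using i by simp
  qed
  show ?thesis
    unfolding direct_sum_def
  proof (intro conjI ballI allI impI)
    fix i assume "i \<in> {..<r}"
    then show "cfun.subspace (X i)" "X i \<subseteq> W" using sX XW by simp_all
  next
    fix w assume "w \<in> W"
    then obtain u where u: "u \<in> Pi\<^sub>E {..<r} X" "w = (\<Sum>i<r. u i)"
      using bij by (auto simp: bij_betw_def)
    then show "\<exists>x. (\<forall>i\<in>{..<r}. x i \<in> X i) \<and> w = (\<Sum>i<r. x i)"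
      by (intro exI[of _ u]) auto
  next
    fix x i assume x: "(\<forall>i\<in>{..<r}. x i \<in> X i) \<and> (\<Sum>i<r. x i) = 0" and i: "i \<in> {..<r}"
    \<comment> \<open>Both families are cut off outside \<open>{..<r}\<close>, since the injectivity
      in the decomposition concerns extensional families only.\<close>
    define u where "u = restrict x {..<r}"
    define v where "v = restrict (\<lambda>_. 0 :: (nat \<Rightarrow> 'a) \<Rightarrow> complex) {..<r}"
    have "u \<in> Pi\<^sub>E {..<r} X" using x by (auto simp: u_def)
    moreover have "v \<in> Pi\<^sub>E {..<r} X" using cfun.subspace_0[OF sX] by (auto simp: v_def)
    moreover have "(\<Sum>i<r. u i) = (\<Sum>i<r. v i)" using x by (simp add: u_def v_def)
    ultimately have "u = v" using bij unfolding bij_betw_def inj_on_def by blast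
    then have "u i = v i" by simp
    then show "x i = 0" using i by (simp add: u_def v_def)
  qed (use W in auto)
qed

text \<open>Characters add over the summands, and each summand contributes 1 or 0. The right hand
  side does not mention the decomposition, so the count is the same for all of them.\<close>

lemma multiplicity_of_decomposition:
  assumes S: "irreducible_rep p S" "fin_dim S" "scalar_endomorphisms p S"
    and W: "sym_subrep p W" "fin_dim W" and d: "irreducible_decomposition p W r X"
  shows "of_nat (card {i. i < r \<and> isomorphic_reps p (X i) S}) = character_product p S W"
proof -
  have ds: "direct_sum {..<r} X W"
    by (rule irreducible_decomposition_direct_sum[OF d sym_subrepD(1)[OF W(1)]])
  have irr: "irreducible_rep p (X i)" if "i < r" for i
    using d that by (simp add: irreducible_decomposition_def)
  have rep: "sym_subrep p (X i)" if "i < r" for i using irr[OF that] by (simp add: irreducible_rep_def)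
  have fd: "fin_dim (X i)" if "i < r" for i
    by (rule fin_dim_subset[OF W(2)]) (use direct_sum_summand[OF ds] that in simp_all)
  have "character W \<sigma> = (\<Sum>i<r. character (X i) \<sigma>)" if g: "\<sigma> \<in> carrier (sym_group p)" for \<sigma>
    unfolding character_def
    by (rule trace_on_direct_sum[OF ds W(2) clinear_left_act]) (use sym_subrepD(2)[OF rep g] in blast)
  then have "character_product p S W =
      (\<Sum>\<sigma>\<in>carrier (sym_group p). \<Sum>i<r. character S \<sigma> * character (X i) (inv' \<sigma>)) / fact p"
    by (simp add: character_product_def sym_group_inv_closed sum_distrib_left)
  also have "\<dots> = (\<Sum>i<r. character_product p S (X i))"
    by (subst sum.swap) (simp add: character_product_def sum_divide_distrib)
  also have "\<dots> = (\<Sum>i<r. if isomorphic_reps p (X i) S then 1 else 0)"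
    by (rule sum.cong[OF refl], rule character_product_irreducible[OF S irr fd]) simp_all
  also have "\<dots> = of_nat (card ({..<r} \<inter> {i. isomorphic_reps p (X i) S}))"
    by (simp add: sum.If_cases)
  also have "{..<r} \<inter> {i. isomorphic_reps p (X i) S} = {i. i < r \<and> isomorphic_reps p (X i) S}"
    by auto
  finally show ?thesis by simp
qed

text \<open>A nonzero subrepresentation of least dimension works: a nonzero one inside it has the
  same dimension and so equals it.\<close>

lemma irreducible_subrep_exists:
  assumes W: "sym_subrep p W" "fin_dim W" "W \<noteq> {0}"
  obtains X where "irreducible_rep p X" "X \<subseteq> W"
proof -
  define P where "P X \<longleftrightarrow> sym_subrep p X \<and> X \<subseteq> W \<and> X \<noteq> {0}" for X
  have "P W" using W by (simp add: P_def)
  then have "P (ARG_MIN cfun.dim X. P X)" by (rule arg_min_natI)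
  moreover have min: "cfun.dim (ARG_MIN cfun.dim X. P X) \<le> cfun.dim Y" if "P Y" for Y
    using that by (rule arg_min_nat_le)
  ultimately obtain X where X: "P X" and le: "\<And>Y. P Y \<Longrightarrow> cfun.dim X \<le> cfun.dim Y" by blast
  have XW: "X \<subseteq> W" and rX: "sym_subrep p X" and X0: "X \<noteq> {0}" using X by (simp_all add: P_def)
  have fdX: "fin_dim X" by (rule fin_dim_subset[OF W(2) XW sym_subrepD(1)[OF rX]])
  have "Y = {0} \<or> Y = X" if Y: "Y \<subseteq> X" "sym_subrep p Y" for Y
  proof (cases "Y = {0}")
    case False
    then have "P Y" using Y XW by (auto simp: P_def)
    then show ?thesis using fin_dim_dim_eq[OF fdX sym_subrepD(1)[OF Y(2)] Y(1) le] by blast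
  qed simp
  then have "irreducible_rep p X" using rX X0 by (simp add: irreducible_rep_def)
  then show ?thesis using that XW by blast
qed

text \<open>Maschke's theorem: the projection \<open>\<Sum>b. \<xi> b v \<cdot> b\<close> onto X,
  averaged over the group. It is defined on all functions, so one P serves for every representation
  containing X.\<close>

lemma averaged_projection_exists:
  assumes W: "fin_dim X" "sym_subrep p X"
  obtains P where "clinear P" "\<And>v. P v \<in> X" "\<And>v. v \<in> X \<Longrightarrow> P v = v"
    "\<And>\<sigma> v. \<sigma> \<in> carrier (sym_group p) \<Longrightarrow> P (left_act \<sigma> v) = left_act \<sigma> (P v)"
proof -
  obtain B \<xi> where B: "basis_of X B" and x: "dual_family B \<xi>" using trace_on_basis[OF W(1)] by blast
  note BD = basis_ofD[OF B]
  have fx: "cfunctional (\<xi> c)" for c using x by (simp add: dual_family_def)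
  define P where "P v = (\<Sum>b\<in>B. cscale (1 / fact p) (averaged_rank_one p (\<xi> b) b v))" for v
  have lin: "clinear P"
    unfolding P_def
    by (intro cpair.linear_compose_sum ballI cpair.linear_compose_scale_right clinear_averaged_rank_one fx)
  have 1: "P v \<in> X" for v
    unfolding P_def
    by (intro cfun.subspace_sum cfun.subspace_scale sym_subrepD(1)[OF W(2)] averaged_rank_one_in[OF W(2)])
      (use BD(4) in blast)
  have 2: "P v = v" if v: "v \<in> X" for v
  proof -
    have "(\<Sum>b\<in>B. averaged_rank_one p (\<xi> b) b v) =
        (\<Sum>\<sigma>\<in>carrier (sym_group p). \<Sum>b\<in>B. cscale (\<xi> b (left_act (inv' \<sigma>) v)) (left_act \<sigma> b))"
      unfolding averaged_rank_one_def by (rule sum.swap)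
    also have "\<dots> = (\<Sum>\<sigma>\<in>carrier (sym_group p). v)"
    proof (rule sum.cong[OF refl])
      fix \<sigma> assume g: "\<sigma> \<in> carrier (sym_group p)"
      have "left_act (inv' \<sigma>) v \<in> cfun.span B"
        using sym_subrepD(2)[OF W(2) sym_group_inv_closed[OF g] v] BD(3) by blast
      then have e: "left_act (inv' \<sigma>) v = (\<Sum>b\<in>B. cscale (\<xi> b (left_act (inv' \<sigma>) v)) b)"
        by (rule dual_family_expand[OF BD(1) x])
      have "(\<Sum>b\<in>B. cscale (\<xi> b (left_act (inv' \<sigma>) v)) (left_act \<sigma> b)) = left_act \<sigma> (left_act (inv' \<sigma>) v)"
        by (subst (2) e) (simp only: clinear_expand[OF clinear_left_act])
      then show "(\<Sum>b\<in>B. cscale (\<xi> b (left_act (inv' \<sigma>) v)) (left_act \<sigma> b)) = v"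
        by (simp only: left_act_inv(2)[OF g])
    qed
    also have "\<dots> = cscale (fact p) v"
    proof
      fix \<phi> show "(\<Sum>\<sigma>\<in>carrier (sym_group p). v) \<phi> = cscale (fact p) v \<phi>"
        unfolding sum_fun_apply cscale_apply by (simp add: card_sym_group)
    qed
    finally show ?thesis
      unfolding P_def by (simp add: cfun.scale_sum_right[symmetric])
  qed
  have 3: "P (left_act \<sigma> v) = left_act \<sigma> (P v)" if "\<sigma> \<in> carrier (sym_group p)" for \<sigma> v
    unfolding P_def
    by (simp add: averaged_rank_one_left_act[OF that] cpair.linear_sum[OF clinear_left_act]
        cpair.linear_scale[OF clinear_left_act])
  show ?thesis using that[OF lin 1 2 3] by blast
qed

lemma irreducible_decomposition_exists:
  assumes "sym_subrep p W" "fin_dim W"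
  shows "\<exists>r X. irreducible_decomposition p W r X"
  using assms
proof (induction "cfun.dim W" arbitrary: W rule: less_induct)
  case less
  show ?case
  proof (cases "W = {0}")
    case True
    then have "irreducible_decomposition p W 0 (\<lambda>_. {})"
      by (simp add: irreducible_decomposition_def bij_betw_def)
    then show ?thesis by blast
  next
    case False
    obtain Z where Z: "irreducible_rep p Z" "Z \<subseteq> W"
      using irreducible_subrep_exists[OF less.prems False] by blast
    have rZ: "sym_subrep p Z" and Z0: "Z \<noteq> {0}" using Z(1) by (simp_all add: irreducible_rep_def)
    have fdZ: "fin_dim Z" by (rule fin_dim_subset[OF less.prems(2) Z(2) sym_subrepD(1)[OF rZ]])
    obtain P where P: "clinear P" "\<And>v. P v \<in> Z" "\<And>v. v \<in> Z \<Longrightarrow> P v = v"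
      "\<And>\<sigma> v. \<sigma> \<in> carrier (sym_group p) \<Longrightarrow> P (left_act \<sigma> v) = left_act \<sigma> (P v)"
      using averaged_projection_exists[OF fdZ rZ] by metis
    note sW = sym_subrepD(1)[OF less.prems(1)]
    \<comment> \<open>The invariant complement of Z in W. It is strictly smaller than W because P is
      the identity on Z.\<close>
    define Y where "Y = {w \<in> W. P w = 0}"
    have YW: "Y \<subseteq> W" by (auto simp: Y_def)
    have sY: "cfun.subspace Y"
    proof (rule cfun.subspaceI)
      show "0 \<in> Y" using cfun.subspace_0[OF sW] cpair.linear_0[OF P(1)] by (simp add: Y_def)
      show "x + y \<in> Y" if "x \<in> Y" "y \<in> Y" for x y
        using that cfun.subspace_add[OF sW] cpair.linear_add[OF P(1)] by (simp add: Y_def)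
      show "cscale c x \<in> Y" if "x \<in> Y" for c x
        using that cfun.subspace_scale[OF sW] cpair.linear_scale[OF P(1)] by (simp add: Y_def)
    qed
    have l0: "left_act \<sigma> (0 :: (nat \<Rightarrow> 'a) \<Rightarrow> complex) = 0" for \<sigma>
      by (rule cpair.linear_0[OF clinear_left_act])
    have rY: "sym_subrep p Y"
      using sY sym_subrepD(2)[OF less.prems(1)] P(4) l0 by (simp add: sym_subrep_def Y_def)
    have "Y \<noteq> W"
    proof
      assume "Y = W"
      have "v = 0" if "v \<in> Z" for v
      proof -
        have "v \<in> Y" using subsetD[OF Z(2) that] \<open>Y = W\<close> by simp
        then show ?thesis using P(3)[OF that] by (simp add: Y_def)
      qed
      then show False using Z0 cfun.subspace_0[OF sym_subrepD(1)[OF rZ]] by blast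
    qed
    then have "cfun.dim Y < cfun.dim W"
      using fin_dim_dim_eq[OF less.prems(2) sY YW] by linarith
    then obtain r X where d: "irreducible_decomposition p Y r X"
      using less.hyps[OF _ rY fin_dim_subset[OF less.prems(2) YW sY]] by blast
    have irr: "irreducible_rep p (X i)" if "i < r" for i
      using d that by (simp add: irreducible_decomposition_def)
    have bij: "bij_betw (\<lambda>w. \<Sum>i<r. w i) (Pi\<^sub>E {..<r} X) Y"
      using d by (simp add: irreducible_decomposition_def)
    define X' where "X' = X(r := Z)"
    have X': "X' r = Z" "\<And>i. i < r \<Longrightarrow> X' i = X i" by (simp_all add: X'_def)
    have part: "restrict u {..<r} \<in> Pi\<^sub>E {..<r} X" "(\<Sum>i<r. restrict u {..<r} i) = (\<Sum>i<r. u i)"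
      "(\<Sum>i<r. u i) \<in> Y" "u r \<in> Z"
      if u: "u \<in> Pi\<^sub>E {..<Suc r} X'" for u
    proof -
      show 1: "restrict u {..<r} \<in> Pi\<^sub>E {..<r} X"
      proof (rule restrict_PiE_iff[THEN iffD2], rule ballI)
        fix i assume "i \<in> {..<r}"
        then show "u i \<in> X i" using PiE_mem[OF u, of i] X'(2)[of i] by simp
      qed
      show 2: "(\<Sum>i<r. restrict u {..<r} i) = (\<Sum>i<r. u i)" by simp
      show "(\<Sum>i<r. u i) \<in> Y" using bij_betwE[OF bij] 1 2 by metis
      have "u r \<in> X' r" using u by (rule PiE_mem) simp
      then show "u r \<in> Z" using X'(1) by simp
    qed
    have "irreducible_decomposition p W (Suc r) X'"
      unfolding irreducible_decomposition_def bij_betw_def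
    proof (intro conjI allI impI)
      show "irreducible_rep p (X' i)" if "i < Suc r" for i
        using that irr Z(1) by (auto simp: X'_def)
      show "inj_on (\<lambda>w. \<Sum>i<Suc r. w i) (Pi\<^sub>E {..<Suc r} X')"
      proof (rule inj_onI)
        fix u v assume u: "u \<in> Pi\<^sub>E {..<Suc r} X'" and v: "v \<in> Pi\<^sub>E {..<Suc r} X'"
          and eq: "(\<Sum>i<Suc r. u i) = (\<Sum>i<Suc r. v i)"
        \<comment> \<open>P kills the part in Y and fixes the part in Z, so it reads off the last
          summand; injectivity is thereby reduced to that for Y.\<close>
        have Pu: "P (\<Sum>i<Suc r. w i) = w r" if w: "w \<in> Pi\<^sub>E {..<Suc r} X'" for w
        proof -
          have "P (\<Sum>i<r. w i) = 0" using part(3)[OF w] by (simp add: Y_def)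
          then show ?thesis using P(3)[OF part(4)[OF w]] cpair.linear_add[OF P(1)] by simp
        qed
        have r: "u r = v r" using Pu[OF u] Pu[OF v] eq by simp
        then have "(\<Sum>i<r. u i) = (\<Sum>i<r. v i)" using eq by simp
        then have "restrict u {..<r} = restrict v {..<r}"
          using inj_onD[OF bij_betw_imp_inj_on[OF bij] _ part(1)[OF u] part(1)[OF v]] by simp
        then have "restrict u {..<r} i = restrict v {..<r} i" for i by (rule fun_cong)
        then have "u i = v i" if "i < r" for i
          using that by (metis lessThan_iff restrict_apply')
        then show "u = v"
          using r u v by (intro PiE_ext[OF u v]) (auto simp: less_Suc_eq)
      qed
      show "(\<lambda>w. \<Sum>i<Suc r. w i) ` Pi\<^sub>E {..<Suc r} X' = W"
      proof
        show "(\<lambda>w. \<Sum>i<Suc r. w i) ` Pi\<^sub>E {..<Suc r} X' \<subseteq> W"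
        proof
          fix w assume "w \<in> (\<lambda>w. \<Sum>i<Suc r. w i) ` Pi\<^sub>E {..<Suc r} X'"
          then obtain u where u: "u \<in> Pi\<^sub>E {..<Suc r} X'" "w = (\<Sum>i<Suc r. u i)" by blast
          have "(\<Sum>i<r. u i) + u r \<in> W"
            by (rule cfun.subspace_add[OF sW subsetD[OF YW part(3)[OF u(1)]] subsetD[OF Z(2) part(4)[OF u(1)]]])
          then show "w \<in> W" using u(2) by simp
        qed
        show "W \<subseteq> (\<lambda>w. \<Sum>i<Suc r. w i) ` Pi\<^sub>E {..<Suc r} X'"
        proof
          fix w assume w: "w \<in> W"
          have Pw: "P w \<in> W" using P(2) Z(2) by blast
          have "P (w - P w) = 0" using cpair.linear_diff[OF P(1)] P(3)[OF P(2)] by simp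
          then have "w - P w \<in> Y" using cfun.subspace_diff[OF sW w Pw] by (simp add: Y_def)
          then obtain u where u: "u \<in> Pi\<^sub>E {..<r} X" "(\<Sum>i<r. u i) = w - P w"
            using bij by (auto simp: bij_betw_def)
          have "u(r := P w) \<in> Pi\<^sub>E {..<Suc r} X'"
            using u(1) P(2) by (auto simp: X'_def PiE_def Pi_def extensional_def less_Suc_eq)
          moreover have "(\<Sum>i<Suc r. (u(r := P w)) i) = w"
            using u(2) by simp
          ultimately show "w \<in> (\<lambda>w. \<Sum>i<Suc r. w i) ` Pi\<^sub>E {..<Suc r} X'" by (metis image_eqI)
        qed
      qed
    qed
    then show ?thesis by blast
  qed
qed

text \<open>This also shows that the definite description in \<open>multiplicity_in\<close> denotes:
  a decomposition exists by complete reducibility, and all of them have the same character product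
  as their count.\<close>

theorem multiplicity_eq_character_product:
  assumes S: "irreducible_rep p S" "fin_dim S" "scalar_endomorphisms p S"
    and W: "sym_subrep p W" "fin_dim W"
  shows "of_nat (multiplicity_in p S W) = character_product p S W"
proof -
  obtain r X where d: "irreducible_decomposition p W r X"
    using irreducible_decomposition_exists[OF W] by blast
  have "multiplicity_in p S W = card {i. i < r \<and> isomorphic_reps p (X i) S}"
    unfolding multiplicity_in_def
  proof (rule the_equality)
    show "\<exists>r' X'. irreducible_decomposition p W r' X' \<and>
        card {i. i < r \<and> isomorphic_reps p (X i) S} = card {i. i < r' \<and> isomorphic_reps p (X' i) S}"
      using d by blast
  next
    fix m assume "\<exists>r X. irreducible_decomposition p W r X \<and> m = card {i. i < r \<and> isomorphic_reps p (X i) S}"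
    then obtain r' X' where d': "irreducible_decomposition p W r' X'"
      and m: "m = card {i. i < r' \<and> isomorphic_reps p (X' i) S}" by blast
    have "(of_nat m :: complex) = of_nat (card {i. i < r \<and> isomorphic_reps p (X i) S})"
      unfolding m multiplicity_of_decomposition[OF S W d'] multiplicity_of_decomposition[OF S W d] ..
    then show "m = card {i. i < r \<and> isomorphic_reps p (X i) S}" by (simp only: of_nat_eq_iff)
  qed
  then show ?thesis using multiplicity_of_decomposition[OF S W d] by simp
qed

section \<open>Specht modules\<close>

lemma bij_betw_factor_permutation:
  assumes "bij_betw t A D" "bij_betw s A D"
  shows "\<exists>\<pi>. \<pi> permutes A \<and> (\<forall>i\<in>A. s (\<pi> i) = t i)"
proof -
  define \<pi> where "\<pi> = (\<lambda>i. if i \<in> A then inv_into A s (t i) else i)"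
  have "bij_betw (inv_into A s \<circ> t) A A"
    by (rule bij_betw_trans[OF assms(1) bij_betw_inv_into[OF assms(2)]])
  then have "bij_betw \<pi> A A"
    by (rule bij_betw_cong[THEN iffD1, rotated]) (simp add: \<pi>_def)
  then have "\<pi> permutes A"
    by (rule bij_imp_permutes) (simp add: \<pi>_def)
  moreover have "s (\<pi> i) = t i" if "i \<in> A" for i
    using that bij_betwE[OF assms(1)] bij_betw_inv_into_right[OF assms(2)] by (simp add: \<pi>_def)
  ultimately show ?thesis by blast
qed

lemma card_eq_sum_fibers:
  assumes "finite A" "finite C" "f ` A \<subseteq> C"
  shows "card A = (\<Sum>c\<in>C. card {a \<in> A. f a = c})"
  using sum.group[OF assms, of "\<lambda>_. 1 :: nat"] by simp

lemma finite_down_closed_eq_lessThan: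
  assumes "finite S" "\<And>a b. a \<in> S \<Longrightarrow> b < a \<Longrightarrow> b \<in> (S :: nat set)"
  shows "S = {..<card S}"
proof (cases "S = {}")
  case False
  have "S = {..Max S}"
  proof
    show "S \<subseteq> {..Max S}" using Max_ge[OF assms(1)] by blast
    show "{..Max S} \<subseteq> S"
    proof
      fix b assume "b \<in> {..Max S}"
      then have "b = Max S \<or> b < Max S" by auto
      then show "b \<in> S" using assms(2)[OF Max_in[OF assms(1) False]] Max_in[OF assms(1) False] by blast
    qed
  qed
  then have "S = {..<Suc (Max S)}" by (simp add: lessThan_Suc_atMost)
  then show ?thesis by (metis card_lessThan)
qed simp

definition row_fun :: "nat \<Rightarrow> (nat \<Rightarrow> nat \<times> nat) \<Rightarrow> nat \<Rightarrow> nat" where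
  "row_fun p t = (\<lambda>i. if i \<in> {1..p} then fst (t i) else 0)"

text \<open>The tabloids of shape \<open>mu\<close>, encoded by the row of each entry; the value 0
  outside \<open>{1..p}\<close> makes the encoding unique.\<close>

definition row_assignments :: "nat \<Rightarrow> nat list \<Rightarrow> (nat \<Rightarrow> nat) set" where
  "row_assignments p mu = {\<rho>. (\<forall>i. i \<notin> {1..p} \<longrightarrow> \<rho> i = 0) \<and> (\<forall>r. card {i \<in> {1..p}. \<rho> i = r} = part mu r)}"

definition point_fun :: "'y \<Rightarrow> 'y \<Rightarrow> complex" where
  "point_fun \<rho> = (\<lambda>\<rho>'. if \<rho>' = \<rho> then 1 else 0)"

text \<open>The signed column sum, often written \<kappa> with index t, as an operator on every
  function space on which the symmetric group acts.\<close>

definition column_antisymmetrizer ::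
    "nat \<Rightarrow> (nat \<Rightarrow> nat \<times> nat) \<Rightarrow> ((nat \<Rightarrow> 'y) \<Rightarrow> complex) \<Rightarrow> (nat \<Rightarrow> 'y) \<Rightarrow> complex" where
  "column_antisymmetrizer p t v = (\<Sum>\<sigma>\<in>column_stabilizer p t. cscale (of_int (sign \<sigma>)) (left_act \<sigma> v))"

lemma polytabloid_eq: "polytabloid p t = column_antisymmetrizer p t (point_fun (row_fun p t))"
  by (simp add: polytabloid_def column_antisymmetrizer_def tabloid_def point_fun_def row_fun_def)

lemma finite_diagram: "finite (diagram mu)"
proof -
  have "diagram mu = Sigma {..<length mu} (\<lambda>r. {..<mu ! r})" by (auto simp: diagram_def)
  then show ?thesis by simp
qed

lemma diagram_row: "{x \<in> diagram mu. fst x = r} = {r} \<times> {..<part mu r}"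
  by (auto simp: diagram_def part_def)

lemma card_diagram: "card (diagram mu) = sum_list mu"
proof -
  have "diagram mu = Sigma {..<length mu} (\<lambda>r. {..<mu ! r})" by (auto simp: diagram_def)
  then have "card (diagram mu) = (\<Sum>r<length mu. mu ! r)" by simp
  then show ?thesis by (simp add: sum_list_sum_nth atLeast0LessThan)
qed

lemma tableau_exists:
  assumes "partition_of p mu"
  obtains t where "is_tableau p mu t"
proof -
  have "card {1..p} = card (diagram mu)" using assms by (simp add: card_diagram partition_of_def)
  then show ?thesis
    using that finite_same_card_bij[OF finite_atLeastAtMost finite_diagram] unfolding is_tableau_def by blast
qed

lemma card_tableau_preimage:
  assumes "is_tableau p mu t"
  shows "card {i \<in> {1..p}. Q (t i)} = card {x \<in> diagram mu. Q x}"
proof -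
  have b: "bij_betw t {1..p} (diagram mu)" using assms by (simp add: is_tableau_def)
  have "t ` {i \<in> {1..p}. Q (t i)} = {x \<in> diagram mu. Q x}"
  proof (intro equalityI subsetI)
    fix x assume "x \<in> t ` {i \<in> {1..p}. Q (t i)}"
    then obtain i where i: "i \<in> {1..p}" "Q (t i)" "x = t i" by (elim imageE CollectE conjE)
    then show "x \<in> {x \<in> diagram mu. Q x}" using bij_betwE[OF b] by simp
  next
    fix x assume x: "x \<in> {x \<in> diagram mu. Q x}"
    then have "x \<in> t ` {1..p}" using bij_betw_imp_surj_on[OF b] by simp
    then obtain i where i: "i \<in> {1..p}" "x = t i" by (elim imageE)
    show "x \<in> t ` {i \<in> {1..p}. Q (t i)}" using x i(1) unfolding i(2) by (intro imageI) simp
  qed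
  moreover have "inj_on t {i \<in> {1..p}. Q (t i)}"
    by (rule inj_on_subset[OF bij_betw_imp_inj_on[OF b]]) blast
  ultimately show ?thesis using card_image[of t "{i \<in> {1..p}. Q (t i)}"] by simp
qed

lemma row_fun_in: "is_tableau p mu t \<Longrightarrow> row_fun p t \<in> row_assignments p mu"
proof -
  assume t: "is_tableau p mu t"
  have "{i \<in> {1..p}. row_fun p t i = r} = {i \<in> {1..p}. fst (t i) = r}" for r
    by (auto simp: row_fun_def)
  moreover have "card {i \<in> {1..p}. fst (t i) = r} = part mu r" for r
    using card_tableau_preimage[OF t, of "\<lambda>x. fst x = r"] by (simp only: diagram_row card_cartesian_product) simp
  ultimately have "card {i \<in> {1..p}. row_fun p t i = r} = part mu r" for r by (simp only:)
  moreover have "row_fun p t i = 0" if "i \<notin> {1..p}" for i using that by (simp only: row_fun_def if_False)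
  ultimately show ?thesis unfolding row_assignments_def by (intro CollectI conjI allI impI)
qed

lemma finite_row_assignments: "finite (row_assignments p mu)"
proof -
  have "row_assignments p mu \<subseteq> {\<rho>. \<forall>x. (x \<in> {1..p} \<longrightarrow> \<rho> x \<in> {..<length mu}) \<and> (x \<notin> {1..p} \<longrightarrow> \<rho> x = 0)}"
  proof (rule subsetI, rule CollectI, intro allI conjI impI)
    fix \<rho> x assume \<rho>: "\<rho> \<in> row_assignments p mu"
    show "\<rho> x = 0" if "x \<notin> {1..p}" using \<rho> that by (simp add: row_assignments_def)
    assume x: "x \<in> {1..p}"
    show "\<rho> x \<in> {..<length mu}"
    proof (rule ccontr)
      assume "\<rho> x \<notin> {..<length mu}"
      then have "part mu (\<rho> x) = 0" by (simp add: part_def)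
      then have "card {i \<in> {1..p}. \<rho> i = \<rho> x} = 0" using \<rho> by (simp add: row_assignments_def)
      moreover have "x \<in> {i \<in> {1..p}. \<rho> i = \<rho> x}" using x by simp
      moreover have "finite {i \<in> {1..p}. \<rho> i = \<rho> x}" by simp
      ultimately show False by (simp only: card_0_eq) blast
    qed
  qed
  then show ?thesis
    using finite_set_of_finite_funs[of "{1..p}" "{..<length mu}" 0] by (rule finite_subset) simp_all
qed

lemma row_assignments_comp:
  assumes s: "\<sigma> \<in> carrier (sym_group p)"
  shows "\<rho> \<circ> \<sigma> \<in> row_assignments p mu \<longleftrightarrow> \<rho> \<in> row_assignments p mu"
proof -
  have perm: "\<sigma> permutes {1..p}" using s by (simp add: sym_group_carrier)
  have "(i \<notin> {1..p} \<longrightarrow> (\<rho> \<circ> \<sigma>) i = 0) \<longleftrightarrow> (i \<notin> {1..p} \<longrightarrow> \<rho> i = 0)" for i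
    by (cases "i \<in> {1..p}") (simp_all only: comp_apply permutes_not_in[OF perm] not_True_eq_False simp_thms)
  then have 1: "(\<forall>i. i \<notin> {1..p} \<longrightarrow> (\<rho> \<circ> \<sigma>) i = 0) \<longleftrightarrow> (\<forall>i. i \<notin> {1..p} \<longrightarrow> \<rho> i = 0)"
    by (simp only:)
  have "\<sigma> ` {i \<in> {1..p}. (\<rho> \<circ> \<sigma>) i = r} = {i \<in> {1..p}. \<rho> i = r}" for r
  proof
    show "\<sigma> ` {i \<in> {1..p}. (\<rho> \<circ> \<sigma>) i = r} \<subseteq> {i \<in> {1..p}. \<rho> i = r}"
    proof (rule image_subsetI)
      fix i assume "i \<in> {i \<in> {1..p}. (\<rho> \<circ> \<sigma>) i = r}"
      then have "i \<in> {1..p}" "\<rho> (\<sigma> i) = r" by simp_all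
      then show "\<sigma> i \<in> {i \<in> {1..p}. \<rho> i = r}" by (intro CollectI conjI) (simp_all only: permutes_in_image[OF perm])
    qed
    show "{i \<in> {1..p}. \<rho> i = r} \<subseteq> \<sigma> ` {i \<in> {1..p}. (\<rho> \<circ> \<sigma>) i = r}"
    proof
      fix i assume i: "i \<in> {i \<in> {1..p}. \<rho> i = r}"
      have "i = \<sigma> (inv' \<sigma> i)" using permutes_inverses(1)[OF perm] by simp
      moreover have "inv' \<sigma> i \<in> {i \<in> {1..p}. (\<rho> \<circ> \<sigma>) i = r}"
      proof (intro CollectI conjI)
        show "inv' \<sigma> i \<in> {1..p}" using i by (simp only: permutes_in_image[OF permutes_inv[OF perm]] mem_Collect_eq)
        show "(\<rho> \<circ> \<sigma>) (inv' \<sigma> i) = r" using i by (simp only: comp_apply permutes_inverses(1)[OF perm] mem_Collect_eq)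
      qed
      ultimately show "i \<in> \<sigma> ` {i \<in> {1..p}. (\<rho> \<circ> \<sigma>) i = r}" by blast
    qed
  qed
  then have 2: "card {i \<in> {1..p}. (\<rho> \<circ> \<sigma>) i = r} = card {i \<in> {1..p}. \<rho> i = r}" for r
    using card_image[OF permutes_inj_on[OF perm], of "{i \<in> {1..p}. (\<rho> \<circ> \<sigma>) i = r}"] by (simp only:)
  show ?thesis unfolding row_assignments_def mem_Collect_eq 1 2 ..
qed

lemma left_act_point_fun:
  fixes \<rho> :: "nat \<Rightarrow> 'y"
  assumes "\<sigma> \<in> carrier (sym_group p)"
  shows "left_act \<sigma> (point_fun (\<rho> \<circ> \<sigma>)) = point_fun \<rho>"
proof
  fix \<phi>
  have "inj (\<lambda>\<phi> :: nat \<Rightarrow> 'y. \<phi> \<circ> \<sigma>)"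
  proof (rule injI)
    have perm: "\<sigma> permutes {1..p}" using assms by (simp add: sym_group_carrier)
    fix \<phi> \<psi> :: "nat \<Rightarrow> 'y" assume "\<phi> \<circ> \<sigma> = \<psi> \<circ> \<sigma>"
    then have "(\<phi> \<circ> \<sigma>) \<circ> inv' \<sigma> = (\<psi> \<circ> \<sigma>) \<circ> inv' \<sigma>" by simp
    then show "\<phi> = \<psi>" by (simp only: comp_assoc permutes_inv_o[OF perm] comp_id)
  qed
  then have "\<phi> \<circ> \<sigma> = \<rho> \<circ> \<sigma> \<longleftrightarrow> \<phi> = \<rho>" by (rule inj_eq)
  then show "left_act \<sigma> (point_fun (\<rho> \<circ> \<sigma>)) \<phi> = point_fun \<rho> \<phi>"
    by (simp add: left_act_apply[OF assms] point_fun_def)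
qed

lemma column_stabilizer_carrier: "\<sigma> \<in> column_stabilizer p t \<Longrightarrow> \<sigma> \<in> carrier (sym_group p)"
  by (simp add: column_stabilizer_def)

lemma finite_column_stabilizer: "finite (column_stabilizer p t)"
  using finite_sym_group by (rule finite_subset[rotated]) (auto simp: column_stabilizer_def)

lemma column_stabilizer_comp:
  assumes "\<sigma> \<in> column_stabilizer p t" "\<tau> \<in> column_stabilizer p t"
  shows "\<sigma> \<circ> \<tau> \<in> column_stabilizer p t"
  using assms permutes_in_image[of \<tau> "{1..p}"]
  by (auto simp: column_stabilizer_def sym_group_carrier permutes_compose)

lemma column_stabilizer_inv:
  assumes "\<sigma> \<in> column_stabilizer p t"
  shows "inv' \<sigma> \<in> column_stabilizer p t"
proof -
  have perm: "\<sigma> permutes {1..p}" using assms by (simp add: column_stabilizer_def sym_group_carrier)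
  have "snd (t (inv' \<sigma> i)) = snd (t i)" if "i \<in> {1..p}" for i
  proof -
    have "inv' \<sigma> i \<in> {1..p}" using that permutes_in_image[OF permutes_inv[OF perm]] by simp
    then have "snd (t (\<sigma> (inv' \<sigma> i))) = snd (t (inv' \<sigma> i))"
      using assms by (simp add: column_stabilizer_def)
    then show ?thesis using permutes_inverses(1)[OF perm] by simp
  qed
  then show ?thesis using permutes_inv[OF perm] by (simp add: column_stabilizer_def sym_group_carrier)
qed

lemma sign_compose_perm:
  assumes "\<sigma> \<in> carrier (sym_group p)" "\<tau> \<in> carrier (sym_group p)"
  shows "sign (\<sigma> \<circ> \<tau>) = sign \<sigma> * sign \<tau>"
  using assms by (intro sign_compose) (auto intro: sym_group_carrier')

lemma clinear_column_antisymmetrizer: "clinear (column_antisymmetrizer p t)"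
  unfolding column_antisymmetrizer_def
  by (intro cpair.linear_compose_sum ballI cpair.linear_compose_scale_right clinear_left_act)

lemma column_antisymmetrizer_left_act:
  assumes t: "\<tau> \<in> column_stabilizer p t"
  shows "column_antisymmetrizer p t (left_act \<tau> v) = cscale (of_int (sign \<tau>)) (column_antisymmetrizer p t v)"
proof -
  have pt: "\<tau> permutes {1..p}" using column_stabilizer_carrier[OF t] by (simp add: sym_group_carrier)
  have e: "\<sigma> \<circ> \<tau> \<circ> inv' \<tau> = \<sigma>" "\<sigma> \<circ> inv' \<tau> \<circ> \<tau> = \<sigma>" for \<sigma> :: "nat \<Rightarrow> nat"
    by (simp_all only: comp_assoc permutes_inv_o[OF pt] comp_id)
  have "column_antisymmetrizer p t (left_act \<tau> v) =
      (\<Sum>\<sigma>\<in>column_stabilizer p t. cscale (of_int (sign \<tau>)) (cscale (of_int (sign (\<sigma> \<circ> \<tau>))) (left_act (\<sigma> \<circ> \<tau>) v)))"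
    unfolding column_antisymmetrizer_def
  proof (rule sum.cong[OF refl])
    fix \<sigma> assume s: "\<sigma> \<in> column_stabilizer p t"
    have "sign \<tau> * (sign \<sigma> * sign \<tau>) = sign \<sigma>"
      using sign_idempotent[of \<tau>] by (simp add: mult.assoc mult.left_commute)
    then have m: "of_int (sign \<tau>) * of_int (sign \<sigma> * sign \<tau>) = (of_int (sign \<sigma>) :: complex)"
      by (metis of_int_mult)
    show "cscale (of_int (sign \<sigma>)) (left_act \<sigma> (left_act \<tau> v)) =
        cscale (of_int (sign \<tau>)) (cscale (of_int (sign (\<sigma> \<circ> \<tau>))) (left_act (\<sigma> \<circ> \<tau>) v))"
      unfolding cfun.scale_scale sign_compose_perm[OF column_stabilizer_carrier[OF s] column_stabilizer_carrier[OF t]] m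
        left_act_compose[OF column_stabilizer_carrier[OF s] column_stabilizer_carrier[OF t]] ..
  qed
  also have "\<dots> = cscale (of_int (sign \<tau>)) (\<Sum>\<sigma>\<in>column_stabilizer p t. cscale (of_int (sign (\<sigma> \<circ> \<tau>))) (left_act (\<sigma> \<circ> \<tau>) v))"
    by (rule cfun.scale_sum_right[symmetric])
  also have "(\<Sum>\<sigma>\<in>column_stabilizer p t. cscale (of_int (sign (\<sigma> \<circ> \<tau>))) (left_act (\<sigma> \<circ> \<tau>) v)) = column_antisymmetrizer p t v"
    unfolding column_antisymmetrizer_def
    by (rule sum.reindex_bij_witness[where i = "\<lambda>\<sigma>. \<sigma> \<circ> inv' \<tau>" and j = "\<lambda>\<sigma>. \<sigma> \<circ> \<tau>"])
      (simp_all add: e column_stabilizer_comp column_stabilizer_inv t)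
  finally show ?thesis .
qed

text \<open>The square of the signed column sum is its multiple by the order of the column group,
  and a polytabloid lies in its image.\<close>

lemma antisymmetrizer_polytabloid:
  "column_antisymmetrizer p t (polytabloid p t) = cscale (of_nat (card (column_stabilizer p t))) (polytabloid p t)"
proof -
  have "column_antisymmetrizer p t (polytabloid p t) =
      (\<Sum>\<sigma>\<in>column_stabilizer p t. cscale (of_int (sign \<sigma>)) (column_antisymmetrizer p t (left_act \<sigma> (point_fun (row_fun p t)))))"
    unfolding polytabloid_eq by (subst (2) column_antisymmetrizer_def) (rule clinear_expand[OF clinear_column_antisymmetrizer])
  also have "\<dots> = (\<Sum>\<sigma>\<in>column_stabilizer p t. polytabloid p t)"
  proof (rule sum.cong[OF refl])
    fix \<sigma> assume s: "\<sigma> \<in> column_stabilizer p t"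
    have m: "of_int (sign \<sigma>) * of_int (sign \<sigma>) = (1 :: complex)"
      using sign_idempotent[of \<sigma>] by (metis of_int_1 of_int_mult)
    show "cscale (of_int (sign \<sigma>)) (column_antisymmetrizer p t (left_act \<sigma> (point_fun (row_fun p t)))) = polytabloid p t"
      unfolding column_antisymmetrizer_left_act[OF s] cfun.scale_scale m cfun.scale_one polytabloid_eq ..
  qed
  also have "\<dots> = cscale (of_nat (card (column_stabilizer p t))) (polytabloid p t)"
    by (rule ext) (simp add: sum_fun_apply cscale_apply)
  finally show ?thesis .
qed

text \<open>A row assignment that is injective on the columns of t arises from t by permuting the entries
  of each column: otherwise some column c of height h has an entry in a row beyond h, and counting
  column by column the entries in the first h rows gives too few.\<close>

lemma row_assignment_column_rearrangement:
  assumes t: "is_tableau p mu t" and mu: "partition_of p mu" and \<rho>: "\<rho> \<in> row_assignments p mu"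
    and inj: "\<And>a b. a \<in> {1..p} \<Longrightarrow> b \<in> {1..p} \<Longrightarrow> snd (t a) = snd (t b) \<Longrightarrow> \<rho> a = \<rho> b \<Longrightarrow> a = b"
  obtains \<sigma> where "\<sigma> \<in> column_stabilizer p t" "\<rho> \<circ> \<sigma> = row_fun p t"
proof -
  define D where "D = diagram mu"
  have bt: "bij_betw t {1..p} D" using t by (simp add: is_tableau_def D_def)
  have finD: "finite D" using finite_diagram by (simp add: D_def)
  define h where "h c = card {r. (r, c) \<in> D}" for c
  have srt: "mu ! j \<le> mu ! i" if "i \<le> j" "j < length mu" for i j
    using mu that sorted_wrt_nth_less[of "(\<ge>)" mu i j] by (cases "i = j") (auto simp: partition_of_def)
  \<comment> \<open>Because \<open>mu\<close> decreases weakly, each column of the diagram is an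
    initial segment of the rows.\<close>
  have seg: "{r. (r, c) \<in> D} = {..<h c}" for c
    unfolding h_def
  proof (rule finite_down_closed_eq_lessThan)
    have "{r. (r, c) \<in> D} \<subseteq> {..<length mu}" by (auto simp: D_def diagram_def)
    then show "finite {r. (r, c) \<in> D}" by (rule finite_subset) simp
    fix a b assume "a \<in> {r. (r, c) \<in> D}" "b < a"
    then show "b \<in> {r. (r, c) \<in> D}"
      using srt[of b a] by (auto simp: D_def diagram_def)
  qed
  then have D_iff: "(r, c) \<in> D \<longleftrightarrow> r < h c" for r c by (metis lessThan_iff mem_Collect_eq)
  define s where "s = (\<lambda>i. (\<rho> i, snd (t i)))"
  have col: "card {i \<in> {1..p}. snd (t i) = c} = h c" for c
  proof -
    have "card {i \<in> {1..p}. snd (t i) = c} = card {x \<in> D. snd x = c}"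
      unfolding D_def by (rule card_tableau_preimage[OF t])
    also have "{x \<in> D. snd x = c} = {..<h c} \<times> {c}" using D_iff by auto
    finally show ?thesis by (simp add: card_cartesian_product)
  qed
  have in_D: "s i \<in> D" if i: "i \<in> {1..p}" for i
  proof (rule ccontr)
    assume not: "s i \<notin> D"
    define R where "R = h (snd (t i))"
    have iR: "R \<le> \<rho> i" using not D_iff by (simp add: s_def R_def)
    define A where "A = {j \<in> {1..p}. \<rho> j < R}"
    define E where "E = {x \<in> D. fst x < R}"
    have finA: "finite A" and finE: "finite E" using finD by (simp_all add: A_def E_def)
    have "card A = (\<Sum>r<R. card {j \<in> A. \<rho> j = r})"
      by (rule card_eq_sum_fibers[OF finA]) (auto simp: A_def)
    also have "\<dots> = (\<Sum>r<R. card {x \<in> E. fst x = r})"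
    proof (rule sum.cong[OF refl])
      fix r assume r: "r \<in> {..<R}"
      have "{j \<in> A. \<rho> j = r} = {j \<in> {1..p}. \<rho> j = r}" using r by (auto simp: A_def)
      moreover have "{x \<in> E. fst x = r} = {x \<in> diagram mu. fst x = r}" using r by (auto simp: E_def D_def)
      ultimately show "card {j \<in> A. \<rho> j = r} = card {x \<in> E. fst x = r}"
        using \<rho> by (simp add: diagram_row row_assignments_def card_cartesian_product)
    qed
    also have "\<dots> = card E"
      by (rule card_eq_sum_fibers[OF finE, symmetric]) (auto simp: E_def)
    finally have AE: "card A = card E" .
    have cE: "card {x \<in> E. snd x = c} = min (h c) R" for c
    proof -
      have "{x \<in> E. snd x = c} = {..<min (h c) R} \<times> {c}" using D_iff by (auto simp: E_def)
      then show ?thesis by (simp add: card_cartesian_product)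
    qed
    have sub: "{j \<in> A. snd (t j) = c} \<subseteq> {j \<in> {1..p}. snd (t j) = c}" for c by (auto simp: A_def)
    have le: "card {j \<in> A. snd (t j) = c} \<le> card {x \<in> E. snd x = c}" for c
    proof -
      have "card {j \<in> A. snd (t j) = c} \<le> h c"
        unfolding col[symmetric] by (rule card_mono[OF _ sub]) simp
      moreover have "inj_on \<rho> {j \<in> A. snd (t j) = c}"
        using inj by (intro inj_onI) (auto simp: A_def)
      then have "card {j \<in> A. snd (t j) = c} \<le> card {..<R}"
        by (rule card_inj_on_le) (auto simp: A_def)
      ultimately show ?thesis by (simp add: cE)
    qed
    \<comment> \<open>R is the height of the column of i, and i lies in this column but in a row
      beyond R. So A misses at least one of the R entries of the column, while E contains all of its
      cells.\<close>
    have less: "card {j \<in> A. snd (t j) = snd (t i)} < card {x \<in> E. snd x = snd (t i)}"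
    proof -
      have "i \<notin> A" using iR by (simp add: A_def)
      then have "{j \<in> A. snd (t j) = snd (t i)} \<subset> {j \<in> {1..p}. snd (t j) = snd (t i)}"
        using i sub by blast
      then have "card {j \<in> A. snd (t j) = snd (t i)} < h (snd (t i))"
        unfolding col[symmetric] by (intro psubset_card_mono) simp_all
      then show ?thesis by (simp add: cE R_def)
    qed
    have "card A = (\<Sum>c\<in>snd ` D. card {j \<in> A. snd (t j) = c})"
    proof (rule card_eq_sum_fibers[OF finA])
      show "(\<lambda>j. snd (t j)) ` A \<subseteq> snd ` D" unfolding A_def using bij_betwE[OF bt] by blast
    qed (use finD in simp)
    also have "\<dots> < (\<Sum>c\<in>snd ` D. card {x \<in> E. snd x = c})"
      using finD le less bij_betwE[OF bt] i by (intro sum_strict_mono_ex1) auto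
    also have "\<dots> = card E"
      by (rule card_eq_sum_fibers[OF finE, symmetric]) (use finD in \<open>auto simp: E_def\<close>)
    finally show False using AE by simp
  qed
  \<comment> \<open>New rows paired with old columns form a second tableau s of the same shape. The
    permutation relating t to s keeps columns, since s and t agree in the second component.\<close>
  have "inj_on s {1..p}" using inj by (intro inj_onI) (auto simp: s_def)
  moreover have "s ` {1..p} = D"
  proof (rule card_subset_eq[OF finD])
    show "s ` {1..p} \<subseteq> D" using in_D by blast
    show "card (s ` {1..p}) = card D"
      using card_image[OF \<open>inj_on s {1..p}\<close>] bij_betw_same_card[OF bt] by simp
  qed
  ultimately have bs: "bij_betw s {1..p} D" by (simp add: bij_betw_def)
  obtain \<sigma> where "\<sigma> permutes {1..p} \<and> (\<forall>i\<in>{1..p}. s (\<sigma> i) = t i)"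
    using bij_betw_factor_permutation[OF bt bs] ..
  then have s: "\<sigma> permutes {1..p}" "\<And>i. i \<in> {1..p} \<Longrightarrow> s (\<sigma> i) = t i" by simp_all
  have "\<sigma> \<in> column_stabilizer p t"
    using s unfolding column_stabilizer_def s_def by (auto simp: sym_group_carrier) (metis snd_conv)
  moreover have "\<rho> \<circ> \<sigma> = row_fun p t"
  proof
    fix i
    show "(\<rho> \<circ> \<sigma>) i = row_fun p t i"
    proof (cases "i \<in> {1..p}")
      case True
      then show ?thesis using s(2)[OF True] by (simp add: s_def row_fun_def) (metis fst_conv)
    next
      case False
      then have "\<rho> i = 0" using \<rho> unfolding row_assignments_def by blast
      then show ?thesis using False permutes_not_in[OF s(1) False] by (simp only: comp_apply row_fun_def if_False)
    qed
  qed
  ultimately show ?thesis using that by blast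
qed

text \<open>If two entries of a column of t share a row, their transposition fixes the tabloid but
  changes the sign, so the result is 0. Otherwise the tabloid is a column rearrangement of that of
  t, and the result is the polytabloid up to sign.\<close>

lemma antisymmetrizer_point_fun:
  assumes t: "is_tableau p mu t" and mu: "partition_of p mu" and \<rho>: "\<rho> \<in> row_assignments p mu"
  shows "\<exists>c. column_antisymmetrizer p t (point_fun \<rho>) = cscale c (polytabloid p t)"
proof (cases "\<exists>a b. a \<in> {1..p} \<and> b \<in> {1..p} \<and> a \<noteq> b \<and> snd (t a) = snd (t b) \<and> \<rho> a = \<rho> b")
  case True
  then obtain a b where ab: "a \<in> {1..p}" "b \<in> {1..p}" "a \<noteq> b" "snd (t a) = snd (t b)" "\<rho> a = \<rho> b" by blast
  define \<tau> where "\<tau> = transpose a b"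
  have perm: "\<tau> permutes {1..p}" unfolding \<tau>_def by (rule permutes_swap_id[OF ab(1,2)])
  then have \<tau>: "\<tau> \<in> column_stabilizer p t"
    using ab by (auto simp: column_stabilizer_def sym_group_carrier \<tau>_def transpose_def)
  have "\<rho> \<circ> \<tau> = \<rho>" using ab(5) by (auto simp: \<tau>_def transpose_def fun_eq_iff)
  then have "left_act \<tau> (point_fun \<rho>) = point_fun \<rho>"
    using left_act_point_fun[OF column_stabilizer_carrier[OF \<tau>], of \<rho>] by simp
  then have "column_antisymmetrizer p t (point_fun \<rho>) = cscale (- 1) (column_antisymmetrizer p t (point_fun \<rho>))"
    using column_antisymmetrizer_left_act[OF \<tau>, of "point_fun \<rho>"] ab(3) by (simp add: \<tau>_def sign_swap_id)
  then have e: "column_antisymmetrizer p t (point_fun \<rho>) \<phi> = - column_antisymmetrizer p t (point_fun \<rho>) \<phi>" for \<phi>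
    by (metis cscale_apply mult_minus1)
  have "column_antisymmetrizer p t (point_fun \<rho>) \<phi> = 0" for \<phi>
  proof -
    have "column_antisymmetrizer p t (point_fun \<rho>) \<phi> + column_antisymmetrizer p t (point_fun \<rho>) \<phi> = 0"
      by (subst (2) e) (rule add.right_inverse)
    then have "2 * column_antisymmetrizer p t (point_fun \<rho>) \<phi> = 0" by (simp only: mult_2)
    then show ?thesis by simp
  qed
  then show ?thesis by (intro exI[of _ 0]) (auto simp: cscale_def)
next
  case False
  then obtain \<sigma> where s: "\<sigma> \<in> column_stabilizer p t" "\<rho> \<circ> \<sigma> = row_fun p t"
    using row_assignment_column_rearrangement[OF t mu \<rho>] by metis
  have "point_fun \<rho> = left_act \<sigma> (point_fun (row_fun p t))"
    using left_act_point_fun[OF column_stabilizer_carrier[OF s(1)], of \<rho>] s(2) by simp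
  then have "column_antisymmetrizer p t (point_fun \<rho>) = cscale (of_int (sign \<sigma>)) (polytabloid p t)"
    by (simp add: column_antisymmetrizer_left_act[OF s(1)] polytabloid_eq)
  then show ?thesis by blast
qed

definition permutation_module :: "nat \<Rightarrow> nat list \<Rightarrow> ((nat \<Rightarrow> nat) \<Rightarrow> complex) set" where
  "permutation_module p mu = {v. \<forall>\<rho>. \<rho> \<notin> row_assignments p mu \<longrightarrow> v \<rho> = 0}"

lemma permutation_moduleD: "v \<in> permutation_module p mu \<Longrightarrow> \<rho> \<notin> row_assignments p mu \<Longrightarrow> v \<rho> = 0"
  unfolding permutation_module_def by blast

lemma permutation_moduleI: "(\<And>\<rho>. \<rho> \<notin> row_assignments p mu \<Longrightarrow> v \<rho> = 0) \<Longrightarrow> v \<in> permutation_module p mu"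
  unfolding permutation_module_def by blast

lemma permutation_module_expand:
  assumes "v \<in> permutation_module p mu"
  shows "v = (\<Sum>\<rho>\<in>row_assignments p mu. cscale (v \<rho>) (point_fun \<rho>))"
proof
  fix \<phi>
  have "(\<Sum>\<rho>\<in>row_assignments p mu. cscale (v \<rho>) (point_fun \<rho>)) \<phi> =
      (\<Sum>\<rho>\<in>row_assignments p mu. if \<phi> = \<rho> then v \<rho> else 0)"
    unfolding sum_fun_apply by (rule sum.cong[OF refl]) (simp add: cscale_apply point_fun_def)
  also have "\<dots> = v \<phi>"
  proof (cases "\<phi> \<in> row_assignments p mu")
    case False
    then have "(\<Sum>\<rho>\<in>row_assignments p mu. if \<phi> = \<rho> then v \<rho> else 0) = 0" by (intro sum.neutral) auto
    then show ?thesis using permutation_moduleD[OF assms False] by simp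
  qed (simp add: finite_row_assignments)
  finally show "v \<phi> = (\<Sum>\<rho>\<in>row_assignments p mu. cscale (v \<rho>) (point_fun \<rho>)) \<phi>" ..
qed

lemma sym_subrep_permutation_module: "sym_subrep p (permutation_module p mu)"
  unfolding sym_subrep_def
proof (intro conjI ballI cfun.subspaceI)
  show "0 \<in> permutation_module p mu" by (rule permutation_moduleI) (rule zero_fun_apply)
next
  fix x y assume x: "x \<in> permutation_module p mu" and y: "y \<in> permutation_module p mu"
  show "x + y \<in> permutation_module p mu"
  proof (rule permutation_moduleI)
    fix \<rho> assume n: "\<rho> \<notin> row_assignments p mu"
    show "(x + y) \<rho> = 0" using permutation_moduleD[OF x n] permutation_moduleD[OF y n] by simp
  qed
next
  fix c x assume x: "x \<in> permutation_module p mu"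
  show "cscale c x \<in> permutation_module p mu"
  proof (rule permutation_moduleI)
    fix \<rho> assume n: "\<rho> \<notin> row_assignments p mu"
    show "cscale c x \<rho> = 0" unfolding cscale_apply using permutation_moduleD[OF x n] by simp
  qed
next
  fix \<sigma> F assume s: "\<sigma> \<in> carrier (sym_group p)" and F: "F \<in> permutation_module p mu"
  show "left_act \<sigma> F \<in> permutation_module p mu"
  proof (rule permutation_moduleI)
    fix \<rho> assume n: "\<rho> \<notin> row_assignments p mu"
    have "\<rho> \<circ> \<sigma> \<notin> row_assignments p mu" using n row_assignments_comp[OF s, of \<rho> mu] by argo
    from permutation_moduleD[OF F this] show "left_act \<sigma> F \<rho> = 0" using left_act_apply[OF s, of F \<rho>] by argo
  qed
qed

lemma antisymmetrizer_in:
  assumes "sym_subrep p W" "v \<in> W"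
  shows "column_antisymmetrizer p t v \<in> W"
  unfolding column_antisymmetrizer_def
proof (rule cfun.subspace_sum[OF sym_subrepD(1)[OF assms(1)]])
  fix \<sigma> assume "\<sigma> \<in> column_stabilizer p t"
  then have "left_act \<sigma> v \<in> W"
    by (rule sym_subrepD(2)[OF assms(1) column_stabilizer_carrier assms(2)])
  then show "cscale (of_int (sign \<sigma>)) (left_act \<sigma> v) \<in> W"
    by (rule cfun.subspace_scale[OF sym_subrepD(1)[OF assms(1)]])
qed

lemma polytabloid_in_permutation_module:
  assumes "is_tableau p mu t"
  shows "polytabloid p t \<in> permutation_module p mu"
proof -
  have "point_fun (row_fun p t) \<in> permutation_module p mu"
  proof (rule permutation_moduleI)
    fix \<rho> assume "\<rho> \<notin> row_assignments p mu"
    then have "\<rho> \<noteq> row_fun p t" using row_fun_in[OF assms] by blast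
    then show "point_fun (row_fun p t) \<rho> = 0" by (simp add: point_fun_def)
  qed
  then show ?thesis unfolding polytabloid_eq by (rule antisymmetrizer_in[OF sym_subrep_permutation_module])
qed

text \<open>The image of the antisymmetrizer on the whole permutation module lies on the line of one
  polytabloid. Both irreducibility and the scalar endomorphisms of Specht modules rest on
  this.\<close>

lemma antisymmetrizer_permutation_module:
  assumes t: "is_tableau p mu t" and mu: "partition_of p mu" and v: "v \<in> permutation_module p mu"
  shows "\<exists>c. column_antisymmetrizer p t v = cscale c (polytabloid p t)"
proof -
  have "\<forall>\<rho>\<in>row_assignments p mu. \<exists>c. column_antisymmetrizer p t (point_fun \<rho>) = cscale c (polytabloid p t)"
    using antisymmetrizer_point_fun[OF t mu] by (rule ballI)
  from bchoice[OF this] obtain c where c: "\<forall>\<rho>\<in>row_assignments p mu.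
      column_antisymmetrizer p t (point_fun \<rho>) = cscale (c \<rho>) (polytabloid p t)" ..
  have "column_antisymmetrizer p t v =
      (\<Sum>\<rho>\<in>row_assignments p mu. cscale (v \<rho>) (column_antisymmetrizer p t (point_fun \<rho>)))"
    by (subst permutation_module_expand[OF v]) (rule clinear_expand[OF clinear_column_antisymmetrizer])
  also have "\<dots> = (\<Sum>\<rho>\<in>row_assignments p mu. cscale (v \<rho> * c \<rho>) (polytabloid p t))"
    by (rule sum.cong[OF refl]) (simp only: bspec[OF c] cfun.scale_scale)
  also have "\<dots> = cscale (\<Sum>\<rho>\<in>row_assignments p mu. v \<rho> * c \<rho>) (polytabloid p t)"
    by (rule cfun.scale_sum_left[symmetric])
  finally show ?thesis by blast
qed

lemma conjugate_column_stabilizer: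
  assumes \<tau>: "\<tau> \<in> carrier (sym_group p)" and \<sigma>: "\<sigma> \<in> column_stabilizer p t"
    and t': "\<And>i. i \<in> {1..p} \<Longrightarrow> t' (\<tau> i) = t i"
  shows "\<tau> \<circ> \<sigma> \<circ> inv' \<tau> \<in> column_stabilizer p t'"
proof -
  have pt: "\<tau> permutes {1..p}" and ps: "\<sigma> permutes {1..p}"
    using \<tau> column_stabilizer_carrier[OF \<sigma>] by (simp_all add: sym_group_carrier)
  have "snd (t' ((\<tau> \<circ> \<sigma> \<circ> inv' \<tau>) i)) = snd (t' i)" if i: "i \<in> {1..p}" for i
  proof -
    define j where "j = inv' \<tau> i"
    have j: "j \<in> {1..p}" using i permutes_in_image[OF permutes_inv[OF pt]] by (simp add: j_def)
    have ij: "i = \<tau> j" using permutes_inverses(1)[OF pt] by (simp add: j_def)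
    have "\<sigma> j \<in> {1..p}" using j permutes_in_image[OF ps] by simp
    then have "t' (\<tau> (\<sigma> j)) = t (\<sigma> j)" by (rule t')
    moreover have "snd (t (\<sigma> j)) = snd (t j)" using \<sigma> j by (simp add: column_stabilizer_def)
    moreover have "t' i = t j" using t'[OF j] ij by simp
    ultimately show ?thesis by (simp add: j_def)
  qed
  moreover have "\<tau> \<circ> \<sigma> \<circ> inv' \<tau> permutes {1..p}"
    by (intro permutes_compose permutes_inv pt ps)
  ultimately show ?thesis by (simp add: column_stabilizer_def sym_group_carrier)
qed

lemma left_act_polytabloid:
  assumes \<tau>: "\<tau> \<in> carrier (sym_group p)" and t': "\<And>i. i \<in> {1..p} \<Longrightarrow> t' (\<tau> i) = t i"
  shows "left_act \<tau> (polytabloid p t) = polytabloid p t'"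
proof -
  have pt: "\<tau> permutes {1..p}" using \<tau> by (simp add: sym_group_carrier)
  have e: "inv' \<tau> \<circ> (\<tau> \<circ> \<sigma> \<circ> inv' \<tau>) \<circ> \<tau> = \<sigma>" "\<tau> \<circ> (inv' \<tau> \<circ> \<sigma> \<circ> \<tau>) \<circ> inv' \<tau> = \<sigma>"
    "(\<tau> \<circ> \<sigma> \<circ> inv' \<tau>) \<circ> \<tau> = \<tau> \<circ> \<sigma>" for \<sigma> :: "nat \<Rightarrow> nat"
    by (simp_all only: comp_assoc permutes_inv_o[OF pt] comp_id)
      (simp_all only: comp_assoc[symmetric] permutes_inv_o[OF pt] id_comp)
  have inv: "t (inv' \<tau> i) = t' i" if "i \<in> {1..p}" for i
    using t'[of "inv' \<tau> i"] that permutes_in_image[OF permutes_inv[OF pt]] permutes_inverses(1)[OF pt] by simp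
  have row: "row_fun p t' \<circ> \<tau> = row_fun p t"
    using t' permutes_in_image[OF pt] by (auto simp: row_fun_def fun_eq_iff)
  have "left_act \<tau> (polytabloid p t) =
      (\<Sum>\<sigma>\<in>column_stabilizer p t. cscale (of_int (sign \<sigma>)) (left_act \<tau> (left_act \<sigma> (point_fun (row_fun p t)))))"
    unfolding polytabloid_eq column_antisymmetrizer_def by (rule clinear_expand[OF clinear_left_act])
  also have "\<dots> = (\<Sum>\<sigma>\<in>column_stabilizer p t'. cscale (of_int (sign \<sigma>)) (left_act \<sigma> (point_fun (row_fun p t'))))"
  proof (rule sum.reindex_bij_witness[where i = "\<lambda>\<sigma>. inv' \<tau> \<circ> \<sigma> \<circ> \<tau>" and j = "\<lambda>\<sigma>. \<tau> \<circ> \<sigma> \<circ> inv' \<tau>"])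
    fix \<sigma> assume s: "\<sigma> \<in> column_stabilizer p t"
    show "inv' \<tau> \<circ> (\<tau> \<circ> \<sigma> \<circ> inv' \<tau>) \<circ> \<tau> = \<sigma>" by (rule e)
    show m: "\<tau> \<circ> \<sigma> \<circ> inv' \<tau> \<in> column_stabilizer p t'" by (rule conjugate_column_stabilizer[OF \<tau> s t'])
    have "sign ((\<tau> \<circ> \<sigma> \<circ> inv' \<tau>) \<circ> \<tau>) = sign (\<tau> \<circ> \<sigma>)" by (simp only: e)
    then have "sign (\<tau> \<circ> \<sigma> \<circ> inv' \<tau>) * sign \<tau> = sign \<tau> * sign \<sigma>"
      by (simp only: sign_compose_perm[OF column_stabilizer_carrier[OF m] \<tau>]
          sign_compose_perm[OF \<tau> column_stabilizer_carrier[OF s]])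
    then have sg: "sign (\<tau> \<circ> \<sigma> \<circ> inv' \<tau>) = sign \<sigma>"
      by (auto simp: sign_def split: if_splits)
    have "left_act (\<tau> \<circ> \<sigma> \<circ> inv' \<tau>) (point_fun (row_fun p t')) =
        left_act (\<tau> \<circ> \<sigma> \<circ> inv' \<tau>) (left_act \<tau> (point_fun (row_fun p t)))"
      using left_act_point_fun[OF \<tau>, of "row_fun p t'"] by (simp only: row)
    also have "\<dots> = left_act \<tau> (left_act \<sigma> (point_fun (row_fun p t)))"
      by (simp only: left_act_compose[OF column_stabilizer_carrier[OF m] \<tau>] e
          left_act_compose[OF \<tau> column_stabilizer_carrier[OF s]])
    finally show "cscale (of_int (sign (\<tau> \<circ> \<sigma> \<circ> inv' \<tau>))) (left_act (\<tau> \<circ> \<sigma> \<circ> inv' \<tau>) (point_fun (row_fun p t'))) =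
        cscale (of_int (sign \<sigma>)) (left_act \<tau> (left_act \<sigma> (point_fun (row_fun p t))))"
      by (simp only: sg)
  next
    fix \<sigma> assume s: "\<sigma> \<in> column_stabilizer p t'"
    show "\<tau> \<circ> (inv' \<tau> \<circ> \<sigma> \<circ> \<tau>) \<circ> inv' \<tau> = \<sigma>" by (rule e)
    show "inv' \<tau> \<circ> \<sigma> \<circ> \<tau> \<in> column_stabilizer p t"
      using conjugate_column_stabilizer[OF sym_group_inv_closed[OF \<tau>] s inv] permutes_inv_inv[OF pt] by simp
  qed
  also have "\<dots> = polytabloid p t'" unfolding polytabloid_eq column_antisymmetrizer_def ..
  finally show ?thesis .
qed

text \<open>The symmetric group is transitive on the tableaux of a shape, so any single polytabloid
  generates the Specht module.\<close>

lemma left_act_polytabloid_exists: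
  assumes "is_tableau p mu t" "is_tableau p mu t'"
  obtains \<tau> where "\<tau> \<in> carrier (sym_group p)" "left_act \<tau> (polytabloid p t) = polytabloid p t'"
proof -
  obtain \<tau> where \<tau>: "\<tau> permutes {1..p} \<and> (\<forall>i\<in>{1..p}. t' (\<tau> i) = t i)"
    using bij_betw_factor_permutation[OF assms[unfolded is_tableau_def]] ..
  then have c: "\<tau> \<in> carrier (sym_group p)" by (simp only: sym_group_carrier)
  show ?thesis by (rule that[OF c left_act_polytabloid[OF c]]) (use \<tau> in blast)
qed

lemma specht_subset_permutation_module: "specht p mu \<subseteq> permutation_module p mu"
  unfolding specht_def
  by (rule cfun.span_minimal[OF _ sym_subrepD(1)[OF sym_subrep_permutation_module]])
    (use polytabloid_in_permutation_module in blast)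

lemma sym_subrep_specht: "sym_subrep p (specht p mu)"
  unfolding sym_subrep_def
proof (intro conjI ballI)
  show sub: "cfun.subspace (specht p mu)" by (simp add: specht_def)
  fix \<sigma> F assume s: "\<sigma> \<in> carrier (sym_group p)" and F: "F \<in> specht p mu"
  have ps: "\<sigma> permutes {1..p}" using s by (simp add: sym_group_carrier)
  have g: "left_act \<sigma> (polytabloid p t) \<in> specht p mu" if t: "is_tableau p mu t" for t
  proof -
    have "bij_betw (t \<circ> inv' \<sigma>) {1..p} (diagram mu)"
      using t permutes_imp_bij[OF permutes_inv[OF ps]] unfolding is_tableau_def by (rule bij_betw_trans[rotated])
    moreover have "left_act \<sigma> (polytabloid p t) = polytabloid p (t \<circ> inv' \<sigma>)"
      by (rule left_act_polytabloid[OF s]) (simp add: permutes_inverses(2)[OF ps])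
    ultimately show ?thesis unfolding specht_def is_tableau_def by (auto intro: cfun.span_base)
  qed
  have "left_act \<sigma> ` specht p mu = cfun.span (left_act \<sigma> ` {polytabloid p t | t. is_tableau p mu t})"
    unfolding specht_def by (rule cpair.linear_span_image[OF clinear_left_act, symmetric])
  also have "\<dots> \<subseteq> specht p mu"
    by (rule cfun.span_minimal[OF _ sub]) (use g in blast)
  finally show "left_act \<sigma> F \<in> specht p mu" using F by blast
qed

lemma fin_dim_specht: "fin_dim (specht p mu)"
proof -
  have "permutation_module p mu \<subseteq> cfun.span (point_fun ` row_assignments p mu)"
  proof
    fix v assume v: "v \<in> permutation_module p mu"
    have "(\<Sum>\<rho>\<in>row_assignments p mu. cscale (v \<rho>) (point_fun \<rho>)) \<in> cfun.span (point_fun ` row_assignments p mu)"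
      by (intro cfun.span_sum cfun.span_scale cfun.span_base imageI)
    then show "v \<in> cfun.span (point_fun ` row_assignments p mu)"
      using permutation_module_expand[OF v] by simp
  qed
  from subset_trans[OF specht_subset_permutation_module this] show ?thesis
    unfolding fin_dim_def
    by (intro conjI exI[of _ "point_fun ` row_assignments p mu"])
      (simp_all only: sym_subrepD(1)[OF sym_subrep_specht] finite_imageI[OF finite_row_assignments])
qed

text \<open>Only the identity preserves both rows and columns of a tableau, so no other term meets
  this tabloid. In particular polytabloids do not vanish.\<close>

lemma polytabloid_row_fun:
  assumes t: "is_tableau p mu t"
  shows "polytabloid p t (row_fun p t) = 1"
proof -
  have inj: "inj_on t {1..p}" using t by (simp add: is_tableau_def bij_betw_def)
  have val: "left_act \<sigma> (point_fun (row_fun p t)) (row_fun p t) = (if \<sigma> = id then 1 else 0)"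
    if s: "\<sigma> \<in> column_stabilizer p t" for \<sigma>
  proof -
    have ps: "\<sigma> permutes {1..p}" using column_stabilizer_carrier[OF s] by (simp add: sym_group_carrier)
    have "\<sigma> = id" if eq: "row_fun p t \<circ> \<sigma> = row_fun p t"
    proof
      fix i show "\<sigma> i = id i"
      proof (cases "i \<in> {1..p}")
        case True
        then have si: "\<sigma> i \<in> {1..p}" using permutes_in_image[OF ps] by simp
        have "fst (t (\<sigma> i)) = fst (t i)"
          using fun_cong[OF eq, of i] True si by (simp add: row_fun_def)
        moreover have "snd (t (\<sigma> i)) = snd (t i)" using s True by (simp add: column_stabilizer_def)
        ultimately have "t (\<sigma> i) = t i" by (rule prod_eqI)
        then show ?thesis using inj_onD[OF inj _ si True] by simp
      next
        case False
        then show ?thesis using permutes_not_in[OF ps] by simp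
      qed
    qed
    then show ?thesis
      unfolding left_act_apply[OF column_stabilizer_carrier[OF s]] point_fun_def by auto
  qed
  have id: "id \<in> column_stabilizer p t" by (simp add: column_stabilizer_def sym_group_carrier permutes_id)
  have "polytabloid p t (row_fun p t) =
      (\<Sum>\<sigma>\<in>column_stabilizer p t. of_int (sign \<sigma>) * (if \<sigma> = id then 1 else 0))"
    unfolding polytabloid_eq column_antisymmetrizer_def sum_fun_apply cscale_apply
    by (rule sum.cong[OF refl]) (simp only: val)
  also have "\<dots> = (\<Sum>\<sigma>\<in>column_stabilizer p t. if \<sigma> = id then 1 else 0)"
    by (rule sum.cong[OF refl]) simp
  also have "\<dots> = 1" using id finite_column_stabilizer by simp
  finally show ?thesis .
qed

text \<open>Adjointness of the antisymmetrizer: pairing v with a polytabloid is evaluating the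
  antisymmetrization of v.\<close>

lemma antisymmetrizer_adjoint:
  assumes t: "is_tableau p mu t" and v: "v \<in> permutation_module p mu"
  shows "(\<Sum>\<rho>\<in>row_assignments p mu. v \<rho> * polytabloid p t \<rho>) = column_antisymmetrizer p t v (row_fun p t)"
proof -
  have "(\<Sum>\<rho>\<in>row_assignments p mu. v \<rho> * polytabloid p t \<rho>) =
      (\<Sum>\<rho>\<in>row_assignments p mu. \<Sum>\<sigma>\<in>column_stabilizer p t.
         of_int (sign \<sigma>) * (v \<rho> * left_act \<sigma> (point_fun (row_fun p t)) \<rho>))"
    unfolding polytabloid_eq column_antisymmetrizer_def sum_fun_apply cscale_apply sum_distrib_left
    by (intro sum.cong refl) simp
  also have "\<dots> = (\<Sum>\<sigma>\<in>column_stabilizer p t. of_int (sign \<sigma>) *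
      (\<Sum>\<rho>\<in>row_assignments p mu. v \<rho> * left_act \<sigma> (point_fun (row_fun p t)) \<rho>))"
    by (subst sum.swap) (simp only: sum_distrib_left)
  also have "\<dots> = (\<Sum>\<sigma>\<in>column_stabilizer p t. of_int (sign \<sigma>) * v (row_fun p t \<circ> inv' \<sigma>))"
  proof (rule sum.cong[OF refl])
    fix \<sigma> assume s: "\<sigma> \<in> column_stabilizer p t"
    note c = column_stabilizer_carrier[OF s]
    have ps: "\<sigma> permutes {1..p}" using c by (simp add: sym_group_carrier)
    have r: "row_fun p t \<circ> inv' \<sigma> \<in> row_assignments p mu"
      using row_assignments_comp[OF sym_group_inv_closed[OF c]] row_fun_in[OF t] by blast
    have "left_act \<sigma> (point_fun (row_fun p t)) = point_fun (row_fun p t \<circ> inv' \<sigma>)"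
      using left_act_point_fun[OF c, of "row_fun p t \<circ> inv' \<sigma>"]
      by (simp only: comp_assoc permutes_inv_o[OF ps] comp_id)
    then have "(\<Sum>\<rho>\<in>row_assignments p mu. v \<rho> * left_act \<sigma> (point_fun (row_fun p t)) \<rho>) =
        (\<Sum>\<rho>\<in>row_assignments p mu. if \<rho> = row_fun p t \<circ> inv' \<sigma> then v \<rho> else 0)"
      by (intro sum.cong refl) (simp add: point_fun_def)
    also have "\<dots> = v (row_fun p t \<circ> inv' \<sigma>)"
      using r finite_row_assignments by simp
    finally show "of_int (sign \<sigma>) * (\<Sum>\<rho>\<in>row_assignments p mu. v \<rho> * left_act \<sigma> (point_fun (row_fun p t)) \<rho>) =
        of_int (sign \<sigma>) * v (row_fun p t \<circ> inv' \<sigma>)" by (simp only:)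
  qed
  also have "\<dots> = (\<Sum>\<sigma>\<in>column_stabilizer p t. of_int (sign \<sigma>) * v (row_fun p t \<circ> \<sigma>))"
  proof (rule sum.reindex_bij_witness[where i = "\<lambda>\<sigma>. inv' \<sigma>" and j = "\<lambda>\<sigma>. inv' \<sigma>"])
    fix \<sigma> assume s: "\<sigma> \<in> column_stabilizer p t"
    have ps: "\<sigma> permutes {1..p}" using column_stabilizer_carrier[OF s] by (simp add: sym_group_carrier)
    show "inv' (inv' \<sigma>) = \<sigma>" "inv' (inv' \<sigma>) = \<sigma>" by (simp_all only: permutes_inv_inv[OF ps])
    show "inv' \<sigma> \<in> column_stabilizer p t" "inv' \<sigma> \<in> column_stabilizer p t"
      by (simp_all only: column_stabilizer_inv[OF s])
    show "of_int (sign (inv' \<sigma>)) * v (row_fun p t \<circ> inv' \<sigma>) = of_int (sign \<sigma>) * v (row_fun p t \<circ> inv' \<sigma>)"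
      using sign_inverse[OF sym_group_carrier'[OF column_stabilizer_carrier[OF s]]] by simp
  qed
  also have "\<dots> = column_antisymmetrizer p t v (row_fun p t)"
    unfolding column_antisymmetrizer_def sum_fun_apply cscale_apply
    by (intro sum.cong refl) (simp add: left_act_apply[OF column_stabilizer_carrier])
  finally show ?thesis .
qed

text \<open>James's argument: a nonzero u in a subrepresentation is not annihilated by all
  antisymmetrizers, and one that does not annihilate it turns u into a nonzero multiple of a
  polytabloid, which generates everything.\<close>

theorem irreducible_specht:
  assumes mu: "partition_of p mu"
  shows "irreducible_rep p (specht p mu)"
  unfolding irreducible_rep_def
proof (intro conjI allI impI)
  show "sym_subrep p (specht p mu)" by (rule sym_subrep_specht)
  obtain t0 where t0: "is_tableau p mu t0" using tableau_exists[OF mu] by blast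
  have base: "polytabloid p t \<in> specht p mu" if "is_tableau p mu t" for t
    unfolding specht_def using that by (intro cfun.span_base) blast
  show "specht p mu \<noteq> {0}"
  proof
    assume "specht p mu = {0}"
    then have "polytabloid p t0 = 0" using base[OF t0] by simp
    then show False using polytabloid_row_fun[OF t0] by simp
  qed
  fix X assume X: "X \<subseteq> specht p mu" "sym_subrep p X"
  show "X = {0} \<or> X = specht p mu"
  proof (cases "X \<subseteq> {0}")
    case True
    then show ?thesis using cfun.subspace_0[OF sym_subrepD(1)[OF X(2)]] by blast
  next
    case False
    then obtain u where u: "u \<in> X" "u \<noteq> 0" by blast
    have um: "u \<in> permutation_module p mu" using u(1) X(1) specht_subset_permutation_module by blast
    have "\<exists>t. is_tableau p mu t \<and> column_antisymmetrizer p t u \<noteq> 0"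
    proof (rule ccontr)
      assume no: "\<nexists>t. is_tableau p mu t \<and> column_antisymmetrizer p t u \<noteq> 0"
      \<comment> \<open>If every antisymmetrizer killed u, then u would be orthogonal to all
        polytabloids for the Hermitian form and hence to itself. Polytabloids have real values, so
        the conjugation does not disturb adjointness.\<close>
      define H where "H = {w. (\<Sum>\<rho>\<in>row_assignments p mu. u \<rho> * cnj (w \<rho>)) = 0}"
      have "cfun.subspace H"
      proof (rule cfun.subspaceI)
        show "0 \<in> H" by (simp add: H_def)
        show "x + y \<in> H" if "x \<in> H" "y \<in> H" for x y
          using that by (simp add: H_def algebra_simps sum.distrib)
        show "cscale c x \<in> H" if "x \<in> H" for c x
        proof -
          have "(\<Sum>\<rho>\<in>row_assignments p mu. u \<rho> * cnj (cscale c x \<rho>)) =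
              cnj c * (\<Sum>\<rho>\<in>row_assignments p mu. u \<rho> * cnj (x \<rho>))"
            unfolding sum_distrib_left by (rule sum.cong[OF refl]) (simp add: cscale_apply)
          then show ?thesis using that by (simp add: H_def)
        qed
      qed
      moreover have "{polytabloid p t | t. is_tableau p mu t} \<subseteq> H"
      proof clarify
        fix t assume t: "is_tableau p mu t"
        have "cnj (polytabloid p t \<rho>) = polytabloid p t \<rho>" for \<rho>
          unfolding polytabloid_def sum_fun_apply cscale_apply cnj_sum
        proof (rule sum.cong[OF refl])
          fix \<sigma> assume s: "\<sigma> \<in> column_stabilizer p t"
          show "cnj (of_int (sign \<sigma>) * left_act \<sigma> (tabloid p t) \<rho>) = of_int (sign \<sigma>) * left_act \<sigma> (tabloid p t) \<rho>"
            unfolding left_act_apply[OF column_stabilizer_carrier[OF s]] by (simp add: tabloid_def)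
        qed
        then have "(\<Sum>\<rho>\<in>row_assignments p mu. u \<rho> * cnj (polytabloid p t \<rho>)) = column_antisymmetrizer p t u (row_fun p t)"
          using antisymmetrizer_adjoint[OF t um] by (simp only:)
        also have "\<dots> = 0"
        proof -
          have "column_antisymmetrizer p t u = 0" using no t by blast
          then show ?thesis by simp
        qed
        finally show "polytabloid p t \<in> H" by (simp add: H_def)
      qed
      ultimately have "specht p mu \<subseteq> H" unfolding specht_def by (intro cfun.span_minimal)
      then have "u \<in> H" using u(1) X(1) by blast
      then have "of_real (\<Sum>\<rho>\<in>row_assignments p mu. (cmod (u \<rho>))\<^sup>2) = (0 :: complex)"
        unfolding of_real_sum complex_norm_square H_def by (rule CollectD)
      then have "(\<Sum>\<rho>\<in>row_assignments p mu. (cmod (u \<rho>))\<^sup>2) = 0" by (simp only: of_real_eq_0_iff)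
      then have "\<forall>\<rho>\<in>row_assignments p mu. (cmod (u \<rho>))\<^sup>2 = 0"
        by (subst (asm) sum_nonneg_eq_0_iff[OF finite_row_assignments]) simp_all
      then have "u \<rho> = 0" for \<rho>
      proof (cases "\<rho> \<in> row_assignments p mu")
        case True
        then have "(cmod (u \<rho>))\<^sup>2 = 0" using \<open>\<forall>\<rho>\<in>row_assignments p mu. (cmod (u \<rho>))\<^sup>2 = 0\<close> by (rule bspec[rotated])
        then show ?thesis by simp
      qed (rule permutation_moduleD[OF um, of \<rho>])
      then show False using u(2) by (simp add: fun_eq_iff)
    qed
    then obtain t where t: "is_tableau p mu t" "column_antisymmetrizer p t u \<noteq> 0" by blast
    obtain c where c: "column_antisymmetrizer p t u = cscale c (polytabloid p t)"
      using antisymmetrizer_permutation_module[OF t(1) mu um] by blast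
    have c0: "c \<noteq> 0" using t(2) c by (intro notI) (simp add: fun_eq_iff cscale_apply)
    have "cscale c (polytabloid p t) \<in> X" using antisymmetrizer_in[OF X(2) u(1), of t] c by simp
    then have "cscale (1 / c) (cscale c (polytabloid p t)) \<in> X"
      by (rule cfun.subspace_scale[OF sym_subrepD(1)[OF X(2)]])
    then have "cscale (1 / c * c) (polytabloid p t) \<in> X" by (simp only: cfun.scale_scale)
    then have pX: "polytabloid p t \<in> X" using c0 by simp
    have "{polytabloid p t | t. is_tableau p mu t} \<subseteq> X"
    proof clarify
      fix t' assume t': "is_tableau p mu t'"
      obtain \<tau> where "\<tau> \<in> carrier (sym_group p)" "left_act \<tau> (polytabloid p t) = polytabloid p t'"
        using left_act_polytabloid_exists[OF t(1) t'] .
      then show "polytabloid p t' \<in> X" using sym_subrepD(2)[OF X(2) _ pX, of \<tau>] by simp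
    qed
    then have "specht p mu \<subseteq> X"
      unfolding specht_def by (rule cfun.span_minimal[OF _ sym_subrepD(1)[OF X(2)]])
    then show ?thesis using X(1) by blast
  qed
qed

text \<open>f commutes with the antisymmetrizer, whose image is a line; hence a polytabloid is an
  eigenvector of f. The translates of this polytabloid span the module and have the same
  eigenvalue.\<close>

theorem scalar_endomorphisms_specht:
  assumes mu: "partition_of p mu"
  shows "scalar_endomorphisms p (specht p mu)"
  unfolding scalar_endomorphisms_def
proof (intro allI impI, elim conjE)
  fix f assume f: "intertwines p (specht p mu) f" and im: "f ` specht p mu \<subseteq> specht p mu"
  have lin: "clinear f" and com: "\<And>\<sigma> F. \<sigma> \<in> carrier (sym_group p) \<Longrightarrow> F \<in> specht p mu \<Longrightarrow>
      f (left_act \<sigma> F) = left_act \<sigma> (f F)"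
    using f by (simp_all add: intertwines_def)
  have base: "polytabloid p t \<in> specht p mu" if "is_tableau p mu t" for t
    unfolding specht_def using that by (intro cfun.span_base) blast
  obtain t where t: "is_tableau p mu t" using tableau_exists[OF mu] by blast
  define N where "N = (of_nat (card (column_stabilizer p t)) :: complex)"
  have "id \<in> column_stabilizer p t" by (simp add: column_stabilizer_def sym_group_carrier permutes_id)
  then have N0: "N \<noteq> 0" using finite_column_stabilizer[of p t] by (auto simp: N_def)
  have fm: "f (polytabloid p t) \<in> permutation_module p mu"
    using im base[OF t] specht_subset_permutation_module by blast
  have "cscale N (f (polytabloid p t)) = f (column_antisymmetrizer p t (polytabloid p t))"
    unfolding antisymmetrizer_polytabloid N_def by (rule cpair.linear_scale[OF lin, symmetric])
  also have "\<dots> = (\<Sum>\<sigma>\<in>column_stabilizer p t. cscale (of_int (sign \<sigma>)) (f (left_act \<sigma> (polytabloid p t))))"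
    unfolding column_antisymmetrizer_def by (rule clinear_expand[OF lin])
  also have "\<dots> = column_antisymmetrizer p t (f (polytabloid p t))"
    unfolding column_antisymmetrizer_def
    by (rule sum.cong[OF refl]) (simp only: com[OF column_stabilizer_carrier base[OF t]])
  finally have e: "cscale N (f (polytabloid p t)) = column_antisymmetrizer p t (f (polytabloid p t))" .
  obtain c where "column_antisymmetrizer p t (f (polytabloid p t)) = cscale c (polytabloid p t)"
    using antisymmetrizer_permutation_module[OF t mu fm] by blast
  then have "cscale (1 / N) (cscale N (f (polytabloid p t))) = cscale (1 / N) (cscale c (polytabloid p t))"
    using e by simp
  then have ft: "f (polytabloid p t) = cscale (c / N) (polytabloid p t)" using N0 by simp
  define K where "K = {v. f v = cscale (c / N) v}"
  have "cfun.subspace K"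
  proof (rule cfun.subspaceI)
    show "0 \<in> K" using cpair.linear_0[OF lin] by (simp add: K_def)
    show "x + y \<in> K" if "x \<in> K" "y \<in> K" for x y
      using that cpair.linear_add[OF lin] by (simp add: K_def cfun.scale_right_distrib)
    show "cscale d x \<in> K" if "x \<in> K" for d x
      using that cpair.linear_scale[OF lin] by (simp add: K_def mult.commute)
  qed
  moreover have "{polytabloid p t | t. is_tableau p mu t} \<subseteq> K"
  proof clarify
    fix t' assume t': "is_tableau p mu t'"
    obtain \<tau> where \<tau>: "\<tau> \<in> carrier (sym_group p)" "left_act \<tau> (polytabloid p t) = polytabloid p t'"
      using left_act_polytabloid_exists[OF t t'] .
    have "f (polytabloid p t') = left_act \<tau> (f (polytabloid p t))"
      using com[OF \<tau>(1) base[OF t]] \<tau>(2) by simp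
    also have "\<dots> = cscale (c / N) (polytabloid p t')"
      unfolding ft cpair.linear_scale[OF clinear_left_act] \<tau>(2) ..
    finally show "polytabloid p t' \<in> K" by (simp add: K_def)
  qed
  ultimately have "specht p mu \<subseteq> K" unfolding specht_def by (intro cfun.span_minimal)
  then show "\<exists>c. \<forall>v\<in>specht p mu. f v = cscale c v" by (auto simp: K_def)
qed

section \<open>Borel subgroups, maximal tori and maximal unipotent subgroups in coordinates\<close>

lemma linear_on_GL: "g \<in> carrier (GL scale) \<Longrightarrow> Vector_Spaces.linear scale scale g"
  and bij_on_GL: "g \<in> carrier (GL scale) \<Longrightarrow> bij g"
  by (simp_all add: GL_def)

lemma GL_mult: "mult (GL scale) = (\<circ>)" and GL_one: "one (GL scale) = id"
  by (simp_all add: GL_def)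

locale flagged_space = vector_space scale
  for scale :: "complex \<Rightarrow> 'v::ab_group_add \<Rightarrow> 'v" +
  fixes n :: nat and e :: "nat \<Rightarrow> 'v"
  assumes inj_e: "inj_on e {..<n}" and indep_e: "independent (e ` {..<n})" and span_e: "span (e ` {..<n}) = UNIV"
begin

sublocale fd: finite_dimensional_vector_space scale "e ` {..<n}"
  by unfold_locales (simp_all add: indep_e span_e)

sublocale vp: vector_space_pair scale scale by unfold_locales

sublocale vf: vector_space_pair scale "(*) :: complex \<Rightarrow> complex \<Rightarrow> complex" by unfold_locales

definition coord :: "nat \<Rightarrow> 'v \<Rightarrow> complex" where
  "coord j v = representation (e ` {..<n}) v (e j)"

lemma linear_coord: "Vector_Spaces.linear scale (*) (coord j)"
  unfolding coord_def by (rule linear_representation[OF indep_e span_e])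

lemmas coord_simps = vf.linear_add[OF linear_coord] vf.linear_scale[OF linear_coord]
  vf.linear_diff[OF linear_coord] vf.linear_0[OF linear_coord]

lemma coord_expand: "v = (\<Sum>j<n. scale (coord j v) (e j))"
proof -
  have "(\<Sum>b\<in>e ` {..<n}. scale (representation (e ` {..<n}) v b) b) = v"
    by (rule sum_representation_eq[OF indep_e]) (simp_all add: span_e)
  then show ?thesis using inj_e by (simp add: sum.reindex coord_def)
qed

lemma coord_basis: "i < n \<Longrightarrow> j < n \<Longrightarrow> coord j (e i) = (if i = j then 1 else 0)"
  using inj_e by (auto simp: coord_def representation_basis[OF indep_e] inj_on_def)

lemma coord_eqI: "(\<And>j. j < n \<Longrightarrow> coord j v = coord j w) \<Longrightarrow> v = w"
  by (subst coord_expand[of v], subst coord_expand[of w]) simp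

text \<open>The standard flag in coordinates. Indices beyond n are allowed and give the whole space,
  which saves bounds on i.\<close>

definition flag :: "nat \<Rightarrow> 'v set" where
  "flag i = {v. \<forall>j<n. i \<le> j \<longrightarrow> coord j v = 0}"

lemma subspace_flag: "subspace (flag i)"
  by (rule subspaceI) (simp_all add: flag_def coord_simps)

lemma flag_0: "flag 0 = {0}"
proof -
  have "v = 0" if "v \<in> flag 0" for v
    by (rule coord_eqI) (use that in \<open>simp add: flag_def coord_simps\<close>)
  then show ?thesis using subspace_0[OF subspace_flag] by blast
qed

lemma flag_n: "n \<le> i \<Longrightarrow> flag i = UNIV"
  by (auto simp: flag_def)

lemma flag_mono: "i \<le> j \<Longrightarrow> flag i \<subseteq> flag j"
  by (auto simp: flag_def)

lemma basis_in_flag: "i < j \<Longrightarrow> i < n \<Longrightarrow> e i \<in> flag j"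
  by (simp add: flag_def coord_basis)

lemma flag_eq_span: "i \<le> n \<Longrightarrow> flag i = span (e ` {..<i})"
proof
  assume i: "i \<le> n"
  show "flag i \<subseteq> span (e ` {..<i})"
  proof
    fix v assume v: "v \<in> flag i"
    have "v = (\<Sum>j<n. scale (coord j v) (e j))" by (rule coord_expand)
    also have "\<dots> = (\<Sum>j<i. scale (coord j v) (e j))"
      by (rule sum.mono_neutral_right) (use v i in \<open>auto simp: flag_def\<close>)
    also have "\<dots> \<in> span (e ` {..<i})" by (intro span_sum span_scale span_base) simp
    finally show "v \<in> span (e ` {..<i})" .
  qed
  show "span (e ` {..<i}) \<subseteq> flag i"
    by (rule span_minimal[OF _ subspace_flag]) (use i in \<open>auto intro!: basis_in_flag\<close>)
qed

lemma flag_Suc_decompose: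
  assumes "v \<in> flag (Suc i)"
  shows "v - scale (coord i v) (e i) \<in> flag i"
  using assms by (cases "i < n") (auto simp: flag_def coord_simps coord_basis not_less Suc_le_eq le_less)

section \<open>The general linear group and the filtration of its triangular subgroup\<close>

lemma GL_group: "group (GL scale)"
proof (rule groupI)
  fix g h assume g: "g \<in> carrier (GL scale)" and h: "h \<in> carrier (GL scale)"
  show "g \<otimes>\<^bsub>GL scale\<^esub> h \<in> carrier (GL scale)"
    using g h by (auto simp: GL_def intro: Vector_Spaces.linear_compose bij_comp)
next
  show "\<one>\<^bsub>GL scale\<^esub> \<in> carrier (GL scale)" by (simp add: GL_def linear_id id_def[symmetric])
next
  fix g assume g: "g \<in> carrier (GL scale)"
  interpret g: Vector_Spaces.linear scale scale g using g by (simp add: GL_def)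
  have b: "bij g" using g by (simp add: GL_def)
  have "Vector_Spaces.linear scale scale (inv' g)"
  proof (unfold_locales, goal_cases)
    case (1 a b)
    have "g (inv' g (a + b)) = g (inv' g a + inv' g b)"
      using b by (simp add: g.add bij_is_surj surj_f_inv_f)
    then show ?case using b by (meson bij_is_inj injD)
  next
    case (2 c a)
    have "g (inv' g (scale c a)) = g (scale c (inv' g a))"
      using b by (simp add: g.scale bij_is_surj surj_f_inv_f)
    then show ?case using b by (meson bij_is_inj injD)
  qed
  then show "\<exists>y\<in>carrier (GL scale). y \<otimes>\<^bsub>GL scale\<^esub> g = \<one>\<^bsub>GL scale\<^esub>"
    using b by (intro bexI[of _ "inv' g"]) (auto simp: GL_def bij_is_inj bij_imp_bij_inv)
qed (auto simp: GL_def comp_assoc)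

lemma GL_inv:
  assumes g: "g \<in> carrier (GL scale)"
  shows "g ((inv\<^bsub>GL scale\<^esub> g) v) = v" "(inv\<^bsub>GL scale\<^esub> g) (g v) = v" "inv\<^bsub>GL scale\<^esub> g \<in> carrier (GL scale)"
proof -
  interpret GL: group "GL scale" by (rule GL_group)
  have "g \<circ> inv\<^bsub>GL scale\<^esub> g = id" "inv\<^bsub>GL scale\<^esub> g \<circ> g = id"
    using GL.r_inv[OF g] GL.l_inv[OF g] by (simp_all only: GL_mult GL_one)
  from fun_cong[OF this(1), of v] fun_cong[OF this(2), of v]
  show "g ((inv\<^bsub>GL scale\<^esub> g) v) = v" "(inv\<^bsub>GL scale\<^esub> g) (g v) = v" by simp_all
  show "inv\<^bsub>GL scale\<^esub> g \<in> carrier (GL scale)" using g by simp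
qed

text \<open>The maps g for which g - 1 lowers the flag by k steps. For k = 0 this is the group of
  upper triangular maps, for k = 1 the unitriangular group, and for k = n the trivial group; the
  truncated subtraction fits since \<open>flag 0\<close> is zero.\<close>

definition lower_by :: "nat \<Rightarrow> ('v \<Rightarrow> 'v) set" where
  "lower_by k = {g \<in> carrier (GL scale). \<forall>i. \<forall>v\<in>flag i. g v - v \<in> flag (i - k)}"

lemma lower_byD:
  assumes "g \<in> lower_by k"
  shows "g \<in> carrier (GL scale)" "v \<in> flag i \<Longrightarrow> g v - v \<in> flag (i - k)" "v \<in> flag i \<Longrightarrow> g v \<in> flag i"
proof -
  show "g \<in> carrier (GL scale)" using assms by (simp add: lower_by_def)
  show 1: "g v - v \<in> flag (i - k)" if "v \<in> flag i" using assms that by (simp add: lower_by_def)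
  show "g v \<in> flag i" if v: "v \<in> flag i"
  proof -
    have "g v - v \<in> flag i" using 1[OF v] flag_mono[of "i - k" i] by auto
    from subspace_add[OF subspace_flag this v] show ?thesis by simp
  qed
qed

text \<open>A bijective linear map sending a member of the flag into itself sends it onto itself, by
  dimension.\<close>

lemma inv_flag:
  assumes g: "g \<in> carrier (GL scale)" and "\<And>v. v \<in> flag i \<Longrightarrow> g v \<in> flag i" and v: "v \<in> flag i"
  shows "(inv\<^bsub>GL scale\<^esub> g) v \<in> flag i"
proof -
  have lin: "Vector_Spaces.linear scale scale g" by (rule linear_on_GL[OF g])
  have inj: "inj g" by (rule bij_is_inj[OF bij_on_GL[OF g]])
  interpret fdp: finite_dimensional_vector_space_pair_1 scale "e ` {..<n}" scale by unfold_locales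
  have "dim (g ` flag i) = dim (flag i)"
    by (rule fdp.dim_image_eq[OF lin]) (rule inj_on_subset[OF inj subset_UNIV])
  then have "g ` flag i = flag i"
    using assms(2) vp.linear_subspace_image[OF lin subspace_flag]
    by (intro fd.subspace_dim_equal subspace_flag) auto
  then obtain w where "w \<in> flag i" "v = g w" using v by blast
  then show ?thesis using GL_inv(2)[OF g] by simp
qed

lemma subgroup_lower_by: "subgroup (lower_by k) (GL scale)"
proof -
  interpret GL: group "GL scale" by (rule GL_group)
  show ?thesis
  proof (rule GL.subgroupI)
    show "lower_by k \<subseteq> carrier (GL scale)" by (auto simp: lower_by_def)
    have "id \<in> lower_by k"
      using GL.one_closed subspace_0[OF subspace_flag] by (simp add: lower_by_def GL_one)
    then show "lower_by k \<noteq> {}" by blast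
  next
    fix g assume g: "g \<in> lower_by k"
    note gc = lower_byD(1)[OF g]
    have "(inv\<^bsub>GL scale\<^esub> g) v - v \<in> flag (i - k)" if v: "v \<in> flag i" for i v
    proof -
      have w: "(inv\<^bsub>GL scale\<^esub> g) v \<in> flag i" by (rule inv_flag[OF gc lower_byD(3)[OF g] v])
      have "v - (inv\<^bsub>GL scale\<^esub> g) v \<in> flag (i - k)" using lower_byD(2)[OF g w] GL_inv(1)[OF gc] by simp
      from subspace_neg[OF subspace_flag this] show ?thesis by simp
    qed
    then show "inv\<^bsub>GL scale\<^esub> g \<in> lower_by k" using GL_inv(3)[OF gc] by (simp add: lower_by_def)
  next
    fix g h assume g: "g \<in> lower_by k" and h: "h \<in> lower_by k"
    have "g (h v) - v \<in> flag (i - k)" if v: "v \<in> flag i" for i v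
      using subspace_add[OF subspace_flag lower_byD(2)[OF g lower_byD(3)[OF h v]] lower_byD(2)[OF h v]] by simp
    then show "g \<otimes>\<^bsub>GL scale\<^esub> h \<in> lower_by k"
      using GL.m_closed[OF lower_byD(1)[OF g] lower_byD(1)[OF h]] by (simp add: lower_by_def GL_mult)
  qed
qed

text \<open>gh - hg is the commutator of g - 1 and h - 1. For k > 0 it lowers by 2k, which is at
  least k + 1. For k = 0 it lowers by 1 because g and h act by scalars on the successive quotients
  of the flag, and scalars commute.\<close>

lemma lower_by_commutator:
  assumes g: "g \<in> lower_by k" and h: "h \<in> lower_by k" and v: "v \<in> flag i"
  shows "g (h v) - h (g v) \<in> flag (i - Suc k)"
proof (cases i)
  case 0
  then have "v = 0" using v flag_0 by simp
  then show ?thesis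
    using subspace_0[OF subspace_flag] vp.linear_0[OF linear_on_GL[OF lower_byD(1)[OF g]]]
      vp.linear_0[OF linear_on_GL[OF lower_byD(1)[OF h]]] by simp
next
  case (Suc j)
  note lg = linear_on_GL[OF lower_byD(1)[OF g]] and lh = linear_on_GL[OF lower_byD(1)[OF h]]
  show ?thesis
  proof (cases "k = 0")
    case False
    define a where "a = g v - v"
    define b where "b = h v - v"
    have ab: "a \<in> flag (i - k)" "b \<in> flag (i - k)"
      unfolding a_def b_def using lower_byD(2)[OF g v] lower_byD(2)[OF h v] by simp_all
    have m: "g b - b \<in> flag (i - k - k)" "h a - a \<in> flag (i - k - k)"
      by (rule lower_byD(2)[OF g ab(2)], rule lower_byD(2)[OF h ab(1)])
    have "g (h v) - h (g v) = (g b - b) - (h a - a)"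
      unfolding a_def b_def by (simp add: vp.linear_diff[OF lg] vp.linear_diff[OF lh])
    also have "\<dots> \<in> flag (i - k - k)" by (rule subspace_diff[OF subspace_flag m])
    finally show ?thesis by (rule subsetD[OF flag_mono, rotated]) (use False in linarith)
  next
    case True
    define w where "w = v - scale (coord j v) (e j)"
    have vw: "v = scale (coord j v) (e j) + w" by (simp add: w_def)
    have w: "w \<in> flag j" unfolding w_def using flag_Suc_decompose v Suc by blast
    \<comment> \<open>On the quotient of neighbouring members of the flag, f acts by its diagonal
      entry.\<close>
    have dec: "f u - scale (coord j (f (e j))) u \<in> flag j"
      if f: "f \<in> lower_by k" and u: "u \<in> flag (Suc j)" and jn: "j < n" for f u
    proof -
      note lf = linear_on_GL[OF lower_byD(1)[OF f]]
      define r where "r = u - scale (coord j u) (e j)"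
      have r: "r \<in> flag j" unfolding r_def by (rule flag_Suc_decompose[OF u])
      have fe: "f (e j) - scale (coord j (f (e j))) (e j) \<in> flag j"
        by (rule flag_Suc_decompose) (rule lower_byD(3)[OF f basis_in_flag[OF _ jn]], simp)
      have "f u - scale (coord j (f (e j))) u =
          scale (coord j u) (f (e j) - scale (coord j (f (e j))) (e j)) + (f r - scale (coord j (f (e j))) r)"
        by (simp add: r_def vp.linear_diff[OF lf] vp.linear_scale[OF lf] scale_right_diff_distrib mult.commute)
      also have "\<dots> \<in> flag j"
        by (intro subspace_add[OF subspace_flag] subspace_diff[OF subspace_flag] subspace_scale[OF subspace_flag]
            fe r lower_byD(3)[OF f r])
      finally show ?thesis .
    qed
    show ?thesis
    proof (cases "j < n")
      case jn: True
      define x where "x = coord j (g (e j))"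
      define y where "y = coord j (h (e j))"
      have v': "v \<in> flag (Suc j)" using v Suc by simp
      have 1: "h v - scale y v \<in> flag j" "g v - scale x v \<in> flag j"
        unfolding x_def y_def by (rule dec[OF h v' jn], rule dec[OF g v' jn])
      have 2: "g (h v - scale y v) \<in> flag j" "h (g v - scale x v) \<in> flag j"
        using lower_byD(3)[OF g 1(1)] lower_byD(3)[OF h 1(2)] by simp_all
      have "g (h v) - h (g v) = (g (h v - scale y v) + scale y (g v - scale x v)) - (h (g v - scale x v) + scale x (h v - scale y v))"
        by (simp add: vp.linear_diff[OF lg] vp.linear_diff[OF lh] vp.linear_scale[OF lg] vp.linear_scale[OF lh]
            scale_right_diff_distrib mult.commute)
      also have "\<dots> \<in> flag j"
        by (intro subspace_diff[OF subspace_flag] subspace_add[OF subspace_flag] subspace_scale[OF subspace_flag] 1 2)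
      finally show ?thesis using True Suc by simp
    next
      case False
      then have "flag (i - Suc k) = UNIV" using True Suc by (intro flag_n) simp
      then show ?thesis by simp
    qed
  qed
qed

lemma derived_lower_by: "derived (GL scale) (lower_by k) \<subseteq> lower_by (Suc k)"
proof -
  interpret GL: group "GL scale" by (rule GL_group)
  show ?thesis
    unfolding derived_def
  proof (rule GL.generate_subgroup_incl[OF _ subgroup_lower_by], clarify)
    fix g h assume g: "g \<in> lower_by k" and h: "h \<in> lower_by k"
    note gc = lower_byD(1)[OF g] and hc = lower_byD(1)[OF h]
    note gi = GL_inv[OF gc] and hi = GL_inv[OF hc]
    define c where "c = g \<otimes>\<^bsub>GL scale\<^esub> h \<otimes>\<^bsub>GL scale\<^esub> inv\<^bsub>GL scale\<^esub> g \<otimes>\<^bsub>GL scale\<^esub> inv\<^bsub>GL scale\<^esub> h"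
    have "c v - v \<in> flag (i - Suc k)" if v: "v \<in> flag i" for i v
    proof -
      \<comment> \<open>With this u the vector v is \<open>h (g u)\<close> and the image of v under
        the commutator is \<open>g (h u)\<close>, so the preceding lemma applies.\<close>
      define u where "u = (inv\<^bsub>GL scale\<^esub> g) ((inv\<^bsub>GL scale\<^esub> h) v)"
      have "u \<in> flag i"
        unfolding u_def
        by (intro inv_flag[OF gc lower_byD(3)[OF g]] inv_flag[OF hc lower_byD(3)[OF h]] v)
      from lower_by_commutator[OF g h this]
      have "g (h u) - h (g u) \<in> flag (i - Suc k)" .
      moreover have "h (g u) = v" by (simp add: u_def gi(1) hi(1))
      moreover have "c v = g (h u)" by (simp add: c_def u_def GL_mult)
      ultimately show ?thesis by simp
    qed
    moreover have "c \<in> carrier (GL scale)" using gc hc by (simp add: c_def)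
    ultimately have "c \<in> lower_by (Suc k)" by (simp add: lower_by_def)
    then show "g \<otimes>\<^bsub>GL scale\<^esub> h \<otimes>\<^bsub>GL scale\<^esub> inv\<^bsub>GL scale\<^esub> g \<otimes>\<^bsub>GL scale\<^esub> inv\<^bsub>GL scale\<^esub> h \<in> lower_by (Suc k)"
      by (simp only: c_def)
  qed
qed

text \<open>The m-th derived group lies in \<open>lower_by m\<close>, which is trivial for m =
  n.\<close>

lemma solvable_subset_lower_by_0:
  assumes H: "subgroup H (GL scale)" "H \<subseteq> lower_by 0"
  shows "solvable (GL scale\<lparr>carrier := H\<rparr>)"
proof -
  interpret GL: group "GL scale" by (rule GL_group)
  interpret HG: group "GL scale\<lparr>carrier := H\<rparr>" by (rule GL.subgroup_imp_group[OF H(1)])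
  have 1: "(derived (GL scale\<lparr>carrier := H\<rparr>) ^^ m) H \<subseteq> H \<and>
      (derived (GL scale\<lparr>carrier := H\<rparr>) ^^ m) H \<subseteq> lower_by m" for m
  proof (induction m)
    case 0 then show ?case using H by simp
  next
    case (Suc m)
    define D where "D = (derived (GL scale\<lparr>carrier := H\<rparr>) ^^ m) H"
    have D: "D \<subseteq> H" "D \<subseteq> lower_by m" using Suc by (simp_all add: D_def)
    have e: "derived (GL scale\<lparr>carrier := H\<rparr>) D = derived (GL scale) D"
      by (rule GL.derived_consistent[OF D(1) H(1)])
    have "derived (GL scale) D \<subseteq> H" by (rule GL.derived_incl[OF D(1) H(1)])
    moreover have "derived (GL scale) D \<subseteq> lower_by (Suc m)"
      using GL.mono_derived[OF D(2)] derived_lower_by by blast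
    ultimately show ?case by (simp add: D_def[symmetric] e)
  qed
  have "lower_by n \<subseteq> {id}"
  proof
    fix g assume g: "g \<in> lower_by n"
    have "g v - v = 0" for v
      using lower_byD(2)[OF g, of v n] flag_n[of n] flag_0 by simp
    then show "g \<in> {id}" by (auto simp: fun_eq_iff)
  qed
  moreover have "id \<in> (derived (GL scale\<lparr>carrier := H\<rparr>) ^^ n) H"
  proof -
    have "subgroup ((derived (GL scale\<lparr>carrier := H\<rparr>) ^^ n) H) (GL scale\<lparr>carrier := H\<rparr>)"
      by (rule HG.exp_of_derived_is_subgroup) (use HG.subgroup_self in simp)
    from subgroup.one_closed[OF this] show ?thesis by (simp add: GL_one)
  qed
  ultimately have "(derived (GL scale\<lparr>carrier := H\<rparr>) ^^ n) (carrier (GL scale\<lparr>carrier := H\<rparr>)) = {\<one>\<^bsub>GL scale\<lparr>carrier := H\<rparr>\<^esub>}"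
    using 1[of n] by (auto simp: GL_one)
  then show ?thesis using HG.solvable_iff_trivial_derived_seq by blast
qed

definition triangular :: "('v \<Rightarrow> 'v) \<Rightarrow> bool" where
  "triangular g \<longleftrightarrow> Vector_Spaces.linear scale scale g \<and> (\<forall>i j. i < j \<longrightarrow> j < n \<longrightarrow> coord j (g (e i)) = 0)"

lemma linear_coord_image:
  assumes "Vector_Spaces.linear scale scale g"
  shows "coord j (g v) = (\<Sum>i<n. coord i v * coord j (g (e i)))"
proof -
  have "g v = (\<Sum>i<n. scale (coord i v) (g (e i)))"
    by (subst coord_expand[of v]) (simp add: vp.linear_sum[OF assms] vp.linear_scale[OF assms])
  then show ?thesis by (simp add: vf.linear_sum[OF linear_coord] coord_simps)
qed

lemma triangular_flag:
  assumes g: "triangular g" and v: "v \<in> flag i"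
  shows "g v \<in> flag i"
  unfolding flag_def
proof (intro CollectI allI impI)
  fix j assume j: "j < n" "i \<le> j"
  have "coord l v * coord j (g (e l)) = 0" if "l < n" for l
    using v g that j by (cases "i \<le> l") (simp_all add: flag_def triangular_def)
  then have "(\<Sum>l<n. coord l v * coord j (g (e l))) = 0" by (intro sum.neutral) simp
  moreover have "Vector_Spaces.linear scale scale g" using g by (simp add: triangular_def)
  ultimately show "coord j (g v) = 0" by (simp only: linear_coord_image[of g j v])
qed

lemma triangular_top_coord:
  assumes g: "triangular g" and j: "j < n" and v: "v \<in> flag (Suc j)"
  shows "coord j (g v) = coord j v * coord j (g (e j))"
proof -
  have "coord j (g v) = (\<Sum>i<n. coord i v * coord j (g (e i)))"
    using g by (intro linear_coord_image) (simp add: triangular_def)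
  also have "\<dots> = (\<Sum>i<n. if i = j then coord j v * coord j (g (e j)) else 0)"
    by (rule sum.cong) (use g v j in \<open>auto simp: triangular_def flag_def Suc_le_eq neq_iff\<close>)
  finally show ?thesis using j by simp
qed

text \<open>A kernel vector descends the flag one step at a time, since each diagonal entry is
  nonzero, and ends in \<open>flag 0\<close>.\<close>

lemma triangular_bij:
  assumes g: "triangular g" and d: "\<And>i. i < n \<Longrightarrow> coord i (g (e i)) \<noteq> 0"
  shows "bij g"
proof -
  have lin: "Vector_Spaces.linear scale scale g" using g by (simp add: triangular_def)
  have step: "v \<in> flag i" if "v \<in> flag (Suc i)" "g v = 0" for v i
  proof (cases "i < n")
    case True
    then have "coord i v * coord i (g (e i)) = 0"
      using triangular_top_coord[OF g True that(1)] that(2) coord_simps by simp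
    then have "coord i v = 0" using d[OF True] by simp
    then show ?thesis using flag_Suc_decompose[OF that(1)] by simp
  next
    case False
    then show ?thesis using flag_n by simp
  qed
  have "v \<in> flag (n - m)" if "g v = 0" for v m
  proof (induction m)
    case 0 then show ?case using flag_n by simp
  next
    case (Suc m)
    then show ?case
      by (cases "n \<le> m") (use step[of v "n - Suc m"] that in \<open>simp_all add: Suc_diff_Suc\<close>)
  qed
  then have "v = 0" if "g v = 0" for v using that flag_0 by (metis diff_self_eq_0 singletonD)
  then have inj: "inj g" unfolding vp.linear_inj_iff_eq_0[OF lin] by blast
  interpret fdp: finite_dimensional_vector_space_pair scale "e ` {..<n}" scale "e ` {..<n}" by unfold_locales
  have "surj g" by (rule fdp.linear_injective_imp_surjective[OF lin inj refl])
  then show ?thesis using inj by (simp add: bij_def)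
qed

lemma lower_by_0_iff: "g \<in> lower_by 0 \<longleftrightarrow> g \<in> carrier (GL scale) \<and> triangular g"
proof
  assume g: "g \<in> lower_by 0"
  have "coord j (g (e i)) = 0" if "i < j" "j < n" for i j
  proof -
    have "g (e i) \<in> flag (Suc i)" by (rule lower_byD(3)[OF g basis_in_flag]) (use that in simp_all)
    then show ?thesis using that by (simp add: flag_def)
  qed
  then show "g \<in> carrier (GL scale) \<and> triangular g"
    using lower_byD(1)[OF g] linear_on_GL by (simp add: triangular_def)
next
  assume g: "g \<in> carrier (GL scale) \<and> triangular g"
  then show "g \<in> lower_by 0"
    using triangular_flag subspace_diff[OF subspace_flag] by (simp add: lower_by_def)
qed

lemma diagonal_nonzero:
  assumes g: "g \<in> lower_by 0" and i: "i < n"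
  shows "coord i (g (e i)) \<noteq> 0"
proof
  assume 0: "coord i (g (e i)) = 0"
  note gc = lower_byD(1)[OF g]
  have "g (e i) \<in> flag (Suc i)" by (rule lower_byD(3)[OF g basis_in_flag]) (use i in simp_all)
  from flag_Suc_decompose[OF this] have "g (e i) \<in> flag i" using 0 by simp
  from inv_flag[OF gc lower_byD(3)[OF g] this]
  have "e i \<in> flag i" by (simp only: GL_inv(2)[OF gc])
  then have "coord i (e i) = 0" using i unfolding flag_def by blast
  then show False using coord_basis[OF i i] by simp
qed

section \<open>Zariski closed and connected groups\<close>

lemma zariski_closed_coords:
  assumes "H = {g \<in> carrier (GL scale). \<forall>(i, j)\<in>R. coord j (g (e i)) = 0}"
  shows "zariski_closed scale H"
  unfolding zariski_closed_def
proof (intro exI conjI)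
  show "(\<lambda>(i, j) g. coord j (g (e i))) ` R \<subseteq> regular_funs scale"
    using linear_coord by (auto intro!: regular_funs.coeff simp: dual_space_def)
  show "H = {g \<in> carrier (GL scale). \<forall>a\<in>(\<lambda>(i, j) g. coord j (g (e i))) ` R. a g = 0}"
    unfolding assms by auto
qed

definition line_pt :: "('v \<Rightarrow> 'v) \<Rightarrow> ('v \<Rightarrow> 'v) \<Rightarrow> complex \<Rightarrow> 'v \<Rightarrow> 'v" where
  "line_pt g h t = (\<lambda>v. scale (1 - t) (g v) + scale t (h v))"

lemma regular_on_line:
  assumes "a \<in> regular_funs scale"
  shows "\<exists>q. \<forall>t. a (line_pt g h t) = poly q t"
  using assms
proof (induction rule: regular_funs.induct)
  case (const c)
  show ?case by (rule exI[of _ "[:c:]"]) simp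
next
  case (coeff \<phi> v)
  then have l: "Vector_Spaces.linear scale (*) \<phi>" by (simp add: dual_space_def)
  show ?case
    by (rule exI[of _ "[:\<phi> (g v), \<phi> (h v) - \<phi> (g v):]"])
      (unfold line_pt_def vf.linear_add[OF l] vf.linear_scale[OF l], simp add: left_diff_distrib right_diff_distrib)
next
  case (add a b)
  then obtain q r where "\<And>t. a (line_pt g h t) = poly q t" "\<And>t. b (line_pt g h t) = poly r t" by blast
  then show ?case by (intro exI[of _ "q + r"]) simp
next
  case (mult a b)
  then obtain q r where "\<And>t. a (line_pt g h t) = poly q t" "\<And>t. b (line_pt g h t) = poly r t" by blast
  then show ?case by (intro exI[of _ "q * r"]) simp
qed

text \<open>Connectedness is tested on the affine line through two matrices, where regular functions
  become polynomials in t. It is enough that H contains all but finitely many points of the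
  line.\<close>

lemma zariski_connected_of_lines:
  assumes fin: "\<And>g h. g \<in> H \<Longrightarrow> h \<in> H \<Longrightarrow> finite {t. line_pt g h t \<notin> H}"
  shows "zariski_connected scale H"
  unfolding zariski_connected_def
proof
  assume "\<exists>Z1 Z2. zariski_closed scale Z1 \<and> zariski_closed scale Z2 \<and>
      Z1 \<noteq> {} \<and> Z2 \<noteq> {} \<and> Z1 \<inter> Z2 = {} \<and> Z1 \<union> Z2 = H"
  then obtain Z1 Z2 where Z: "zariski_closed scale Z1" "zariski_closed scale Z2"
    "Z1 \<noteq> {}" "Z2 \<noteq> {}" "Z1 \<inter> Z2 = {}" "Z1 \<union> Z2 = H" by blast
  obtain g h where g: "g \<in> Z1" and h: "h \<in> Z2" using Z(3,4) by blast
  obtain P where P: "P \<subseteq> regular_funs scale" "Z1 = {g \<in> carrier (GL scale). \<forall>a\<in>P. a g = 0}"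
    using Z(1) unfolding zariski_closed_def by blast
  obtain Q where Q: "Q \<subseteq> regular_funs scale" "Z2 = {g \<in> carrier (GL scale). \<forall>a\<in>Q. a g = 0}"
    using Z(2) unfolding zariski_closed_def by blast
  have gh: "g \<in> carrier (GL scale)" "h \<in> carrier (GL scale)" "g \<notin> Z2" "h \<notin> Z1"
    using g h P(2) Q(2) Z(5) by blast+
  \<comment> \<open>a vanishes on Z1 but not at h, and b vanishes on Z2 but not at g. On the line
    their product is a nonzero polynomial, yet it vanishes at every t whose point lies in H.\<close>
  obtain a where a: "a \<in> P" "a h \<noteq> 0" using gh(2,4) P(2) by blast
  obtain b where b: "b \<in> Q" "b g \<noteq> 0" using gh(1,3) Q(2) by blast
  obtain q where q: "\<And>t. a (line_pt g h t) = poly q t" using regular_on_line a(1) P(1) by blast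
  obtain r where r: "\<And>t. b (line_pt g h t) = poly r t" using regular_on_line b(1) Q(1) by blast
  have "line_pt g h 0 = g" "line_pt g h 1 = h" by (simp_all add: line_pt_def)
  then have "poly q 1 \<noteq> 0" "poly r 0 \<noteq> 0" using a(2) b(2) q[of 1] r[of 0] by simp_all
  then have "q \<noteq> 0" "r \<noteq> 0" by auto
  then have "finite {t. poly (q * r) t = 0}" by (intro poly_roots_finite) simp
  moreover have "finite {t. line_pt g h t \<notin> H}" using fin g h Z(6) by blast
  ultimately have "finite ({t. poly (q * r) t = 0} \<union> {t. line_pt g h t \<notin> H})" by simp
  moreover have "{t. poly (q * r) t = 0} \<union> {t. line_pt g h t \<notin> H} = UNIV"
  proof (rule equalityI[OF subset_UNIV], rule subsetI)
    fix t
    show "t \<in> {t. poly (q * r) t = 0} \<union> {t. line_pt g h t \<notin> H}"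
    proof (cases "line_pt g h t \<in> H")
      case True
      then have "line_pt g h t \<in> Z1 \<or> line_pt g h t \<in> Z2" using Z(6) by blast
      then have "a (line_pt g h t) = 0 \<or> b (line_pt g h t) = 0" using P(2) Q(2) a(1) b(1) by blast
      then show ?thesis using q r by auto
    qed simp
  qed
  ultimately have "finite (UNIV :: complex set)" by metis
  then show False by (simp add: infinite_UNIV_char_0)
qed

text \<open>Each diagonal entry is an affine function of t with a nonzero value at t = 0; outside
  its zeros the point on the line stays invertible.\<close>

lemma finite_line_degenerate:
  assumes "g \<in> lower_by 0" "h \<in> lower_by 0"
  shows "finite {t. \<exists>i<n. coord i (line_pt g h t (e i)) = 0}"
proof -
  have "finite {t. coord i (line_pt g h t (e i)) = 0}" if i: "i < n" for i
  proof -
    define q where "q = [:coord i (g (e i)), coord i (h (e i)) - coord i (g (e i)):]"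
    have "q \<noteq> 0" using diagonal_nonzero[OF assms(1) i] by (simp add: q_def)
    moreover have "coord i (line_pt g h t (e i)) = poly q t" for t
      by (simp add: line_pt_def q_def coord_simps algebra_simps)
    ultimately show ?thesis by (simp add: poly_roots_finite)
  qed
  then have "finite (\<Union>i<n. {t. coord i (line_pt g h t (e i)) = 0})" by blast
  then show ?thesis by (rule finite_subset[rotated]) blast
qed

lemma triangular_line:
  assumes "triangular g" "triangular h"
  shows "triangular (line_pt g h t)"
proof -
  have l: "Vector_Spaces.linear scale scale g" "Vector_Spaces.linear scale scale h"
    using assms by (simp_all add: triangular_def)
  have "Vector_Spaces.linear scale scale (line_pt g h t)"
    unfolding line_pt_def by (intro vp.linear_compose_add vp.linear_compose_scale_right l)
  then show ?thesis using assms by (simp add: triangular_def line_pt_def coord_simps)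
qed

lemma line_in_lower_by_0:
  assumes "g \<in> lower_by 0" "h \<in> lower_by 0" "\<not> (\<exists>i<n. coord i (line_pt g h t (e i)) = 0)"
  shows "line_pt g h t \<in> lower_by 0"
proof -
  have tr: "triangular (line_pt g h t)" using assms(1,2) triangular_line by (simp add: lower_by_0_iff)
  moreover have "bij (line_pt g h t)" by (rule triangular_bij[OF tr]) (use assms(3) in blast)
  ultimately show ?thesis by (simp add: lower_by_0_iff GL_def triangular_def)
qed

lemma conn_solvable_lower_by_0: "conn_solvable_subgroup scale (lower_by 0)"
  unfolding conn_solvable_subgroup_def conn_closed_subgroup_def
proof (intro conjI subgroup_lower_by)
  show "zariski_closed scale (lower_by 0)"
    by (rule zariski_closed_coords[where R = "{(i, j). i < j \<and> j < n}"])
      (auto simp: lower_by_0_iff triangular_def linear_on_GL)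
  show "zariski_connected scale (lower_by 0)"
  proof (rule zariski_connected_of_lines)
    fix g h assume g: "g \<in> lower_by 0" and h: "h \<in> lower_by 0"
    show "finite {t. line_pt g h t \<notin> lower_by 0}"
      using finite_line_degenerate[OF g h] by (rule finite_subset[rotated]) (use line_in_lower_by_0[OF g h] in blast)
  qed
  show "solvable (GL scale\<lparr>carrier := lower_by 0\<rparr>)"
    by (rule solvable_subset_lower_by_0[OF subgroup_lower_by order_refl])
qed

section \<open>The standard torus and the standard unipotent group\<close>

definition diagonal_group :: "('v \<Rightarrow> 'v) set" where
  "diagonal_group = {g \<in> carrier (GL scale). \<forall>i<n. \<exists>c. g (e i) = scale c (e i)}"

lemma diagonal_iff:
  assumes "i < n"
  shows "(\<exists>c. v = scale c (e i)) \<longleftrightarrow> (\<forall>j<n. j \<noteq> i \<longrightarrow> coord j v = 0)"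
proof
  assume "\<exists>c. v = scale c (e i)"
  then show "\<forall>j<n. j \<noteq> i \<longrightarrow> coord j v = 0" using assms by (auto simp: coord_simps coord_basis)
next
  assume "\<forall>j<n. j \<noteq> i \<longrightarrow> coord j v = 0"
  then have "v = scale (coord i v) (e i)" using assms by (intro coord_eqI) (auto simp: coord_simps coord_basis)
  then show "\<exists>c. v = scale c (e i)" by blast
qed

lemma diagonal_group_lower_by_0: "diagonal_group \<subseteq> lower_by 0"
proof
  fix g assume g: "g \<in> diagonal_group"
  have "coord j (g (e i)) = 0" if "i < j" "j < n" for i j
  proof -
    have "\<exists>c. g (e i) = scale c (e i)" using g that by (simp add: diagonal_group_def)
    then show ?thesis using diagonal_iff[of i "g (e i)"] that by simp
  qed
  then show "g \<in> lower_by 0"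
    using g linear_on_GL[of g scale] by (simp add: lower_by_0_iff triangular_def diagonal_group_def)
qed

lemma torus_diagonal_group: "torus scale diagonal_group"
  unfolding torus_def conn_closed_subgroup_def
proof (intro conjI)
  interpret GL: group "GL scale" by (rule GL_group)
  show "subgroup diagonal_group (GL scale)"
  proof (rule GL.subgroupI)
    show "diagonal_group \<subseteq> carrier (GL scale)" by (auto simp: diagonal_group_def)
    have "\<exists>c. id (e i) = scale c (e i)" for i by (rule exI[of _ 1]) simp
    then have "id \<in> diagonal_group" using GL.one_closed by (simp only: diagonal_group_def GL_one mem_Collect_eq) simp
    then show "diagonal_group \<noteq> {}" by blast
  next
    fix g assume g: "g \<in> diagonal_group"
    then have gc: "g \<in> carrier (GL scale)" by (simp add: diagonal_group_def)
    have "\<exists>d. (inv\<^bsub>GL scale\<^esub> g) (e i) = scale d (e i)" if i: "i < n" for i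
    proof -
      obtain c where c: "g (e i) = scale c (e i)" using g i by (auto simp: diagonal_group_def)
      have lin: "Vector_Spaces.linear scale scale (inv\<^bsub>GL scale\<^esub> g)" by (rule linear_on_GL[OF GL_inv(3)[OF gc]])
      have ce: "e i = scale c ((inv\<^bsub>GL scale\<^esub> g) (e i))"
        using GL_inv(2)[OF gc, of "e i"] by (simp add: c vp.linear_scale[OF lin])
      have "c \<noteq> 0"
      proof
        assume "c = 0"
        then have "e i = 0" using ce by simp
        then show False using coord_basis[OF i i] coord_simps by simp
      qed
      then have "(inv\<^bsub>GL scale\<^esub> g) (e i) = scale (1 / c) (e i)" by (subst (2) ce) simp
      then show ?thesis by blast
    qed
    then show "inv\<^bsub>GL scale\<^esub> g \<in> diagonal_group" using GL_inv(3)[OF gc] by (simp add: diagonal_group_def)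
  next
    fix g h assume g: "g \<in> diagonal_group" and h: "h \<in> diagonal_group"
    then have c: "g \<in> carrier (GL scale)" "h \<in> carrier (GL scale)" by (simp_all add: diagonal_group_def)
    have "\<exists>d. g (h (e i)) = scale d (e i)" if i: "i < n" for i
    proof -
      obtain x y where "g (e i) = scale x (e i)" "h (e i) = scale y (e i)"
        using g h i unfolding diagonal_group_def by blast
      then have "g (h (e i)) = scale (y * x) (e i)" by (simp add: vp.linear_scale[OF linear_on_GL[OF c(1)]])
      then show ?thesis by blast
    qed
    then show "g \<otimes>\<^bsub>GL scale\<^esub> h \<in> diagonal_group"
      using GL.m_closed[OF c] by (simp add: diagonal_group_def GL_mult)
  qed
  show "zariski_closed scale diagonal_group"
    by (rule zariski_closed_coords[where R = "{(i, j). i < n \<and> j < n \<and> j \<noteq> i}"])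
      (auto simp: diagonal_group_def diagonal_iff)
  show "zariski_connected scale diagonal_group"
  proof (rule zariski_connected_of_lines)
    fix g h assume g: "g \<in> diagonal_group" and h: "h \<in> diagonal_group"
    have B: "g \<in> lower_by 0" "h \<in> lower_by 0" using g h diagonal_group_lower_by_0 by blast+
    have "line_pt g h t \<in> diagonal_group" if "\<not> (\<exists>i<n. coord i (line_pt g h t (e i)) = 0)" for t
    proof -
      have "line_pt g h t \<in> carrier (GL scale)" by (rule lower_byD(1)[OF line_in_lower_by_0[OF B that]])
      moreover have "\<exists>c. line_pt g h t (e i) = scale c (e i)" if i: "i < n" for i
      proof -
        obtain x y where "g (e i) = scale x (e i)" "h (e i) = scale y (e i)"
          using g h i unfolding diagonal_group_def by blast
        then have "line_pt g h t (e i) = scale ((1 - t) * x + t * y) (e i)"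
          by (simp add: line_pt_def scale_left_distrib)
        then show ?thesis by blast
      qed
      ultimately show ?thesis by (simp add: diagonal_group_def)
    qed
    then show "finite {t. line_pt g h t \<notin> diagonal_group}"
      using finite_line_degenerate[OF B] by (rule_tac finite_subset[rotated]) blast+
  qed
  show "simultaneously_diagonalizable scale diagonal_group"
    unfolding simultaneously_diagonalizable_def
    by (intro exI[of _ "e ` {..<n}"]) (auto simp: indep_e span_e diagonal_group_def)
qed

lemma unipotent_lower_by_1: "unipotent_subgroup scale (lower_by 1)"
  unfolding unipotent_subgroup_def
proof (intro conjI ballI subgroup_lower_by exI[of _ n] allI)
  fix u v assume u: "u \<in> lower_by 1"
  have "((\<lambda>w. u w - w) ^^ m) v \<in> flag (n - m)" for m
  proof (induction m)
    case 0 then show ?case using flag_n by simp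
  next
    case (Suc m)
    from lower_byD(2)[OF u Suc.IH] show ?case by simp
  qed
  from this[of n] show "((\<lambda>w. u w - w) ^^ n) v = 0" using flag_0 by simp
qed

text \<open>The i-th diagonal entry of a power of u - 1 is the power of the diagonal entry of u
  minus 1, so nilpotency forces the diagonal entries of u to be 1.\<close>

lemma unipotent_in_lower_by_1:
  assumes U: "unipotent_subgroup scale U" "U \<subseteq> lower_by 0"
  shows "U \<subseteq> lower_by 1"
proof
  fix u assume u: "u \<in> U"
  have uB: "u \<in> lower_by 0" using u U(2) by blast
  note gc = lower_byD(1)[OF uB]
  have tr: "triangular u" using uB by (simp add: lower_by_0_iff)
  obtain m where m: "\<And>v. ((\<lambda>w. u w - w) ^^ m) v = 0" using U(1) u unfolding unipotent_subgroup_def by blast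
  have d: "coord i (u (e i)) = 1" if i: "i < n" for i
  proof -
    \<comment> \<open>The iterates stay in the same member of the flag, where the top coordinate is
      multiplied by the diagonal entry each time.\<close>
    have "((\<lambda>w. u w - w) ^^ k) (e i) \<in> flag (Suc i) \<and>
        coord i (((\<lambda>w. u w - w) ^^ k) (e i)) = (coord i (u (e i)) - 1) ^ k" for k
    proof (induction k)
      case 0 then show ?case using basis_in_flag i coord_basis by simp
    next
      case (Suc k)
      define w where "w = ((\<lambda>w. u w - w) ^^ k) (e i)"
      have w: "w \<in> flag (Suc i)" "coord i w = (coord i (u (e i)) - 1) ^ k" using Suc by (simp_all add: w_def)
      have "u w - w \<in> flag (Suc i)" by (rule subspace_diff[OF subspace_flag lower_byD(3)[OF uB w(1)] w(1)])
      moreover have "coord i (u w - w) = (coord i (u (e i)) - 1) ^ Suc k"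
        using triangular_top_coord[OF tr i w(1)] w(2) by (simp add: coord_simps algebra_simps)
      ultimately show ?case by (simp add: w_def)
    qed
    from this[of m] have "(coord i (u (e i)) - 1) ^ m = 0" using m coord_simps by simp
    then show ?thesis by simp
  qed
  have "u v - v \<in> flag (i - 1)" if v: "v \<in> flag i" for i v
  proof (cases i)
    case 0
    then show ?thesis using lower_byD(2)[OF uB v] by simp
  next
    case (Suc j)
    have "u v - v \<in> flag (Suc j)" using lower_byD(2)[OF uB v] Suc by simp
    from flag_Suc_decompose[OF this]
    have "u v - v - scale (coord j (u v - v)) (e j) \<in> flag j" .
    moreover have "coord j (u v - v) = 0 \<or> \<not> j < n"
      using triangular_top_coord[OF tr _ v[unfolded Suc]] d by (auto simp: coord_simps)
    ultimately show ?thesis using Suc flag_n[of j] by auto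
  qed
  then show "u \<in> lower_by 1" using gc by (simp add: lower_by_def)
qed

text \<open>The adapted basis places B inside the upper triangular group, which is itself connected
  and solvable, so maximality gives equality. The same argument inside B identifies T and U.\<close>

theorem adapted_groups:
  assumes B: "borel_subgroup scale B" and T: "maximal_torus scale B T"
    and U: "maximal_unipotent_subgroup scale B U" and ad: "adapted_basis scale n B T e"
  shows "T = diagonal_group" "U = lower_by 1"
proof -
  have BGL: "B \<subseteq> carrier (GL scale)"
    using B by (auto simp: borel_subgroup_def conn_solvable_subgroup_def conn_closed_subgroup_def dest: subgroup.subset)
  have "B \<subseteq> lower_by 0"
  proof
    fix b assume b: "b \<in> B"
    have bc: "b \<in> carrier (GL scale)" using b BGL by blast
    have "coord j (b (e i)) = 0" if "i < j" "j < n" for i j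
    proof -
      have "b (e i) \<in> span (e ` {..i})" using ad b that by (simp add: adapted_basis_def)
      then have "b (e i) \<in> flag (Suc i)" using flag_eq_span[of "Suc i"] that by (simp add: lessThan_Suc_atMost)
      then show ?thesis using that by (simp add: flag_def)
    qed
    then show "b \<in> lower_by 0" using bc linear_on_GL by (simp add: lower_by_0_iff triangular_def)
  qed
  then have BL: "B = lower_by 0" using B conn_solvable_lower_by_0 unfolding borel_subgroup_def by blast
  have tT: "torus scale T" "T \<subseteq> B" "\<And>T'. torus scale T' \<Longrightarrow> T' \<subseteq> B \<Longrightarrow> T \<subseteq> T' \<Longrightarrow> T' = T"
    using T unfolding maximal_torus_def by blast+
  have "T \<subseteq> diagonal_group" using tT(2) BGL ad unfolding diagonal_group_def adapted_basis_def by blast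
  then show "T = diagonal_group"
    using tT(3)[OF torus_diagonal_group] diagonal_group_lower_by_0 BL by blast
  have uU: "unipotent_subgroup scale U" "U \<subseteq> B"
    "\<And>U'. unipotent_subgroup scale U' \<Longrightarrow> U' \<subseteq> B \<Longrightarrow> U \<subseteq> U' \<Longrightarrow> U' = U"
    using U unfolding maximal_unipotent_subgroup_def by blast+
  have "lower_by 1 \<subseteq> lower_by 0"
  proof
    fix g assume g: "g \<in> lower_by 1"
    have "g v - v \<in> flag i" if "v \<in> flag i" for v i
      using lower_byD(2)[OF g that] flag_mono[of "i - 1" i] by auto
    then show "g \<in> lower_by 0" using lower_byD(1)[OF g] by (simp add: lower_by_def)
  qed
  then show "U = lower_by 1"
    using uU(3)[OF unipotent_lower_by_1] unipotent_in_lower_by_1[OF uU(1)] uU(2) BL by blast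
qed

end

section \<open>Counting lattice points in dilated polytopes\<close>

lemma ratio_cancel: "(x :: real) \<noteq> 0 \<Longrightarrow> y / x * (x / z) = y / z"
  by simp

text \<open>The family \<open>G d\<close> consists of the lattice points x satisfying finitely many inequalities
  \<open>l j x \<ge> 0\<close> and homogeneous equations \<open>m k x = d * c k\<close>; \<open>I\<close> contains the supports.\<close>

locale dilated_lattice_points =
  fixes I :: "'b set" and J :: "'j set" and l :: "'j \<Rightarrow> ('b \<Rightarrow> int) \<Rightarrow> int"
    and K :: "'k set" and m :: "'k \<Rightarrow> ('b \<Rightarrow> int) \<Rightarrow> int" and c :: "'k \<Rightarrow> int"
  assumes finI: "finite I" and finJ: "finite J"
    and l_add: "\<And>j x y. j \<in> J \<Longrightarrow> l j (\<lambda>b. x b + y b) = l j x + l j y"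
    and m_add: "\<And>k x y. k \<in> K \<Longrightarrow> m k (\<lambda>b. x b + y b) = m k x + m k y"
begin

definition G :: "nat \<Rightarrow> ('b \<Rightarrow> int) set" where
  "G d = {x. (\<forall>b. b \<notin> I \<longrightarrow> x b = 0) \<and> (\<forall>j\<in>J. 0 \<le> l j x) \<and> (\<forall>k\<in>K. m k x = int d * c k)}"

abbreviation h :: "nat \<Rightarrow> nat" where "h d \<equiv> card (G d)"

definition plus_pt :: "('b \<Rightarrow> int) \<Rightarrow> ('b \<Rightarrow> int) \<Rightarrow> 'b \<Rightarrow> int" where
  "plus_pt x y = (\<lambda>b. x b + y b)"

definition mult_pt :: "nat \<Rightarrow> ('b \<Rightarrow> int) \<Rightarrow> 'b \<Rightarrow> int" where
  "mult_pt n x = (\<lambda>b. int n * x b)"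

lemma plus_pt_cancel: "plus_pt x z = plus_pt y z \<longleftrightarrow> x = y"
  by (auto simp: plus_pt_def fun_eq_iff)

lemma l_plus: "j \<in> J \<Longrightarrow> l j (plus_pt x y) = l j x + l j y"
  unfolding plus_pt_def by (rule l_add)

lemma m_plus: "k \<in> K \<Longrightarrow> m k (plus_pt x y) = m k x + m k y"
  unfolding plus_pt_def by (rule m_add)

lemma mult_pt_0: "mult_pt 0 x = (\<lambda>_. 0)" by (simp add: mult_pt_def)

lemma mult_pt_Suc: "mult_pt (Suc n) x = plus_pt (mult_pt n x) x"
  by (simp add: mult_pt_def plus_pt_def fun_eq_iff algebra_simps)

lemma l_zero: "j \<in> J \<Longrightarrow> l j (\<lambda>_. 0) = 0"
  using l_add[of j "\<lambda>_. 0" "\<lambda>_. 0"] by simp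

lemma m_zero: "k \<in> K \<Longrightarrow> m k (\<lambda>_. 0) = 0"
  using m_add[of k "\<lambda>_. 0" "\<lambda>_. 0"] by simp

lemma l_mult: "j \<in> J \<Longrightarrow> l j (mult_pt n x) = int n * l j x"
  by (induction n) (simp_all add: mult_pt_0 l_zero mult_pt_Suc l_plus algebra_simps)

lemma m_mult: "k \<in> K \<Longrightarrow> m k (mult_pt n x) = int n * m k x"
  by (induction n) (simp_all add: mult_pt_0 m_zero mult_pt_Suc m_plus algebra_simps)

lemma G_plus:
  assumes "x \<in> G d" "y \<in> G e" shows "plus_pt x y \<in> G (d + e)"
  using assms by (simp add: G_def l_plus m_plus algebra_simps) (simp add: plus_pt_def)

lemma G_mult:
  assumes "x \<in> G d" shows "mult_pt n x \<in> G (n * d)"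
  using assms by (simp add: G_def l_mult m_mult) (simp add: mult_pt_def)

end

text \<open>Translation by a point g of degree 1 embeds \<open>G d\<close> into
  \<open>G (Suc d)\<close>; the growth is measured by what this translation misses.\<close>

locale dilated_lattice_points_nonempty = dilated_lattice_points I J l K m c
  for I :: "'b set" and J :: "'j set" and l and K :: "'k set" and m c +
  fixes g :: "'b \<Rightarrow> int"
  assumes finG: "\<And>d. finite (G d)" and g: "g \<in> G 1"
begin

lemma h_pos: "0 < h d"
  using G_mult[OF g, of d] finG[of d] by (auto simp: card_gt_0_iff)

lemma h_mono_Suc: "h d \<le> h (Suc d)"
proof (rule card_inj_on_le[OF _ _ finG])
  show "inj_on (\<lambda>x. plus_pt x g) (G d)" by (intro inj_onI) (simp add: plus_pt_cancel)
  show "(\<lambda>x. plus_pt x g) ` G d \<subseteq> G (Suc d)"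
    unfolding Suc_eq_plus1 by (rule image_subsetI) (rule G_plus[OF _ g])
qed

lemma h_mono: "d \<le> e \<Longrightarrow> h d \<le> h e"
  by (rule lift_Suc_mono_le[of h]) (rule h_mono_Suc)

text \<open>Within a parity class, \<open>y \<mapsto> (y + z) / 2\<close> maps \<open>G (2 * d)\<close> injectively into \<open>G (d + e)\<close>
  for any fixed z of the same class in \<open>G (2 * e)\<close>.\<close>

lemma doubling: "\<exists>C e. \<forall>d. h (2 * d) \<le> C * h (d + e)"
proof -
  define cls where "cls x = (\<lambda>b. x b mod 2)" for x :: "'b \<Rightarrow> int"
  define R where "R = {r. \<forall>b. (b \<in> I \<longrightarrow> r b \<in> {0, 1 :: int}) \<and> (b \<notin> I \<longrightarrow> r b = 0)}"
  have finR: "finite R" unfolding R_def by (rule finite_set_of_finite_funs[OF finI]) simp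
  have clsR: "cls x \<in> R" if "x \<in> G d" for x d
    using that by (auto simp: cls_def R_def G_def)
  \<comment> \<open>A half-degree in which the parity class r occurs. For a class that never occurs
    the choice is arbitrary, and that class contributes nothing to the count.\<close>
  define E where "E r = (SOME e. \<exists>z\<in>G (2 * e). cls z = r)" for r
  define e where "e = (\<Sum>r\<in>R. E r)"
  have le: "card {y \<in> G (2 * d). cls y = r} \<le> h (d + e)" if r: "r \<in> R" for d r
  proof (cases "{y \<in> G (2 * d). cls y = r} = {}")
    case True
    then show ?thesis by (simp only: card.empty)
  next
    case False
    then have "\<exists>e. \<exists>z\<in>G (2 * e). cls z = r" by blast
    then have "\<exists>z\<in>G (2 * E r). cls z = r" unfolding E_def by (rule someI_ex)
    then obtain z where z: "z \<in> G (2 * E r)" "cls z = r" by blast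
    define hf where "hf y = (\<lambda>b. (y b + z b) div 2)" for y :: "'b \<Rightarrow> int"
    have twice: "mult_pt 2 (hf y) = plus_pt y z" if y: "cls y = r" for y
    proof
      fix b
      have "y b mod 2 = z b mod 2" using y z(2) by (metis cls_def)
      then have "2 * ((y b + z b) div 2) = y b + z b" by presburger
      then show "mult_pt 2 (hf y) b = plus_pt y z b" by (simp add: mult_pt_def plus_pt_def hf_def)
    qed
    have "card {y \<in> G (2 * d). cls y = r} \<le> h (d + E r)"
    proof (rule card_inj_on_le[OF _ _ finG])
      show "inj_on hf {y \<in> G (2 * d). cls y = r}"
      proof (rule inj_onI)
        fix x y assume "x \<in> {y \<in> G (2 * d). cls y = r}" "y \<in> {y \<in> G (2 * d). cls y = r}" "hf x = hf y"
        then have "plus_pt x z = plus_pt y z" using twice[of x] twice[of y] by simp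
        then show "x = y" by (simp only: plus_pt_cancel)
      qed
      show "hf ` {y \<in> G (2 * d). cls y = r} \<subseteq> G (d + E r)"
      proof (rule image_subsetI)
        fix y assume "y \<in> {y \<in> G (2 * d). cls y = r}"
        then have y: "y \<in> G (2 * d)" and r': "r = cls y" by auto
        have p: "plus_pt y z \<in> G (2 * d + 2 * E r)" by (rule G_plus[OF y z(1)])
        have t: "mult_pt 2 (hf y) = plus_pt y z" by (rule twice) (simp only: r')
        have "l j (plus_pt y z) = 2 * l j (hf y)" if "j \<in> J" for j using l_mult[OF that, of 2 "hf y"] t by simp
        then have 1: "0 \<le> l j (hf y)" if "j \<in> J" for j using p that by (force simp: G_def)
        have "m k (plus_pt y z) = 2 * m k (hf y)" if "k \<in> K" for k using m_mult[OF that, of 2 "hf y"] t by simp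
        then have 2: "m k (hf y) = int (d + E r) * c k" if "k \<in> K" for k
          using p that by (force simp: G_def algebra_simps)
        have "hf y b = 0" if "b \<notin> I" for b using y z(1) that by (simp add: G_def hf_def)
        then show "hf y \<in> G (d + E r)" using 1 2 by (simp add: G_def)
      qed
    qed
    also have "\<dots> \<le> h (d + e)"
      using member_le_sum[OF r _ finR, of E] by (intro h_mono) (simp add: e_def)
    finally show ?thesis .
  qed
  have "h (2 * d) \<le> card R * h (d + e)" for d
  proof -
    have "(\<Sum>r\<in>R. card {y \<in> G (2 * d). cls y = r}) = h (2 * d)"
      using sum.group[OF finG[of "2 * d"] finR, of cls "\<lambda>_. 1 :: nat"] clsR by auto
    moreover have "(\<Sum>r\<in>R. card {y \<in> G (2 * d). cls y = r}) \<le> (\<Sum>r\<in>R. h (d + e))"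
      by (rule sum_mono[OF le])
    ultimately show ?thesis by simp
  qed
  then show ?thesis by blast
qed

text \<open>If \<open>l j\<close> is not constant on \<open>G e\<close>, adding the points \<open>i * a + (N - i) * b\<close> gives
  \<open>N + 1\<close> disjoint translates of a slice \<open>l j = v\<close>.\<close>

lemma slice_bound:
  assumes j: "j \<in> J" and a: "a \<in> G e" and b: "b \<in> G e" and ab: "l j a \<noteq> l j b"
  shows "Suc N * card {y \<in> G d. l j y = v} \<le> h (d + N * e)"
proof -
  define F where "F = {y \<in> G d. l j y = v}"
  have finF: "finite F" using finG by (simp add: F_def)
  define s where "s i = plus_pt (mult_pt i a) (mult_pt (N - i) b)" for i
  have sG: "s i \<in> G (N * e)" if "i \<le> N" for i
  proof -
    have "s i \<in> G (i * e + (N - i) * e)" unfolding s_def by (intro G_plus G_mult a b)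
    then show ?thesis using that by (simp add: add_mult_distrib[symmetric])
  qed
  have ls: "l j (s i) = int i * (l j a - l j b) + int N * l j b" if "i \<le> N" for i
    using that by (simp add: s_def l_plus[OF j] l_mult[OF j] of_nat_diff algebra_simps)
  have "card ({..N} \<times> F) \<le> h (d + N * e)"
  proof (rule card_inj_on_le[OF _ _ finG])
    show "inj_on (\<lambda>(i, y). plus_pt y (s i)) ({..N} \<times> F)"
    proof (rule inj_onI)
      fix q q' assume q: "q \<in> {..N} \<times> F" "q' \<in> {..N} \<times> F" "(\<lambda>(i, y). plus_pt y (s i)) q = (\<lambda>(i, y). plus_pt y (s i)) q'"
      obtain i y i' y' where qq: "q = (i, y)" "q' = (i', y')" by (cases q, cases q') blast
      have i: "i \<in> {..N}" "i' \<in> {..N}" and y: "y \<in> F" "y' \<in> F" and eq: "plus_pt y (s i) = plus_pt y' (s i')"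
        using q by (simp_all add: qq)
      have "l j y + l j (s i) = l j y' + l j (s i')" using eq l_plus[OF j] by metis
      then have "int i * (l j a - l j b) = int i' * (l j a - l j b)"
        using y ls[of i] ls[of i'] i by (simp add: F_def)
      then have "i = i'" using ab by simp
      then show "q = q'" using eq by (simp add: qq plus_pt_cancel)
    qed
    show "(\<lambda>(i, y). plus_pt y (s i)) ` ({..N} \<times> F) \<subseteq> G (d + N * e)"
    proof (rule image_subsetI)
      fix q assume q: "q \<in> {..N} \<times> F"
      obtain i y where qq: "q = (i, y)" by (cases q)
      have "plus_pt y (s i) \<in> G (d + N * e)" using q by (intro G_plus sG) (simp_all add: qq F_def)
      then show "(\<lambda>(i, y). plus_pt y (s i)) q \<in> G (d + N * e)" by (simp add: qq)
    qed
  qed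
  then show ?thesis by (simp add: card_cartesian_product F_def)
qed

text \<open>The points of \<open>G d\<close> outside the translate of \<open>G (d - 1)\<close> lie
  in finitely many slices \<open>l j = v\<close>. Disjoint translates of one slice fit into a degree
  at most 2d, their number grows linearly in d, and doubling compares with \<open>h d\<close> again;
  so a slice has size of order \<open>h d / d\<close>.\<close>

lemma increment_bound:
  "\<exists>A B. \<forall>d>B. real (h d - h (d - 1)) * (real d - real B) \<le> A * real (h d)"
proof -
  obtain C e where C: "\<And>d. h (2 * d) \<le> C * h (d + e)" using doubling by blast
  \<comment> \<open>Only inequalities that take two values in some degree can supply the disjoint
    translates. The others never obstruct subtraction of g, as shown below.\<close>
  define J' where "J' = {j \<in> J. \<exists>e a b. a \<in> G e \<and> b \<in> G e \<and> l j a \<noteq> l j b}"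
  have finJ': "finite J'" using finJ by (simp add: J'_def)
  have "\<forall>j\<in>J'. \<exists>f. \<exists>a b. a \<in> G f \<and> b \<in> G f \<and> l j a \<noteq> l j b" by (auto simp: J'_def)
  from bchoice[OF this] obtain f where f: "\<forall>j\<in>J'. \<exists>a b. a \<in> G (f j) \<and> b \<in> G (f j) \<and> l j a \<noteq> l j b" ..
  define M where "M = Suc (\<Sum>j\<in>J'. f j)"
  have slice: "card {y \<in> G d. l j y = v} * (d - 2 * e) \<le> M * (C * h d)"
    if j: "j \<in> J'" and d: "2 * e \<le> d" for j v d
  proof -
    obtain a b where ab: "a \<in> G (f j)" "b \<in> G (f j)" "l j a \<noteq> l j b" using f j by blast
    have fM: "f j < M" unfolding M_def using member_le_sum[OF j _ finJ', of f] by simp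
    \<comment> \<open>As many translation steps, of degree at most M each, as keep the total degree
      within \<open>2 * (d - e)\<close>, the degree to which \<open>doubling\<close>
      applies.\<close>
    define N where "N = (d - 2 * e) div M"
    have "0 < M" by (simp add: M_def)
    then have NM: "N * M \<le> d - 2 * e" "d - 2 * e \<le> Suc N * M"
      using div_times_less_eq_dividend[of "d - 2 * e" M] dividend_less_div_times[of M "d - 2 * e"]
      by (simp_all add: N_def)
    have "Suc N * card {y \<in> G d. l j y = v} \<le> h (d + N * f j)"
      using slice_bound[OF _ ab] j by (simp add: J'_def)
    also have "\<dots> \<le> h (2 * (d - e))"
    proof (rule h_mono)
      have "N * f j \<le> N * M" using fM by simp
      then show "d + N * f j \<le> 2 * (d - e)" using NM(1) d by linarith
    qed
    also have "\<dots> \<le> C * h d" using C[of "d - e"] d by simp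
    finally have s: "Suc N * card {y \<in> G d. l j y = v} \<le> C * h d" .
    have "card {y \<in> G d. l j y = v} * (d - 2 * e) \<le> card {y \<in> G d. l j y = v} * (Suc N * M)"
      using NM(2) by (rule mult_le_mono2)
    also have "\<dots> = M * (Suc N * card {y \<in> G d. l j y = v})" by (simp only: mult_ac)
    also have "\<dots> \<le> M * (C * h d)" using s by (rule mult_le_mono2)
    finally show ?thesis .
  qed
  \<comment> \<open>Subtracting g from y makes \<open>l j\<close> negative exactly when
    \<open>l j y\<close> is less than \<open>l j g\<close>; these finitely many values label the
    slices.\<close>
  define P where "P = (SIGMA j:J'. {0..<l j g})"
  have finP: "finite P" unfolding P_def using finJ' by simp
  have missing: "G d - (\<lambda>x. plus_pt x g) ` G (d - 1) \<subseteq> (\<Union>(j, v)\<in>P. {y \<in> G d. l j y = v})" if d: "0 < d" for d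
  proof
    fix y assume y: "y \<in> G d - (\<lambda>x. plus_pt x g) ` G (d - 1)"
    define x where "x = (\<lambda>b. y b - g b)"
    have yx: "y = plus_pt x g" by (simp add: x_def plus_pt_def)
    have "x \<notin> G (d - 1)" using y yx by blast
    moreover have "x b = 0" if "b \<notin> I" for b using y g that by (simp add: G_def x_def)
    moreover have "m k x = int (d - 1) * c k" if "k \<in> K" for k
    proof -
      have "m k y = int d * c k" "m k g = c k" using y g that by (simp_all add: G_def)
      then show ?thesis using m_plus[OF that, of x g] yx d by (simp add: of_nat_diff algebra_simps)
    qed
    ultimately have "\<exists>j\<in>J. l j x < 0" unfolding G_def by force
    then obtain j where j: "j \<in> J" "l j x < 0" by blast
    have ly: "l j y = l j x + l j g" using l_plus[OF j(1)] yx by simp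
    \<comment> \<open>Were \<open>l j\<close> constant on each degree, its value on
      \<open>G d\<close> would be that at the d-fold multiple of g. For positive d this is at least
      \<open>l j g\<close>, so subtracting g could not make it negative.\<close>
    have "j \<in> J'"
    proof (rule ccontr)
      assume n: "j \<notin> J'"
      have "mult_pt d g \<in> G d" using G_mult[OF g, of d] by simp
      then have "l j y = l j (mult_pt d g)" using n y j(1) unfolding J'_def by blast
      then have "l j y = int d * l j g" by (simp only: l_mult[OF j(1)])
      moreover have "0 \<le> l j g" using g j(1) by (simp add: G_def)
      then have "1 * l j g \<le> int d * l j g" using d by (intro mult_right_mono) auto
      ultimately show False using ly j(2) by simp
    qed
    moreover have "0 \<le> l j y" using y j(1) unfolding G_def by blast
    then have "l j y \<in> {0..<l j g}" using ly j(2) by simp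
    ultimately have "(j, l j y) \<in> P" by (simp add: P_def)
    then show "y \<in> (\<Union>(j, v)\<in>P. {y \<in> G d. l j y = v})" using y by blast
  qed
  have main: "(h d - h (d - 1)) * (d - 2 * e) \<le> card P * (M * (C * h d))" if d: "2 * e < d" for d
  proof -
    have "(h d - h (d - 1)) = card (G d - (\<lambda>x. plus_pt x g) ` G (d - 1))"
    proof -
      have "(\<lambda>x. plus_pt x g) ` G (d - 1) \<subseteq> G d"
      proof (rule image_subsetI)
        fix x assume "x \<in> G (d - 1)"
        then have "plus_pt x g \<in> G (d - 1 + 1)" by (rule G_plus[OF _ g])
        then show "plus_pt x g \<in> G d" using d by simp
      qed
      then have "card (G d - (\<lambda>x. plus_pt x g) ` G (d - 1)) = h d - card ((\<lambda>x. plus_pt x g) ` G (d - 1))"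
        by (intro card_Diff_subset finite_imageI finG)
      also have "card ((\<lambda>x. plus_pt x g) ` G (d - 1)) = h (d - 1)"
        by (rule card_image) (simp add: inj_on_def plus_pt_cancel)
      finally show ?thesis ..
    qed
    also have "\<dots> \<le> card (\<Union>(j, v)\<in>P. {y \<in> G d. l j y = v})"
    proof (rule card_mono[OF _ missing])
      show "finite (\<Union>(j, v)\<in>P. {y \<in> G d. l j y = v})"
        using finG[of d] by (rule finite_subset[rotated]) auto
    qed (use d in simp)
    also have "\<dots> \<le> (\<Sum>(j, v)\<in>P. card {y \<in> G d. l j y = v})"
      unfolding case_prod_unfold by (rule card_UN_le[OF finP])
    finally have "(h d - h (d - 1)) * (d - 2 * e) \<le> (\<Sum>(j, v)\<in>P. card {y \<in> G d. l j y = v}) * (d - 2 * e)"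
      by (rule mult_le_mono1)
    also have "\<dots> = (\<Sum>(j, v)\<in>P. card {y \<in> G d. l j y = v} * (d - 2 * e))"
      by (simp add: sum_distrib_right case_prod_unfold)
    also have "\<dots> \<le> (\<Sum>(j, v)\<in>P. M * (C * h d))"
      using slice d by (intro sum_mono) (auto simp: P_def)
    also have "\<dots> = card P * (M * (C * h d))" by (simp add: case_prod_unfold)
    finally show ?thesis .
  qed
  have "real (h d - h (d - 1)) * (real d - real (2 * e)) \<le> real (card P * M * C) * real (h d)"
    if d: "d > 2 * e" for d
  proof -
    have "real (h d - h (d - 1)) * (real d - real (2 * e)) = real ((h d - h (d - 1)) * (d - 2 * e))"
      using d by (simp add: of_nat_diff)
    also have "\<dots> \<le> real (card P * (M * (C * h d)))" using main[OF d] by (simp only: of_nat_le_iff)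
    finally show ?thesis by (simp add: mult.assoc)
  qed
  then show ?thesis by blast
qed

text \<open>Dividing \<open>increment_bound\<close> by \<open>h (Suc d)\<close> bounds the relative
  increment by a quantity of order 1/d, which squeezes the inverse ratio.\<close>

lemma ratio_step: "(\<lambda>d. real (h (Suc d)) / real (h d)) \<longlonglongrightarrow> 1"
proof -
  obtain A B where AB: "\<And>d. d > B \<Longrightarrow> real (h d - h (d - 1)) * (real d - real B) \<le> A * real (h d)"
    using increment_bound by blast
  have bound: "real (h d) / real (h (Suc d)) \<ge> 1 - \<bar>A\<bar> / (real (Suc d) - real B)" if d: "d \<ge> B" for d
  proof -
    have pos: "real (Suc d) - real B > 0" using d by simp
    have hp: "real (h (Suc d)) > 0" using h_pos by simp
    have "real (h (Suc d) - h d) * (real (Suc d) - real B) \<le> \<bar>A\<bar> * real (h (Suc d))"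
    proof -
      have "real (h (Suc d) - h d) * (real (Suc d) - real B) \<le> A * real (h (Suc d))"
        using AB[of "Suc d"] d by simp
      also have "\<dots> \<le> \<bar>A\<bar> * real (h (Suc d))" by (rule mult_right_mono) simp_all
      finally show ?thesis .
    qed
    then have "real (h (Suc d) - h d) \<le> \<bar>A\<bar> * real (h (Suc d)) / (real (Suc d) - real B)"
      using pos by (simp add: pos_le_divide_eq)
    then have "real (h (Suc d)) - real (h d) \<le> \<bar>A\<bar> * real (h (Suc d)) / (real (Suc d) - real B)"
      using h_mono_Suc[of d] by (simp add: of_nat_diff)
    then have "(real (h (Suc d)) - real (h d)) / real (h (Suc d)) \<le> \<bar>A\<bar> / (real (Suc d) - real B)"
      using hp by (simp add: divide_le_eq mult.commute)
    then show ?thesis using hp by (simp add: diff_divide_distrib)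
  qed
  have "(\<lambda>d. real (h d) / real (h (Suc d))) \<longlonglongrightarrow> 1"
  proof (rule tendsto_sandwich[where f = "\<lambda>d. 1 - \<bar>A\<bar> / (real (Suc d) - real B)" and h = "\<lambda>_. 1"])
    show "\<forall>\<^sub>F d in sequentially. 1 - \<bar>A\<bar> / (real (Suc d) - real B) \<le> real (h d) / real (h (Suc d))"
      using eventually_ge_at_top[of B] by eventually_elim (rule bound)
    show "\<forall>\<^sub>F d in sequentially. real (h d) / real (h (Suc d)) \<le> 1"
      using h_mono_Suc h_pos by (intro always_eventually allI) (simp add: divide_le_eq_1)
    have "filterlim (\<lambda>d. - real B + real (Suc d)) at_top sequentially"
      by (intro filterlim_tendsto_add_at_top[OF tendsto_const] filterlim_compose[OF filterlim_real_sequentially] filterlim_Suc)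
    then have "filterlim (\<lambda>d. real (Suc d) - real B) at_top sequentially" by simp
    then have "filterlim (\<lambda>d. real (Suc d) - real B) at_infinity sequentially"
      by (rule filterlim_at_top_imp_at_infinity)
    then have "(\<lambda>d. \<bar>A\<bar> / (real (Suc d) - real B)) \<longlonglongrightarrow> 0"
      by (rule tendsto_divide_0[OF tendsto_const])
    from tendsto_diff[OF tendsto_const this, of 1]
    show "(\<lambda>d. 1 - \<bar>A\<bar> / (real (Suc d) - real B)) \<longlonglongrightarrow> 1" by simp
  qed simp
  from tendsto_inverse[OF this] show ?thesis by (simp add: inverse_eq_divide)
qed

theorem ratio_tendsto_1: "(\<lambda>d. real (h (d + D)) / real (h d)) \<longlonglongrightarrow> 1"
proof (induction D)
  case 0
  have "(\<lambda>d. real (h (d + 0)) / real (h d)) = (\<lambda>_. 1)"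
  proof (rule ext)
    fix d
    have "real (h d) \<noteq> 0" using h_pos[of d] by linarith
    then show "real (h (d + 0)) / real (h d) = 1" unfolding add_0_right by (rule divide_self)
  qed
  then show ?case by (simp only: tendsto_const)
next
  case (Suc D)
  have "(\<lambda>d. real (h (Suc (d + D))) / real (h (d + D))) \<longlonglongrightarrow> 1"
    using LIMSEQ_ignore_initial_segment[OF ratio_step, of D] by simp
  from tendsto_mult[OF this Suc.IH]
  have "(\<lambda>d. real (h (Suc (d + D))) / real (h (d + D)) * (real (h (d + D)) / real (h d))) \<longlonglongrightarrow> 1" by simp
  moreover have "(\<lambda>d. real (h (Suc (d + D))) / real (h (d + D)) * (real (h (d + D)) / real (h d))) =
      (\<lambda>d. real (h (d + Suc D)) / real (h d))"
  proof (rule ext)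
    fix d
    have "real (h (d + D)) \<noteq> 0" using h_pos[of "d + D"] by linarith
    then show "real (h (Suc (d + D))) / real (h (d + D)) * (real (h (d + D)) / real (h d)) = real (h (d + Suc D)) / real (h d)"
      unfolding add_Suc_right by (rule ratio_cancel)
  qed
  ultimately show ?case by (simp only:)
qed

end

section \<open>Monomials and leading exponents\<close>

definition monf :: "'q set \<Rightarrow> ('q \<Rightarrow> nat) \<Rightarrow> ('q \<Rightarrow> complex) \<Rightarrow> complex" where
  "monf I a z = (\<Prod>q\<in>I. z q ^ a q)"

text \<open>With all exponents below M, the weight orders exponents lexicographically, the position
  with the largest value of \<open>pos\<close> being the most significant.\<close>

definition wt :: "nat \<Rightarrow> ('q \<Rightarrow> nat) \<Rightarrow> 'q set \<Rightarrow> ('q \<Rightarrow> nat) \<Rightarrow> nat" where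
  "wt M pos I a = (\<Sum>q\<in>I. a q * M ^ pos q)"

lemma wt_Diff: "finite I \<Longrightarrow> K \<subseteq> I \<Longrightarrow> wt M pos I a = wt M pos (I - K) a + wt M pos K a"
  unfolding wt_def by (rule sum.subset_diff)

lemma monf_Diff: "finite I \<Longrightarrow> K \<subseteq> I \<Longrightarrow> monf I a z = monf (I - K) a z * monf K a z"
  unfolding monf_def by (rule prod.subset_diff)

lemma monf_cong: "(\<And>q. q \<in> I \<Longrightarrow> z q = z' q) \<Longrightarrow> monf I a z = monf I a z'"
  unfolding monf_def by (rule prod.cong) auto

lemma digits_less_power:
  assumes M: "0 < M" and "finite I" "inj_on pos I" "\<And>q. q \<in> I \<Longrightarrow> a q < M" "\<And>q. q \<in> I \<Longrightarrow> pos q < N"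
  shows "wt M pos I a < M ^ N"
proof -
  have g: "(\<Sum>k<N. (M - 1) * M ^ k) < M ^ N" for N
  proof (induction N)
    case (Suc N)
    have "(\<Sum>k<Suc N. (M - 1) * M ^ k) < (M - 1) * M ^ N + M ^ N" using Suc.IH by simp
    also have "\<dots> = M ^ Suc N" using M by (cases M) simp_all
    finally show ?case .
  qed simp
  have "wt M pos I a \<le> (\<Sum>q\<in>I. (M - 1) * M ^ pos q)"
    unfolding wt_def
  proof (rule sum_mono)
    fix q assume "q \<in> I"
    then have "a q < M" by (rule assms(4))
    then have "a q \<le> M - 1" by simp
    then show "a q * M ^ pos q \<le> (M - 1) * M ^ pos q" by (rule mult_le_mono1)
  qed
  also have "\<dots> = (\<Sum>k\<in>pos ` I. (M - 1) * M ^ k)" using assms(3) by (simp add: sum.reindex)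
  also have "\<dots> \<le> (\<Sum>k<N. (M - 1) * M ^ k)"
    by (rule sum_mono2) (use assms(5) in auto)
  also have "\<dots> < M ^ N" by (rule g)
  finally show ?thesis .
qed

text \<open>Positional notation in base M: the digits of a below the position of q are together
  worth less than one unit at q.\<close>

lemma wt_less:
  assumes I: "finite I" "inj_on pos I" and a: "\<And>q. q \<in> I \<Longrightarrow> a q < M"
    and q: "q \<in> I" "a q < b q" and eq: "\<And>q'. q' \<in> I \<Longrightarrow> pos q < pos q' \<Longrightarrow> a q' = b q'"
  shows "wt M pos I a < wt M pos I b"
proof -
  define H where "H = {q' \<in> I. pos q < pos q'}"
  define L where "L = {q' \<in> I. pos q' < pos q}"
  have split: "wt M pos I f = wt M pos H f + (f q * M ^ pos q + wt M pos L f)" for f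
  proof -
    have LI: "I - H - {q} = L"
      using inj_onD[OF I(2) _ q(1)] by (auto simp: H_def L_def) (metis linorder_neqE_nat)
    have "wt M pos I f = wt M pos (I - H) f + wt M pos H f"
      by (rule wt_Diff[OF I(1)]) (auto simp: H_def)
    also have "wt M pos (I - H) f = wt M pos (I - H - {q}) f + wt M pos {q} f"
      by (rule wt_Diff) (use I(1) q(1) in \<open>auto simp: H_def\<close>)
    finally show ?thesis by (simp add: LI) (simp add: wt_def)
  qed
  have "wt M pos H a = wt M pos H b"
    unfolding wt_def using eq by (intro sum.cong) (auto simp: H_def)
  moreover have "wt M pos L a < M ^ pos q"
  proof (rule digits_less_power)
    show "0 < M" using a[OF q(1)] by simp
    show "finite L" using I(1) by (simp add: L_def)
    show "inj_on pos L" by (rule inj_on_subset[OF I(2)]) (auto simp: L_def)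
  qed (use a in \<open>simp_all add: L_def\<close>)
  moreover have "a q * M ^ pos q + M ^ pos q \<le> b q * M ^ pos q"
    using q(2) mult_le_mono1[of "Suc (a q)" "b q" "M ^ pos q"] by simp
  ultimately show ?thesis unfolding split[of a] split[of b] by linarith
qed

lemma largest_difference:
  fixes pos :: "'q \<Rightarrow> nat" and a b :: "'q \<Rightarrow> nat"
  assumes "finite I" "inj_on pos I" "\<exists>q\<in>I. a q \<noteq> b q"
  obtains q where "q \<in> I" "a q \<noteq> b q" "\<And>q'. q' \<in> I \<Longrightarrow> pos q < pos q' \<Longrightarrow> a q' = b q'"
proof -
  define D where "D = {q \<in> I. a q \<noteq> b q}"
  have D: "finite D" "D \<noteq> {}" using assms by (auto simp: D_def)
  then have "Max (pos ` D) \<in> pos ` D" by simp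
  then obtain q where q: "q \<in> D" "pos q = Max (pos ` D)" by force
  have "a q' = b q'" if "q' \<in> I" "pos q < pos q'" for q'
  proof (rule ccontr)
    assume "a q' \<noteq> b q'"
    then have "q' \<in> D" using that by (simp add: D_def)
    then have "pos q' \<le> pos q" using D(1) q(2) by simp
    then show False using that(2) by simp
  qed
  then show ?thesis using that q(1) by (auto simp: D_def)
qed

lemma wt_inj:
  assumes I: "finite I" "inj_on pos I" and a: "\<And>q. q \<in> I \<Longrightarrow> a q < M" "\<And>q. q \<in> I \<Longrightarrow> b q < M"
    and eq: "wt M pos I a = wt M pos I b"
  shows "\<forall>q\<in>I. a q = b q"
proof (rule ccontr)
  assume "\<not> (\<forall>q\<in>I. a q = b q)"
  then obtain q where q: "q \<in> I" "a q \<noteq> b q" "\<And>q'. q' \<in> I \<Longrightarrow> pos q < pos q' \<Longrightarrow> a q' = b q'"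
    using largest_difference[OF I] by blast
  show False
  proof (cases "a q < b q")
    case True
    then show False using wt_less[of I pos a M q b, OF I a(1) q(1) True q(3)] eq by simp
  next
    case False
    then have "b q < a q" using q(2) by simp
    from wt_less[of I pos b M q a, OF I a(2) q(1) this q(3)[symmetric]] show False using eq by simp
  qed
qed

text \<open>Kronecker substitution: monomials with exponents below M become distinct powers of
  t.\<close>

definition curve :: "nat \<Rightarrow> ('q \<Rightarrow> nat) \<Rightarrow> complex \<Rightarrow> 'q \<Rightarrow> complex" where
  "curve M pos t = (\<lambda>q. t ^ (M ^ pos q))"

lemma monf_curve: "monf I a (curve M pos t) = t ^ wt M pos I a"
  by (simp add: monf_def curve_def wt_def power_sum power_mult[symmetric] mult.commute)

lemma poly_eq_0_everywhere:
  assumes "\<And>t :: complex. poly q t = 0"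
  shows "q = 0"
  using assms by (metis poly_all_0_iff_0)

text \<open>Several members of X may agree on I, hence the sum of coefficients. With I a part of all
  variables this extracts the coefficient of one monomial in these variables, the others being held
  fixed.\<close>

lemma monf_independent:
  fixes pos :: "'q \<Rightarrow> nat"
  assumes I: "finite I" "inj_on pos I" and X: "finite X" and b: "b \<in> X"
    and zero: "\<And>z. (\<Sum>a\<in>X. c a * monf I a z) = 0"
  shows "(\<Sum>a | a \<in> X \<and> (\<forall>q\<in>I. a q = b q). c a) = 0"
proof -
  define M where "M = Suc (\<Sum>a\<in>X. \<Sum>q\<in>I. a q)"
  have less: "a q < M" if "a \<in> X" "q \<in> I" for a q
    unfolding M_def less_Suc_eq_le
    using member_le_sum[of q I a] member_le_sum[of a X "\<lambda>a. \<Sum>q\<in>I. a q"] that I(1) X by simp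
  define P where "P = (\<Sum>a\<in>X. monom (c a) (wt M pos I a))"
  have "poly P t = (\<Sum>a\<in>X. c a * monf I a (curve M pos t))" for t
    by (simp add: P_def poly_sum poly_monom monf_curve)
  then have "P = 0" using zero by (intro poly_eq_0_everywhere) simp
  then have "0 = coeff P (wt M pos I b)" by simp
  also have "\<dots> = (\<Sum>a\<in>X. if \<forall>q\<in>I. a q = b q then c a else 0)"
    unfolding P_def coeff_sum
  proof (rule sum.cong[OF refl])
    fix a assume a: "a \<in> X"
    have "wt M pos I a = wt M pos I b \<longleftrightarrow> (\<forall>q\<in>I. a q = b q)"
    proof
      assume eq: "wt M pos I a = wt M pos I b"
      show "\<forall>q\<in>I. a q = b q" by (rule wt_inj[OF I _ _ eq]) (rule less[OF a], assumption, rule less[OF b], assumption)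
    next
      assume "\<forall>q\<in>I. a q = b q"
      then show "wt M pos I a = wt M pos I b" by (simp add: wt_def)
    qed
    then show "coeff (monom (c a) (wt M pos I a)) (wt M pos I b) = (if \<forall>q\<in>I. a q = b q then c a else 0)"
      by (simp add: coeff_monom)
  qed
  also have "\<dots> = (\<Sum>a | a \<in> X \<and> (\<forall>q\<in>I. a q = b q). c a)"
    using X by (simp add: sum.If_cases Int_def)
  finally show ?thesis by simp
qed

section \<open>Leading exponents of invariants interlace\<close>

text \<open>Right multiplication by an elementary unitriangular matrix, acting on two neighbouring
  columns.\<close>

definition shift :: "nat \<Rightarrow> complex \<Rightarrow> (nat \<times> nat \<Rightarrow> complex) \<Rightarrow> nat \<times> nat \<Rightarrow> complex" where
  "shift r t z = (\<lambda>(i, j). if j = Suc r then z (i, j) + t * z (i, r) else z (i, j))"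

text \<open>The last row is the most significant, and within a row the last column.\<close>

definition lexpos :: "nat \<Rightarrow> nat \<times> nat \<Rightarrow> nat" where
  "lexpos n = (\<lambda>(i, j). i * n + j)"

lemma lexpos_less_row:
  assumes "i < i'" "j < n" shows "lexpos n (i, j) < lexpos n (i', j')"
proof -
  have "i * n + j < Suc i * n" using assms(2) by simp
  also have "\<dots> \<le> i' * n" using assms(1) by (intro mult_le_mono1) simp
  finally show ?thesis by (simp add: lexpos_def)
qed

lemma lexpos_less_iff:
  assumes "j < n" "j' < n"
  shows "lexpos n (i, j) < lexpos n (i', j') \<longleftrightarrow> i < i' \<or> i = i' \<and> j < j'"
proof (cases i i' rule: linorder_cases)
  case less then show ?thesis using lexpos_less_row[OF less assms(1)] by simp
next
  case equal then show ?thesis by (simp add: lexpos_def)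
next
  case greater then show ?thesis using lexpos_less_row[OF greater assms(2), of j] by simp
qed

lemma inj_on_lexpos: "inj_on (lexpos n) (A \<times> {..<n})"
proof (rule inj_onI)
  fix q q' assume q: "q \<in> A \<times> {..<n}" "q' \<in> A \<times> {..<n}" and eq: "lexpos n q = lexpos n q'"
  obtain i j i' j' where qq: "q = (i, j)" "q' = (i', j')" by (cases q, cases q') blast
  show "q = q'"
    using lexpos_less_iff[of j n j' i i'] lexpos_less_iff[of j' n j i' i] q eq unfolding qq
    by (auto simp: not_less)
qed

text \<open>An invariant polynomial given by its exponents X and coefficients c, with b of largest
  weight. Row sums are at most m entrywise, so the base \<open>Suc m\<close> separates
  exponents.\<close>

locale leading_exponent =
  fixes p n m :: nat and X :: "(nat \<times> nat \<Rightarrow> nat) set" and c :: "(nat \<times> nat \<Rightarrow> nat) \<Rightarrow> complex"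
    and w :: "nat \<Rightarrow> nat" and b :: "nat \<times> nat \<Rightarrow> nat"
  assumes finX: "finite X"
    and outside: "\<And>a q. a \<in> X \<Longrightarrow> q \<notin> {1..p} \<times> {..<n} \<Longrightarrow> a q = 0"
    and rows: "\<And>a i. a \<in> X \<Longrightarrow> i \<in> {1..p} \<Longrightarrow> (\<Sum>j<n. a (i, j)) = m"
    and cols: "\<And>a j. a \<in> X \<Longrightarrow> j < n \<Longrightarrow> (\<Sum>i=1..p. a (i, j)) = w j"
    and invariant: "\<And>r t z. Suc r < n \<Longrightarrow>
      (\<Sum>a\<in>X. c a * monf ({1..p} \<times> {..<n}) a (shift r t z)) = (\<Sum>a\<in>X. c a * monf ({1..p} \<times> {..<n}) a z)"
    and lead: "b \<in> X" "c b \<noteq> 0"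
    and lead_max: "\<And>a. a \<in> X \<Longrightarrow> c a \<noteq> 0 \<Longrightarrow>
      wt (Suc m) (lexpos n) ({1..p} \<times> {..<n}) a \<le> wt (Suc m) (lexpos n) ({1..p} \<times> {..<n}) b"
begin

abbreviation I where "I \<equiv> {1..p} \<times> {..<n}"

lemma less_M: assumes "a \<in> X" shows "a q < Suc m"
proof (cases "q \<in> I")
  case True
  then obtain i j where q: "q = (i, j)" "i \<in> {1..p}" "j < n" by auto
  have "a (i, j) \<le> (\<Sum>j<n. a (i, j))" using q by (intro member_le_sum[of j "{..<n}" "\<lambda>j. a (i, j)"]) auto
  then show ?thesis using rows[OF assms q(2)] q(1) by simp
next
  case False
  then show ?thesis using outside[OF assms] by simp
qed

lemma lead_difference:
  assumes a: "a \<in> X" "c a \<noteq> 0" and q: "q \<in> I" "\<And>q'. q' \<in> I \<Longrightarrow> lexpos n q < lexpos n q' \<Longrightarrow> a q' = b q'"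
  shows "a q \<le> b q"
proof (rule ccontr)
  assume "\<not> a q \<le> b q"
  then have "b q < a q" by simp
  then have "wt (Suc m) (lexpos n) I b < wt (Suc m) (lexpos n) I a"
    by (intro wt_less[of I "lexpos n" b "Suc m" q a] less_M lead(1) inj_on_lexpos q(1))
      (use q(2) in auto)
  then show False using lead_max[OF a] by simp
qed

context
  fixes r q :: nat
  assumes r: "Suc r < n" and q: "1 \<le> q" "q \<le> p"
begin

text \<open>K consists of the two columns touched by the shift, Kl and Kh of their rows up to q and
  beyond q. X1 freezes the exponents outside K at those of b, and X2 also those in Kh, so that only
  the rows up to q of the two columns remain free.\<close>

definition K where "K = {1..p} \<times> {r, Suc r}"
definition Kl where "Kl = {1..q} \<times> {r, Suc r}"
definition Kh where "Kh = {Suc q..p} \<times> {r, Suc r}"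
definition X1 where "X1 = {a \<in> X. \<forall>v\<in>I - K. a v = b v}"
definition X2 where "X2 = {a \<in> X1. \<forall>v\<in>Kh. a v = b v}"

lemma K_sub: "K \<subseteq> I" and Kl_sub: "Kl \<subseteq> K" and K_Diff: "K - Kl = Kh" and finK: "finite K" and Kh_sub: "Kh \<subseteq> I"
  using r q by (auto simp: K_def Kl_def Kh_def)

lemma fin_X1: "finite X1" and fin_X2: "finite X2"
  using finX by (simp_all add: X1_def X2_def)

text \<open>The shift does not touch the variables outside K, so the coefficient at the exponents of
  b in these variables is itself invariant.\<close>

lemma X1_invariant: "(\<Sum>a\<in>X1. c a * monf K a (shift r t z)) = (\<Sum>a\<in>X1. c a * monf K a z)"
proof -
  define \<delta> where "\<delta> a = c a * monf K a (shift r t z) - c a * monf K a z" for a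
  have "(\<Sum>a | a \<in> X \<and> (\<forall>v\<in>I - K. a v = b v). \<delta> a) = 0"
  proof (rule monf_independent[OF _ _ finX lead(1)])
    show "inj_on (lexpos n) (I - K)" by (rule inj_on_subset[OF inj_on_lexpos]) blast
    fix z'
    define z'' where "z'' = (\<lambda>v. if v \<in> K then z v else z' v)"
    have K': "(i, r) \<in> K" if "(i, Suc r) \<in> K" for i using that by (simp add: K_def)
    have 1: "monf K a (shift r t z'') = monf K a (shift r t z)" "monf K a z'' = monf K a z" for a
      by (rule monf_cong, use K' in \<open>force simp: shift_def z''_def\<close>)
        (rule monf_cong, simp add: z''_def)
    have off: "snd v \<noteq> Suc r \<and> v \<notin> K" if "v \<in> I - K" for v using that by (auto simp: K_def)
    have 2: "monf (I - K) a (shift r t z'') = monf (I - K) a z'" "monf (I - K) a z'' = monf (I - K) a z'" for a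
      using off by (intro monf_cong; simp add: shift_def z''_def case_prod_unfold)+
    have "(\<Sum>a\<in>X. \<delta> a * monf (I - K) a z') =
        (\<Sum>a\<in>X. c a * monf I a (shift r t z'')) - (\<Sum>a\<in>X. c a * monf I a z'')"
      unfolding sum_subtractf[symmetric]
      by (rule sum.cong[OF refl], subst (1 2) monf_Diff[OF _ K_sub])
        (simp_all only: 1 2 \<delta>_def finite_cartesian_product finite_atLeastAtMost finite_lessThan algebra_simps)
    then show "(\<Sum>a\<in>X. \<delta> a * monf (I - K) a z') = 0" using invariant[OF r] by simp
  qed simp
  then have "(\<Sum>a\<in>X1. \<delta> a) = 0" by (simp only: X1_def)
  then show ?thesis by (simp add: \<delta>_def sum_subtractf)
qed

text \<open>For an exponent in X1 the most significant difference from b within Kh is the most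
  significant one in the whole grid, where b is maximal.\<close>

lemma high_weight_le:
  assumes a: "a \<in> X1" "c a \<noteq> 0"
  shows "wt (Suc m) (lexpos n) Kh a \<le> wt (Suc m) (lexpos n) Kh b"
proof (cases "\<exists>v\<in>Kh. a v \<noteq> b v")
  case False
  then show ?thesis by (simp add: wt_def)
next
  case True
  have Kh: "finite Kh" "inj_on (lexpos n) Kh"
    using inj_on_subset[OF inj_on_lexpos Kh_sub] by (simp_all add: Kh_def)
  obtain v where v: "v \<in> Kh" "a v \<noteq> b v" "\<And>v'. v' \<in> Kh \<Longrightarrow> lexpos n v < lexpos n v' \<Longrightarrow> a v' = b v'"
    using largest_difference[OF Kh True] by blast
  have aX: "a \<in> X" using a(1) by (simp add: X1_def)
  have "a v \<le> b v"
  proof (rule lead_difference[OF aX a(2)])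
    show "v \<in> I" using v(1) Kh_sub by blast
    fix v' assume v': "v' \<in> I" "lexpos n v < lexpos n v'"
    show "a v' = b v'"
    proof (cases "v' \<in> K")
      case True
      obtain i j i' j' where ij: "v = (i, j)" "v' = (i', j')" by (cases v, cases v') blast
      have "j < n" "j' < n" "q < i" using v(1) v'(1) r unfolding ij by (auto simp: Kh_def)
      then have "i \<le> i'" using v'(2) lexpos_less_iff[of j n j' i i'] unfolding ij by auto
      then have "v' \<in> Kh" using True \<open>q < i\<close> unfolding ij by (simp add: K_def Kh_def)
      then show ?thesis using v(3) v'(2) by blast
    next
      case False
      then show ?thesis using a(1) v'(1) by (simp add: X1_def)
    qed
  qed
  then have "a v < b v" using v(2) by simp
  then have "wt (Suc m) (lexpos n) Kh a < wt (Suc m) (lexpos n) Kh b"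
    by (rule wt_less[of Kh "lexpos n" a "Suc m" v b, OF Kh less_M[OF aX] v(1) _ v(3)])
  then show ?thesis by simp
qed

text \<open>Scaling the rows beyond q along the lexicographic curve isolates the exponents that agree
  with b there.\<close>

definition scaled_row :: "complex \<Rightarrow> (nat \<times> nat \<Rightarrow> nat) \<Rightarrow> nat \<Rightarrow> complex poly" where
  "scaled_row t a i = monom 1 (Suc m ^ lexpos n (i, r)) ^ a (i, r) *
     (monom 1 (Suc m ^ lexpos n (i, Suc r)) + smult t (monom 1 (Suc m ^ lexpos n (i, r)))) ^ a (i, Suc r)"

lemma prod_two_columns: "(\<Prod>v\<in>A \<times> {r, Suc r}. f v) = (\<Prod>i\<in>A. f (i, r) * f (i, Suc r :: nat))"
  and sum_two_columns: "(\<Sum>v\<in>A \<times> {r, Suc r}. g v) = (\<Sum>i\<in>A. g (i, r) + g (i, Suc r :: nat))"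
  by (simp_all add: prod.cartesian_product' sum.cartesian_product')

text \<open>With positive m the base exceeds 1, so the column \<open>Suc r\<close> dominates and the
  shift does not affect the leading term.\<close>

lemma scaled_factor:
  assumes m: "0 < m"
  shows "degree (monom 1 (Suc m ^ lexpos n (i, Suc r)) + smult t (monom 1 (Suc m ^ lexpos n (i, r)))) =
      Suc m ^ lexpos n (i, Suc r)" (is "degree ?f = _")
    and "lead_coeff (monom 1 (Suc m ^ lexpos n (i, Suc r)) + smult t (monom 1 (Suc m ^ lexpos n (i, r)))) = (1 :: complex)"
proof -
  have "lexpos n (i, r) < lexpos n (i, Suc r)" by (simp add: lexpos_def)
  then have less: "Suc m ^ lexpos n (i, r) < Suc m ^ lexpos n (i, Suc r)" using m by (intro power_strict_increasing) simp_all
  have "degree (smult t (monom 1 (Suc m ^ lexpos n (i, r)))) < degree (monom (1 :: complex) (Suc m ^ lexpos n (i, Suc r)))"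
    using less degree_smult_le[of t "monom 1 (Suc m ^ lexpos n (i, r))"] by (simp add: degree_monom_eq)
  then show d: "degree ?f = Suc m ^ lexpos n (i, Suc r)"
    by (subst degree_add_eq_left) (simp_all add: degree_monom_eq)
  show "lead_coeff ?f = (1 :: complex)" unfolding d using less by (simp add: coeff_monom)
qed

lemma scaled_rows_lead:
  assumes "0 < m"
  shows "degree (\<Prod>i=Suc q..p. scaled_row t a i) = wt (Suc m) (lexpos n) Kh a"
    "lead_coeff (\<Prod>i=Suc q..p. scaled_row t a i) = 1"
proof -
  note f = scaled_factor[OF assms]
  have nz: "monom 1 (Suc m ^ lexpos n (i, Suc r)) + smult t (monom 1 (Suc m ^ lexpos n (i, r))) \<noteq> (0 :: complex poly)" for i
  proof
    assume "monom 1 (Suc m ^ lexpos n (i, Suc r)) + smult t (monom 1 (Suc m ^ lexpos n (i, r))) = (0 :: complex poly)"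
    then show False using f(2)[of i t] by (metis coeff_0 zero_neq_one)
  qed
  have nz': "scaled_row t a i \<noteq> 0" for i
    using nz[of i] by (simp add: scaled_row_def monom_eq_0_iff)
  have "degree (scaled_row t a i) = a (i, r) * Suc m ^ lexpos n (i, r) + a (i, Suc r) * Suc m ^ lexpos n (i, Suc r)" for i
    unfolding scaled_row_def
    by (subst degree_mult_eq) (simp_all only: power_not_zero nz monom_eq_0_iff one_neq_zero not_False_eq_True degree_power_eq f(1)
        degree_monom_eq)
  then show "degree (\<Prod>i=Suc q..p. scaled_row t a i) = wt (Suc m) (lexpos n) Kh a"
    using nz' by (simp add: degree_prod_eq_sum_degree wt_def Kh_def sum_two_columns)
  have "lead_coeff (scaled_row t a i) = 1" for i
    unfolding scaled_row_def lead_coeff_mult lead_coeff_power f(2) by (simp add: degree_monom_eq)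
  then show "lead_coeff (\<Prod>i=Suc q..p. scaled_row t a i) = 1" by (simp add: lead_coeff_prod)
qed

text \<open>The coefficient at the power W of s, where W is the weight of b on Kh: no exponent of X1
  with nonzero coefficient exceeds W there, exactly those in X2 attain it, and each contributes a
  leading coefficient 1 whatever t is.\<close>

lemma X2_invariant: 
  assumes m: "0 < m"
  shows "(\<Sum>a\<in>X2. c a * monf Kl a (shift r t z)) = (\<Sum>a\<in>X2. c a * monf Kl a z)"
proof -
  define W where "W = wt (Suc m) (lexpos n) Kh b"
  define P where "P t = (\<Sum>a\<in>X1. smult (c a * monf Kl a (shift r t z)) (\<Prod>i=Suc q..p. scaled_row t a i))" for t
  define zs where "zs s = (\<lambda>(i, j). if q < i then s ^ (Suc m ^ lexpos n (i, j)) else z (i, j))" for s :: complex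
  have ev: "poly (P t) s = (\<Sum>a\<in>X1. c a * monf K a (shift r t (zs s)))" for t s
  proof -
    have e: "monf K a (shift r t (zs s)) = monf Kl a (shift r t z) * (\<Prod>i=Suc q..p. poly (scaled_row t a i) s)" for a
    proof -
      have "monf K a (shift r t (zs s)) = monf Kh a (shift r t (zs s)) * monf Kl a (shift r t (zs s))"
        using monf_Diff[OF finK Kl_sub] by (simp only: K_Diff)
      also have "monf Kl a (shift r t (zs s)) = monf Kl a (shift r t z)"
        by (rule monf_cong) (auto simp: Kl_def shift_def zs_def)
      also have "monf Kh a (shift r t (zs s)) = (\<Prod>i=Suc q..p. poly (scaled_row t a i) s)"
        unfolding monf_def Kh_def prod_two_columns
        by (rule prod.cong[OF refl]) (simp add: shift_def zs_def scaled_row_def poly_monom split del: if_split)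
      finally show ?thesis by (subst mult.commute)
    qed
    show ?thesis
      unfolding P_def poly_sum poly_smult poly_prod e by (rule sum.cong[OF refl]) (rule mult.assoc)
  qed
  have s0: "shift r 0 y = y" for y by (auto simp: shift_def)
  have "P t = P 0"
  proof -
    have "poly (P t - P 0) s = 0" for s
      unfolding poly_diff ev s0 X1_invariant by (rule diff_self)
    then have "P t - P 0 = 0" by (rule poly_eq_0_everywhere)
    then show ?thesis by simp
  qed
  moreover have "coeff (P t) W = (\<Sum>a\<in>X2. c a * monf Kl a (shift r t z))" for t
  proof -
    have Kh: "finite Kh" "inj_on (lexpos n) Kh"
      by (simp add: Kh_def, rule inj_on_subset[OF inj_on_lexpos Kh_sub])
    have "coeff (P t) W = (\<Sum>a\<in>X1. if \<forall>v\<in>Kh. a v = b v then c a * monf Kl a (shift r t z) else 0)"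
      unfolding P_def coeff_sum coeff_smult
    proof (rule sum.cong[OF refl])
      fix a assume a: "a \<in> X1"
      show "c a * monf Kl a (shift r t z) * coeff (\<Prod>i=Suc q..p. scaled_row t a i) W =
          (if \<forall>v\<in>Kh. a v = b v then c a * monf Kl a (shift r t z) else 0)"
      proof (cases "c a = 0")
        case False
        have aX: "a \<in> X" using a by (simp add: X1_def)
        show ?thesis
        proof (cases "\<forall>v\<in>Kh. a v = b v")
          case True
          then have "wt (Suc m) (lexpos n) Kh a = W" by (simp add: W_def wt_def)
          then have "coeff (\<Prod>i=Suc q..p. scaled_row t a i) W = 1" using scaled_rows_lead[OF m, of t a] by simp
          then show ?thesis using True by simp
        next
          case neq: False
          have "wt (Suc m) (lexpos n) Kh a \<noteq> W"
            using wt_inj[of Kh "lexpos n" a "Suc m" b, OF Kh less_M[OF aX] less_M[OF lead(1)]] neq by (auto simp: W_def)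
          then have "degree (\<Prod>i=Suc q..p. scaled_row t a i) < W"
            using high_weight_le[OF a False] scaled_rows_lead(1)[OF m, of t a] by (simp add: W_def)
          then have "coeff (\<Prod>i=Suc q..p. scaled_row t a i) W = 0" by (rule coeff_eq_0)
          then show ?thesis by (simp only: if_not_P[OF neq] mult_zero_right)
        qed
      qed simp
    qed
    also have "\<dots> = (\<Sum>a\<in>X2. c a * monf Kl a (shift r t z))"
      using fin_X1 by (simp add: sum.If_cases X2_def Int_def)
    finally show ?thesis .
  qed
  ultimately show ?thesis by (metis s0)
qed

definition N where "N = b (q, r) + b (q, Suc r)"

text \<open>With all other entries frozen, row and column sums determine the sums over the free
  part. The entry at \<open>(q, Suc r)\<close> is then the most significant one still free, and
  maximality of b bounds it.\<close>

lemma X2_props: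
  assumes a: "a \<in> X2"
  shows "a (q, r) + a (q, Suc r) = N"
    and "(\<Sum>i=1..<q. a (i, r)) + a (q, r) = (\<Sum>i=1..q. b (i, r))"
    and "(\<Sum>i=1..<q. a (i, Suc r)) + a (q, Suc r) = (\<Sum>i=1..q. b (i, Suc r))"
    and "c a \<noteq> 0 \<Longrightarrow> a (q, Suc r) \<le> b (q, Suc r)"
proof -
  have aX: "a \<in> X" and off: "\<And>v. v \<in> I - K \<Longrightarrow> a v = b v" and hi: "\<And>v. v \<in> Kh \<Longrightarrow> a v = b v"
    using a by (simp_all add: X2_def X1_def)
  have "(\<Sum>j<n. a (q, j)) = (\<Sum>j<n. b (q, j))" using rows aX lead(1) q by simp
  moreover have "(\<Sum>j<n. f (q, j)) = (\<Sum>j\<in>{..<n} - {r, Suc r}. f (q, j)) + (f (q, r) + f (q, Suc r))" for f :: "nat \<times> nat \<Rightarrow> nat"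
    using sum.subset_diff[of "{r, Suc r}" "{..<n}" "\<lambda>j. f (q, j)"] r by simp
  moreover have "(\<Sum>j\<in>{..<n} - {r, Suc r}. a (q, j)) = (\<Sum>j\<in>{..<n} - {r, Suc r}. b (q, j))"
    by (rule sum.cong[OF refl], rule off) (use q in \<open>auto simp: K_def\<close>)
  ultimately show "a (q, r) + a (q, Suc r) = N" by (simp add: N_def)
  have col: "(\<Sum>i=1..q. a (i, j)) = (\<Sum>i=1..q. b (i, j))" if j: "j \<in> {r, Suc r}" for j
  proof -
    have jn: "j < n" using j r by auto
    have "(\<Sum>i=1..p. f (i, j)) = (\<Sum>i=1..q. f (i, j)) + (\<Sum>i=Suc q..p. f (i, j))" for f :: "nat \<times> nat \<Rightarrow> nat"
      using sum.ub_add_nat[of 1 q "\<lambda>i. f (i, j)" "p - q"] q by simp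
    moreover have "(\<Sum>i=Suc q..p. a (i, j)) = (\<Sum>i=Suc q..p. b (i, j))"
      by (rule sum.cong[OF refl], rule hi) (use j in \<open>auto simp: Kh_def\<close>)
    moreover have "(\<Sum>i=1..p. a (i, j)) = (\<Sum>i=1..p. b (i, j))" using cols[OF aX jn] cols[OF lead(1) jn] by simp
    ultimately show ?thesis by simp
  qed
  have last: "(\<Sum>i=1..q. f i) = (\<Sum>i=1..<q. f i) + f q" for f :: "nat \<Rightarrow> nat"
    using q(1) by (metis sum.last_plus add.commute)
  show "(\<Sum>i=1..<q. a (i, r)) + a (q, r) = (\<Sum>i=1..q. b (i, r))"
    using col[of r] last[of "\<lambda>i. a (i, r)"] by simp
  show "(\<Sum>i=1..<q. a (i, Suc r)) + a (q, Suc r) = (\<Sum>i=1..q. b (i, Suc r))"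
    using col[of "Suc r"] last[of "\<lambda>i. a (i, Suc r)"] by simp
  assume ca: "c a \<noteq> 0"
  show "a (q, Suc r) \<le> b (q, Suc r)"
  proof (rule lead_difference[OF aX ca])
    show "(q, Suc r) \<in> I" using q r by simp
    fix v assume v: "v \<in> I" "lexpos n (q, Suc r) < lexpos n v"
    obtain i j where ij: "v = (i, j)" by (cases v)
    have "q < i \<or> q = i \<and> Suc r < j"
      using v lexpos_less_iff[OF r, of j q i] unfolding ij by simp
    then have "v \<in> Kh \<or> v \<in> I - K" using v(1) unfolding ij by (auto simp: K_def Kh_def)
    then show "a v = b v" using hi off by blast
  qed
qed

text \<open>Row q is dehomogenized to the pair of 1 and \<tau>, which loses no information because
  its two exponents have the fixed sum N.\<close>

definition pt :: "(nat \<Rightarrow> complex) \<Rightarrow> (nat \<Rightarrow> complex) \<Rightarrow> complex \<Rightarrow> nat \<times> nat \<Rightarrow> complex" where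
  "pt x y \<tau> = (\<lambda>(i, j). if i = q then (if j = Suc r then \<tau> else 1) else if j = Suc r then y i else x i)"

lemma monf_pt:
  "monf Kl a (pt x y \<tau>) = (\<Prod>i=1..<q. x i ^ a (i, r) * y i ^ a (i, Suc r)) * \<tau> ^ a (q, Suc r)"
proof -
  have "monf Kl a (pt x y \<tau>) = (\<Prod>i=1..q. pt x y \<tau> (i, r) ^ a (i, r) * pt x y \<tau> (i, Suc r) ^ a (i, Suc r))"
    unfolding monf_def Kl_def prod_two_columns ..
  also have "{1..q} = insert q {1..<q}" using q by auto
  also have "(\<Prod>i\<in>insert q {1..<q}. pt x y \<tau> (i, r) ^ a (i, r) * pt x y \<tau> (i, Suc r) ^ a (i, Suc r)) =
      \<tau> ^ a (q, Suc r) * (\<Prod>i=1..<q. pt x y \<tau> (i, r) ^ a (i, r) * pt x y \<tau> (i, Suc r) ^ a (i, Suc r))"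
    by (subst prod.insert) (simp_all add: pt_def)
  also have "(\<Prod>i=1..<q. pt x y \<tau> (i, r) ^ a (i, r) * pt x y \<tau> (i, Suc r) ^ a (i, Suc r)) =
      (\<Prod>i=1..<q. x i ^ a (i, r) * y i ^ a (i, Suc r))"
    by (rule prod.cong[OF refl]) (simp add: pt_def)
  finally show ?thesis by (simp only: mult.commute)
qed

definition g where "g x y \<tau> = (\<Sum>a\<in>X2. c a * monf Kl a (pt x y \<tau>))"

lemma g_shift:
  assumes "0 < m"
  shows "g x (\<lambda>i. y i + t * x i) (\<tau> + t) = g x y \<tau>"
proof -
  have "shift r t (pt x y \<tau>) = pt x (\<lambda>i. y i + t * x i) (\<tau> + t)"
    by (auto simp: shift_def pt_def fun_eq_iff)
  then show ?thesis using X2_invariant[OF assms, of t "pt x y \<tau>"] by (simp only: g_def)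
qed

text \<open>The key step: if the claimed inequality failed, \<open>s \<mapsto> s ^ Q * g (v - s y) (v / s) 0\<close> would be a
  polynomial of degree less than its order of vanishing at 0.\<close>

lemma g_vanishes:
  assumes m: "0 < m" and small: "(\<Sum>i=1..<q. b (i, r)) < (\<Sum>i=1..q. b (i, Suc r))"
  shows "g x v 0 = 0"
proof -
  define y where "y i = v i - x i" for i
  define Q where "Q = (\<Sum>i=1..q. b (i, Suc r))"
  define B where "B = b (q, Suc r)"
  define lf where "lf i = [:v i, - y i:]" for i
  \<comment> \<open>This is \<open>s ^ Q * g (v - s y) (v / s) 0\<close>. The value 0 for \<tau>
    retains only exponents with \<open>a (q, Suc r) = 0\<close>, by \<open>0 ^ 0 = 1\<close>; their
    degree in the second argument is exactly Q, so the denominators clear.\<close>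
  define P where "P = (\<Sum>a\<in>X2. smult (c a * (\<Prod>i=1..<q. v i ^ a (i, Suc r)) * 0 ^ a (q, Suc r)) (\<Prod>i=1..<q. lf i ^ a (i, r)))"
  \<comment> \<open>The same function after a shift by \<open>- 1 / s\<close>. The exponent of
    \<tau> is at most B, so a factor \<open>s ^ (Q - B)\<close> splits off.\<close>
  define R where "R = (\<Sum>a\<in>X2. smult (c a * (\<Prod>i=1..<q. y i ^ a (i, Suc r)) * (-1) ^ a (q, Suc r))
     (monom 1 (B - a (q, Suc r)) * (\<Prod>i=1..<q. lf i ^ a (i, r))))"
  have last: "(\<Sum>i=1..q. f i) = (\<Sum>i=1..<q. f i) + f q" for f :: "nat \<Rightarrow> nat"
    using q(1) by (metis sum.last_plus add.commute)
  have BQ: "B \<le> Q" using last[of "\<lambda>i. b (i, Suc r)"] by (simp add: Q_def B_def)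
  have Pg: "poly P s = s ^ Q * g (\<lambda>i. v i - s * y i) (\<lambda>i. v i / s) 0" if s: "s \<noteq> 0" for s
    unfolding P_def g_def monf_pt poly_sum sum_distrib_left
  proof (rule sum.cong[OF refl])
    fix a assume a: "a \<in> X2"
    show "poly (smult (c a * (\<Prod>i=1..<q. v i ^ a (i, Suc r)) * 0 ^ a (q, Suc r)) (\<Prod>i=1..<q. lf i ^ a (i, r))) s =
        s ^ Q * (c a * ((\<Prod>i=1..<q. (v i - s * y i) ^ a (i, r) * (v i / s) ^ a (i, Suc r)) * 0 ^ a (q, Suc r)))"
    proof (cases "a (q, Suc r) = 0")
      case True
      then have "(\<Sum>i=1..<q. a (i, Suc r)) = Q" using X2_props(3)[OF a] by (simp add: Q_def)
      then have "(\<Prod>i=1..<q. s ^ a (i, Suc r)) = s ^ Q" by (simp only: power_sum[symmetric])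
      moreover have "(\<Prod>i=1..<q. (v i / s) ^ a (i, Suc r)) * (\<Prod>i=1..<q. s ^ a (i, Suc r)) = (\<Prod>i=1..<q. v i ^ a (i, Suc r))"
        unfolding prod.distrib[symmetric] power_mult_distrib[symmetric] using s by simp
      ultimately have e: "(\<Prod>i=1..<q. v i ^ a (i, Suc r)) = (\<Prod>i=1..<q. (v i / s) ^ a (i, Suc r)) * s ^ Q" by simp
      have Zp: "poly (\<Prod>i=1..<q. lf i ^ a (i, r)) s = (\<Prod>i=1..<q. (v i - s * y i) ^ a (i, r))"
        unfolding poly_prod by (rule prod.cong[OF refl]) (simp add: lf_def)
      show ?thesis unfolding e poly_smult Zp prod.distrib True power_0 mult_1_right by (simp only: mult_ac)
    qed simp
  qed
  have Rg: "s ^ (Q - B) * poly R s = s ^ Q * g (\<lambda>i. v i - s * y i) y (- 1 / s)" if s: "s \<noteq> 0" for s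
    unfolding R_def g_def monf_pt poly_sum sum_distrib_left
  proof (rule sum.cong[OF refl])
    fix a assume a: "a \<in> X2"
    show "s ^ (Q - B) * poly (smult (c a * (\<Prod>i=1..<q. y i ^ a (i, Suc r)) * (-1) ^ a (q, Suc r))
         (monom 1 (B - a (q, Suc r)) * (\<Prod>i=1..<q. lf i ^ a (i, r)))) s =
        s ^ Q * (c a * ((\<Prod>i=1..<q. (v i - s * y i) ^ a (i, r) * y i ^ a (i, Suc r)) * (- 1 / s) ^ a (q, Suc r)))"
    proof (cases "c a = 0")
      case False
      define \<beta> where "\<beta> = a (q, Suc r)"
      have \<beta>: "\<beta> \<le> B" using X2_props(4)[OF a False] by (simp add: \<beta>_def B_def)
      have "s ^ Q = s ^ (Q - B) * s ^ (B - \<beta>) * s ^ \<beta>"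
        using \<beta> BQ by (simp add: power_add[symmetric])
      then have sQ: "s ^ Q * (- 1 / s) ^ \<beta> = s ^ (Q - B) * (-1) ^ \<beta> * s ^ (B - \<beta>)"
      proof -
        assume sQ: "s ^ Q = s ^ (Q - B) * s ^ (B - \<beta>) * s ^ \<beta>"
        have "s ^ \<beta> * (- 1 / s) ^ \<beta> = (s * (- 1 / s)) ^ \<beta>" by (rule power_mult_distrib[symmetric])
        also have "s * (- 1 / s) = - 1" using s by simp
        finally have E: "s ^ \<beta> * (- 1 / s) ^ \<beta> = (- 1) ^ \<beta>" .
        have "s ^ Q * (- 1 / s) ^ \<beta> = s ^ (Q - B) * s ^ (B - \<beta>) * (s ^ \<beta> * (- 1 / s) ^ \<beta>)"
          by (simp only: sQ mult.assoc)
        also have "\<dots> = s ^ (Q - B) * (- 1) ^ \<beta> * s ^ (B - \<beta>)" unfolding E by (simp only: mult_ac)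
        finally show ?thesis .
      qed
      define Y where "Y = (\<Prod>i=1..<q. y i ^ a (i, Suc r))"
      define Z where "Z = (\<Prod>i=1..<q. (v i - s * y i) ^ a (i, r))"
      have Zp: "poly (\<Prod>i=1..<q. lf i ^ a (i, r)) s = Z"
        unfolding Z_def poly_prod by (rule prod.cong[OF refl]) (simp add: lf_def)
      have YZ: "(\<Prod>i=1..<q. (v i - s * y i) ^ a (i, r) * y i ^ a (i, Suc r)) = Z * Y"
        by (simp only: prod.distrib Y_def Z_def)
      have "s ^ Q * (c a * (Z * Y * (- 1 / s) ^ \<beta>)) = c a * Z * Y * (s ^ Q * (- 1 / s) ^ \<beta>)"
        by (simp only: mult_ac)
      also have "\<dots> = s ^ (Q - B) * (c a * Y * (-1) ^ \<beta> * (s ^ (B - \<beta>) * Z))"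
        unfolding sQ by (simp only: mult_ac)
      finally show ?thesis
        unfolding \<beta>_def[symmetric] Y_def[symmetric] YZ poly_smult poly_mult Zp poly_monom mult_1 by (rule sym)
    qed simp
  qed
  have PR: "P = monom 1 (Q - B) * R"
  proof -
    \<comment> \<open>The extra factor, which vanishes at 0, spares the comparison at s = 0, where
      the fractions make no sense.\<close>
    have "poly ((P - monom 1 (Q - B) * R) * [:0, 1:]) s = 0" for s
    proof (cases "s = 0")
      case False
      have yy: "v i / s + (- 1 / s) * (v i - s * y i) = y i" for i
      proof -
        have "(- 1 / s) * (v i - s * y i) = - ((v i - s * y i) / s)" by simp
        also have "(v i - s * y i) / s = v i / s - y i" using False by (simp add: diff_divide_distrib)
        finally show ?thesis by simp
      qed
      \<comment> \<open>The shift by \<open>- 1 / s\<close> was chosen to carry \<open>v / s\<close>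
        to y while moving \<tau> from 0 to \<open>- 1 / s\<close>.\<close>
      have "g (\<lambda>i. v i - s * y i) y (0 + (- 1 / s)) = g (\<lambda>i. v i - s * y i) (\<lambda>i. v i / s) 0"
        using g_shift[OF m, of "\<lambda>i. v i - s * y i" "\<lambda>i. v i / s" "- 1 / s" 0] unfolding yy .
      then have "g (\<lambda>i. v i - s * y i) y (- 1 / s) = g (\<lambda>i. v i - s * y i) (\<lambda>i. v i / s) 0"
        unfolding add_0 .
      then have "poly P s = s ^ (Q - B) * poly R s" unfolding Pg[OF False] Rg[OF False] by (rule arg_cong[OF sym])
      then have z: "poly P s - s ^ (Q - B) * poly R s = 0" by (rule right_minus_eq[THEN iffD2])
      show ?thesis unfolding poly_mult poly_diff poly_monom mult_1 z mult_zero_left ..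
    next
      case True
      then have z: "poly [:0, 1 :: complex:] s = 0" by (simp only: poly_pCons poly_0 mult_zero_left add_0)
      show ?thesis unfolding poly_mult z mult_zero_right ..
    qed
    then have "(P - monom 1 (Q - B) * R) * [:0, 1:] = 0" by (rule poly_eq_0_everywhere)
    then have "P - monom 1 (Q - B) * R = 0 \<or> [:0, 1 :: complex:] = 0" by (simp only: mult_eq_0_iff)
    moreover have "[:0, 1 :: complex:] \<noteq> 0" by simp
    ultimately have "P - monom 1 (Q - B) * R = 0" by argo
    then show ?thesis by (rule right_minus_eq[THEN iffD1])
  qed
  have "P = 0"
  proof (rule ccontr)
    assume P0: "P \<noteq> 0"
    have dP: "degree P + N \<le> (\<Sum>i=1..q. b (i, r))"
    proof -
      \<comment> \<open>An exponent surviving in P shows that N does not exceed the column sum, so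
        the subtraction below is not truncated.\<close>
      obtain a0 where a0: "a0 \<in> X2" "a0 (q, Suc r) = 0"
      proof -
        have "\<exists>a\<in>X2. a (q, Suc r) = 0"
        proof (rule ccontr)
          assume none: "\<not> (\<exists>a\<in>X2. a (q, Suc r) = 0)"
          have "smult (c a * (\<Prod>i=1..<q. v i ^ a (i, Suc r)) * 0 ^ a (q, Suc r)) (\<Prod>i=1..<q. lf i ^ a (i, r)) = 0"
            if "a \<in> X2" for a
          proof -
            have "a (q, Suc r) \<noteq> 0"
            proof
              assume "a (q, Suc r) = 0"
              then have "\<exists>a\<in>X2. a (q, Suc r) = 0" using that by (rule bexI)
              with none show False by (rule notE)
            qed
            then have "(0 :: complex) ^ a (q, Suc r) = 0" by (simp only: power_0_left if_False)
            then show ?thesis by (simp only: mult_zero_right smult_0_left)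
          qed
          then have "P = 0" unfolding P_def by (intro sum.neutral ballI)
          with P0 show False ..
        qed
        then show ?thesis using that by blast
      qed
      have "N \<le> (\<Sum>i=1..q. b (i, r))" using X2_props(1,2)[OF a0(1)] a0(2) by simp
      moreover have "degree P \<le> (\<Sum>i=1..q. b (i, r)) - N"
        unfolding P_def
      proof (rule degree_sum_le[OF fin_X2])
        fix a assume a: "a \<in> X2"
        show "degree (smult (c a * (\<Prod>i=1..<q. v i ^ a (i, Suc r)) * 0 ^ a (q, Suc r)) (\<Prod>i=1..<q. lf i ^ a (i, r)))
            \<le> (\<Sum>i=1..q. b (i, r)) - N"
        proof (cases "a (q, Suc r) = 0")
          case True
          have "degree (lf i ^ k) \<le> k" for i k
          proof -
            have "degree (lf i ^ k) \<le> degree (lf i) * k" by (rule degree_power_le)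
            also have "\<dots> \<le> 1 * k" by (rule mult_le_mono1) (simp add: lf_def)
            finally show ?thesis by simp
          qed
          then have "(\<Sum>i=1..<q. degree (lf i ^ a (i, r))) \<le> (\<Sum>i=1..<q. a (i, r))" by (rule sum_mono)
          then have "degree (\<Prod>i=1..<q. lf i ^ a (i, r)) \<le> (\<Sum>i=1..<q. a (i, r))"
            using degree_prod_sum_le[of "{1..<q}" "\<lambda>i. lf i ^ a (i, r)"] by (simp add: o_def)
          also have "\<dots> = (\<Sum>i=1..q. b (i, r)) - N" using X2_props(1,2)[OF a] True by simp
          finally show ?thesis by (rule order_trans[OF degree_smult_le])
        qed simp
      qed
      ultimately show ?thesis by simp
    qed
    have "Q - B \<le> degree P"
    proof -
      have "monom 1 (Q - B) \<noteq> (0 :: complex poly)" "R \<noteq> 0" using P0 PR by (simp_all add: monom_eq_0_iff)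
      then have "degree (monom 1 (Q - B) * R) = degree (monom (1 :: complex) (Q - B)) + degree R" by (rule degree_mult_eq)
      then show ?thesis unfolding PR by (simp add: degree_monom_eq)
    qed
    moreover have "(\<Sum>i=1..<q. b (i, r)) + b (q, r) = (\<Sum>i=1..q. b (i, r))" using last[of "\<lambda>i. b (i, r)"] by simp
    ultimately show False using dP small BQ unfolding N_def B_def[symmetric] Q_def[symmetric] by linarith
  qed
  \<comment> \<open>At s = 1 the arguments are \<open>v - y = x\<close> and v, for which y was
    defined.\<close>
  then show ?thesis using Pg[of 1] by (simp add: y_def)
qed

text \<open>A shift moves every \<tau> to 0, so \<open>g_vanishes\<close> makes g vanish
  identically. This contradicts the nonzero coefficient at b, since dehomogenizing merges no two
  exponents of X2.\<close>

lemma interlacing_positive: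
  assumes m: "0 < m"
  shows "(\<Sum>i=1..q. b (i, Suc r)) \<le> (\<Sum>i=1..<q. b (i, r))"
proof (rule ccontr)
  assume "\<not> ?thesis"
  then have small: "(\<Sum>i=1..<q. b (i, r)) < (\<Sum>i=1..q. b (i, Suc r))" by simp
  have g0: "g x y \<tau> = 0" for x y \<tau>
    using g_shift[OF m, of x "\<lambda>i. y i - \<tau> * x i" \<tau> 0] g_vanishes[OF m small] by simp
  \<comment> \<open>The variable at \<open>(q, r)\<close> has been set to 1; its exponent is
    recovered from the one at \<open>(q, Suc r)\<close> through N.\<close>
  define L where "L = Kl - {(q, r)}"
  have LI: "L \<subseteq> I" using Kl_sub K_sub by (auto simp: L_def)
  have bX2: "b \<in> X2" using lead(1) by (simp add: X2_def X1_def)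
  have "(\<Sum>a | a \<in> X2 \<and> (\<forall>v\<in>L. a v = b v). c a) = 0"
  proof (rule monf_independent[OF _ _ fin_X2 bX2])
    show "finite L" by (simp add: L_def Kl_def)
    show "inj_on (lexpos n) L" by (rule inj_on_subset[OF inj_on_lexpos LI])
    fix z
    have "monf L a z = monf Kl a (pt (\<lambda>i. z (i, r)) (\<lambda>i. z (i, Suc r)) (z (q, Suc r)))" for a
    proof -
      have "monf Kl a (pt (\<lambda>i. z (i, r)) (\<lambda>i. z (i, Suc r)) (z (q, Suc r))) =
          monf (Kl - {(q, r)}) a (pt (\<lambda>i. z (i, r)) (\<lambda>i. z (i, Suc r)) (z (q, Suc r))) *
          monf {(q, r)} a (pt (\<lambda>i. z (i, r)) (\<lambda>i. z (i, Suc r)) (z (q, Suc r)))"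
        by (rule monf_Diff) (use q in \<open>auto simp: Kl_def\<close>)
      also have "monf {(q, r)} a (pt (\<lambda>i. z (i, r)) (\<lambda>i. z (i, Suc r)) (z (q, Suc r))) = 1"
        by (simp add: monf_def pt_def)
      also have "monf (Kl - {(q, r)}) a (pt (\<lambda>i. z (i, r)) (\<lambda>i. z (i, Suc r)) (z (q, Suc r))) = monf L a z"
        unfolding L_def
      proof (rule monf_cong)
        fix v' assume v': "v' \<in> Kl - {(q, r)}"
        obtain i j where ij: "v' = (i, j)" by (cases v')
        have "j = r \<or> j = Suc r" "\<not> (i = q \<and> j = r)" using v' by (auto simp: ij Kl_def)
        then show "pt (\<lambda>i. z (i, r)) (\<lambda>i. z (i, Suc r)) (z (q, Suc r)) v' = z v'"
          by (cases "i = q"; cases "j = Suc r") (simp_all add: pt_def ij)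
      qed
      finally show ?thesis by simp
    qed
    then show "(\<Sum>a\<in>X2. c a * monf L a z) = 0"
      using g0[of "\<lambda>i. z (i, r)" "\<lambda>i. z (i, Suc r)" "z (q, Suc r)"] by (simp add: g_def)
  qed
  moreover have "{a. a \<in> X2 \<and> (\<forall>v\<in>L. a v = b v)} = {b}"
  proof
    show "{b} \<subseteq> {a. a \<in> X2 \<and> (\<forall>v\<in>L. a v = b v)}" using bX2 by simp
    show "{a. a \<in> X2 \<and> (\<forall>v\<in>L. a v = b v)} \<subseteq> {b}"
    proof
      fix a assume "a \<in> {a. a \<in> X2 \<and> (\<forall>v\<in>L. a v = b v)}"
      then have a: "a \<in> X2" "\<And>v. v \<in> L \<Longrightarrow> a v = b v" by simp_all
      have "a (q, Suc r) = b (q, Suc r)" using q by (intro a(2)) (simp add: L_def Kl_def)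
      then have "a (q, r) = b (q, r)" using X2_props(1)[OF a(1)] by (simp add: N_def)
      then have l: "a v = b v" if "v \<in> Kl" for v using that a(2)[of v] by (cases "v = (q, r)") (simp_all add: L_def)
      have aX: "a \<in> X" using a(1) by (simp add: X2_def X1_def)
      have "a = b"
      proof (rule ext)
       fix v show "a v = b v"
       proof (cases "v \<in> I")
        case True
        have h: "a v = b v" if "v \<in> Kh" using a(1) that by (simp add: X2_def)
        have o: "a v = b v" if "v \<in> I - K" using a(1) that by (simp add: X2_def X1_def)
        show ?thesis
        proof (cases "v \<in> Kl")
          case nl: False
          show ?thesis
          proof (cases "v \<in> K")
            case True
            then have "v \<in> Kh" unfolding K_Diff[symmetric] using nl by (rule DiffI)
            then show ?thesis by (rule h)
          next
            case False
            with True have "v \<in> I - K" by (rule DiffI)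
            then show ?thesis by (rule o)
          qed
        next
          case True
          then show ?thesis by (rule l)
        qed
      next
        case False
        then have "a v = 0" "b v = 0" by (rule outside[OF aX], rule outside[OF lead(1)])
        then show ?thesis by (simp only:)
       qed
      qed
      then show "a \<in> {b}" by (simp only: singleton_iff)
    qed
  qed
  ultimately have "sum c {b} = 0" by (simp only:)
  then show False using lead(2) by simp
qed

end

text \<open>For m = 0 the base would be 1 and separate nothing, but then all entries are 0.\<close>

lemma interlacing:
  assumes r: "Suc r < n" and q: "1 \<le> q" "q \<le> p"
  shows "(\<Sum>i=1..q. b (i, Suc r)) \<le> (\<Sum>i=1..<q. b (i, r))"
proof (cases "m = 0")
  case True
  have "b (i, Suc r) = 0" for i using less_M[OF lead(1), of "(i, Suc r)"] True by simp
  then show ?thesis by simp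
next
  case False
  then show ?thesis using interlacing_positive[OF r q] by simp
qed

end

section \<open>The space of highest weight functions on matrices\<close>

abbreviation grid :: "nat \<Rightarrow> nat \<Rightarrow> (nat \<times> nat) set" where
  "grid p n \<equiv> {1..p} \<times> {..<n}"

definition exps :: "nat \<Rightarrow> nat \<Rightarrow> (nat \<Rightarrow> nat) \<Rightarrow> (nat \<times> nat \<Rightarrow> nat) set" where
  "exps p n \<rho> = {a. (\<forall>q. q \<notin> grid p n \<longrightarrow> a q = 0) \<and> (\<forall>i\<in>{1..p}. (\<Sum>j<n. a (i, j)) = \<rho> i)}"

definition hom_space :: "nat \<Rightarrow> nat \<Rightarrow> (nat \<Rightarrow> nat) \<Rightarrow> ((nat \<times> nat \<Rightarrow> complex) \<Rightarrow> complex) set" where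
  "hom_space p n \<rho> = cfun.span (monf (grid p n) ` exps p n \<rho>)"

lemma expsD:
  assumes "a \<in> exps p n \<rho>"
  shows "q \<notin> grid p n \<Longrightarrow> a q = 0" "i \<in> {1..p} \<Longrightarrow> (\<Sum>j<n. a (i, j)) = \<rho> i" "i \<in> {1..p} \<Longrightarrow> a (i, j) \<le> \<rho> i"
proof -
  show z: "a q = 0" if "q \<notin> grid p n" for q using assms that unfolding exps_def by blast
  show r: "(\<Sum>j<n. a (i, j)) = \<rho> i" if "i \<in> {1..p}" using assms that unfolding exps_def by blast
  show "a (i, j) \<le> \<rho> i" if i: "i \<in> {1..p}"
  proof (cases "j < n")
    case True
    then have "a (i, j) \<le> (\<Sum>j<n. a (i, j))" by (intro member_le_sum[of j "{..<n}" "\<lambda>j. a (i, j)"]) auto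
    then show ?thesis using r[OF i] by simp
  next
    case False
    then show ?thesis using z[of "(i, j)"] by simp
  qed
qed

lemma finite_exps: "finite (exps p n \<rho>)"
proof -
  define N where "N = (\<Sum>i=1..p. \<rho> i)"
  have "exps p n \<rho> \<subseteq> {a. \<forall>q. (q \<in> grid p n \<longrightarrow> a q \<in> {..N}) \<and> (q \<notin> grid p n \<longrightarrow> a q = 0)}"
  proof (intro subsetI CollectI allI conjI impI)
    fix a q assume a: "a \<in> exps p n \<rho>"
    show "a q = 0" if "q \<notin> grid p n" by (rule expsD(1)[OF a that])
    assume q: "q \<in> grid p n"
    obtain i j where ij: "q = (i, j)" by (cases q)
    have i: "i \<in> {1..p}" using q ij by simp
    have "a q \<le> \<rho> i" unfolding ij by (rule expsD(3)[OF a i])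
    also have "\<dots> \<le> N" unfolding N_def by (rule member_le_sum[OF i]) simp_all
    finally show "a q \<in> {..N}" by simp
  qed
  moreover have "finite {a. \<forall>q. (q \<in> grid p n \<longrightarrow> a q \<in> {..N}) \<and> (q \<notin> grid p n \<longrightarrow> a q = 0)}"
    by (rule finite_set_of_finite_funs) simp_all
  ultimately show ?thesis by (rule finite_subset)
qed

lemma monf_times: "monf I a * monf I b = monf I (\<lambda>q. a q + b q)"
  by (rule ext) (simp add: monf_def power_add prod.distrib)

lemma span_times:
  assumes "\<And>x y. x \<in> A \<Longrightarrow> y \<in> B \<Longrightarrow> x * y \<in> cfun.span C" and F: "F \<in> cfun.span A" and G: "G \<in> cfun.span B"
  shows "F * G \<in> cfun.span (C :: ('x \<Rightarrow> complex) set)"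
proof -
  have l1: "cfun.subspace {x. x * y \<in> cfun.span C}" for y :: "'x \<Rightarrow> complex"
  proof (rule cfun.subspaceI)
    have "0 * y = 0" by simp
    then show "0 \<in> {x. x * y \<in> cfun.span C}" using cfun.span_zero[of C] by simp
    fix u v c assume u: "u \<in> {x. x * y \<in> cfun.span C}"
    have "cscale c u * y = cscale c (u * y)" by (rule ext) (simp add: cscale_apply)
    then show "cscale c u \<in> {x. x * y \<in> cfun.span C}" using u cfun.span_scale[of "u * y" C c] by simp
    assume v: "v \<in> {x. x * y \<in> cfun.span C}"
    have "(u + v) * y = u * y + v * y" by (rule distrib_right)
    then show "u + v \<in> {x. x * y \<in> cfun.span C}" using u v cfun.span_add[of "u * y" C "v * y"] by simp
  qed
  have l2: "cfun.subspace {y. F * y \<in> cfun.span C}" for F :: "'x \<Rightarrow> complex"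
    using l1[of F] by (simp only: mult.commute)
  have 1: "F * y \<in> cfun.span C" if y: "y \<in> B" for y
  proof -
    have "A \<subseteq> {x. x * y \<in> cfun.span C}" using assms(1) y by blast
    then have "cfun.span A \<subseteq> {x. x * y \<in> cfun.span C}" using l1 by (rule cfun.span_minimal)
    then show ?thesis using F by blast
  qed
  then have "B \<subseteq> {y. F * y \<in> cfun.span C}" by blast
  then have "cfun.span B \<subseteq> {y. F * y \<in> cfun.span C}" using l2 by (rule cfun.span_minimal)
  then show ?thesis using G by blast
qed

lemma hom_space_times:
  assumes "F \<in> hom_space p n \<rho>" "G \<in> hom_space p n \<rho>'"
  shows "F * G \<in> hom_space p n (\<lambda>i. \<rho> i + \<rho>' i)"
  unfolding hom_space_def
proof (rule span_times[OF _ assms[unfolded hom_space_def]])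
  fix x y assume "x \<in> monf (grid p n) ` exps p n \<rho>" "y \<in> monf (grid p n) ` exps p n \<rho>'"
  then obtain a b where a: "a \<in> exps p n \<rho>" "x = monf (grid p n) a" and b: "b \<in> exps p n \<rho>'" "y = monf (grid p n) b"
    by (elim imageE)
  have "(\<lambda>q. a q + b q) \<in> exps p n (\<lambda>i. \<rho> i + \<rho>' i)"
    using expsD(1,2)[OF a(1)] expsD(1,2)[OF b(1)] unfolding exps_def by (simp add: sum.distrib)
  then show "x * y \<in> cfun.span (monf (grid p n) ` exps p n (\<lambda>i. \<rho> i + \<rho>' i))"
    unfolding a(2) b(2) monf_times by (intro cfun.span_base imageI)
qed

lemma monf_in_hom_space:
  assumes "\<And>i. i \<in> {1..p} \<Longrightarrow> (\<Sum>j<n. a (i, j)) = \<rho> i"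
  shows "monf (grid p n) a \<in> hom_space p n \<rho>"
proof -
  define a' where "a' q = (if q \<in> grid p n then a q else 0)" for q
  have "monf (grid p n) a = monf (grid p n) a'"
    unfolding monf_def a'_def by (intro ext prod.cong) simp_all
  moreover have "a' \<in> exps p n \<rho>" using assms by (simp add: exps_def a'_def)
  ultimately show ?thesis unfolding hom_space_def by (simp only:) (intro cfun.span_base imageI)
qed

lemma hom_space_expand:
  assumes "F \<in> hom_space p n \<rho>"
  obtains c where "F = (\<Sum>a\<in>exps p n \<rho>. cscale (c a) (monf (grid p n) a))"
proof -
  define S where "S = {F. \<exists>c. F = (\<Sum>a\<in>exps p n \<rho>. cscale (c a) (monf (grid p n) a))}"
  have "cfun.subspace S"
  proof (rule cfun.subspaceI)
    show "0 \<in> S" unfolding S_def by (intro CollectI exI[of _ "\<lambda>_. 0"]) simp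
  next
    fix x y assume "x \<in> S" "y \<in> S"
    then obtain c d where "x = (\<Sum>a\<in>exps p n \<rho>. cscale (c a) (monf (grid p n) a))"
      "y = (\<Sum>a\<in>exps p n \<rho>. cscale (d a) (monf (grid p n) a))" unfolding S_def by (elim CollectE exE)
    then have "x + y = (\<Sum>a\<in>exps p n \<rho>. cscale (c a + d a) (monf (grid p n) a))"
      by (simp only: sum.distrib cfun.scale_left_distrib)
    then show "x + y \<in> S" unfolding S_def by (intro CollectI exI[of _ "\<lambda>a. c a + d a"])
  next
    fix e x assume "x \<in> S"
    then obtain c where "x = (\<Sum>a\<in>exps p n \<rho>. cscale (c a) (monf (grid p n) a))" unfolding S_def by (elim CollectE exE)
    then have "cscale e x = (\<Sum>a\<in>exps p n \<rho>. cscale (e * c a) (monf (grid p n) a))"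
      by (simp only: cfun.scale_sum_right cfun.scale_scale)
    then show "cscale e x \<in> S" unfolding S_def by (intro CollectI exI[of _ "\<lambda>a. e * c a"])
  qed
  moreover have "monf (grid p n) ` exps p n \<rho> \<subseteq> S"
  proof (rule image_subsetI)
    fix b assume b: "b \<in> exps p n \<rho>"
    have "(\<Sum>a\<in>exps p n \<rho>. cscale (if a = b then 1 else 0) (monf (grid p n) a)) =
        (\<Sum>a\<in>exps p n \<rho>. if a = b then monf (grid p n) b else 0)"
      by (rule sum.cong) simp_all
    also have "\<dots> = monf (grid p n) b" using b finite_exps by simp
    finally show "monf (grid p n) b \<in> S" unfolding S_def by (intro CollectI exI[of _ "\<lambda>a. if a = b then 1 else 0"]) (rule sym)
  qed
  ultimately have "hom_space p n \<rho> \<subseteq> S" unfolding hom_space_def by (intro cfun.span_minimal)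
  then have "F \<in> S" using assms by blast
  then obtain c where "F = (\<Sum>a\<in>exps p n \<rho>. cscale (c a) (monf (grid p n) a))"
    unfolding S_def by (elim CollectE exE)
  then show ?thesis by (rule that)
qed

lemma hom_space_cong:
  assumes F: "F \<in> hom_space p n \<rho>" and z: "\<And>q. q \<in> grid p n \<Longrightarrow> z q = z' q"
  shows "F z = F z'"
proof -
  obtain c where c: "F = (\<Sum>a\<in>exps p n \<rho>. cscale (c a) (monf (grid p n) a))" by (rule hom_space_expand[OF F])
  have e: "monf (grid p n) a z = monf (grid p n) a z'" for a by (rule monf_cong) (rule z)
  show ?thesis unfolding c sum_fun_apply cscale_apply e ..
qed

lemma exps_eq_on_grid:
  assumes "a \<in> exps p n \<rho>" "b \<in> exps p n \<rho>" "\<forall>q\<in>grid p n. a q = b q"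
  shows "a = b"
proof
  fix q show "a q = b q"
  proof (cases "q \<in> grid p n")
    case True then show ?thesis by (rule bspec[OF assms(3)])
  next
    case False
    then show ?thesis using expsD(1)[OF assms(1) False] expsD(1)[OF assms(2) False] by simp
  qed
qed

lemma monf_exps_zero:
  assumes zero: "\<And>z. (\<Sum>a\<in>exps p n \<rho>. c a * monf (grid p n) a z) = 0" and b: "b \<in> exps p n \<rho>"
  shows "c b = 0"
proof -
  have "(\<Sum>a | a \<in> exps p n \<rho> \<and> (\<forall>q\<in>grid p n. a q = b q). c a) = 0"
    by (rule monf_independent[OF _ inj_on_lexpos finite_exps b zero]) simp
  moreover have "{a. a \<in> exps p n \<rho> \<and> (\<forall>q\<in>grid p n. a q = b q)} = {b}"
    using exps_eq_on_grid[OF _ b] b by blast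
  ultimately show ?thesis by simp
qed

definition rmul :: "nat \<Rightarrow> (nat \<times> nat \<Rightarrow> complex) \<Rightarrow> (nat \<Rightarrow> nat \<Rightarrow> complex) \<Rightarrow> nat \<times> nat \<Rightarrow> complex" where
  "rmul n z u = (\<lambda>(i, j). \<Sum>l<n. z (i, l) * u l j)"

definition unitri :: "nat \<Rightarrow> (nat \<Rightarrow> nat \<Rightarrow> complex) \<Rightarrow> bool" where
  "unitri n u \<longleftrightarrow> (\<forall>l<n. \<forall>j<n. (l = j \<longrightarrow> u l j = 1) \<and> (j < l \<longrightarrow> u l j = 0))"

definition col_scale :: "(nat \<Rightarrow> complex) \<Rightarrow> (nat \<times> nat \<Rightarrow> complex) \<Rightarrow> nat \<times> nat \<Rightarrow> complex" where
  "col_scale s z = (\<lambda>(i, j). z (i, j) * s j)"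

definition unip_inv :: "nat \<Rightarrow> ((nat \<times> nat \<Rightarrow> complex) \<Rightarrow> complex) \<Rightarrow> bool" where
  "unip_inv n F \<longleftrightarrow> (\<forall>u z. unitri n u \<longrightarrow> F (rmul n z u) = F z)"

definition has_weight :: "nat \<Rightarrow> (nat \<Rightarrow> nat) \<Rightarrow> ((nat \<times> nat \<Rightarrow> complex) \<Rightarrow> complex) \<Rightarrow> bool" where
  "has_weight n w F \<longleftrightarrow> (\<forall>s z. (\<forall>j<n. s j \<noteq> 0) \<longrightarrow> F (col_scale s z) = (\<Prod>j<n. s j ^ w j) * F z)"

definition hwv_space :: "nat \<Rightarrow> nat \<Rightarrow> nat \<Rightarrow> (nat \<Rightarrow> nat) \<Rightarrow> ((nat \<times> nat \<Rightarrow> complex) \<Rightarrow> complex) set" where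
  "hwv_space p n m w = {F \<in> hom_space p n (\<lambda>_. m). unip_inv n F \<and> has_weight n w F}"

text \<open>The q-th row of the Gelfand-Tsetlin pattern consists of the partial column sums up to q.
  One interlacing inequality is the condition listed here, the other is nonnegativity of the
  entries. Equivalently \<open>a (i, j)\<close> counts the entries i in row j of a semistandard
  tableau of shape w in which each of 1, ..., p occurs m times.\<close>

definition gt_patterns :: "nat \<Rightarrow> nat \<Rightarrow> nat \<Rightarrow> (nat \<Rightarrow> nat) \<Rightarrow> (nat \<times> nat \<Rightarrow> nat) set" where
  "gt_patterns p n m w = {a \<in> exps p n (\<lambda>_. m). (\<forall>j<n. (\<Sum>i=1..p. a (i, j)) = w j) \<and>
     (\<forall>r q. Suc r < n \<longrightarrow> 1 \<le> q \<longrightarrow> q \<le> p \<longrightarrow> (\<Sum>i=1..q. a (i, Suc r)) \<le> (\<Sum>i=1..<q. a (i, r)))}"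

lemma finite_gt_patterns: "finite (gt_patterns p n m w)"
  using finite_exps by (rule finite_subset[rotated]) (auto simp: gt_patterns_def)

lemma subspace_hwv_space: "cfun.subspace (hwv_space p n m w)"
proof (rule cfun.subspaceI)
  show "0 \<in> hwv_space p n m w"
    unfolding hwv_space_def hom_space_def unip_inv_def has_weight_def using cfun.span_zero by simp
next
  fix x y assume x: "x \<in> hwv_space p n m w" and y: "y \<in> hwv_space p n m w"
  then have "x + y \<in> hom_space p n (\<lambda>_. m)" unfolding hwv_space_def hom_space_def by (intro cfun.span_add) simp_all
  moreover have "unip_inv n (x + y)" using x y unfolding hwv_space_def unip_inv_def by simp
  moreover have "has_weight n w (x + y)" using x y unfolding hwv_space_def has_weight_def by (simp add: distrib_left)
  ultimately show "x + y \<in> hwv_space p n m w" unfolding hwv_space_def by simp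
next
  fix c x assume x: "x \<in> hwv_space p n m w"
  then have "cscale c x \<in> hom_space p n (\<lambda>_. m)" unfolding hwv_space_def hom_space_def by (intro cfun.span_scale) simp
  moreover have "unip_inv n (cscale c x)" using x unfolding hwv_space_def unip_inv_def by (simp add: cscale_apply)
  moreover have "has_weight n w (cscale c x)"
    using x unfolding hwv_space_def has_weight_def by (simp add: cscale_apply mult.left_commute)
  ultimately show "cscale c x \<in> hwv_space p n m w" unfolding hwv_space_def by simp
qed

lemma fin_dim_hwv_space: "fin_dim (hwv_space p n m w)"
proof -
  have "fin_dim (hom_space p n (\<lambda>_. m))" unfolding hom_space_def by (intro fin_dim_span finite_imageI finite_exps)
  then show ?thesis by (rule fin_dim_subset[OF _ _ subspace_hwv_space]) (auto simp: hwv_space_def)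
qed

lemma monf_col_scale:
  "monf (grid p n) a (col_scale s z) = (\<Prod>j<n. s j ^ (\<Sum>i=1..p. a (i, j))) * monf (grid p n) a z"
proof -
  have g: "(\<Prod>q\<in>grid p n. f q) = (\<Prod>i=1..p. \<Prod>j<n. f (i, j))" for f :: "nat \<times> nat \<Rightarrow> complex"
    by (simp add: prod.cartesian_product')
  have "monf (grid p n) a (col_scale s z) = monf (grid p n) a z * (\<Prod>i=1..p. \<Prod>j<n. s j ^ a (i, j))"
    unfolding monf_def g by (simp add: col_scale_def power_mult_distrib prod.distrib)
  also have "(\<Prod>i=1..p. \<Prod>j<n. s j ^ a (i, j)) = (\<Prod>j<n. \<Prod>i=1..p. s j ^ a (i, j))"
    by (rule prod.swap)
  also have "\<dots> = (\<Prod>j<n. s j ^ (\<Sum>i=1..p. a (i, j)))" by (simp only: power_sum)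
  finally show ?thesis by (simp only: mult.commute)
qed

lemma weight_support:
  assumes F: "F = (\<Sum>a\<in>exps p n \<rho>. cscale (c a) (monf (grid p n) a))" and w: "has_weight n w F"
    and a: "a \<in> exps p n \<rho>" "c a \<noteq> 0" and j: "j < n"
  shows "(\<Sum>i=1..p. a (i, j)) = w j"
proof -
  \<comment> \<open>Scaling one column by 2 suffices, because powers of 2 determine their
    exponents.\<close>
  define s where "s l = (if l = j then 2 else 1 :: complex)" for l
  have ps: "(\<Prod>l<n. s l ^ f l) = 2 ^ f j" for f :: "nat \<Rightarrow> nat"
  proof -
    have "(\<Prod>l<n. s l ^ f l) = (\<Prod>l<n. if l = j then 2 ^ f j else 1)"
      by (rule prod.cong) (auto simp: s_def)
    then show ?thesis using j by simp
  qed
  define d where "d a = c a * (2 ^ (\<Sum>i=1..p. a (i, j)) - 2 ^ w j)" for a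
  have "(\<Sum>a\<in>exps p n \<rho>. d a * monf (grid p n) a z) = 0" for z
  proof -
    have "F (col_scale s z) = (\<Prod>l<n. s l ^ w l) * F z" using w unfolding has_weight_def by (simp add: s_def)
    then have "(\<Sum>a\<in>exps p n \<rho>. c a * (2 ^ (\<Sum>i=1..p. a (i, j)) * monf (grid p n) a z)) =
        2 ^ w j * (\<Sum>a\<in>exps p n \<rho>. c a * monf (grid p n) a z)"
      unfolding F sum_fun_apply cscale_apply monf_col_scale ps .
    then have "(\<Sum>a\<in>exps p n \<rho>. c a * (2 ^ (\<Sum>i=1..p. a (i, j)) * monf (grid p n) a z)) -
        (\<Sum>a\<in>exps p n \<rho>. 2 ^ w j * (c a * monf (grid p n) a z)) = 0"
      by (simp only: sum_distrib_left diff_self)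
    moreover have "(\<Sum>a\<in>exps p n \<rho>. d a * monf (grid p n) a z) =
        (\<Sum>a\<in>exps p n \<rho>. c a * (2 ^ (\<Sum>i=1..p. a (i, j)) * monf (grid p n) a z) - 2 ^ w j * (c a * monf (grid p n) a z))"
      unfolding d_def by (rule sum.cong[OF refl]) (simp only: left_diff_distrib right_diff_distrib mult_ac)
    ultimately show ?thesis by (simp only: sum_subtractf)
  qed
  then have "d a = 0" using a(1) by (rule monf_exps_zero)
  then have "(2 :: complex) ^ (\<Sum>i=1..p. a (i, j)) = 2 ^ w j" using a(2) by (simp add: d_def)
  then have "of_nat (2 ^ (\<Sum>i=1..p. a (i, j))) = (of_nat (2 ^ w j) :: complex)" by simp
  then have "(2 :: nat) ^ (\<Sum>i=1..p. a (i, j)) = 2 ^ w j" by (simp only: of_nat_eq_iff)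
  then show ?thesis by simp
qed

lemma shift_eq_rmul:
  assumes "Suc r < n" "q \<in> grid p n"
  shows "shift r t z q = rmul n z (\<lambda>l j. if l = j then 1 else if l = r \<and> j = Suc r then t else 0) q"
proof -
  obtain i j where q: "q = (i, j)" "j < n" using assms(2) by (cases q) simp
  have "(\<Sum>l<n. z (i, l) * (if l = j then 1 else if l = r \<and> j = Suc r then t else 0)) =
      (\<Sum>l<n. (if l = j then z (i, j) else 0) + (if l = r then (if j = Suc r then t * z (i, r) else 0) else 0))"
    by (rule sum.cong) auto
  also have "\<dots> = z (i, j) + (if j = Suc r then t * z (i, r) else 0)"
    using q(2) assms(1) by (simp add: sum.distrib)
  finally show ?thesis by (simp add: q(1) rmul_def shift_def)
qed

text \<open>An exponent of largest weight among those occurring in F satisfies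
  \<open>leading_exponent\<close>, since the elementary column operations are unitriangular.\<close>

lemma leading_gt_pattern:
  assumes F: "F \<in> hwv_space p n m w" "F \<noteq> 0" and c: "F = (\<Sum>a\<in>exps p n (\<lambda>_. m). cscale (c a) (monf (grid p n) a))"
  shows "\<exists>b\<in>gt_patterns p n m w. c b \<noteq> 0"
proof -
  have hom: "F \<in> hom_space p n (\<lambda>_. m)" and inv: "unip_inv n F" and wtF: "has_weight n w F"
    using F(1) by (simp_all add: hwv_space_def)
  define X where "X = {a \<in> exps p n (\<lambda>_. m). c a \<noteq> 0}"
  have finX: "finite X" using finite_exps by (simp add: X_def)
  have FX: "F z = (\<Sum>a\<in>X. c a * monf (grid p n) a z)" for z
    unfolding c sum_fun_apply cscale_apply X_def
    by (rule sum.mono_neutral_right[OF finite_exps]) auto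
  have "X \<noteq> {}"
  proof
    assume "X = {}"
    then have "F = 0" by (intro ext) (simp add: FX)
    then show False using F(2) by simp
  qed
  define wf where "wf = wt (Suc m) (lexpos n) (grid p n)"
  have "Max (wf ` X) \<in> wf ` X" using finX \<open>X \<noteq> {}\<close> by (intro Max_in) simp_all
  then obtain b where b: "b \<in> X" "wf b = Max (wf ` X)" by (elim imageE) simp
  have bmax: "wf a \<le> wf b" if "a \<in> X" for a using b(2) finX that by simp
  interpret leading_exponent p n m X c w b
  proof
    fix a q assume "a \<in> X"
    then have "a \<in> exps p n (\<lambda>_. m)" by (simp add: X_def)
    then show "a q = 0" if "q \<notin> grid p n" using that by (rule expsD(1))
  next
    fix a i assume a: "a \<in> X" and i: "i \<in> {1..p}"
    have "a \<in> exps p n (\<lambda>_. m)" using a by (simp add: X_def)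
    then show "(\<Sum>j<n. a (i, j)) = m" using i by (rule expsD(2))
  next
    fix a j assume "a \<in> X" "j < n"
    then show "(\<Sum>i=1..p. a (i, j)) = w j" using weight_support[OF c wtF] by (simp add: X_def)
  next
    fix r t z assume r: "Suc r < n"
    have "unitri n (\<lambda>l j. if l = j then 1 else if l = r \<and> j = Suc r then t else 0)"
      by (simp add: unitri_def)
    then have "F (rmul n z (\<lambda>l j. if l = j then 1 else if l = r \<and> j = Suc r then t else 0)) = F z"
      using inv unfolding unip_inv_def by blast
    moreover have "F (shift r t z) = F (rmul n z (\<lambda>l j. if l = j then 1 else if l = r \<and> j = Suc r then t else 0))"
      by (rule hom_space_cong[OF hom]) (rule shift_eq_rmul[OF r])
    ultimately have "F (shift r t z) = F z" by (simp only:)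
    then show "(\<Sum>a\<in>X. c a * monf (grid p n) a (shift r t z)) = (\<Sum>a\<in>X. c a * monf (grid p n) a z)"
      unfolding FX .
  next
    show "c b \<noteq> 0" using b(1) by (simp add: X_def)
  next
    fix a assume "a \<in> X"
    then show "wt (Suc m) (lexpos n) (grid p n) a \<le> wt (Suc m) (lexpos n) (grid p n) b"
      using bmax by (simp only: wf_def)
  qed (use finX b in simp_all)
  have "b \<in> exps p n (\<lambda>_. m)" using b(1) by (simp add: X_def)
  moreover have "\<forall>j<n. (\<Sum>i=1..p. b (i, j)) = w j" using cols[OF b(1)] by blast
  moreover have "\<forall>r q. Suc r < n \<longrightarrow> 1 \<le> q \<longrightarrow> q \<le> p \<longrightarrow> (\<Sum>i=1..q. b (i, Suc r)) \<le> (\<Sum>i=1..<q. b (i, r))"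
    using interlacing by blast
  ultimately have "b \<in> gt_patterns p n m w" unfolding gt_patterns_def by blast
  then show ?thesis using lead(2) by blast
qed

text \<open>Stated for an indexed family, so that injectivity comes along and the image has as many
  elements as the index set.\<close>

lemma independent_family:
  fixes F :: "'a \<Rightarrow> 'x \<Rightarrow> complex"
  assumes X: "finite X" and zero: "\<And>c. \<forall>z. (\<Sum>a\<in>X. c a * F a z) = 0 \<Longrightarrow> \<forall>b\<in>X. c b = 0"
  shows "inj_on F X" "cfun.independent (F ` X)"
proof -
  show inj: "inj_on F X"
  proof (rule inj_onI, rule ccontr)
    fix a b assume a: "a \<in> X" and b: "b \<in> X" and eq: "F a = F b" and ne: "a \<noteq> b"
    define c where "c x = (if x = a then 1 else 0) + (if x = b then - 1 else 0 :: complex)" for x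
    have "\<forall>z. (\<Sum>x\<in>X. c x * F x z) = 0"
    proof
      fix z
      have "(\<Sum>x\<in>X. c x * F x z) = (\<Sum>x\<in>X. (if x = a then F a z else 0) + (if x = b then - F b z else 0))"
        by (rule sum.cong) (auto simp: c_def)
      also have "\<dots> = F a z - F b z" using a b X by (simp add: sum.distrib)
      finally show "(\<Sum>x\<in>X. c x * F x z) = 0" using eq by simp
    qed
    from bspec[OF zero[OF this] a] show False using ne by (simp add: c_def)
  qed
  have z: "\<forall>x\<in>F ` X. f x = 0" if f: "(\<Sum>x\<in>F ` X. cscale (f x) x) = 0" for f
  proof -
    define g where "g a = f (F a)" for a
    have "(\<Sum>a\<in>X. cscale (g a) (F a)) = 0" using f unfolding sum.reindex[OF inj] o_def g_def .
    then have "\<forall>y. (\<Sum>a\<in>X. cscale (g a) (F a)) y = 0 y" by simp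
    then have "\<forall>b\<in>X. g b = 0" unfolding sum_fun_apply cscale_apply zero_fun_apply by (rule zero)
    then show ?thesis by (simp add: g_def)
  qed
  show "cfun.independent (F ` X)"
    by (rule cfun.independent_if_scalars_zero[OF finite_imageI[OF X]]) (drule z, blast)
qed

text \<open>Reading off only the coefficients at patterns is injective on the space, because a
  nonzero element has a nonzero coefficient at some pattern.\<close>

lemma dim_hwv_space_le: "cfun.dim (hwv_space p n m w) \<le> card (gt_patterns p n m w)"
proof -
  let ?E = "exps p n (\<lambda>_. m)" and ?m = "monf (grid p n)"
  have "\<forall>b\<in>?E. c b = 0" if "\<forall>z. (\<Sum>a\<in>?E. c a * ?m a z) = 0" for c
    by (rule ballI) (rule monf_exps_zero[OF spec[OF that]])
  note indep = independent_family[OF finite_exps this]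
  have injm: "inj_on ?m ?E" by (rule indep(1))
  have ind: "cfun.independent (?m ` ?E)" by (rule indep(2))
  obtain \<xi> where xi: "dual_family (?m ` ?E) \<xi>" using dual_family_exists[OF ind] ..
  let ?G = "gt_patterns p n m w"
  have GE: "?G \<subseteq> ?E" by (auto simp: gt_patterns_def)
  define T where "T F = (\<Sum>a\<in>?G. cscale (\<xi> (?m a) F) (?m a))" for F
  have fx: "cfunctional (\<xi> b)" for b using xi by (simp add: dual_family_def)
  have lin: "clinear T"
  proof (rule clinearI)
    show "T (x + y) = T x + T y" for x y
      by (simp only: T_def cfpair.linear_add[OF fx] cfun.scale_left_distrib sum.distrib)
    show "T (cscale k x) = cscale k (T x)" for k x
      by (simp only: T_def cfpair.linear_scale[OF fx] cfun.scale_sum_right cfun.scale_scale)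
  qed
  have "cfun.dim (hwv_space p n m w) \<le> cfun.dim (cfun.span (?m ` ?G))"
  proof (rule dim_le_of_inj[OF fin_dim_hwv_space fin_dim_span lin])
    show "finite (?m ` ?G)" by (intro finite_imageI finite_gt_patterns)
    show "T ` hwv_space p n m w \<subseteq> cfun.span (?m ` ?G)"
      unfolding T_def by (intro image_subsetI cfun.span_sum cfun.span_scale cfun.span_base imageI)
    fix F assume F: "F \<in> hwv_space p n m w" and T0: "T F = 0"
    show "F = 0"
    proof (rule ccontr)
      assume F0: "F \<noteq> 0"
      have "F \<in> cfun.span (?m ` ?E)" using F by (simp add: hwv_space_def hom_space_def)
      then have "F = (\<Sum>b\<in>?m ` ?E. cscale (\<xi> b F) b)"
        by (rule dual_family_expand[OF finite_imageI[OF finite_exps] xi])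
      then have "F = (\<Sum>a\<in>?E. cscale (\<xi> (?m a) F) (?m a))" by (simp only: sum.reindex[OF injm] o_def)
      from leading_gt_pattern[OF F F0 this] obtain b where b: "b \<in> ?G" "\<xi> (?m b) F \<noteq> 0" by blast
      have "0 = \<xi> (?m b) (T F)" unfolding T0 by (rule cfpair.linear_0[OF fx, symmetric])
      also have "\<dots> = (\<Sum>a\<in>?G. \<xi> (?m a) F * \<xi> (?m b) (?m a))" unfolding T_def by (rule dual_family_sum[OF xi])
      also have "\<dots> = (\<Sum>a\<in>?G. if a = b then \<xi> (?m b) F else 0)"
      proof (rule sum.cong[OF refl])
        fix a assume a: "a \<in> ?G"
        have "\<xi> (?m b) (?m a) = (if ?m b = ?m a then 1 else 0)"
          using xi a b(1) GE unfolding dual_family_def by blast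
        also have "?m b = ?m a \<longleftrightarrow> a = b" using inj_onD[OF injm, of a b] a b(1) GE by (metis subsetD)
        finally show "\<xi> (?m a) F * \<xi> (?m b) (?m a) = (if a = b then \<xi> (?m b) F else 0)" by simp
      qed
      also have "\<dots> = \<xi> (?m b) F" using b(1) finite_gt_patterns by simp
      finally show False using b(2) by simp
    qed
  qed
  also have "\<dots> \<le> card (?m ` ?G)"
    unfolding cfun.dim_span by (rule cfun.dim_le_card[OF cfun.span_superset]) (intro finite_imageI finite_gt_patterns)
  also have "\<dots> \<le> card ?G" by (rule card_image_le[OF finite_gt_patterns])
  finally show ?thesis .
qed

section \<open>Products of minors\<close>

text \<open>A minor on arbitrary rows but on the first h columns, which is what makes it invariant
  under unitriangular column operations.\<close>

definition minor :: "nat \<Rightarrow> (nat \<Rightarrow> nat) \<Rightarrow> (nat \<times> nat \<Rightarrow> complex) \<Rightarrow> complex" where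
  "minor h \<iota> z = det (mat h h (\<lambda>(s, t). z (\<iota> s, t)))"

definition perm_exp :: "nat \<Rightarrow> (nat \<Rightarrow> nat) \<Rightarrow> (nat \<Rightarrow> nat) \<Rightarrow> nat \<times> nat \<Rightarrow> nat" where
  "perm_exp h \<iota> \<pi> = (\<lambda>(i, j). if \<exists>s<h. i = \<iota> s \<and> j = \<pi> s then 1 else 0)"

text \<open>Evaluation on the curve makes the largest exponent visible as a degree.\<close>

definition curve_degree :: "nat \<Rightarrow> nat \<Rightarrow> ((nat \<times> nat \<Rightarrow> complex) \<Rightarrow> complex) \<Rightarrow> nat \<Rightarrow> bool" where
  "curve_degree M n F N \<longleftrightarrow>
     (\<exists>P. (\<forall>t. F (curve M (lexpos n) t) = poly P t) \<and> P \<noteq> 0 \<and> degree P = N)"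

lemma curve_degree_times:
  assumes "curve_degree M n F N" "curve_degree M n G N'"
  shows "curve_degree M n (F * G) (N + N')"
proof -
  obtain P where P: "\<forall>t. F (curve M (lexpos n) t) = poly P t" "P \<noteq> 0" "degree P = N"
    using assms(1) unfolding curve_degree_def by (elim exE conjE)
  obtain Q where Q: "\<forall>t. G (curve M (lexpos n) t) = poly Q t" "Q \<noteq> 0" "degree Q = N'"
    using assms(2) unfolding curve_degree_def by (elim exE conjE)
  have "\<forall>t. (F * G) (curve M (lexpos n) t) = poly (P * Q) t" using P(1) Q(1) by simp
  moreover have "degree (P * Q) = N + N'" using P(2,3) Q(2,3) degree_mult_eq[of P Q] by simp
  moreover have "P * Q \<noteq> 0" using P(2) Q(2) by simp
  ultimately show ?thesis unfolding curve_degree_def by (intro exI[of _ "P * Q"] conjI)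
qed

locale row_selection =
  fixes p n h :: nat and \<iota> :: "nat \<Rightarrow> nat"
  assumes hn: "h \<le> n" and \<iota>_range: "\<And>s. s < h \<Longrightarrow> \<iota> s \<in> {1..p}"
    and \<iota>_mono: "\<And>s t. s < t \<Longrightarrow> t < h \<Longrightarrow> \<iota> s < \<iota> t"
begin

lemma \<iota>_inj: "s < h \<Longrightarrow> t < h \<Longrightarrow> \<iota> s = \<iota> t \<Longrightarrow> s = t"
  using \<iota>_mono[of s t] \<iota>_mono[of t s] by (cases s t rule: linorder_cases) simp_all

lemma perm_exp_row:
  assumes "\<pi> permutes {0..<h}" "s < h"
  shows "perm_exp h \<iota> \<pi> (\<iota> s, j) = (if j = \<pi> s then 1 else 0)"
proof -
  have "(\<exists>t<h. \<iota> s = \<iota> t \<and> j = \<pi> t) \<longleftrightarrow> j = \<pi> s"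
  proof
    assume "\<exists>t<h. \<iota> s = \<iota> t \<and> j = \<pi> t"
    then obtain t where t: "t < h" "\<iota> s = \<iota> t" "j = \<pi> t" by (elim exE conjE)
    have "s = t" by (rule \<iota>_inj[OF assms(2) t(1,2)])
    then show "j = \<pi> s" using t(3) by simp
  next
    assume "j = \<pi> s"
    then show "\<exists>t<h. \<iota> s = \<iota> t \<and> j = \<pi> t" using assms(2) by (intro exI[of _ s]) simp
  qed
  then show ?thesis by (simp add: perm_exp_def)
qed

lemma perm_exp_other_row: "i \<notin> \<iota> ` {..<h} \<Longrightarrow> perm_exp h \<iota> \<pi> (i, j) = 0"
  by (auto simp: perm_exp_def)

lemma permutes_less: "\<pi> permutes {0..<h} \<Longrightarrow> s < h \<Longrightarrow> \<pi> s < h"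
  using permutes_in_image[of \<pi> "{0..<h}" s] by simp

lemma monf_perm_exp:
  assumes \<pi>: "\<pi> permutes {0..<h}"
  shows "monf (grid p n) (perm_exp h \<iota> \<pi>) z = (\<Prod>s = 0..<h. z (\<iota> s, \<pi> s))"
proof -
  define K where "K = (\<lambda>s. (\<iota> s, \<pi> s)) ` {0..<h}"
  have inj: "inj_on (\<lambda>s. (\<iota> s, \<pi> s)) {0..<h}" by (rule inj_onI) (simp add: \<iota>_inj)
  have K: "K \<subseteq> grid p n"
    unfolding K_def using \<iota>_range permutes_less[OF \<pi>] hn by (intro image_subsetI) force
  have "monf (grid p n) (perm_exp h \<iota> \<pi>) z = (\<Prod>q\<in>K. z q ^ perm_exp h \<iota> \<pi> q)"
    unfolding monf_def
  proof (rule prod.mono_neutral_right[OF _ K])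
    show "\<forall>q\<in>grid p n - K. z q ^ perm_exp h \<iota> \<pi> q = 1"
    proof
      fix q assume q: "q \<in> grid p n - K"
      obtain i j where ij: "q = (i, j)" by (cases q)
      have "\<not> (\<exists>s<h. i = \<iota> s \<and> j = \<pi> s)" using q unfolding ij K_def by auto
      then have "perm_exp h \<iota> \<pi> q = 0" by (simp only: ij perm_exp_def case_prod_conv if_False)
      then show "z q ^ perm_exp h \<iota> \<pi> q = 1" by (simp only: power_0)
    qed
  qed simp
  also have "\<dots> = (\<Prod>s = 0..<h. z (\<iota> s, \<pi> s) ^ perm_exp h \<iota> \<pi> (\<iota> s, \<pi> s))"
    unfolding K_def by (simp only: prod.reindex[OF inj] o_def)
  also have "\<dots> = (\<Prod>s = 0..<h. z (\<iota> s, \<pi> s))"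
    by (rule prod.cong) (simp_all add: perm_exp_row[OF \<pi>])
  finally show ?thesis .
qed

lemma minor_expand:
  "minor h \<iota> z = (\<Sum>\<pi> | \<pi> permutes {0..<h}. signof \<pi> * monf (grid p n) (perm_exp h \<iota> \<pi>) z)"
proof -
  have "minor h \<iota> z = (\<Sum>\<pi> | \<pi> permutes {0..<h}.
      signof \<pi> * (\<Prod>s = 0..<h. mat h h (\<lambda>(s, t). z (\<iota> s, t)) $$ (s, \<pi> s)))"
    unfolding minor_def by (rule det_def') simp
  also have "\<dots> = (\<Sum>\<pi> | \<pi> permutes {0..<h}. signof \<pi> * monf (grid p n) (perm_exp h \<iota> \<pi>) z)"
    by (rule sum.cong) (simp_all add: monf_perm_exp permutes_less del: One_nat_def)
  finally show ?thesis .
qed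

lemma minor_hom_space: "minor h \<iota> \<in> hom_space p n (\<lambda>i. if i \<in> \<iota> ` {..<h} then 1 else 0)"
proof -
  have e: "minor h \<iota> = (\<Sum>\<pi> | \<pi> permutes {0..<h}. cscale (signof \<pi>) (monf (grid p n) (perm_exp h \<iota> \<pi>)))"
    by (rule ext) (simp only: minor_expand sum_fun_apply cscale_apply)
  have s: "cfun.subspace (hom_space p n \<rho>)" for \<rho> unfolding hom_space_def by (rule cfun.subspace_span)
  show ?thesis
    unfolding e
  proof (intro cfun.subspace_sum[OF s] cfun.subspace_scale[OF s] monf_in_hom_space)
    fix \<pi> i assume "\<pi> \<in> {\<pi>. \<pi> permutes {0..<h}}"
    then have \<pi>: "\<pi> permutes {0..<h}" by simp
    show "(\<Sum>j<n. perm_exp h \<iota> \<pi> (i, j)) = (if i \<in> \<iota> ` {..<h} then 1 else 0)"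
    proof (cases "i \<in> \<iota> ` {..<h}")
      case True
      then obtain s where s: "s < h" "i = \<iota> s" by auto
      have "\<pi> s < n" using permutes_less[OF \<pi> s(1)] hn by simp
      then show ?thesis using True by (simp add: s(2) perm_exp_row[OF \<pi> s(1)])
    next
      case False
      then show ?thesis by (simp add: perm_exp_other_row)
    qed
  qed
qed

text \<open>As u is upper triangular, the first h columns of the product involve only the first h
  columns of z; the submatrix is multiplied by a unitriangular block of determinant 1.\<close>

lemma minor_unip_inv: "unip_inv n (minor h \<iota>)"
  unfolding unip_inv_def
proof (intro allI impI)
  fix u and z :: "nat \<times> nat \<Rightarrow> complex" assume u: "unitri n u"
  have u1: "u l l = 1" if "l < n" for l using u that unfolding unitri_def by blast
  have u0: "u l j = 0" if "j < l" "l < n" for l j using u that unfolding unitri_def by (meson order.strict_trans)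
  define Z where "Z = mat h h (\<lambda>(s, t). z (\<iota> s, t))"
  define V where "V = mat h h (\<lambda>(l, t). u l t)"
  have c: "Z \<in> carrier_mat h h" "V \<in> carrier_mat h h" by (simp_all add: Z_def V_def)
  have "mat h h (\<lambda>(s, t). rmul n z u (\<iota> s, t)) = Z * V"
  proof (rule eq_matI)
    fix s t assume "s < dim_row (Z * V)" "t < dim_col (Z * V)"
    then have st: "s < h" "t < h" by (simp_all add: Z_def V_def)
    have "(\<Sum>l<n. z (\<iota> s, l) * u l t) = (\<Sum>l\<in>{0..<h}. z (\<iota> s, l) * u l t)"
    proof (rule sum.mono_neutral_right)
      show "\<forall>l\<in>{..<n} - {0..<h}. z (\<iota> s, l) * u l t = 0"
      proof
        fix l assume "l \<in> {..<n} - {0..<h}"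
        then have "l < n" "t < l" "t < n" using st hn by auto
        then have "u l t = 0" using u0 by simp
        then show "z (\<iota> s, l) * u l t = 0" by simp
      qed
    qed (use hn in auto)
    then show "mat h h (\<lambda>(s, t). rmul n z u (\<iota> s, t)) $$ (s, t) = (Z * V) $$ (s, t)"
      using st by (simp add: Z_def V_def scalar_prod_def rmul_def)
  qed (simp_all add: Z_def V_def)
  then have "minor h \<iota> (rmul n z u) = det Z * det V" unfolding minor_def by (simp only: det_mult[OF c])
  also have "det V = prod_list (diag_mat V)"
  proof (rule det_upper_triangular[OF _ c(2)])
    show "upper_triangular V" using u0 hn by (auto simp: upper_triangular_def V_def)
  qed
  also have "\<dots> = (\<Prod>l = 0..<h. V $$ (l, l))" by (simp add: prod_list_diag_prod V_def)
  also have "\<dots> = 1" by (rule prod.neutral) (use u1 hn in \<open>auto simp: V_def\<close>)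
  finally show "minor h \<iota> (rmul n z u) = minor h \<iota> z" by (simp add: minor_def Z_def)
qed

lemma minor_has_weight: "has_weight n (\<lambda>j. if j < h then 1 else 0) (minor h \<iota>)"
  unfolding has_weight_def
proof (intro allI impI)
  fix s :: "nat \<Rightarrow> complex" and z
  have "(\<Prod>j<n. s j ^ (if j < h then 1 else 0)) = (\<Prod>j\<in>{0..<h}. s j ^ (if j < h then 1 else 0))"
    by (rule prod.mono_neutral_right) (use hn in auto)
  also have "\<dots> = (\<Prod>j\<in>{0..<h}. s j)" by (rule prod.cong) simp_all
  finally have w: "(\<Prod>j<n. s j ^ (if j < h then 1 else 0)) = (\<Prod>j\<in>{0..<h}. s j)" .
  have "signof \<pi> * monf (grid p n) (perm_exp h \<iota> \<pi>) (col_scale s z) =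
      (\<Prod>j\<in>{0..<h}. s j) * (signof \<pi> * monf (grid p n) (perm_exp h \<iota> \<pi>) z)" if \<pi>: "\<pi> permutes {0..<h}" for \<pi>
  proof -
    have "(\<Prod>j\<in>{0..<h}. s (\<pi> j)) = (\<Prod>j\<in>{0..<h}. s j)"
      using prod.permute[OF \<pi>, of s] by (simp add: o_def)
    then show ?thesis by (simp add: monf_perm_exp[OF \<pi>] col_scale_def prod.distrib del: One_nat_def)
  qed
  then have "minor h \<iota> (col_scale s z) =
      (\<Sum>\<pi> | \<pi> permutes {0..<h}. (\<Prod>j\<in>{0..<h}. s j) * (signof \<pi> * monf (grid p n) (perm_exp h \<iota> \<pi>) z))"
    unfolding minor_expand by (intro sum.cong) simp_all
  then show "minor h \<iota> (col_scale s z) = (\<Prod>j<n. s j ^ (if j < h then 1 else 0)) * minor h \<iota> z"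
    unfolding w minor_expand by (simp only: sum_distrib_left)
qed

text \<open>Let s be the last index moved by \<pi>. Then \<open>\<pi> s < s\<close>, since larger
  values are fixed; so in row \<open>\<iota> s\<close> the identity reaches a later column than
  \<pi>, and all more significant positions agree. Hence the diagonal monomial leads.\<close>

lemma perm_exp_wt_less:
  assumes M: "2 \<le> M" and \<pi>: "\<pi> permutes {0..<h}" "\<pi> \<noteq> id"
  shows "wt M (lexpos n) (grid p n) (perm_exp h \<iota> \<pi>) < wt M (lexpos n) (grid p n) (perm_exp h \<iota> id)"
proof -
  define S where "S = {s. \<pi> s \<noteq> s}"
  have S: "S \<subseteq> {0..<h}" unfolding S_def using permutes_not_in[OF \<pi>(1)] by blast
  then have finS: "finite S" by (rule finite_subset) simp
  have "S \<noteq> {}" using \<pi>(2) by (auto simp: S_def fun_eq_iff)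
  define s where "s = Max S"
  have sS: "s \<in> S" unfolding s_def by (rule Max_in[OF finS \<open>S \<noteq> {}\<close>])
  then have s: "s < h" "\<pi> s \<noteq> s" using S by (auto simp: S_def)
  have fix_above: "\<pi> t = t" if "s < t" for t
  proof (rule ccontr)
    assume "\<pi> t \<noteq> t"
    then have "t \<le> s" unfolding s_def using finS by (intro Max_ge) (simp_all add: S_def)
    then show False using that by simp
  qed
  have "\<pi> s < s"
  proof (rule ccontr)
    assume "\<not> \<pi> s < s"
    then have "s < \<pi> s" using s(2) by simp
    then have "\<pi> (\<pi> s) = \<pi> s" by (rule fix_above)
    then have "\<pi> s = s" using permutes_inj[OF \<pi>(1)] by (simp add: inj_eq)
    then show False using s(2) by simp
  qed
  have idp: "id permutes {0..<h}" by (rule permutes_id)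
  show ?thesis
  proof (rule wt_less[where q = "(\<iota> s, s)"])
    show "inj_on (lexpos n) (grid p n)" by (rule inj_on_lexpos)
    show "perm_exp h \<iota> \<pi> q < M" for q using M by (simp add: perm_exp_def split: prod.split)
    show "(\<iota> s, s) \<in> grid p n" using \<iota>_range[OF s(1)] s(1) hn by simp
    show "perm_exp h \<iota> \<pi> (\<iota> s, s) < perm_exp h \<iota> id (\<iota> s, s)"
      using s by (simp add: perm_exp_row[OF \<pi>(1)] perm_exp_row[OF idp])
    fix q' assume q': "q' \<in> grid p n" "lexpos n (\<iota> s, s) < lexpos n q'"
    obtain i j where ij: "q' = (i, j)" by (cases q')
    have j: "j < n" "s < n" using q'(1) s(1) hn by (simp_all add: ij)
    have lt: "\<iota> s < i \<or> \<iota> s = i \<and> s < j" using q'(2) lexpos_less_iff[OF j(2,1)] by (simp add: ij)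
    show "perm_exp h \<iota> \<pi> q' = perm_exp h \<iota> id q'"
    proof (cases "i \<in> \<iota> ` {..<h}")
      case False
      then show ?thesis by (simp add: ij perm_exp_other_row)
    next
      case True
      then obtain t where t: "t < h" "i = \<iota> t" by auto
      have st: "s \<le> t"
      proof (rule ccontr)
        assume "\<not> s \<le> t"
        then have "\<iota> t < \<iota> s" using s(1) by (intro \<iota>_mono) simp_all
        then show False using lt t(2) by simp
      qed
      show ?thesis
      proof (cases "s = t")
        case True
        then have "s < j" using lt t(2) by simp
        then show ?thesis using \<open>\<pi> s < s\<close> True
          by (simp add: ij t(2) perm_exp_row[OF \<pi>(1) t(1)] perm_exp_row[OF idp t(1)])
      next
        case False
        then have "\<pi> t = t" using st by (intro fix_above) simp
        then show ?thesis by (simp add: ij t(2) perm_exp_row[OF \<pi>(1) t(1)] perm_exp_row[OF idp t(1)])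
      qed
    qed
  qed simp
qed

lemma minor_curve_degree:
  assumes M: "2 \<le> M"
  shows "curve_degree M n (minor h \<iota>) (wt M (lexpos n) (grid p n) (perm_exp h \<iota> id))"
proof -
  define w where "w \<pi> = wt M (lexpos n) (grid p n) (perm_exp h \<iota> \<pi>)" for \<pi>
  define P :: "complex poly" where "P = (\<Sum>\<pi> | \<pi> permutes {0..<h}. monom (signof \<pi>) (w \<pi>))"
  have fin: "finite {\<pi>. \<pi> permutes {0..<h}}" by (rule finite_permutations) simp
  have idp: "id permutes {0..<h}" by (rule permutes_id)
  have ev: "minor h \<iota> (curve M (lexpos n) t) = poly P t" for t
    by (simp add: minor_expand P_def poly_sum poly_monom monf_curve w_def)
  have le: "w \<pi> < w id" if "\<pi> permutes {0..<h}" "\<pi> \<noteq> id" for \<pi>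
    unfolding w_def by (rule perm_exp_wt_less[OF M that])
  have "coeff P (w id) = (\<Sum>\<pi> | \<pi> permutes {0..<h}. if \<pi> = id then 1 else 0)"
    unfolding P_def coeff_sum
  proof (rule sum.cong[OF refl])
    fix \<pi> assume "\<pi> \<in> {\<pi>. \<pi> permutes {0..<h}}"
    then have \<pi>: "\<pi> permutes {0..<h}" by simp
    show "coeff (monom (signof \<pi>) (w \<pi>)) (w id) = (if \<pi> = id then 1 else 0 :: complex)"
    proof (cases "\<pi> = id")
      case True then show ?thesis by (simp add: coeff_monom)
    next
      case False
      then show ?thesis using le[OF \<pi> False] by (simp add: coeff_monom)
    qed
  qed
  also have "\<dots> = 1" using fin idp by simp
  finally have c: "coeff P (w id) = 1" .
  then have P0: "P \<noteq> 0" by auto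
  have "degree P \<le> w id"
  proof (rule degree_le, intro allI impI)
    fix i assume i: "w id < i"
    have "coeff (monom (signof \<pi>) (w \<pi>)) i = (0 :: complex)" if "\<pi> permutes {0..<h}" for \<pi>
      using le[OF that] i by (cases "\<pi> = id") (simp_all add: coeff_monom)
    then show "coeff P i = 0" unfolding P_def coeff_sum by (intro sum.neutral) simp
  qed
  moreover have "w id \<le> degree P" by (rule le_degree) (simp add: c)
  ultimately have "degree P = w id" by simp
  then show ?thesis unfolding curve_degree_def w_def[symmetric] using ev P0 by (intro exI[of _ P]) simp
qed

end

lemma unip_inv_times: "unip_inv n F \<Longrightarrow> unip_inv n G \<Longrightarrow> unip_inv n (F * G)"
  by (simp add: unip_inv_def)

lemma has_weight_times: "has_weight n w F \<Longrightarrow> has_weight n w' G \<Longrightarrow> has_weight n (\<lambda>j. w j + w' j) (F * G)"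
  unfolding has_weight_def
proof (intro allI impI)
  fix s :: "nat \<Rightarrow> complex" and z
  assume w: "\<forall>s z. (\<forall>j<n. s j \<noteq> 0) \<longrightarrow> F (col_scale s z) = (\<Prod>j<n. s j ^ w j) * F z"
    "\<forall>s z. (\<forall>j<n. s j \<noteq> 0) \<longrightarrow> G (col_scale s z) = (\<Prod>j<n. s j ^ w' j) * G z" and s: "\<forall>j<n. s j \<noteq> 0"
  have "F (col_scale s z) = (\<Prod>j<n. s j ^ w j) * F z" by (rule mp[OF spec[OF spec[OF w(1)]] s])
  moreover have "G (col_scale s z) = (\<Prod>j<n. s j ^ w' j) * G z" by (rule mp[OF spec[OF spec[OF w(2)]] s])
  ultimately show "(F * G) (col_scale s z) = (\<Prod>j<n. s j ^ (w j + w' j)) * (F * G) z"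
    by (simp only: times_fun_apply power_add prod.distrib mult_ac)
qed

definition interlaces :: "nat \<Rightarrow> nat \<Rightarrow> (nat \<times> nat \<Rightarrow> nat) \<Rightarrow> bool" where
  "interlaces p n a \<longleftrightarrow>
     (\<forall>r q. Suc r < n \<longrightarrow> 1 \<le> q \<longrightarrow> q \<le> p \<longrightarrow> (\<Sum>i=1..q. a (i, Suc r)) \<le> (\<Sum>i=1..<q. a (i, r)))"

lemma interlacesD:
  "interlaces p n a \<Longrightarrow> Suc r < n \<Longrightarrow> 1 \<le> q \<Longrightarrow> q \<le> p \<Longrightarrow> (\<Sum>i=1..q. a (i, Suc r)) \<le> (\<Sum>i=1..<q. a (i, r))"
  unfolding interlaces_def by blast

text \<open>The first entries of the nonempty columns form the rows of a minor; it is split off.\<close>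

lemma split_first_column:
  assumes out: "\<And>q. q \<notin> grid p n \<Longrightarrow> a q = 0" and inter: "interlaces p n a" and nz: "\<exists>q. a q \<noteq> 0"
  obtains h \<iota> a' where "row_selection p n h \<iota>" "0 < h" "\<And>q. a q = a' q + perm_exp h \<iota> id q" "interlaces p n a'"
proof -
  define C where "C = {j. \<exists>i. a (i, j) \<noteq> 0}"
  have in_grid: "i \<in> {1..p} \<and> j < n" if "a (i, j) \<noteq> 0" for i j
  proof -
    have "(i, j) \<in> grid p n" by (rule ccontr) (use out[of "(i, j)"] that in blast)
    then show ?thesis by simp
  qed
  \<comment> \<open>Interlacing at row i: an entry in column \<open>Suc r\<close> forces an entry of
    column r in a strictly earlier row. So the nonempty columns form an initial segment and their
    first entries lie in increasing rows.\<close>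
  have down1: "\<exists>i'<i. a (i', r) \<noteq> 0" if ar: "a (i, Suc r) \<noteq> 0" for i r
  proof -
    have i: "i \<in> {1..p}" "Suc r < n" using in_grid[OF ar] by simp_all
    have "a (i, Suc r) \<le> (\<Sum>i=1..i. a (i, Suc r))"
      by (rule member_le_sum[of i "{1..i}" "\<lambda>i. a (i, Suc r)"]) (use i in simp_all)
    also have "\<dots> \<le> (\<Sum>i=1..<i. a (i, r))" by (rule interlacesD[OF inter i(2)]) (use i in simp_all)
    finally have le: "a (i, Suc r) \<le> (\<Sum>i=1..<i. a (i, r))" .
    have s: "(\<Sum>i=1..<i. a (i, r)) \<noteq> 0" using le ar by linarith
    have "\<not> (\<forall>i'\<in>{1..<i}. a (i', r) = 0)"
    proof
      assume "\<forall>i'\<in>{1..<i}. a (i', r) = 0"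
      then have "(\<Sum>i=1..<i. a (i, r)) = 0" by (rule sum.neutral)
      then show False using s by blast
    qed
    then obtain i' where "i' \<in> {1..<i}" "a (i', r) \<noteq> 0" by blast
    then show ?thesis by (intro exI[of _ i']) simp
  qed
  have "C \<subseteq> {..<n}" using in_grid by (auto simp: C_def)
  then have finC: "finite C" by (rule finite_subset) simp
  have down: "c \<in> C" if "b \<in> C" "c < b" for b c
    using that
  proof (induction b)
    case (Suc r)
    have "r \<in> C" using down1 Suc.prems(1) unfolding C_def by blast
    then show ?case using Suc.IH Suc.prems(2) by (cases "c = r") simp_all
  qed simp
  define h where "h = card C"
  have C: "C = {..<h}" unfolding h_def by (rule finite_down_closed_eq_lessThan[OF finC down])
  define \<iota> where "\<iota> s = (LEAST i. a (i, s) \<noteq> 0)" for s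
  have first: "a (\<iota> s, s) \<noteq> 0" if "s < h" for s
  proof -
    have "s \<in> C" using that C by simp
    then have "\<exists>i. a (i, s) \<noteq> 0" by (simp add: C_def)
    then show ?thesis unfolding \<iota>_def by (rule LeastI_ex)
  qed
  have least: "\<iota> s \<le> i" if "a (i, s) \<noteq> 0" for i s unfolding \<iota>_def using that by (rule Least_le)
  have step: "\<iota> s < \<iota> (Suc s)" if s: "Suc s < h" for s
  proof -
    obtain i' where i': "i' < \<iota> (Suc s)" "a (i', s) \<noteq> 0" using down1[OF first[OF s]] by (elim exE conjE)
    show ?thesis using least[OF i'(2)] i'(1) by simp
  qed
  have mono: "\<iota> s < \<iota> t" if "s < t" "t < h" for s t
    using that
  proof (induction t)
    case (Suc t)
    show ?case
    proof (cases "s = t")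
      case True then show ?thesis using step[of t] Suc.prems(2) by simp
    next
      case False
      then have "\<iota> s < \<iota> t" using Suc by simp
      also have "\<dots> < \<iota> (Suc t)" by (rule step[OF Suc.prems(2)])
      finally show ?thesis .
    qed
  qed simp
  have hn: "h \<le> n" using \<open>C \<subseteq> {..<n}\<close> C by simp
  interpret row_selection p n h \<iota>
  proof
    show "\<iota> s \<in> {1..p}" if "s < h" for s using in_grid[OF first[OF that]] by (rule conjunct1)
  qed (use hn mono in simp_all)
  define a' where "a' q = a q - perm_exp h \<iota> id q" for q
  have pe: "perm_exp h \<iota> id (i, j) = (if j < h \<and> i = \<iota> j then 1 else 0)" for i j by (simp add: perm_exp_def)
  have split: "a q = a' q + perm_exp h \<iota> id q" for q
  proof -
    obtain i j where q: "q = (i, j)" by (cases q)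
    show ?thesis using first[of j] unfolding q a'_def pe by auto
  qed
  have sum: "(\<Sum>i\<in>A. a (i, j)) = (\<Sum>i\<in>A. a' (i, j)) + (if j < h \<and> \<iota> j \<in> A then 1 else 0)" if "finite A" for A j
  proof -
    have "(\<Sum>i\<in>A. perm_exp h \<iota> id (i, j)) = (\<Sum>i\<in>A. if i = \<iota> j then (if j < h then 1 else 0) else 0)"
      unfolding pe by (rule sum.cong) auto
    also have "\<dots> = (if j < h \<and> \<iota> j \<in> A then 1 else 0)" using that by simp
    finally show ?thesis unfolding split[of "(_, j)"] sum.distrib by simp
  qed
  have "interlaces p n a'"
    unfolding interlaces_def
  proof (intro allI impI)
    fix r q assume r: "Suc r < n" and q: "1 \<le> q" "q \<le> p"
    have le: "(\<Sum>i=1..q. a (i, Suc r)) \<le> (\<Sum>i=1..<q. a (i, r))" by (rule interlacesD[OF inter r q])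
    \<comment> \<open>If the removed entry of column \<open>Suc r\<close> lies within the first q
      rows, that of column r lies strictly above it and both sides drop by 1. Otherwise the left
      side was 0 already.\<close>
    show "(\<Sum>i=1..q. a' (i, Suc r)) \<le> (\<Sum>i=1..<q. a' (i, r))"
    proof (cases "Suc r < h \<and> \<iota> (Suc r) \<in> {1..q}")
      case True
      then show ?thesis using le sum[of "{1..q}" "Suc r"] sum[of "{1..<q}" r] by (auto split: if_splits)
    next
      case False
      have "a (i, Suc r) = 0" if i: "i \<in> {1..q}" for i
      proof (rule ccontr)
        assume nz: "a (i, Suc r) \<noteq> 0"
        then have "Suc r \<in> C" by (auto simp: C_def)
        then have h: "Suc r < h" using C by simp
        have "\<iota> (Suc r) \<le> i" by (rule least[OF nz])
        then show False using False h \<iota>_range[OF h] i by simp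
      qed
      then have "(\<Sum>i=1..q. a (i, Suc r)) = 0" by simp
      then show ?thesis using sum[of "{1..q}" "Suc r"] by simp
    qed
  qed
  moreover have "0 < h"
  proof -
    obtain q where "a q \<noteq> 0" using nz ..
    then have "snd q \<in> C" unfolding C_def by (cases q) auto
    then show ?thesis using C by auto
  qed
  ultimately show ?thesis using that[of h \<iota> a'] split row_selection_axioms by blast
qed

lemma wt_add: "wt M pos I (\<lambda>q. a q + b q) = wt M pos I a + wt M pos I b"
  by (simp add: wt_def add_mult_distrib sum.distrib)

lemma hom_space_cong_degree:
  assumes "F \<in> hom_space p n \<rho>" "\<And>i. i \<in> {1..p} \<Longrightarrow> \<rho> i = \<rho>' i"
  shows "F \<in> hom_space p n \<rho>'"
proof -
  have "exps p n \<rho> = exps p n \<rho>'" using assms(2) by (simp add: exps_def)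
  then show ?thesis using assms(1) by (simp only: hom_space_def)
qed

text \<open>Induction on the sum of the entries, splitting off one minor each time. A base of at
  least 2 suffices, because minors only have exponents 0 and 1 and degrees on the curve add
  up.\<close>

lemma pattern_function_exists:
  assumes M: "2 \<le> M"
  shows "(\<And>q. q \<notin> grid p n \<Longrightarrow> a q = 0) \<Longrightarrow> interlaces p n a \<Longrightarrow> (\<Sum>q\<in>grid p n. a q) = N \<Longrightarrow>
    \<exists>F \<in> hom_space p n (\<lambda>i. \<Sum>j<n. a (i, j)). unip_inv n F \<and> has_weight n (\<lambda>j. \<Sum>i=1..p. a (i, j)) F \<and>
      curve_degree M n F (wt M (lexpos n) (grid p n) a)"
proof (induction N arbitrary: a rule: less_induct)
  case (less N)
  note out = less.prems(1) and inter = less.prems(2)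
  show ?case
  proof (cases "\<exists>q. a q \<noteq> 0")
    case False
    then have a0: "a q = 0" for q by blast
    have one: "1 = monf (grid p n) (\<lambda>_. 0)" by (rule ext) (simp add: monf_def)
    have "1 \<in> hom_space p n (\<lambda>i. \<Sum>j<n. a (i, j))" unfolding one by (rule monf_in_hom_space) (simp add: a0)
    moreover have "unip_inv n 1" by (simp add: unip_inv_def)
    moreover have "has_weight n (\<lambda>j. \<Sum>i=1..p. a (i, j)) 1" by (simp add: has_weight_def a0)
    moreover have "curve_degree M n 1 (wt M (lexpos n) (grid p n) a)"
      unfolding curve_degree_def wt_def by (intro exI[of _ 1]) (simp add: a0)
    ultimately show ?thesis by (intro bexI[of _ 1] conjI)
  next
    case True
    obtain h \<iota> a' where rs: "row_selection p n h \<iota>" and h: "0 < h"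
      and split: "\<And>q. a q = a' q + perm_exp h \<iota> id q" and inter': "interlaces p n a'"
      using split_first_column[OF out inter True] by blast
    interpret row_selection p n h \<iota> by (rule rs)
    have out': "a' q = 0" if "q \<notin> grid p n" for q using out[OF that] split[of q] by simp
    have idp: "id permutes {0..<h}" by (rule permutes_id)
    have "(\<iota> 0, 0) \<in> grid p n" using \<iota>_range[OF h] h hn by simp
    then have "perm_exp h \<iota> id (\<iota> 0, 0) \<le> (\<Sum>q\<in>grid p n. perm_exp h \<iota> id q)"
      by (rule member_le_sum) simp_all
    then have "0 < (\<Sum>q\<in>grid p n. perm_exp h \<iota> id q)" using perm_exp_row[OF idp h, of 0] by simp
    moreover have "(\<Sum>q\<in>grid p n. a q) = (\<Sum>q\<in>grid p n. a' q) + (\<Sum>q\<in>grid p n. perm_exp h \<iota> id q)"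
      by (simp only: split sum.distrib)
    ultimately have "(\<Sum>q\<in>grid p n. a' q) < N" using less.prems(3) by simp
    from less.IH[OF this out' inter' refl] obtain F where
      F: "F \<in> hom_space p n (\<lambda>i. \<Sum>j<n. a' (i, j))" "unip_inv n F" "has_weight n (\<lambda>j. \<Sum>i=1..p. a' (i, j)) F"
        "curve_degree M n F (wt M (lexpos n) (grid p n) a')" by blast
    have pe: "perm_exp h \<iota> id (i, j) = (if j < h \<and> i = \<iota> j then 1 else 0)" for i j by (simp add: perm_exp_def)
    have rows: "(\<Sum>j<n. perm_exp h \<iota> id (i, j)) = (if i \<in> \<iota> ` {..<h} then 1 else 0)" for i
    proof (cases "i \<in> \<iota> ` {..<h}")
      case True
      then obtain s where s: "s < h" "i = \<iota> s" by auto
      have "s < n" using s(1) hn by simp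
      then show ?thesis using True by (simp add: s(2) perm_exp_row[OF idp s(1)])
    next
      case False
      then show ?thesis by (simp add: perm_exp_other_row)
    qed
    have cols: "(\<Sum>i=1..p. perm_exp h \<iota> id (i, j)) = (if j < h then 1 else 0)" for j
    proof (cases "j < h")
      case True
      have "\<iota> j \<in> {1..p}" by (rule \<iota>_range[OF True])
      then show ?thesis unfolding pe using True by simp
    next
      case False then show ?thesis by (simp add: pe)
    qed
    have "F * minor h \<iota> \<in> hom_space p n (\<lambda>i. \<Sum>j<n. a (i, j))"
      unfolding split sum.distrib rows by (rule hom_space_times[OF F(1) minor_hom_space])
    moreover have "unip_inv n (F * minor h \<iota>)" by (rule unip_inv_times[OF F(2) minor_unip_inv])
    moreover have "has_weight n (\<lambda>j. \<Sum>i=1..p. a (i, j)) (F * minor h \<iota>)"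
      unfolding split sum.distrib cols by (rule has_weight_times[OF F(3) minor_has_weight])
    moreover have "curve_degree M n (F * minor h \<iota>) (wt M (lexpos n) (grid p n) a)"
    proof -
      have "a = (\<lambda>q. a' q + perm_exp h \<iota> id q)" by (rule ext) (rule split)
      then have "wt M (lexpos n) (grid p n) a = wt M (lexpos n) (grid p n) a' + wt M (lexpos n) (grid p n) (perm_exp h \<iota> id)"
        by (simp only: wt_add)
      then show ?thesis using curve_degree_times[OF F(4) minor_curve_degree[OF M]] by (simp only:)
    qed
    ultimately show ?thesis by (intro bexI[of _ "F * minor h \<iota>"] conjI)
  qed
qed

text \<open>On the curve the functions become univariate polynomials of pairwise different degrees;
  the largest degree with nonzero coefficient cannot cancel.\<close>

lemma curve_degree_independent:
  assumes X: "finite X" and d: "\<And>a. a \<in> X \<Longrightarrow> curve_degree M n (F a) (w a)" and inj: "inj_on w X"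
    and zero: "\<And>z. (\<Sum>a\<in>X. c a * F a z) = 0" and b: "b \<in> X"
  shows "c b = 0"
proof (rule ccontr)
  assume "c b \<noteq> 0"
  define Y where "Y = {a \<in> X. c a \<noteq> 0}"
  have Y: "finite Y" "b \<in> Y" using X b \<open>c b \<noteq> 0\<close> by (simp_all add: Y_def)
  have "\<forall>a\<in>X. \<exists>P. (\<forall>t. F a (curve M (lexpos n) t) = poly P t) \<and> P \<noteq> 0 \<and> degree P = w a"
    using d unfolding curve_degree_def by blast
  from bchoice[OF this] obtain P where
    P: "\<forall>a\<in>X. (\<forall>t. F a (curve M (lexpos n) t) = poly (P a) t) \<and> P a \<noteq> 0 \<and> degree (P a) = w a" ..
  have "Max (w ` Y) \<in> w ` Y" using Y by (intro Max_in) auto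
  then obtain m where m: "Max (w ` Y) = w m" "m \<in> Y" by (rule imageE)
  have mX: "m \<in> X" "c m \<noteq> 0" using m(2) by (simp_all add: Y_def)
  define Q where "Q = (\<Sum>a\<in>X. smult (c a) (P a))"
  have "poly Q t = 0" for t
  proof -
    have "poly Q t = (\<Sum>a\<in>X. c a * F a (curve M (lexpos n) t))"
      unfolding Q_def poly_sum poly_smult using P by (intro sum.cong) simp_all
    then show ?thesis using zero by simp
  qed
  then have "Q = 0" by (rule poly_eq_0_everywhere)
  then have "0 = coeff Q (w m)" by simp
  also have "\<dots> = (\<Sum>a\<in>X. if a = m then c m * coeff (P m) (w m) else 0)"
    unfolding Q_def coeff_sum coeff_smult
  proof (rule sum.cong[OF refl])
    fix a assume a: "a \<in> X"
    show "c a * coeff (P a) (w m) = (if a = m then c m * coeff (P m) (w m) else 0)"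
    proof (cases "a = m \<or> c a = 0")
      case False
      then have "a \<in> Y" using a by (simp add: Y_def)
      then have "w a \<le> w m" unfolding m(1)[symmetric] using Y(1) by (intro Max_ge) simp_all
      moreover have "w a \<noteq> w m" using False inj_onD[OF inj _ a mX(1)] by blast
      ultimately have "degree (P a) < w m" using P a by simp
      then show ?thesis using False by (simp add: coeff_eq_0)
    qed auto
  qed
  also have "\<dots> = c m * coeff (P m) (w m)" using X mX by simp
  also have "coeff (P m) (w m) = lead_coeff (P m)" using P mX(1) by simp
  finally have "c m * lead_coeff (P m) = 0" by (rule sym)
  then have "lead_coeff (P m) = 0" unfolding mult_eq_0_iff using mX(2) by blast
  then have "P m = 0" by (simp only: leading_coeff_0_iff)
  then show False using P mX(1) by blast
qed

theorem dim_hwv_space: "cfun.dim (hwv_space p n m w) = card (gt_patterns p n m w)"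
proof (rule antisym[OF dim_hwv_space_le])
  \<comment> \<open>The base must exceed m for the weight to separate patterns, and be at least 2
    for the minors, also when m = 0.\<close>
  define M where "M = Suc (Suc m)"
  have M2: "2 \<le> M" by (simp add: M_def)
  let ?G = "gt_patterns p n m w"
  have "\<forall>a\<in>?G. \<exists>F. F \<in> hwv_space p n m w \<and> curve_degree M n F (wt M (lexpos n) (grid p n) a)"
  proof
    fix a assume a: "a \<in> ?G"
    have ex: "a \<in> exps p n (\<lambda>_. m)" and co: "\<forall>j<n. (\<Sum>i=1..p. a (i, j)) = w j" and inter: "interlaces p n a"
      using a unfolding gt_patterns_def interlaces_def by blast+
    from pattern_function_exists[OF M2 expsD(1)[OF ex] inter refl] obtain F where
      F: "F \<in> hom_space p n (\<lambda>i. \<Sum>j<n. a (i, j))" "unip_inv n F" "has_weight n (\<lambda>j. \<Sum>i=1..p. a (i, j)) F"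
        "curve_degree M n F (wt M (lexpos n) (grid p n) a)" by blast
    have "F \<in> hom_space p n (\<lambda>_. m)" by (rule hom_space_cong_degree[OF F(1)]) (rule expsD(2)[OF ex])
    moreover have "has_weight n w F" using F(3) co by (simp add: has_weight_def)
    ultimately show "\<exists>F. F \<in> hwv_space p n m w \<and> curve_degree M n F (wt M (lexpos n) (grid p n) a)"
      using F(2,4) by (auto simp: hwv_space_def)
  qed
  from bchoice[OF this] obtain F where
    F: "\<forall>a\<in>?G. F a \<in> hwv_space p n m w \<and> curve_degree M n (F a) (wt M (lexpos n) (grid p n) a)" ..
  have injw: "inj_on (wt M (lexpos n) (grid p n)) ?G"
  proof (rule inj_onI)
    fix a b assume a: "a \<in> ?G" and b: "b \<in> ?G" and eq: "wt M (lexpos n) (grid p n) a = wt M (lexpos n) (grid p n) b"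
    have e: "a \<in> exps p n (\<lambda>_. m)" "b \<in> exps p n (\<lambda>_. m)" using a b by (simp_all add: gt_patterns_def)
    have lt: "x q < M" if x: "x \<in> exps p n (\<lambda>_. m)" and q: "q \<in> grid p n" for x q
    proof -
      obtain i j where ij: "q = (i, j)" by (cases q)
      have "i \<in> {1..p}" using q by (simp add: ij)
      then show ?thesis using expsD(3)[OF x, of i j] by (simp add: M_def ij)
    qed
    have "\<forall>q\<in>grid p n. a q = b q"
      by (rule wt_inj[OF _ inj_on_lexpos lt[OF e(1)] lt[OF e(2)] eq]) simp_all
    then show "a = b" by (rule exps_eq_on_grid[OF e])
  qed
  have "\<forall>b\<in>?G. c b = 0" if z: "\<forall>z. (\<Sum>a\<in>?G. c a * F a z) = 0" for c
  proof (rule ballI)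
    fix b assume b: "b \<in> ?G"
    show "c b = 0"
      by (rule curve_degree_independent[where F = F and M = M and n = n and c = c, OF finite_gt_patterns _ injw spec[OF z] b])
        (use F in blast)
  qed
  note indep = independent_family[OF finite_gt_patterns this]
  have injF: "inj_on F ?G" by (rule indep(1))
  have ind: "cfun.independent (F ` ?G)" by (rule indep(2))
  have "card ?G = card (F ` ?G)" by (simp only: card_image[OF injF])
  also have "\<dots> = cfun.dim (cfun.span (F ` ?G))"
    unfolding cfun.dim_span by (rule cfun.dim_eq_card_independent[OF ind, symmetric])
  also have "\<dots> \<le> cfun.dim (hwv_space p n m w)"
  proof (rule dim_mono_fin_dim[OF fin_dim_hwv_space cfun.subspace_span])
    have "F ` ?G \<subseteq> hwv_space p n m w" using F by blast
    then show "cfun.span (F ` ?G) \<subseteq> hwv_space p n m w" by (rule cfun.span_minimal[OF _ subspace_hwv_space])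
  qed
  finally show "card ?G \<le> cfun.dim (hwv_space p n m w)" .
qed

section \<open>Existence of patterns\<close>

lemma sum_between_bounds:
  fixes lo hi :: "nat \<Rightarrow> nat"
  shows "(\<And>j. j < q \<Longrightarrow> lo j \<le> hi j) \<Longrightarrow> (\<Sum>j<q. lo j) \<le> N \<Longrightarrow> N \<le> (\<Sum>j<q. hi j) \<Longrightarrow>
    \<exists>x. (\<forall>j<q. lo j \<le> x j \<and> x j \<le> hi j) \<and> (\<Sum>j<q. x j) = N"
proof (induction q arbitrary: N)
  case (Suc q)
  \<comment> \<open>The last entry is taken as large as its upper bound permits while the remaining
    entries can still meet their lower bounds.\<close>
  define y where "y = min (hi q) (N - (\<Sum>j<q. lo j))"
  have lohi: "(\<Sum>j<q. lo j) \<le> (\<Sum>j<q. hi j)" by (rule sum_mono) (simp add: Suc.prems(1))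
  have s: "(\<Sum>j<q. lo j) + lo q \<le> N" "N \<le> (\<Sum>j<q. hi j) + hi q" using Suc.prems(2,3) by simp_all
  have lq: "lo q \<le> hi q" by (rule Suc.prems(1)) simp
  have y: "lo q \<le> y" "y \<le> hi q" "y \<le> N" using s lq by (simp_all add: y_def)
  have "(\<Sum>j<q. lo j) \<le> N - y" "N - y \<le> (\<Sum>j<q. hi j)" using s lohi unfolding y_def by linarith+
  from Suc.IH[OF Suc.prems(1) this] obtain x where
    x: "\<forall>j<q. lo j \<le> x j \<and> x j \<le> hi j" "(\<Sum>j<q. x j) = N - y" by (auto simp: less_Suc_eq)
  define x' where "x' j = (if j < q then x j else y)" for j
  have "(\<Sum>j<q. x' j) = (\<Sum>j<q. x j)" by (rule sum.cong) (simp_all add: x'_def)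
  then have "(\<Sum>j<Suc q. x' j) = N" using x(2) y(3) by (simp add: x'_def)
  moreover have "\<forall>j<Suc q. lo j \<le> x' j \<and> x' j \<le> hi j" using x(1) y by (auto simp: x'_def less_Suc_eq)
  ultimately show ?case by blast
qed simp

text \<open>Row by row from the bottom, a shape \<open>\<nu>\<close> with at most \<open>q\<close> parts of average \<open>k\<close> is reduced to an
  interlacing shape with at most \<open>q - 1\<close> parts of the same average.\<close>

lemma pattern_of_shape:
  "(\<And>j. \<nu> (Suc j) \<le> \<nu> j) \<Longrightarrow> \<forall>j\<ge>q. \<nu> j = 0 \<Longrightarrow> (\<Sum>j<q. \<nu> j) = q * k \<Longrightarrow>
   \<exists>a. (\<forall>i j. \<not> (1 \<le> i \<and> i \<le> q \<and> j < q) \<longrightarrow> a (i, j) = (0 :: nat)) \<and> (\<forall>i. 1 \<le> i \<longrightarrow> i \<le> q \<longrightarrow> (\<Sum>j<q. a (i, j)) = k) \<and>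
     (\<forall>j. (\<Sum>i=1..q. a (i, j)) = \<nu> j) \<and>
     (\<forall>r t. 1 \<le> t \<longrightarrow> t \<le> q \<longrightarrow> (\<Sum>i=1..t. a (i, Suc r)) \<le> (\<Sum>i=1..<t. a (i, r)))"
proof (induction q arbitrary: \<nu>)
  case 0
  then show ?case by (intro exI[of _ "\<lambda>_. 0"]) simp
next
  case (Suc q)
  note dec = Suc.prems(1) and tot = Suc.prems(3)
  have zero: "\<nu> j = 0" if "Suc q \<le> j" for j using Suc.prems(2) that by simp
  have anti: "\<nu> j \<le> \<nu> i" if "i \<le> j" for i j using lift_Suc_antimono_le[of \<nu>, OF dec that] .
  have tot': "(\<Sum>j<q. \<nu> j) + \<nu> q = q * k + k" using tot by simp
  have tot0: "\<nu> 0 + (\<Sum>j<q. \<nu> (Suc j)) = q * k + k" using tot unfolding sum.lessThan_Suc_shift by simp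
  \<comment> \<open>The average k lies between the smallest part \<open>\<nu> q\<close> and the
    largest part \<open>\<nu> 0\<close>. Dropping the largest leaves at most \<open>q * k\<close>,
    dropping the smallest at least \<open>q * k\<close>; these are the bounds between which the
    interlacing shape is chosen.\<close>
  have "q * k + k \<le> Suc q * \<nu> 0"
  proof -
    have "(\<Sum>j<Suc q. \<nu> j) \<le> (\<Sum>j<Suc q. \<nu> 0)" by (rule sum_mono) (rule anti, simp)
    then show ?thesis using tot by simp
  qed
  then have "Suc q * k \<le> Suc q * \<nu> 0" by simp
  then have k0: "k \<le> \<nu> 0" by (simp only: Suc_mult_le_cancel1)
  have "Suc q * \<nu> q \<le> Suc q * k"
  proof -
    have "(\<Sum>j<Suc q. \<nu> q) \<le> (\<Sum>j<Suc q. \<nu> j)" by (rule sum_mono) (rule anti, simp)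
    then show ?thesis using tot by simp
  qed
  then have kq: "\<nu> q \<le> k" by (simp only: Suc_mult_le_cancel1)
  have "(\<Sum>j<q. \<nu> (Suc j)) \<le> q * k" "q * k \<le> (\<Sum>j<q. \<nu> j)" using tot' tot0 k0 kq by linarith+
  from sum_between_bounds[OF dec this] obtain x where
    x: "\<forall>j<q. \<nu> (Suc j) \<le> x j \<and> x j \<le> \<nu> j" "(\<Sum>j<q. x j) = q * k" by blast
  define \<nu>' where "\<nu>' j = (if j < q then x j else 0)" for j
  have b: "\<nu> (Suc j) \<le> \<nu>' j" "\<nu>' j \<le> \<nu> j" for j using x(1) zero[of "Suc j"] by (auto simp: \<nu>'_def)
  have sum': "(\<Sum>j<q. \<nu>' j) = q * k" using x(2) by (simp add: \<nu>'_def)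
  have dec': "\<nu>' (Suc j) \<le> \<nu>' j" for j using order_trans[OF b(2)[of "Suc j"] b(1)[of j]] .
  have zero': "\<forall>j\<ge>q. \<nu>' j = 0" by (simp add: \<nu>'_def)
  from Suc.IH[OF dec' zero' sum'] obtain a where
    a: "\<forall>i j. \<not> (1 \<le> i \<and> i \<le> q \<and> j < q) \<longrightarrow> a (i, j) = 0"
      "\<forall>i. 1 \<le> i \<longrightarrow> i \<le> q \<longrightarrow> (\<Sum>j<q. a (i, j)) = k"
      "\<forall>j. (\<Sum>i=1..q. a (i, j)) = \<nu>' j"
      "\<forall>r t. 1 \<le> t \<longrightarrow> t \<le> q \<longrightarrow> (\<Sum>i=1..t. a (i, Suc r)) \<le> (\<Sum>i=1..<t. a (i, r))"
    by (elim exE conjE)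
  \<comment> \<open>The new row is the difference of the two shapes, so the column sums grow from
    \<nu>' to \<nu>.\<close>
  define a' where "a' = (\<lambda>(i, j). if i = Suc q then \<nu> j - \<nu>' j else a (i, j))"
  have old: "(\<Sum>i\<in>A. a' (i, j)) = (\<Sum>i\<in>A. a (i, j))" if "A \<subseteq> {..q}" for A j
    by (rule sum.cong) (use that in \<open>auto simp: a'_def\<close>)
  have new: "a' (Suc q, j) = \<nu> j - \<nu>' j" for j by (simp add: a'_def)
  have cols: "(\<Sum>i=1..Suc q. a' (i, j)) = \<nu> j" for j
  proof -
    have "(\<Sum>i=1..Suc q. a' (i, j)) = (\<Sum>i=1..q. a' (i, j)) + a' (Suc q, j)" by simp
    also have "(\<Sum>i=1..q. a' (i, j)) = \<nu>' j" using old[of "{1..q}" j] a(3) by auto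
    finally show ?thesis using b(2)[of j] by (simp add: new)
  qed
  show ?case
  proof (intro exI[of _ a'] conjI allI impI)
    fix i j assume n: "\<not> (1 \<le> i \<and> i \<le> Suc q \<and> j < Suc q)"
    show "a' (i, j) = 0"
    proof (cases "i = Suc q")
      case True
      then have "Suc q \<le> j" using n by simp
      then show ?thesis using True zero by (simp add: a'_def)
    next
      case False
      then have "\<not> (1 \<le> i \<and> i \<le> q \<and> j < q)" using n False by presburger
      then show ?thesis using False a(1) by (simp add: a'_def)
    qed
  next
    fix i assume i: "1 \<le> i" "i \<le> Suc q"
    show "(\<Sum>j<Suc q. a' (i, j)) = k"
    proof (cases "i = Suc q")
      case True
      have "(\<Sum>j<Suc q. \<nu> j - \<nu>' j) + (\<Sum>j<Suc q. \<nu>' j) = (\<Sum>j<Suc q. \<nu> j)"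
        unfolding sum.distrib[symmetric] by (rule sum.cong) (simp_all add: b(2))
      moreover have "(\<Sum>j<Suc q. \<nu>' j) = q * k" using sum' zero' by simp
      ultimately show ?thesis using tot True by (simp only: new) simp
    next
      case False
      then have "i \<le> q" using i by simp
      then have "(\<Sum>j<q. a (i, j)) = k" "a (i, q) = 0" using a(1,2) i by simp_all
      then show ?thesis using False by (simp add: a'_def)
    qed
  next
    show "(\<Sum>i=1..Suc q. a' (i, j)) = \<nu> j" for j by (rule cols)
  next
    fix r t assume t: "1 \<le> t" "t \<le> Suc q"
    show "(\<Sum>i=1..t. a' (i, Suc r)) \<le> (\<Sum>i=1..<t. a' (i, r))"
    proof (cases "t = Suc q")
      case True
      have "(\<Sum>i=1..<Suc q. a' (i, r)) = (\<Sum>i=1..q. a' (i, r))" by (simp only: atLeastLessThanSuc_atLeastAtMost)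
      also have "\<dots> = \<nu>' r" using old[of "{1..q}" r] a(3) by auto
      finally show ?thesis unfolding True cols using b(1) by simp
    next
      case False
      then have tq: "t \<le> q" using t by simp
      have "(\<Sum>i=1..t. a' (i, Suc r)) = (\<Sum>i=1..t. a (i, Suc r))" "(\<Sum>i=1..<t. a' (i, r)) = (\<Sum>i=1..<t. a (i, r))"
        by (rule old, use tq in auto)+
      then show ?thesis using a(4) t(1) tq by simp
    qed
  qed
qed

lemma part_antimono: "partition_of m la \<Longrightarrow> part la (Suc j) \<le> part la j"
  unfolding partition_of_def part_def sorted_wrt_iff_nth_less by auto

lemma sum_part: "partition_of m la \<Longrightarrow> length la \<le> n \<Longrightarrow> (\<Sum>j<n. part la j) = m"
proof -
  assume la: "partition_of m la" "length la \<le> n"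
  have "(\<Sum>j<n. part la j) = (\<Sum>j<length la. part la j)"
    by (rule sum.mono_neutral_right) (use la(2) in \<open>auto simp: part_def\<close>)
  also have "\<dots> = (\<Sum>j<length la. la ! j)" by (rule sum.cong) (simp_all add: part_def)
  also have "\<dots> = m" using la(1) by (simp add: partition_of_def sum_list_sum_nth atLeast0LessThan)
  finally show ?thesis .
qed

text \<open>The bound on the number of parts makes \<lambda> a shape for p rows of average k; the
  columns from p to n - 1 are empty.\<close>

lemma gt_patterns_nonempty:
  assumes la: "partition_of (p * k) la" "length la \<le> p" and pn: "p \<le> n"
  shows "\<exists>a. a \<in> gt_patterns p n k (part la)"
proof -
  have "\<forall>j\<ge>p. part la j = 0" using la(2) by (simp add: part_def)
  from pattern_of_shape[of "part la" p k, OF part_antimono[OF la(1)] this sum_part[OF la]] obtain a where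
    a: "\<forall>i j. \<not> (1 \<le> i \<and> i \<le> p \<and> j < p) \<longrightarrow> a (i, j) = (0 :: nat)"
      "\<forall>i. 1 \<le> i \<longrightarrow> i \<le> p \<longrightarrow> (\<Sum>j<p. a (i, j)) = k" "\<forall>j. (\<Sum>i=1..p. a (i, j)) = part la j"
      "\<forall>r t. 1 \<le> t \<longrightarrow> t \<le> p \<longrightarrow> (\<Sum>i=1..t. a (i, Suc r)) \<le> (\<Sum>i=1..<t. a (i, r))"
    by (elim exE conjE)
  have "(\<Sum>j<n. a (i, j)) = k" if i: "i \<in> {1..p}" for i
  proof -
    have "(\<Sum>j<n. a (i, j)) = (\<Sum>j<p. a (i, j))"
      by (rule sum.mono_neutral_right) (use pn a(1) in auto)
    then show ?thesis using a(2) i by simp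
  qed
  moreover have "a q = 0" if "q \<notin> grid p n" for q
    using that a(1) pn by (cases q) auto
  ultimately have "a \<in> gt_patterns p n k (part la)" using a(3,4) unfolding gt_patterns_def exps_def by simp
  then show ?thesis by (intro exI[of _ a])
qed

section \<open>Growth of the number of patterns\<close>

definition gt_rows_cols :: "nat \<Rightarrow> nat \<Rightarrow> nat + nat \<Rightarrow> (nat \<times> nat \<Rightarrow> int) \<Rightarrow> int" where
  "gt_rows_cols p n c x = (case c of Inl i \<Rightarrow> \<Sum>j<n. x (i, j) | Inr j \<Rightarrow> \<Sum>i=1..p. x (i, j))"

definition gt_inequality :: "(nat \<times> nat) + (nat \<times> nat) \<Rightarrow> (nat \<times> nat \<Rightarrow> int) \<Rightarrow> int" where
  "gt_inequality c x =
     (case c of Inl q \<Rightarrow> x q | Inr (r, q) \<Rightarrow> (\<Sum>i=1..<q. x (i, r)) - (\<Sum>i=1..q. x (i, Suc r)))"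

text \<open>Nonnegativity and interlacing are inequalities without constant term, and row and column
  sums are equations whose right hand sides are proportional to d. So the patterns are the lattice
  points of a dilated polytope.\<close>

lemma gt_ratio_tendsto_1:
  assumes la: "partition_of (p * k) la" "length la \<le> p" and pn: "p \<le> n"
  defines "H \<equiv> \<lambda>d. card (gt_patterns p n (d * k) (\<lambda>j. d * part la j))"
  shows "(\<lambda>d. real (H (d + D)) / real (H d)) \<longlonglongrightarrow> 1" and "0 < H d"
proof -
  define J where "J = Inl ` grid p n \<union> Inr ` {(r, q). Suc r < n \<and> 1 \<le> q \<and> q \<le> p}"
  define K where "K = Inl ` {1..p} \<union> Inr ` {..<n}"
  define c where "c x = (case x of Inl _ \<Rightarrow> int k | Inr j \<Rightarrow> int (part la j))" for x :: "nat + nat"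
  have "{(r, q). Suc r < n \<and> 1 \<le> q \<and> q \<le> p} \<subseteq> {..<n} \<times> {..p}" by auto
  then have "finite {(r, q). Suc r < n \<and> 1 \<le> q \<and> q \<le> p}" by (rule finite_subset) simp
  then have finJ: "finite J" by (simp add: J_def)
  interpret L: dilated_lattice_points "grid p n" J gt_inequality K "gt_rows_cols p n" c
  proof
    fix x y :: "nat \<times> nat \<Rightarrow> int"
    show "gt_inequality j (\<lambda>b. x b + y b) = gt_inequality j x + gt_inequality j y" for j
      by (cases j) (simp_all add: gt_inequality_def sum.distrib case_prod_unfold)
    show "gt_rows_cols p n j (\<lambda>b. x b + y b) = gt_rows_cols p n j x + gt_rows_cols p n j y" for j
      by (cases j) (simp_all add: gt_rows_cols_def sum.distrib)
  qed (simp_all add: finJ)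
  define emb where "emb a = (\<lambda>q. int (a q))" for a :: "nat \<times> nat \<Rightarrow> nat"
  have G: "L.G d = emb ` gt_patterns p n (d * k) (\<lambda>j. d * part la j)" for d
  proof (rule Set.set_eqI)
    fix x
    have ine: "(\<forall>j\<in>J. 0 \<le> gt_inequality j x) \<longleftrightarrow> (\<forall>q\<in>grid p n. 0 \<le> x q) \<and>
        (\<forall>r q. Suc r < n \<longrightarrow> 1 \<le> q \<longrightarrow> q \<le> p \<longrightarrow> (\<Sum>i=1..q. x (i, Suc r)) \<le> (\<Sum>i=1..<q. x (i, r)))"
      unfolding J_def ball_Un ball_simps(9) by (auto simp: gt_inequality_def)
    have equ: "(\<forall>j\<in>K. gt_rows_cols p n j x = int d * c j) \<longleftrightarrow>
        (\<forall>i\<in>{1..p}. (\<Sum>j<n. x (i, j)) = int (d * k)) \<and> (\<forall>j<n. (\<Sum>i=1..p. x (i, j)) = int (d * part la j))"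
      unfolding K_def ball_Un ball_simps(9) by (auto simp: gt_rows_cols_def c_def)
    show "x \<in> L.G d \<longleftrightarrow> x \<in> emb ` gt_patterns p n (d * k) (\<lambda>j. d * part la j)"
    proof
      assume "x \<in> L.G d"
      then have c: "(\<forall>b. b \<notin> grid p n \<longrightarrow> x b = 0) \<and> ((\<forall>q\<in>grid p n. 0 \<le> x q) \<and>
        (\<forall>r q. Suc r < n \<longrightarrow> 1 \<le> q \<longrightarrow> q \<le> p \<longrightarrow> (\<Sum>i=1..q. x (i, Suc r)) \<le> (\<Sum>i=1..<q. x (i, r)))) \<and>
        (\<forall>i\<in>{1..p}. (\<Sum>j<n. x (i, j)) = int (d * k)) \<and> (\<forall>j<n. (\<Sum>i=1..p. x (i, j)) = int (d * part la j))"
        unfolding L.G_def mem_Collect_eq ine equ .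
      note x = conjunct1[OF c] conjunct1[OF conjunct1[OF conjunct2[OF c]]] conjunct2[OF conjunct1[OF conjunct2[OF c]]]
        conjunct1[OF conjunct2[OF conjunct2[OF c]]] conjunct2[OF conjunct2[OF conjunct2[OF c]]]
      define a where "a q = nat (x q)" for q
      have ax: "x q = int (a q)" for q
      proof (cases "q \<in> grid p n")
        case True
        have "0 \<le> x q" by (rule bspec[OF x(2) True])
        then show ?thesis by (simp add: a_def)
      next
        case False
        have "x q = 0" by (rule mp[OF spec[OF x(1)] False])
        then show ?thesis by (simp add: a_def)
      qed
      have "a \<in> gt_patterns p n (d * k) (\<lambda>j. d * part la j)"
        unfolding gt_patterns_def exps_def mem_Collect_eq
      proof (intro conjI allI impI ballI)
        show "a q = 0" if "q \<notin> grid p n" for q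
        proof -
          have "x q = 0" by (rule mp[OF spec[OF x(1)] that])
          then show ?thesis by (simp add: a_def)
        qed
        show "(\<Sum>j<n. a (i, j)) = d * k" if "i \<in> {1..p}" for i
          using bspec[OF x(4) that] unfolding ax of_nat_sum[symmetric] of_nat_eq_iff .
        show "(\<Sum>i=1..p. a (i, j)) = d * part la j" if "j < n" for j
          using mp[OF spec[OF x(5)] that] unfolding ax of_nat_sum[symmetric] of_nat_eq_iff .
        show "(\<Sum>i=1..q. a (i, Suc r)) \<le> (\<Sum>i=1..<q. a (i, r))" if "Suc r < n" "1 \<le> q" "q \<le> p" for r q
        proof -
          have "(\<Sum>i=1..q. x (i, Suc r)) \<le> (\<Sum>i=1..<q. x (i, r))" using x(3) that by blast
          then show ?thesis unfolding ax of_nat_sum[symmetric] of_nat_le_iff .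
        qed
      qed
      moreover have "x = emb a" by (rule ext) (simp add: emb_def ax)
      ultimately show "x \<in> emb ` gt_patterns p n (d * k) (\<lambda>j. d * part la j)" by (rule_tac image_eqI)
    next
      assume "x \<in> emb ` gt_patterns p n (d * k) (\<lambda>j. d * part la j)"
      then obtain a where xa: "x = emb a" and a: "a \<in> gt_patterns p n (d * k) (\<lambda>j. d * part la j)" by (rule imageE)
      note g = a[unfolded gt_patterns_def mem_Collect_eq]
      note e = conjunct1[OF g] and co = conjunct1[OF conjunct2[OF g]] and il = conjunct2[OF conjunct2[OF g]]
      show "x \<in> L.G d"
        unfolding L.G_def mem_Collect_eq ine equ
      proof (intro conjI allI impI ballI)
        show "x b = 0" if "b \<notin> grid p n" for b using expsD(1)[OF e that] by (simp add: xa emb_def)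
        show "0 \<le> x q" for q by (simp add: xa emb_def)
        show "(\<Sum>j<n. x (i, j)) = int (d * k)" if "i \<in> {1..p}" for i
          unfolding xa emb_def of_nat_sum[symmetric] of_nat_eq_iff by (rule expsD(2)[OF e that])
        show "(\<Sum>i=1..p. x (i, j)) = int (d * part la j)" if "j < n" for j
          unfolding xa emb_def of_nat_sum[symmetric] of_nat_eq_iff by (rule mp[OF spec[OF co] that])
        show "(\<Sum>i=1..q. x (i, Suc r)) \<le> (\<Sum>i=1..<q. x (i, r))" if "Suc r < n" "1 \<le> q" "q \<le> p" for r q
          unfolding xa emb_def of_nat_sum[symmetric] of_nat_le_iff using il that by blast
      qed
    qed
  qed
  have inj: "inj emb" by (rule injI) (simp add: emb_def fun_eq_iff)
  have HG: "card (L.G d) = H d" for d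
    unfolding G H_def by (rule card_image[OF inj_on_subset[OF inj subset_UNIV]])
  obtain g where g: "g \<in> gt_patterns p n k (part la)" using gt_patterns_nonempty[OF la pn] ..
  interpret L1: dilated_lattice_points_nonempty "grid p n" J gt_inequality K "gt_rows_cols p n" c "emb g"
  proof
    show "finite (L.G d)" for d unfolding G by (intro finite_imageI finite_gt_patterns)
    show "emb g \<in> L.G 1" unfolding G using g by simp
  qed
  show "(\<lambda>d. real (H (d + D)) / real (H d)) \<longlonglongrightarrow> 1" using L1.ratio_tendsto_1[of D] unfolding HG .
  show "0 < H d" using L1.h_pos[of d] unfolding HG .
qed

section \<open>Characters of graded domains\<close>

lemma sum_powers_root_of_unity:
  fixes y :: complex
  assumes "y ^ M = 1" "y \<noteq> 1"
  shows "(\<Sum>j<M. y ^ j) = 0"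
  using geometric_sum[OF assms(2), of M] assms by simp

text \<open>The orthogonality relation that makes the eigenspace projections below add up to the
  identity.\<close>

lemma sum_roots_of_unity_power:
  assumes M: "0 < M" and j: "j < M"
  shows "(\<Sum>z | z ^ M = (1 :: complex). inverse z ^ j) = (if j = 0 then of_nat M else 0)"
proof -
  define f where "f r = cis (2 * pi * real r / real M)" for r
  have bij: "bij_betw f {..<M} {z. z ^ M = 1}"
    unfolding f_def using bij_betw_roots_unity[OF M] by (simp only: lessThan_def mult.assoc times_divide_eq_right)
  define y where "y = f 1"
  have fr: "f r = y ^ r" for r
    unfolding y_def f_def DeMoivre by (rule arg_cong[of _ _ cis]) simp
  have f0: "f 0 = 1" by (simp add: f_def)
  have root: "f r ^ M = 1" if "r < M" for r using bij_betw_apply[OF bij, of r] that by simp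
  have "(\<Sum>z | z ^ M = 1. inverse z ^ j) = (\<Sum>r<M. inverse (f r) ^ j)"
    by (rule sum.reindex_bij_betw[OF bij, symmetric])
  also have "\<dots> = (\<Sum>r<M. inverse (f j) ^ r)"
  proof (rule sum.cong[OF refl])
    fix r
    have "(y ^ r) ^ j = (y ^ j) ^ r" by (simp only: power_mult[symmetric] mult.commute)
    then show "inverse (f r) ^ j = inverse (f j) ^ r" unfolding fr power_inverse by (rule arg_cong)
  qed
  also have "\<dots> = (if j = 0 then of_nat M else 0)"
  proof (cases "j = 0")
    case True
    then show ?thesis by (simp add: f0)
  next
    case False
    have "f j \<noteq> f 0"
    proof
      assume "f j = f 0"
      then have "j = 0" using bij_betw_imp_inj_on[OF bij] j M by (auto dest: inj_onD)
      then show False using False by simp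
    qed
    then have "inverse (f j) \<noteq> 1" unfolding f0 by simp
    moreover have "inverse (f j) ^ M = 1" using root[OF j] by (simp add: power_inverse)
    ultimately show ?thesis using False sum_powers_root_of_unity by simp
  qed
  finally show ?thesis .
qed

section \<open>Eigenspaces of an operator of finite order\<close>

locale finite_order_operator =
  fixes L :: "('x \<Rightarrow> complex) \<Rightarrow> 'x \<Rightarrow> complex" and M :: nat
  assumes lin: "clinear L" and M: "0 < M" and order: "\<And>F. (L ^^ M) F = F"
begin

definition eigenspace :: "('x \<Rightarrow> complex) set \<Rightarrow> complex \<Rightarrow> ('x \<Rightarrow> complex) set" where
  "eigenspace W z = {F \<in> W. L F = cscale z F}"

abbreviation Z :: "complex set" where "Z \<equiv> {z. z ^ M = 1}"

lemma finite_Z: "finite Z"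
  using finite_roots_unity[of M] M by simp

lemma Z_nonzero: "z \<in> Z \<Longrightarrow> z \<noteq> 0"
  using M by (auto simp: power_0_left)

lemma subspace_eigenspace:
  assumes "cfun.subspace W" shows "cfun.subspace (eigenspace W z)"
proof (rule cfun.subspaceI)
  show "0 \<in> eigenspace W z" using cfun.subspace_0[OF assms] cpair.linear_0[OF lin] by (simp add: eigenspace_def)
next
  fix x y assume "x \<in> eigenspace W z" "y \<in> eigenspace W z"
  then show "x + y \<in> eigenspace W z"
    using cfun.subspace_add[OF assms, of x y] by (simp add: eigenspace_def cpair.linear_add[OF lin] cfun.scale_right_distrib)
next
  fix c x assume "x \<in> eigenspace W z"
  then show "cscale c x \<in> eigenspace W z"
    using cfun.subspace_scale[OF assms, of x c] by (simp add: eigenspace_def cpair.linear_scale[OF lin] mult.commute)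
qed

text \<open>The discrete Fourier projection onto the eigenspace of z, for z with
  \<open>z ^ M = 1\<close>.\<close>

definition proj :: "complex \<Rightarrow> ('x \<Rightarrow> complex) \<Rightarrow> 'x \<Rightarrow> complex" where
  "proj z F = cscale (1 / of_nat M) (\<Sum>j<M. cscale (inverse z ^ j) ((L ^^ j) F))"

lemma lin_pow: "clinear (L ^^ j)"
proof (induction j)
  case 0 then show ?case by (auto intro: clinearI)
next
  case (Suc j)
  have "clinear (\<lambda>x. L ((L ^^ j) x))"
    by (rule clinearI) (simp_all only: cpair.linear_add[OF Suc] cpair.linear_scale[OF Suc] cpair.linear_add[OF lin] cpair.linear_scale[OF lin])
  then show ?case by (simp add: comp_def)
qed

lemma pow_in: "L ` W \<subseteq> W \<Longrightarrow> F \<in> W \<Longrightarrow> (L ^^ j) F \<in> W"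
  by (induction j) auto

lemma proj_eigenvector:
  assumes z: "z \<in> Z" shows "L (proj z F) = cscale z (proj z F)"
proof -
  define T where "T j = cscale (inverse z ^ j) ((L ^^ j) F)" for j
  have z0: "z \<noteq> 0" by (rule Z_nonzero[OF z])
  have LT: "L (T j) = cscale z (T (Suc j))" for j
    using z0 by (simp add: T_def cpair.linear_scale[OF lin])
  have "T M = T 0" using z order by (simp add: T_def power_inverse)
  have "(\<Sum>j<M. T (Suc j)) = (\<Sum>j<M. T j)"
  proof -
    have "T 0 + (\<Sum>j<M. T (Suc j)) = (\<Sum>j<M. T j) + T M"
      using sum.lessThan_Suc_shift[of T M] sum.lessThan_Suc[of T M] by simp
    then show ?thesis using \<open>T M = T 0\<close> by simp
  qed
  then have "L (\<Sum>j<M. T j) = cscale z (\<Sum>j<M. T j)"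
    by (simp only: cpair.linear_sum[OF lin] LT cfun.scale_sum_right[symmetric])
  then show ?thesis unfolding proj_def T_def[symmetric] by (simp add: cpair.linear_scale[OF lin] mult.commute)
qed

lemma sum_proj: "(\<Sum>z\<in>Z. proj z F) = F"
proof -
  have "(\<Sum>z\<in>Z. proj z F) = cscale (1 / of_nat M) (\<Sum>j<M. cscale (\<Sum>z\<in>Z. inverse z ^ j) ((L ^^ j) F))"
    unfolding proj_def cfun.scale_sum_right[symmetric] cfun.scale_sum_left by (subst sum.swap) (rule refl)
  also have "(\<Sum>j<M. cscale (\<Sum>z\<in>Z. inverse z ^ j) ((L ^^ j) F)) = (\<Sum>j<M. if j = 0 then cscale (of_nat M) F else 0)"
    by (rule sum.cong) (simp_all add: sum_roots_of_unity_power[OF M])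
  also have "\<dots> = cscale (of_nat M) F" using M by simp
  finally show ?thesis using M by simp
qed

lemma proj_of_eigenvector:
  assumes F: "L F = cscale y F" and y: "y \<in> Z" and z: "z \<in> Z"
  shows "proj z F = (if y = z then F else 0)"
proof -
  have "(L ^^ j) F = cscale (y ^ j) F" for j
    by (induction j) (simp_all add: cpair.linear_scale[OF lin] F mult.commute)
  then have "proj z F = cscale (1 / of_nat M * (\<Sum>j<M. (inverse z * y) ^ j)) F"
    by (simp add: proj_def cfun.scale_sum_left[symmetric] power_mult_distrib)
  moreover have "(\<Sum>j<M. (inverse z * y) ^ j) = (if y = z then of_nat M else 0)"
  proof (cases "y = z")
    case True
    then show ?thesis using Z_nonzero[OF z] by simp
  next
    case False
    then have "inverse z * y \<noteq> 1" using Z_nonzero[OF z] by (simp add: field_simps)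
    moreover have "(inverse z * y) ^ M = 1" using y z by (simp add: power_mult_distrib power_inverse)
    ultimately show ?thesis using False sum_powers_root_of_unity by simp
  qed
  ultimately show ?thesis using M by simp
qed

lemma proj_in_eigenspace:
  assumes W: "cfun.subspace W" "L ` W \<subseteq> W" and F: "F \<in> W" and z: "z \<in> Z"
  shows "proj z F \<in> eigenspace W z"
proof -
  have "proj z F \<in> W"
    unfolding proj_def by (intro cfun.subspace_scale[OF W(1)] cfun.subspace_sum[OF W(1)] pow_in[OF W(2) F])
  then show ?thesis using proj_eigenvector[OF z] by (simp add: eigenspace_def)
qed

lemma eigenspace_direct_sum:
  assumes W: "cfun.subspace W" "L ` W \<subseteq> W"
  shows "direct_sum Z (eigenspace W) W"
  unfolding direct_sum_def
proof (intro conjI ballI allI impI)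
  show "finite Z" by (rule finite_Z)
  show "cfun.subspace W" by (rule W(1))
  show "cfun.subspace (eigenspace W z)" for z by (rule subspace_eigenspace[OF W(1)])
  show "eigenspace W z \<subseteq> W" for z by (auto simp: eigenspace_def)
  show "\<exists>x. (\<forall>z\<in>Z. x z \<in> eigenspace W z) \<and> F = (\<Sum>z\<in>Z. x z)" if "F \<in> W" for F
    by (rule exI[of _ "\<lambda>z. proj z F"]) (intro conjI ballI proj_in_eigenspace[OF W that] sum_proj[symmetric])
next
  fix x z assume x: "(\<forall>y\<in>Z. x y \<in> eigenspace W y) \<and> (\<Sum>y\<in>Z. x y) = 0" and z: "z \<in> Z"
  have lp: "clinear (proj z)"
  proof (rule clinearI)
    fix F G c
    show "proj z (F + G) = proj z F + proj z G"
      by (simp only: proj_def cpair.linear_add[OF lin_pow] cfun.scale_right_distrib sum.distrib)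
    show "proj z (cscale c F) = cscale c (proj z F)"
      unfolding proj_def cpair.linear_scale[OF lin_pow] cfun.scale_sum_right cfun.scale_scale
      by (simp only: mult.commute mult.left_commute)
  qed
  have "0 = proj z (\<Sum>y\<in>Z. x y)" using x cpair.linear_0[OF lp] by simp
  also have "\<dots> = (\<Sum>y\<in>Z. if y = z then x z else 0)"
    unfolding cpair.linear_sum[OF lp]
  proof (rule sum.cong[OF refl])
    fix y assume y: "y \<in> Z"
    have "x y \<in> eigenspace W y" using x y by blast
    then have "L (x y) = cscale y (x y)" by (simp add: eigenspace_def)
    from proj_of_eigenvector[OF this y z] show "proj z (x y) = (if y = z then x z else 0)" by simp
  qed
  also have "\<dots> = x z" using z finite_Z by simp
  finally show "x z = 0" by simp
qed

lemma fin_dim_eigenspace: "fin_dim W \<Longrightarrow> fin_dim (eigenspace W z)"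
  by (rule fin_dim_subset) (auto simp: eigenspace_def fin_dim_def intro: subspace_eigenspace[unfolded eigenspace_def])

lemma trace_eigenspaces:
  assumes W: "fin_dim W" "L ` W \<subseteq> W"
  shows "trace_on W L = (\<Sum>z\<in>Z. z * of_nat (cfun.dim (eigenspace W z)))"
    and "cfun.dim W = (\<Sum>z\<in>Z. cfun.dim (eigenspace W z))"
proof -
  have sub: "cfun.subspace W" using W(1) by (simp add: fin_dim_def)
  note ds = eigenspace_direct_sum[OF sub W(2)]
  show "cfun.dim W = (\<Sum>z\<in>Z. cfun.dim (eigenspace W z))" by (rule dim_direct_sum[OF ds W(1)])
  have "trace_on W L = (\<Sum>z\<in>Z. trace_on (eigenspace W z) L)"
  proof (rule trace_on_direct_sum[OF ds W(1) lin])
    show "L ` eigenspace W z \<subseteq> eigenspace W z" for z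
    proof (rule image_subsetI)
      fix F assume F: "F \<in> eigenspace W z"
      then have "L F \<in> eigenspace W z"
        using cfun.subspace_scale[OF subspace_eigenspace[OF sub] F, of z] by (simp add: eigenspace_def)
      then show "L F \<in> eigenspace W z" .
    qed
  qed
  also have "\<dots> = (\<Sum>z\<in>Z. z * of_nat (cfun.dim (eigenspace W z)))"
    by (intro sum.cong refl trace_on_scalar fin_dim_eigenspace W(1) lin) (simp add: eigenspace_def)
  finally show "trace_on W L = (\<Sum>z\<in>Z. z * of_nat (cfun.dim (eigenspace W z)))" .
qed

text \<open>If all eigenvectors belonged to one eigenvalue y, all projections but the one to y would
  vanish and L would be multiplication by y.\<close>

lemma two_eigenvalues:
  assumes W: "cfun.subspace W" "L ` W \<subseteq> W" and ns: "\<And>c. c \<noteq> 0 \<Longrightarrow> \<exists>F\<in>W. L F \<noteq> cscale c F"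
  obtains y z F G where "y \<in> Z" "z \<in> Z" "y \<noteq> z" "F \<in> eigenspace W y" "G \<in> eigenspace W z" "F \<noteq> 0" "G \<noteq> 0"
proof -
  have ex: "\<exists>z\<in>Z. z \<noteq> y \<and> (\<exists>G\<in>eigenspace W z. G \<noteq> 0)" if y0: "y \<noteq> 0" for y
  proof (rule ccontr)
    assume n: "\<not> ?thesis"
    obtain F where F: "F \<in> W" "L F \<noteq> cscale y F" using ns[OF y0] by blast
    have p0: "proj z F = 0" if "z \<in> Z" "z \<noteq> y" for z
      using n that proj_in_eigenspace[OF W F(1) that(1)] by blast
    show False
    proof (cases "y \<in> Z")
      case True
      have "F = (\<Sum>z\<in>Z. proj z F)" by (rule sum_proj[symmetric])
      also have "\<dots> = (\<Sum>z\<in>Z. if z = y then proj y F else 0)" by (rule sum.cong) (auto simp: p0)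
      also have "\<dots> = proj y F" using True finite_Z by simp
      finally have "F = proj y F" .
      then show False using F(2) proj_eigenvector[OF True, of F] by simp
    next
      case False
      then have "z \<noteq> y" if "z \<in> Z" for z using that by blast
      then have "(\<Sum>z\<in>Z. proj z F) = 0" by (intro sum.neutral ballI p0) simp_all
      then have "F = 0" by (simp only: sum_proj)
      then show False using F(2) cpair.linear_0[OF lin] by simp
    qed
  qed
  \<comment> \<open>Here 2 is just some nonzero number; it produces a first eigenvalue, and the same
    statement applied to that eigenvalue produces a different one.\<close>
  obtain y F where y: "y \<in> Z" "F \<in> eigenspace W y" "F \<noteq> 0" using ex[of 2] by auto
  obtain z G where z: "z \<in> Z" "z \<noteq> y" "G \<in> eigenspace W z" "G \<noteq> 0" using ex[OF Z_nonzero[OF y(1)]] by blast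
  show ?thesis by (rule that[OF y(1) z(1) z(2)[symmetric] y(2) z(3) y(3) z(4)])
qed

end

text \<open>Multiplication by a product of eigenvectors of eigenvalue \<open>w\<close> embeds the eigenspace of \<open>z\<close>
  into the one of \<open>w * z\<close>. If both \<open>w = 1\<close> and some \<open>w \<noteq> 1\<close> occur in degree D, the traces in
  degrees d and d + D differ, relative to both embeddings, by at most the growth of the dimension.\<close>

locale graded_domain = finite_order_operator L M
  for L :: "('x \<Rightarrow> complex) \<Rightarrow> 'x \<Rightarrow> complex" and M +
  fixes W :: "nat \<Rightarrow> ('x \<Rightarrow> complex) set"
  assumes fd: "\<And>d. fin_dim (W d)" and inv: "\<And>d. L ` W d \<subseteq> W d"
    and mult: "\<And>d d' F G. F \<in> W d \<Longrightarrow> G \<in> W d' \<Longrightarrow> F * G \<in> W (d + d')"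
    and domain: "\<And>d d' F G. F \<in> W d \<Longrightarrow> G \<in> W d' \<Longrightarrow> F * G = 0 \<Longrightarrow> F = 0 \<or> G = 0"
    and one: "1 \<in> W 0"
    and L_mult: "\<And>F G. L (F * G) = L F * L G" and L_one: "L 1 = 1"
    and growth: "\<And>D. (\<lambda>d. real (cfun.dim (W (d + D))) / real (cfun.dim (W d))) \<longlonglongrightarrow> 1"
    and pos: "\<And>d. 0 < cfun.dim (W d)"
begin

lemma sub: "cfun.subspace (W d)" using fd by (simp add: fin_dim_def)

lemma eigenspace_times:
  assumes "F \<in> eigenspace (W d) y" "G \<in> eigenspace (W d') z"
  shows "F * G \<in> eigenspace (W (d + d')) (y * z)"
proof -
  have "cscale y F * cscale z G = cscale (y * z) (F * G)" by (rule ext) (simp add: cscale_apply)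
  then show ?thesis using assms mult[of F d G d'] by (simp add: eigenspace_def L_mult)
qed

lemma eigenspace_power:
  assumes F: "F \<in> eigenspace (W d) y" "F \<noteq> 0"
  shows "F ^ j \<in> eigenspace (W (j * d)) (y ^ j) \<and> F ^ j \<noteq> 0"
proof (induction j)
  case 0
  have "(1 :: 'x \<Rightarrow> complex) \<noteq> 0" by (simp add: fun_eq_iff)
  moreover have "1 \<in> eigenspace (W 0) 1" using one L_one unfolding eigenspace_def by (simp only: mem_Collect_eq cfun.scale_one simp_thms)
  ultimately show ?case unfolding power_0 mult_0 by (rule conjI[rotated])
next
  case (Suc j)
  have "F * F ^ j \<in> eigenspace (W (d + j * d)) (y * y ^ j)" using F(1) Suc by (intro eigenspace_times) simp_all
  moreover have "F * F ^ j \<noteq> 0"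
    using domain[of F d "F ^ j" "j * d"] F Suc by (auto simp: eigenspace_def)
  ultimately show ?case unfolding power_Suc mult_Suc by (rule conjI)
qed

lemma dim_eigenspace_mono:
  assumes u: "u \<in> eigenspace (W D) w" "u \<noteq> 0"
  shows "cfun.dim (eigenspace (W d) z) \<le> cfun.dim (eigenspace (W (d + D)) (w * z))"
proof (rule dim_le_of_inj[where f = "\<lambda>F. u * F"])
  show "clinear (\<lambda>F. u * F)"
    by (rule clinearI) (rule distrib_left, rule ext, simp add: cscale_apply)
  show "(\<lambda>F. u * F) ` eigenspace (W d) z \<subseteq> eigenspace (W (d + D)) (w * z)"
    using eigenspace_times[OF u(1), of _ d z] by (auto simp: add.commute)
  fix F assume "F \<in> eigenspace (W d) z" "u * F = 0"
  then show "F = 0" using domain[of u D F d] u by (auto simp: eigenspace_def)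
qed (intro fin_dim_eigenspace fd)+

text \<open>Eigenvalues have modulus 1 and multiplicities do not decrease when z is replaced by
  \<open>w * z\<close>. The norm is therefore at most the sum of the increments of the
  multiplicities, which is the increment of the dimension.\<close>

lemma trace_difference:
  assumes u: "u \<in> eigenspace (W D) w" "u \<noteq> 0" and w: "w \<in> Z"
  shows "norm (trace_on (W (d + D)) L - w * trace_on (W d) L) \<le> real (cfun.dim (W (d + D))) - real (cfun.dim (W d))"
proof -
  have w0: "w \<noteq> 0" by (rule Z_nonzero[OF w])
  have bij: "bij_betw (\<lambda>z. w * z) Z Z"
  proof (rule bij_betw_byWitness[where f' = "\<lambda>z. inverse w * z"])
    show "(\<lambda>z. w * z) ` Z \<subseteq> Z" "(\<lambda>z. inverse w * z) ` Z \<subseteq> Z"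
      using w by (auto simp: power_mult_distrib power_inverse)
  qed (use w0 in auto)
  define e where "e d z = cfun.dim (eigenspace (W d) z)" for d z
  have le: "e d z \<le> e (d + D) (w * z)" for z unfolding e_def by (rule dim_eigenspace_mono[OF u])
  have "trace_on (W (d + D)) L = (\<Sum>z\<in>Z. w * z * of_nat (e (d + D) (w * z)))"
    unfolding trace_eigenspaces(1)[OF fd inv] e_def
    by (rule sum.reindex_bij_betw[OF bij, symmetric])
  moreover have "w * trace_on (W d) L = (\<Sum>z\<in>Z. w * z * of_nat (e d z))"
    unfolding trace_eigenspaces(1)[OF fd inv] e_def by (simp only: sum_distrib_left mult.assoc)
  ultimately have "trace_on (W (d + D)) L - w * trace_on (W d) L = (\<Sum>z\<in>Z. w * z * (of_nat (e (d + D) (w * z)) - of_nat (e d z)))"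
    by (simp only: sum_subtractf[symmetric] right_diff_distrib)
  also have "norm \<dots> \<le> (\<Sum>z\<in>Z. real (e (d + D) (w * z)) - real (e d z))"
  proof (rule sum_norm_le)
    fix z assume z: "z \<in> Z"
    have unit: "norm y = 1" if "y \<in> Z" for y
    proof -
      have "norm y ^ M = 1" using that by (simp add: norm_power[symmetric])
      then have "norm y ^ M = 1 ^ M" by simp
      then show ?thesis by (rule power_eq_imp_eq_base) (simp_all add: M)
    qed
    have "norm (of_nat (e (d + D) (w * z)) - of_nat (e d z) :: complex) = real (e (d + D) (w * z)) - real (e d z)"
      using le[of z] by (simp add: of_nat_diff[symmetric] del: of_nat_diff)
    then show "norm (w * z * (of_nat (e (d + D) (w * z)) - of_nat (e d z))) \<le> real (e (d + D) (w * z)) - real (e d z)"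
      by (simp add: norm_mult unit[OF w] unit[OF z])
  qed
  also have "\<dots> = (\<Sum>z\<in>Z. real (e (d + D) z)) - (\<Sum>z\<in>Z. real (e d z))"
    unfolding sum_subtractf by (simp only: sum.reindex_bij_betw[OF bij, of "\<lambda>z. real (e (d + D) z)"])
  also have "\<dots> = real (cfun.dim (W (d + D))) - real (cfun.dim (W d))"
    unfolding trace_eigenspaces(2)[OF fd inv] e_def by (simp only: of_nat_sum)
  finally show ?thesis .
qed

theorem trace_ratio_tendsto_0:
  assumes ns: "\<And>c. c \<noteq> 0 \<Longrightarrow> \<exists>F\<in>W d0. L F \<noteq> cscale c F"
  shows "(\<lambda>d. trace_on (W d) L / of_nat (cfun.dim (W d))) \<longlonglongrightarrow> 0"
proof -
  obtain y z F G where *: "y \<in> Z" "z \<in> Z" "y \<noteq> z" "F \<in> eigenspace (W d0) y" "G \<in> eigenspace (W d0) z" "F \<noteq> 0" "G \<noteq> 0"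
    by (rule two_eigenvalues[OF sub inv ns])
  note yz = *(1-3) and F = *(4,6) and G = *(5,7)
  \<comment> \<open>In this degree both \<open>G ^ M\<close>, with eigenvalue
    \<open>z ^ M = 1\<close>, and \<open>F * G ^ (M - 1)\<close>, with eigenvalue y/z \<noteq> 1,
    are available as multipliers.\<close>
  define D where "D = M * d0"
  define w where "w = y * z ^ (M - 1)"
  have u1: "G ^ M \<in> eigenspace (W D) 1 \<and> G ^ M \<noteq> 0" using eigenspace_power[OF G, of M] yz(2) by (simp add: D_def)
  have g: "G ^ (M - 1) \<in> eigenspace (W ((M - 1) * d0)) (z ^ (M - 1)) \<and> G ^ (M - 1) \<noteq> 0" by (rule eigenspace_power[OF G])
  have D': "d0 + (M - 1) * d0 = D" unfolding D_def using M by (cases M) simp_all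
  have u2: "F * G ^ (M - 1) \<in> eigenspace (W D) w"
    using eigenspace_times[OF F(1) conjunct1[OF g]] unfolding D' w_def .
  have u2': "F * G ^ (M - 1) \<noteq> 0" using domain[of F d0 "G ^ (M - 1)" "(M - 1) * d0"] F g by (auto simp: eigenspace_def)
  have zM: "z * z ^ (M - 1) = 1" using yz(2) M by (cases M) simp_all
  have w: "w \<in> Z"
  proof -
    have "(z ^ (M - 1)) ^ M = (z ^ M) ^ (M - 1)" by (simp only: power_mult[symmetric] mult.commute)
    then show ?thesis using yz by (simp add: w_def power_mult_distrib)
  qed
  have "w \<noteq> 1"
  proof
    assume w1: "w = 1"
    have "z * w = y * (z * z ^ (M - 1))" unfolding w_def by (rule mult.left_commute)
    then have "z = y" unfolding zM w1 by (simp only: mult_1_right)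
    then show False using yz(3) by simp
  qed
  define h where "h d = real (cfun.dim (W d))" for d
  have hp: "0 < h d" for d using pos by (simp add: h_def)
  define \<tau> where "\<tau> d = trace_on (W d) L" for d
  have bound: "norm (w - 1) * norm (\<tau> d) \<le> 2 * (h (d + D) - h d)" for d
  proof -
    have s1: "norm (\<tau> (d + D) - 1 * \<tau> d) \<le> h (d + D) - h d"
      unfolding \<tau>_def h_def using u1 by (intro trace_difference[of "G ^ M"]) simp_all
    have s2: "norm (\<tau> (d + D) - w * \<tau> d) \<le> h (d + D) - h d"
      unfolding \<tau>_def h_def by (rule trace_difference[OF u2 u2' w])
    \<comment> \<open>Subtracting the two estimates eliminates the trace in degree
      \<open>d + D\<close>.\<close>
    have "(w - 1) * \<tau> d = (\<tau> (d + D) - 1 * \<tau> d) - (\<tau> (d + D) - w * \<tau> d)" by (simp add: algebra_simps)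
    then have "norm (w - 1) * norm (\<tau> d) \<le> norm (\<tau> (d + D) - 1 * \<tau> d) + norm (\<tau> (d + D) - w * \<tau> d)"
      unfolding norm_mult[symmetric] by (simp only: norm_triangle_ineq4)
    also have "\<dots> \<le> (h (d + D) - h d) + (h (d + D) - h d)" by (rule add_mono[OF s1 s2])
    also have "\<dots> = 2 * (h (d + D) - h d)" by simp
    finally show ?thesis .
  qed
  have nw: "0 < norm (w - 1)" using \<open>w \<noteq> 1\<close> by simp
  have "(\<lambda>d. 2 / norm (w - 1) * (h (d + D) / h d - 1)) \<longlonglongrightarrow> 2 / norm (w - 1) * (1 - 1)"
    unfolding h_def by (intro tendsto_intros growth)
  then have lim: "(\<lambda>d. 2 / norm (w - 1) * (h (d + D) / h d - 1)) \<longlonglongrightarrow> 0" by simp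
  have "norm (\<tau> d / of_nat (cfun.dim (W d))) \<le> 2 / norm (w - 1) * (h (d + D) / h d - 1)" for d
  proof -
    have "norm (\<tau> d) \<le> 2 / norm (w - 1) * (h (d + D) - h d)" using bound[of d] nw by (simp add: field_simps)
    then have "norm (\<tau> d) / h d \<le> 2 / norm (w - 1) * (h (d + D) - h d) / h d"
      by (rule divide_right_mono) (use hp[of d] in simp)
    also have "\<dots> = 2 / norm (w - 1) * (h (d + D) / h d - 1)" using hp[of d] by (simp add: field_simps)
    finally show ?thesis by (simp add: norm_divide h_def)
  qed
  then have "(\<lambda>d. norm (\<tau> d / of_nat (cfun.dim (W d)))) \<longlonglongrightarrow> 0"
    by (intro tendsto_sandwich[OF _ _ tendsto_const lim] always_eventually allI) simp_all
  then show ?thesis unfolding \<tau>_def by (rule tendsto_norm_zero_cancel)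
qed

end

section \<open>Tensor powers of symmetric powers as polynomials in matrix entries\<close>

text \<open>The matrix of values of the p functionals on the basis. Using \<open>vec_fun\<close>
  makes a row vanish for a map that is not linear, in accordance with the realization of symmetric
  powers.\<close>

definition mat_of :: "(complex \<Rightarrow> 'v::ab_group_add \<Rightarrow> 'v) \<Rightarrow> (nat \<Rightarrow> 'v) \<Rightarrow> (nat \<Rightarrow> 'v \<Rightarrow> complex) \<Rightarrow> nat \<times> nat \<Rightarrow> complex" where
  "mat_of scale e \<phi> = (\<lambda>(i, j). vec_fun scale (e j) (\<phi> i))"

definition pullback :: "(complex \<Rightarrow> 'v::ab_group_add \<Rightarrow> 'v) \<Rightarrow> (nat \<Rightarrow> 'v)
    \<Rightarrow> ((nat \<times> nat \<Rightarrow> complex) \<Rightarrow> complex) \<Rightarrow> (nat \<Rightarrow> 'v \<Rightarrow> complex) \<Rightarrow> complex" where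
  "pullback scale e f = (\<lambda>\<phi>. f (mat_of scale e \<phi>))"

lemma clinear_pullback: "clinear (pullback scale e)"
  by (rule clinearI) (rule ext, simp add: pullback_def cscale_apply)+

lemma pullback_times: "pullback scale e (f * g) = pullback scale e f * pullback scale e g"
  by (rule ext) (simp add: pullback_def)

lemma prod_fun_apply: "(\<Prod>i\<in>I. F i) x = (\<Prod>i\<in>I. F i x :: complex)"
  by (induction I rule: infinite_finite_induct) simp_all

lemma subspace_hom_space: "cfun.subspace (hom_space p n \<rho>)"
  unfolding hom_space_def by (rule cfun.subspace_span)

lemma subspace_pullback_hom: "cfun.subspace (pullback scale e ` hom_space p n \<rho>)"
  by (rule cpair.linear_subspace_image[OF clinear_pullback subspace_hom_space])

lemma pullback_hom_times:
  assumes "F \<in> pullback scale e ` hom_space p n \<rho>" "G \<in> pullback scale e ` hom_space p n \<rho>'"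
  shows "F * G \<in> pullback scale e ` hom_space p n (\<lambda>i. \<rho> i + \<rho>' i)"
proof -
  obtain f where f: "F = pullback scale e f" "f \<in> hom_space p n \<rho>" using assms(1) by (rule imageE)
  obtain g where g: "G = pullback scale e g" "g \<in> hom_space p n \<rho>'" using assms(2) by (rule imageE)
  show ?thesis unfolding f(1) g(1) pullback_times[symmetric]
    by (rule imageI) (rule hom_space_times[OF f(2) g(2)])
qed

lemma pullback_hom_one: "(\<lambda>_. 1) \<in> pullback scale e ` hom_space p n (\<lambda>_. 0)"
proof (rule image_eqI)
  show "(\<lambda>_. 1) = pullback scale e (monf (grid p n) (\<lambda>_. 0))" by (rule ext) (simp add: pullback_def monf_def)
  show "monf (grid p n) (\<lambda>_. 0) \<in> hom_space p n (\<lambda>_. 0)" by (rule monf_in_hom_space) simp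
qed

context flagged_space
begin

abbreviation pb where "pb \<equiv> pullback scale e"

lemma vec_fun_coord: "vec_fun scale v \<phi> = (\<Sum>j<n. coord j v * vec_fun scale (e j) \<phi>)"
proof (cases "\<phi> \<in> dual_space scale")
  case True
  then have l: "Vector_Spaces.linear scale (*) \<phi>" by (simp add: dual_space_def)
  have "\<phi> v = \<phi> (\<Sum>j<n. scale (coord j v) (e j))" using coord_expand[of v] by simp
  also have "\<dots> = (\<Sum>j<n. coord j v * \<phi> (e j))" by (simp add: vf.linear_sum[OF l] vf.linear_scale[OF l])
  finally show ?thesis using True by (simp add: vec_fun_def)
next
  case False
  then show ?thesis by (simp add: vec_fun_def)
qed

lemma vec_fun_row:
  assumes i: "i \<in> {1..p}"
  shows "(\<lambda>\<phi>. vec_fun scale v (\<phi> i)) \<in> pb ` hom_space p n (\<lambda>i'. if i' = i then 1 else 0)"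
proof (rule image_eqI)
  let ?\<delta> = "\<lambda>j q. if q = (i, j) then 1 else (0 :: nat)"
  have m: "monf (grid p n) (?\<delta> j) z = z (i, j)" if j: "j < n" for j and z :: "nat \<times> nat \<Rightarrow> complex"
  proof -
    have "monf (grid p n) (?\<delta> j) z = (\<Prod>q\<in>grid p n. if q = (i, j) then z (i, j) else 1)"
      unfolding monf_def by (rule prod.cong) simp_all
    also have "\<dots> = (if (i, j) \<in> grid p n then z (i, j) else 1)" by (rule prod.delta) simp
    finally show ?thesis using i j by simp
  qed
  let ?f = "\<Sum>j<n. cscale (coord j v) (monf (grid p n) (?\<delta> j))"
  show "(\<lambda>\<phi>. vec_fun scale v (\<phi> i)) = pb ?f"
  proof (rule ext)
    fix \<phi>
    have "pb ?f \<phi> = (\<Sum>j<n. coord j v * mat_of scale e \<phi> (i, j))"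
      unfolding pullback_def sum_fun_apply cscale_apply by (rule sum.cong) (simp_all only: m lessThan_iff)
    then show "vec_fun scale v (\<phi> i) = pb ?f \<phi>" unfolding vec_fun_coord[of v] by (simp add: mat_of_def)
  qed
  show "?f \<in> hom_space p n (\<lambda>i'. if i' = i then 1 else 0)"
    by (intro cfun.subspace_sum[OF subspace_hom_space] cfun.subspace_scale[OF subspace_hom_space] monf_in_hom_space) auto
qed

lemma sym_power_row:
  assumes i: "i \<in> {1..p}" and x: "x \<in> sym_power scale m"
  shows "(\<lambda>\<phi>. x (\<phi> i)) \<in> pb ` hom_space p n (\<lambda>i'. if i' = i then m else 0)"
proof -
  define S where "S = {x. (\<lambda>\<phi> :: nat \<Rightarrow> 'v \<Rightarrow> complex. x (\<phi> i)) \<in> pb ` hom_space p n (\<lambda>i'. if i' = i then m else 0)}"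
  have "cfun.subspace S"
  proof (rule cfun.subspaceI)
    note s = subspace_pullback_hom[of scale e p n "\<lambda>i'. if i' = i then m else 0"]
    show "0 \<in> S" using cfun.subspace_0[OF s] by (simp add: S_def zero_fun_def)
    show "x + y \<in> S" if "x \<in> S" "y \<in> S" for x y
      using cfun.subspace_add[OF s, of "\<lambda>\<phi>. x (\<phi> i)" "\<lambda>\<phi>. y (\<phi> i)"] that by (simp add: S_def plus_fun_def)
    show "cscale c x \<in> S" if "x \<in> S" for c x
      using cfun.subspace_scale[OF s, of "\<lambda>\<phi>. x (\<phi> i)" c] that by (simp add: S_def cscale_def)
  qed
  moreover have "{\<Prod>j<m. vec_fun scale (v j) | v. True} \<subseteq> S"
  proof
    fix x assume "x \<in> {\<Prod>j<m. vec_fun scale (v j) | v. True}"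
    then obtain v where x: "x = (\<Prod>j<m. vec_fun scale (v j))" by blast
    have "(\<lambda>\<phi>. (\<Prod>j<m'. vec_fun scale (v j) (\<phi> i))) \<in> pb ` hom_space p n (\<lambda>i'. if i' = i then m' else 0)" for m'
    proof (induction m')
      case 0
      show ?case using pullback_hom_one[of scale e p n] by simp
    next
      case (Suc m')
      have "(\<lambda>i'. (if i' = i then m' else 0) + (if i' = i then 1 else 0)) = (\<lambda>i'. if i' = i then Suc m' else 0)" by auto
      with pullback_hom_times[OF Suc.IH vec_fun_row[OF i, of "v m'"]] show ?case
        by (simp add: times_fun_def)
    qed
    from this[of m] show "x \<in> S" unfolding S_def x mem_Collect_eq
      by (simp only: prod_fun_apply)
  qed
  ultimately have "sym_power scale m \<subseteq> S" unfolding sym_power_def by (intro cfun.span_minimal)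
  then show ?thesis using x unfolding S_def by blast
qed

text \<open>Generators of a symmetric power are products of a prescribed number of vectors, so the
  powers are unrolled into one long product.\<close>

lemma monomial_in_sym_power: "(\<Prod>j<n'. vec_fun scale (e j) ^ b j) \<in> sym_power scale (\<Sum>j<n'. b j)"
proof -
  have app: "\<exists>v. (\<Prod>j<m. vec_fun scale (u j)) * vec_fun scale w ^ c = (\<Prod>j<m + c. vec_fun scale (v j))" for m u w c
  proof (induction c)
    case 0
    show ?case by (rule exI[of _ u]) simp
  next
    case (Suc c)
    then obtain v where v: "(\<Prod>j<m. vec_fun scale (u j)) * vec_fun scale w ^ c = (\<Prod>j<m + c. vec_fun scale (v j))" ..
    define v' where "v' j = (if j < m + c then v j else w)" for j
    have "(\<Prod>j<m + c. vec_fun scale (v' j)) = (\<Prod>j<m + c. vec_fun scale (v j))"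
      by (rule prod.cong) (simp_all add: v'_def)
    then have "(\<Prod>j<m + Suc c. vec_fun scale (v' j)) = (\<Prod>j<m + c. vec_fun scale (v j)) * vec_fun scale w"
      unfolding add_Suc_right prod.lessThan_Suc by (simp add: v'_def)
    also have "\<dots> = (\<Prod>j<m. vec_fun scale (u j)) * vec_fun scale w ^ Suc c"
      unfolding v[symmetric] power_Suc by (simp only: mult.assoc mult.commute[of "vec_fun scale w"])
    finally show ?case by (intro exI[of _ v']) (rule sym)
  qed
  have "\<exists>v. (\<Prod>j<n'. vec_fun scale (e j) ^ b j) = (\<Prod>l<(\<Sum>j<n'. b j). vec_fun scale (v l))"
  proof (induction n')
    case 0
    show ?case by simp
  next
    case (Suc n')
    then obtain u where u: "(\<Prod>j<n'. vec_fun scale (e j) ^ b j) = (\<Prod>l<(\<Sum>j<n'. b j). vec_fun scale (u l))" ..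
    show ?case unfolding prod.lessThan_Suc sum.lessThan_Suc u by (rule app)
  qed
  then obtain v where v: "(\<Prod>j<n'. vec_fun scale (e j) ^ b j) = (\<Prod>l<(\<Sum>j<n'. b j). vec_fun scale (v l))" ..
  show ?thesis unfolding v sym_power_def by (rule cfun.span_base) blast
qed

text \<open>One inclusion multiplies the factors of a tensor row by row, each being homogeneous in
  its own row. For the other, a monomial is the tensor product of the monomials in its rows.\<close>

theorem A_space_eq: "A_space scale p k d = pb ` hom_space p n (\<lambda>_. d * k)"
proof
  define m where "m = d * k"
  show "A_space scale p k d \<subseteq> pb ` hom_space p n (\<lambda>_. d * k)"
    unfolding A_space_def tensor_power_def m_def[symmetric]
  proof (rule cfun.span_minimal[OF _ subspace_pullback_hom], rule subsetI)
    fix F assume "F \<in> {tensor p x | x. \<forall>i\<in>{1..p}. x i \<in> sym_power scale m}"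
    then obtain x where F: "F = tensor p x" and x: "\<forall>i\<in>{1..p}. x i \<in> sym_power scale m" by blast
    have "(\<lambda>\<phi>. \<Prod>i\<in>A. x i (\<phi> i)) \<in> pb ` hom_space p n (\<lambda>i. if i \<in> A then m else 0)" if "finite A" "A \<subseteq> {1..p}" for A
      using that
    proof (induction A)
      case empty
      show ?case using pullback_hom_one[of scale e p n] by simp
    next
      case (insert i A)
      have i: "i \<in> {1..p}" and A: "A \<subseteq> {1..p}" using insert.prems by simp_all
      have "(\<lambda>i'. (if i' = i then m else 0) + (if i' \<in> A then m else 0)) = (\<lambda>i'. if i' \<in> insert i A then m else 0)"
        using insert.hyps(2) by auto
      moreover have "(\<lambda>\<phi>. x i (\<phi> i)) * (\<lambda>\<phi>. \<Prod>i\<in>A. x i (\<phi> i)) = (\<lambda>\<phi>. \<Prod>i\<in>insert i A. x i (\<phi> i))"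
        using insert.hyps by (simp add: times_fun_def)
      ultimately show ?case
        using pullback_hom_times[OF sym_power_row[OF i bspec[OF x i]] insert.IH[OF A]] by (simp only:)
    qed
    from this[of "{1..p}"] have "F \<in> pb ` hom_space p n (\<lambda>i. if i \<in> {1..p} then m else 0)"
      unfolding F tensor_def by simp
    moreover have "hom_space p n (\<lambda>i. if i \<in> {1..p} then m else 0) \<subseteq> hom_space p n (\<lambda>_. m)"
      by (rule subsetI) (rule hom_space_cong_degree, assumption, simp)
    ultimately show "F \<in> pb ` hom_space p n (\<lambda>_. m)" by blast
  qed
  show "pb ` hom_space p n (\<lambda>_. d * k) \<subseteq> A_space scale p k d"
    unfolding hom_space_def cpair.linear_span_image[OF clinear_pullback, symmetric] m_def[symmetric]
  proof (rule cfun.span_minimal)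
    show "cfun.subspace (A_space scale p k d)" unfolding A_space_def tensor_power_def by (rule cfun.subspace_span)
    show "pb ` monf (grid p n) ` exps p n (\<lambda>_. m) \<subseteq> A_space scale p k d"
      unfolding image_image
    proof (rule image_subsetI)
      fix a assume a: "a \<in> exps p n (\<lambda>_. m)"
      define x where "x i = (\<Prod>j<n. vec_fun scale (e j) ^ a (i, j))" for i
      have "x i \<in> sym_power scale m" if "i \<in> {1..p}" for i
        using monomial_in_sym_power[where b = "\<lambda>j. a (i, j)" and n' = n] expsD(2)[OF a that] by (simp only: x_def)
      moreover have "pb (monf (grid p n) a) = tensor p x"
      proof (rule ext)
        fix \<phi>
        have g: "(\<Prod>q\<in>grid p n. f q) = (\<Prod>i=1..p. \<Prod>j<n. f (i, j))" for f :: "nat \<times> nat \<Rightarrow> complex"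
          by (simp add: prod.cartesian_product')
        have pw: "(vec_fun scale v ^ c) \<psi> = vec_fun scale v \<psi> ^ c" for v c \<psi> by (induction c) simp_all
        show "pb (monf (grid p n) a) \<phi> = tensor p x \<phi>"
          by (simp add: pullback_def monf_def g tensor_def x_def prod_fun_apply pw mat_of_def del: One_nat_def)
      qed
      ultimately show "pb (monf (grid p n) a) \<in> A_space scale p k d"
        unfolding A_space_def tensor_power_def m_def by (intro cfun.span_base CollectI exI[of _ x]) simp
    qed
  qed
qed

text \<open>Every matrix arises from functionals, so a polynomial in matrix entries is determined by
  its pullback.\<close>

lemma mat_of_surj: "\<exists>\<phi>. \<forall>i j. j < n \<longrightarrow> mat_of scale e \<phi> (i, j) = z (i, j)"
proof -
  define \<phi> where "\<phi> i = (\<lambda>v. \<Sum>j<n. coord j v * z (i, j))" for i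
  have lin: "\<phi> i \<in> dual_space scale" for i
    unfolding dual_space_def mem_Collect_eq Vector_Spaces.linear_iff
  proof (intro conjI allI vector_space_axioms cc.vector_space_axioms)
    show "\<phi> i (x + y) = \<phi> i x + \<phi> i y" for x y
      unfolding \<phi>_def coord_simps(1) by (simp only: distrib_right sum.distrib)
    show "\<phi> i (scale c x) = c * \<phi> i x" for c x
      unfolding \<phi>_def coord_simps(2) by (simp only: sum_distrib_left mult.assoc)
  qed
  have "mat_of scale e \<phi> (i, j) = z (i, j)" if j: "j < n" for i j
  proof -
    have "mat_of scale e \<phi> (i, j) = (\<Sum>l<n. coord l (e j) * z (i, l))"
      using lin[of i] by (simp add: mat_of_def vec_fun_def) (simp add: \<phi>_def)
    also have "\<dots> = (\<Sum>l<n. if l = j then z (i, j) else 0)"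
      by (rule sum.cong) (auto simp: coord_basis j)
    finally show ?thesis using j by simp
  qed
  then show ?thesis by (intro exI[of _ \<phi>]) simp
qed

lemma pullback_eqD:
  assumes "F \<in> hom_space p n \<rho>" "G \<in> hom_space p n \<rho>'" "pb F = pb G"
  shows "F = G"
proof (rule ext)
  fix z
  obtain \<phi> where \<phi>: "\<forall>i j. j < n \<longrightarrow> mat_of scale e \<phi> (i, j) = z (i, j)" using mat_of_surj[of z] ..
  have q: "mat_of scale e \<phi> q = z q" if "q \<in> grid p n" for q using that \<phi> by (cases q) simp
  have "F (mat_of scale e \<phi>) = F z" by (rule hom_space_cong[OF assms(1)]) (rule q)
  moreover have "G (mat_of scale e \<phi>) = G z" by (rule hom_space_cong[OF assms(2)]) (rule q)
  moreover have "pb F \<phi> = pb G \<phi>" by (rule fun_cong[OF assms(3)])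
  ultimately show "F z = G z" unfolding pullback_def by simp
qed

text \<open>Composing functionals with g multiplies their matrix on the right by the matrix of g in
  the basis.\<close>

lemma gl_act_pullback:
  assumes g: "g \<in> carrier (GL scale)"
  shows "gl_act g (pb F) = pb (\<lambda>z. F (rmul n z (\<lambda>l j. coord l (g (e j)))))"
proof (rule ext)
  fix \<phi> :: "nat \<Rightarrow> 'v \<Rightarrow> complex"
  have "vec_fun scale (e j) (\<phi> i \<circ> g) = (\<Sum>l<n. mat_of scale e \<phi> (i, l) * coord l (g (e j)))" for i j
  proof -
    have "vec_fun scale (e j) (\<phi> i \<circ> g) = gl_act_sym g (vec_fun scale (e j)) (\<phi> i)" by (simp add: gl_act_sym_def)
    also have "\<dots> = vec_fun scale (g (e j)) (\<phi> i)" unfolding gl_act_sym_vec_fun[OF g] ..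
    finally show ?thesis unfolding vec_fun_coord[of "g (e j)"] by (simp add: mat_of_def mult.commute)
  qed
  then show "gl_act g (pb F) \<phi> = pb (\<lambda>z. F (rmul n z (\<lambda>l j. coord l (g (e j))))) \<phi>"
    by (simp add: gl_act_def pullback_def mat_of_def rmul_def)
qed

lemma gl_act_fixed_iff:
  assumes g: "g \<in> carrier (GL scale)" and F: "F \<in> hom_space p n \<rho>"
  shows "gl_act g (pb F) = pb F \<longleftrightarrow> (\<forall>z. F (rmul n z (\<lambda>l j. coord l (g (e j)))) = F z)"
proof
  assume eq: "gl_act g (pb F) = pb F"
  show "\<forall>z. F (rmul n z (\<lambda>l j. coord l (g (e j)))) = F z"
  proof
    fix z
    obtain \<phi> where \<phi>: "\<forall>i j. j < n \<longrightarrow> mat_of scale e \<phi> (i, j) = z (i, j)" using mat_of_surj[of z] ..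
    have q: "mat_of scale e \<phi> q = z q" if "q \<in> grid p n" for q using that \<phi> by (cases q) simp
    have r: "rmul n (mat_of scale e \<phi>) u = rmul n z u" for u
      unfolding rmul_def by (intro ext) (simp add: \<phi>)
    have c: "F (mat_of scale e \<phi>) = F z" by (rule hom_space_cong[OF F]) (rule q)
    have "pb (\<lambda>z. F (rmul n z (\<lambda>l j. coord l (g (e j))))) \<phi> = pb F \<phi>"
      using eq unfolding gl_act_pullback[OF g] by (rule fun_cong)
    then show "F (rmul n z (\<lambda>l j. coord l (g (e j)))) = F z" unfolding pullback_def r c .
  qed
next
  assume "\<forall>z. F (rmul n z (\<lambda>l j. coord l (g (e j)))) = F z"
  then show "gl_act g (pb F) = pb F" unfolding gl_act_pullback[OF g] by (intro ext) (simp add: pullback_def)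
qed

lemma rmul_cong:
  assumes F: "F \<in> hom_space p n \<rho>" and u: "\<And>l j. l < n \<Longrightarrow> j < n \<Longrightarrow> u l j = u' l j"
  shows "F (rmul n z u) = F (rmul n z u')"
proof (rule hom_space_cong[OF F])
  fix q assume "q \<in> grid p n"
  then show "rmul n z u q = rmul n z u' q" using u by (cases q) (simp add: rmul_def)
qed

definition matrix_map :: "(nat \<Rightarrow> nat \<Rightarrow> complex) \<Rightarrow> 'v \<Rightarrow> 'v" where
  "matrix_map u v = (\<Sum>j<n. scale (coord j v) (\<Sum>l<n. scale (u l j) (e l)))"

lemma coord_sum: "coord l (\<Sum>j<m. scale (x j) (f j)) = (\<Sum>j<m. x j * coord l (f j))"
  by (simp add: vf.linear_sum[OF linear_coord] vf.linear_scale[OF linear_coord])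

lemma coord_matrix_map: "l < n \<Longrightarrow> coord l (matrix_map u v) = (\<Sum>j<n. u l j * coord j v)"
proof -
  assume l: "l < n"
  have "coord l (\<Sum>l<n. scale (u l j) (e l)) = u l j" for j
  proof -
    have "coord l (\<Sum>l<n. scale (u l j) (e l)) = (\<Sum>l'<n. if l' = l then u l j else 0)"
      unfolding coord_sum by (rule sum.cong) (simp_all add: coord_basis l)
    then show ?thesis using l by simp
  qed
  then show ?thesis unfolding matrix_map_def coord_sum by (simp add: mult.commute)
qed

lemma coord_matrix_map_basis: "l < n \<Longrightarrow> j < n \<Longrightarrow> coord l (matrix_map u (e j)) = u l j"
proof -
  assume l: "l < n" and j: "j < n"
  have "(\<Sum>j'<n. u l j' * coord j' (e j)) = (\<Sum>j'<n. if j' = j then u l j else 0)"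
    by (rule sum.cong) (auto simp: coord_basis j)
  then show ?thesis using j unfolding coord_matrix_map[OF l] by simp
qed

lemma matrix_map_GL:
  assumes up: "\<And>l j. l < n \<Longrightarrow> j < l \<Longrightarrow> u l j = 0" and d: "\<And>j. j < n \<Longrightarrow> u j j \<noteq> 0"
  shows "matrix_map u \<in> carrier (GL scale)"
proof -
  have lin: "Vector_Spaces.linear scale scale (matrix_map u)"
    unfolding matrix_map_def Vector_Spaces.linear_iff
    by (intro conjI allI vector_space_axioms)
      (simp_all add: coord_simps scale_left_distrib distrib_right sum.distrib scale_sum_right)
  have "triangular (matrix_map u)" unfolding triangular_def using lin up by (auto simp: coord_matrix_map_basis)
  then have "bij (matrix_map u)" by (rule triangular_bij) (simp add: coord_matrix_map_basis d)
  then show ?thesis using lin by (simp add: GL_def)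
qed

lemma matrix_map_lower_by_1:
  assumes u: "unitri n u"
  shows "matrix_map u \<in> lower_by 1"
proof -
  have uv: "u j j = 1" "l < n \<Longrightarrow> j < l \<Longrightarrow> u l j = 0" if "j < n" for l j
    using u that by (auto simp: unitri_def)
  have up: "u l j = 0" if "l < n" "j < l" for l j using uv(2)[of j l] that by simp
  have "matrix_map u v - v \<in> flag (i - 1)" if v: "v \<in> flag i" for i v
    unfolding flag_def mem_Collect_eq
  proof (intro allI impI)
    fix l assume l: "l < n" "i - 1 \<le> l"
    have "(\<Sum>j<n. u l j * coord j v) = (\<Sum>j<n. if j = l then coord l v else 0)"
    proof (rule sum.cong[OF refl])
      fix j assume j: "j \<in> {..<n}"
      show "u l j * coord j v = (if j = l then coord l v else 0)"
      proof (cases j l rule: linorder_cases)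
        case less then show ?thesis using up[OF l(1) less] by simp
      next
        case equal then show ?thesis using uv(1)[OF l(1)] by simp
      next
        case greater
        then have "coord j v = 0" using v l j by (simp add: flag_def)
        then show ?thesis using greater by simp
      qed
    qed
    then show "coord l (matrix_map u v - v) = 0" using l(1) by (simp add: coord_simps coord_matrix_map)
  qed
  moreover have "matrix_map u \<in> carrier (GL scale)" by (rule matrix_map_GL) (simp_all add: up uv(1))
  ultimately show ?thesis by (simp add: lower_by_def)
qed

lemma unitri_lower_by_1:
  assumes g: "g \<in> lower_by 1"
  shows "unitri n (\<lambda>l j. coord l (g (e j)))"
  unfolding unitri_def
proof (intro allI impI conjI)
  fix l j assume l: "l < n" and j: "j < n"
  have "g (e j) - e j \<in> flag (Suc j - 1)" by (rule lower_byD(2)[OF g]) (rule basis_in_flag, simp_all add: j)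
  then have f: "coord l (g (e j) - e j) = 0" if "j \<le> l" using that l by (simp add: flag_def)
  show "coord l (g (e j)) = 1" if "l = j" using f that l by (simp add: coord_simps coord_basis)
  show "coord l (g (e j)) = 0" if "j < l" using f that l j by (simp add: coord_simps coord_basis)
qed

lemma rmul_diagonal: 
  assumes "q \<in> grid p n" 
  shows "rmul n z (\<lambda>l j. if l = j then s j else 0) q = col_scale s z q"
proof -
  obtain i j where q: "q = (i, j)" "j < n" using assms by (cases q) simp
  have "(\<Sum>l<n. z (i, l) * (if l = j then s j else 0)) = (\<Sum>l<n. if l = j then z (i, j) * s j else 0)"
    by (rule sum.cong) simp_all
  then show ?thesis using q(2) by (simp add: q(1) rmul_def col_scale_def)
qed

text \<open>Testing on \<open>s\<^sub>i = 2\<^bsup>\<lambda>\<^sub>j\<^esup>\<close> and \<open>s\<^sub>j = 2\<^bsup>-\<lambda>\<^sub>i\<^esup>\<close> shows that the column sums are proportional to \<open>\<lambda>\<close>.\<close>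

lemma weight_from_kernel:
  assumes F: "F = (\<Sum>a\<in>exps p n (\<lambda>_. d * k). cscale (c a) (monf (grid p n) a))"
    and ker: "\<forall>s. (\<forall>j<n. s j \<noteq> 0) \<longrightarrow> (\<Prod>j<n. s j ^ wl j) = 1 \<longrightarrow> (\<forall>z. F (col_scale s z) = F z)"
    and tot: "(\<Sum>j<n. wl j) = p * k" and pos: "0 < p * k"
    and a: "a \<in> exps p n (\<lambda>_. d * k)" "c a \<noteq> 0" and j: "j < n"
  shows "(\<Sum>i=1..p. a (i, j)) = d * wl j"
proof -
  define w where "w j = (\<Sum>i=1..p. a (i, j))" for j
  have eq: "wl i * w j = wl j * w i" if i: "i < n" "i \<noteq> j" for i
  proof -
    define s where "s l = (if l = j then 2 ^ wl i else if l = i then inverse (2 ^ wl j) else 1 :: complex)" for l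
    have ps: "(\<Prod>l<n. s l ^ f l) = 2 ^ (wl i * f j) * inverse (2 ^ (wl j * f i))" for f :: "nat \<Rightarrow> nat"
    proof -
      have "(\<Prod>l<n. s l ^ f l) = (\<Prod>l\<in>{i, j}. s l ^ f l)"
        by (rule prod.mono_neutral_right) (use i j in \<open>auto simp: s_def\<close>)
      also have "\<dots> = s i ^ f i * s j ^ f j" using i by simp
      finally have e: "(\<Prod>l<n. s l ^ f l) = s i ^ f i * s j ^ f j" .
      have si: "s i = inverse (2 ^ wl j)" and sj: "s j = 2 ^ wl i" using i by (simp_all add: s_def)
      show ?thesis unfolding e si sj power_mult power_inverse by (rule mult.commute)
    qed
    have s0: "\<forall>l<n. s l \<noteq> 0" by (simp add: s_def)
    have s1: "(\<Prod>l<n. s l ^ wl l) = 1" unfolding ps by (simp add: mult.commute)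
    define dd where "dd a = c a * ((\<Prod>l<n. s l ^ (\<Sum>i=1..p. a (i, l))) - 1)" for a
    have "(\<Sum>a\<in>exps p n (\<lambda>_. d * k). dd a * monf (grid p n) a z) = 0" for z
    proof -
      have "F (col_scale s z) = F z" by (rule spec[OF mp[OF mp[OF spec[OF ker] s0] s1]])
      then have "(\<Sum>a\<in>exps p n (\<lambda>_. d * k). c a * ((\<Prod>l<n. s l ^ (\<Sum>i=1..p. a (i, l))) * monf (grid p n) a z)) -
          (\<Sum>a\<in>exps p n (\<lambda>_. d * k). c a * monf (grid p n) a z) = 0"
        unfolding F sum_fun_apply cscale_apply monf_col_scale by simp
      moreover have "(\<Sum>a\<in>exps p n (\<lambda>_. d * k). dd a * monf (grid p n) a z) = (\<Sum>a\<in>exps p n (\<lambda>_. d * k).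
          c a * ((\<Prod>l<n. s l ^ (\<Sum>i=1..p. a (i, l))) * monf (grid p n) a z) - c a * monf (grid p n) a z)"
        unfolding dd_def by (rule sum.cong[OF refl]) (simp only: left_diff_distrib right_diff_distrib mult_ac mult_1_right mult_1_left)
      ultimately show ?thesis by (simp only: sum_subtractf)
    qed
    then have "dd a = 0" using a(1) by (rule monf_exps_zero)
    then have "(\<Prod>l<n. s l ^ w l) = 1" using a(2) by (simp add: dd_def w_def)
    then have "(2 :: complex) ^ (wl i * w j) = 2 ^ (wl j * w i)" unfolding ps by (simp add: field_simps)
    then have "of_nat (2 ^ (wl i * w j)) = (of_nat (2 ^ (wl j * w i)) :: complex)" by simp
    then have "(2 :: nat) ^ (wl i * w j) = 2 ^ (wl j * w i)" by (simp only: of_nat_eq_iff)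
    then show ?thesis by simp
  qed
  have "(\<Sum>i<n. w i) = (\<Sum>i=1..p. \<Sum>j<n. a (i, j))" unfolding w_def by (rule sum.swap)
  also have "\<dots> = (\<Sum>i=1..p. d * k)" by (rule sum.cong) (simp_all add: expsD(2)[OF a(1)])
  finally have wt: "(\<Sum>i<n. w i) = p * (d * k)" by simp
  \<comment> \<open>Summing the proportionality over i replaces both vectors by their totals
    \<open>p * k\<close> and \<open>p * (d * k)\<close>, which identifies the factor as d.\<close>
  have "(\<Sum>i<n. wl i * w j) = (\<Sum>i<n. wl j * w i)"
    by (rule sum.cong) (use eq in auto)
  then have "p * k * w j = wl j * (p * (d * k))" unfolding sum_distrib_right[symmetric] sum_distrib_left[symmetric] tot wt .
  then have "(p * k) * w j = (p * k) * (d * wl j)" by (simp only: mult_ac)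
  then show ?thesis using pos by (simp add: w_def)
qed

text \<open>The character with exponents d\<lambda> is trivial on the kernel of the one with
  exponents \<lambda>, which gives one inclusion. For the other, all unitriangular matrices and all
  diagonal ones in the kernel occur as group elements, and \<open>weight_from_kernel\<close> yields
  the weight.\<close>

theorem B_space_eq:
  assumes tot: "(\<Sum>j<n. part la j) = p * k" and pos: "0 < p * k"
  shows "B_space scale p k (lower_by 1) (T_kernel scale n e diagonal_group la) d =
    pb ` hwv_space p n (d * k) (\<lambda>j. d * part la j)"
proof
  show "pb ` hwv_space p n (d * k) (\<lambda>j. d * part la j) \<subseteq>
      B_space scale p k (lower_by 1) (T_kernel scale n e diagonal_group la) d"
  proof (rule image_subsetI)
    fix F assume "F \<in> hwv_space p n (d * k) (\<lambda>j. d * part la j)"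
    then have F: "F \<in> hom_space p n (\<lambda>_. d * k)" and ui: "unip_inv n F" and hw: "has_weight n (\<lambda>j. d * part la j) F"
      by (simp_all add: hwv_space_def)
    have 1: "gl_act g (pb F) = pb F" if g: "g \<in> lower_by 1" for g
      using ui unitri_lower_by_1[OF g] unfolding gl_act_fixed_iff[OF lower_byD(1)[OF g] F] unip_inv_def by blast
    have 2: "gl_act g (pb F) = pb F" if g: "g \<in> T_kernel scale n e diagonal_group la" for g
    proof -
      have gd: "g \<in> diagonal_group" and g1: "(\<Prod>i<n. torus_coord scale e i g ^ part la i) = 1"
        using g by (simp_all add: T_kernel_def)
      have gc: "g \<in> carrier (GL scale)" using gd by (simp add: diagonal_group_def)
      define s where "s j = coord j (g (e j))" for j
      have ge: "g (e j) = scale (s j) (e j)" if j: "j < n" for j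
      proof -
        obtain c where c: "g (e j) = scale c (e j)" using gd j by (auto simp: diagonal_group_def)
        then show ?thesis using j by (simp add: s_def coord_simps coord_basis)
      qed
      have tc: "torus_coord scale e j g = s j" if j: "j < n" for j
        unfolding torus_coord_def
      proof (rule the_equality)
        show "g (e j) = scale (s j) (e j)" by (rule ge[OF j])
        fix c assume "g (e j) = scale c (e j)"
        then show "c = s j" using j by (simp add: s_def coord_simps coord_basis)
      qed
      have s0: "s j \<noteq> 0" if j: "j < n" for j
      proof
        assume "s j = 0"
        then have "g (e j) = g 0" using ge[OF j] vp.linear_0[OF linear_on_GL[OF gc]] by simp
        then have "e j = 0" using bij_is_inj[OF bij_on_GL[OF gc]] by (simp add: inj_eq)
        then show False using coord_basis[OF j j] coord_simps(4)[of j] by simp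
      qed
      have "(\<Prod>j<n. s j ^ part la j) = 1" using g1 by (simp add: tc)
      moreover have "(\<Prod>j<n. s j ^ (d * part la j)) = (\<Prod>j<n. s j ^ part la j) ^ d"
        unfolding prod_power_distrib by (rule prod.cong) (simp_all add: power_mult[symmetric] mult.commute)
      ultimately have sd: "(\<Prod>j<n. s j ^ (d * part la j)) = 1" by simp
      have "F (rmul n z (\<lambda>l j. coord l (g (e j)))) = F z" for z
      proof -
        have "F (rmul n z (\<lambda>l j. coord l (g (e j)))) = F (rmul n z (\<lambda>l j. if l = j then s j else 0))"
          by (rule rmul_cong[OF F]) (simp add: ge coord_simps coord_basis)
        also have "\<dots> = F (col_scale s z)" by (rule hom_space_cong[OF F]) (rule rmul_diagonal)
        also have "\<dots> = F z" using hw s0 sd unfolding has_weight_def by simp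
        finally show ?thesis .
      qed
      then show ?thesis unfolding gl_act_fixed_iff[OF gc F] ..
    qed
    show "pb F \<in> B_space scale p k (lower_by 1) (T_kernel scale n e diagonal_group la) d"
      unfolding B_space_def invariants_def A_space_eq using F 1 2 by blast
  qed
  show "B_space scale p k (lower_by 1) (T_kernel scale n e diagonal_group la) d \<subseteq>
      pb ` hwv_space p n (d * k) (\<lambda>j. d * part la j)"
  proof
    fix H assume H: "H \<in> B_space scale p k (lower_by 1) (T_kernel scale n e diagonal_group la) d"
    then have "H \<in> pb ` hom_space p n (\<lambda>_. d * k)" unfolding B_space_def invariants_def A_space_eq by blast
    then obtain F where HF: "H = pb F" and F: "F \<in> hom_space p n (\<lambda>_. d * k)" by (rule imageE)
    have 1: "gl_act g (pb F) = pb F" if "g \<in> lower_by 1" for g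
      using H that unfolding HF B_space_def invariants_def by blast
    have 2: "gl_act g (pb F) = pb F" if "g \<in> T_kernel scale n e diagonal_group la" for g
      using H that unfolding HF B_space_def invariants_def by blast
    have ui: "unip_inv n F"
      unfolding unip_inv_def
    proof (intro allI impI)
      fix u z assume u: "unitri n u"
      note g = matrix_map_lower_by_1[OF u]
      have "F (rmul n z (\<lambda>l j. coord l (matrix_map u (e j)))) = F z"
        using 1[OF g] unfolding gl_act_fixed_iff[OF lower_byD(1)[OF g] F] by blast
      moreover have "F (rmul n z (\<lambda>l j. coord l (matrix_map u (e j)))) = F (rmul n z u)"
        by (rule rmul_cong[OF F]) (rule coord_matrix_map_basis)
      ultimately show "F (rmul n z u) = F z" by simp
    qed
    have ker: "\<forall>z. F (col_scale s z) = F z" if s: "\<forall>j<n. s j \<noteq> 0" "(\<Prod>j<n. s j ^ part la j) = 1" for s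
    proof
      fix z
      let ?u = "\<lambda>l j. if l = j then s j else 0"
      have gc: "matrix_map ?u \<in> carrier (GL scale)" by (rule matrix_map_GL) (use s(1) in simp_all)
      have ge: "matrix_map ?u (e j) = scale (s j) (e j)" if "j < n" for j
        by (rule coord_eqI) (use that in \<open>simp add: coord_matrix_map_basis coord_simps coord_basis\<close>)
      have tc: "torus_coord scale e j (matrix_map ?u) = s j" if j: "j < n" for j
        unfolding torus_coord_def
      proof (rule the_equality)
        show "matrix_map ?u (e j) = scale (s j) (e j)" by (rule ge[OF j])
        fix c assume "matrix_map ?u (e j) = scale c (e j)"
        then have "coord j (scale (s j) (e j)) = coord j (scale c (e j))" unfolding ge[OF j] by (rule arg_cong)
        then show "c = s j" using j by (simp add: coord_simps coord_basis)
      qed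
      have "matrix_map ?u \<in> T_kernel scale n e diagonal_group la"
        unfolding T_kernel_def diagonal_group_def using gc ge s(2) by (auto simp: tc)
      from 2[OF this] have "F (rmul n z (\<lambda>l j. coord l (matrix_map ?u (e j)))) = F z"
        unfolding gl_act_fixed_iff[OF gc F] by blast
      moreover have "F (rmul n z (\<lambda>l j. coord l (matrix_map ?u (e j)))) = F (rmul n z ?u)"
        by (rule rmul_cong[OF F]) (rule coord_matrix_map_basis)
      moreover have "F (rmul n z ?u) = F (col_scale s z)" by (rule hom_space_cong[OF F]) (rule rmul_diagonal)
      ultimately show "F (col_scale s z) = F z" by simp
    qed
    have ker': "\<forall>s. (\<forall>j<n. s j \<noteq> 0) \<longrightarrow> (\<Prod>j<n. s j ^ part la j) = 1 \<longrightarrow> (\<forall>z. F (col_scale s z) = F z)"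
      by (intro allI impI) (rule spec[OF ker])
    obtain c where c: "F = (\<Sum>a\<in>exps p n (\<lambda>_. d * k). cscale (c a) (monf (grid p n) a))"
      by (rule hom_space_expand[OF F])
    have "has_weight n (\<lambda>j. d * part la j) F"
      unfolding has_weight_def
    proof (intro allI impI)
      fix s :: "nat \<Rightarrow> complex" and z
      have "c a * ((\<Prod>j<n. s j ^ (\<Sum>i=1..p. a (i, j))) * monf (grid p n) a z) =
          (\<Prod>j<n. s j ^ (d * part la j)) * (c a * monf (grid p n) a z)" if a: "a \<in> exps p n (\<lambda>_. d * k)" for a
      proof (cases "c a = 0")
        case False
        have "(\<Prod>j<n. s j ^ (\<Sum>i=1..p. a (i, j))) = (\<Prod>j<n. s j ^ (d * part la j))"
          by (rule prod.cong) (simp_all add: weight_from_kernel[OF c ker' tot pos a False] del: One_nat_def)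
        then show ?thesis by simp
      qed simp
      then show "F (col_scale s z) = (\<Prod>j<n. s j ^ (d * part la j)) * F z"
        unfolding c sum_fun_apply cscale_apply monf_col_scale sum_distrib_left by (intro sum.cong) simp_all
    qed
    then have "F \<in> hwv_space p n (d * k) (\<lambda>j. d * part la j)" using F ui by (simp add: hwv_space_def)
    then show "H \<in> pb ` hwv_space p n (d * k) (\<lambda>j. d * part la j)" unfolding HF by (rule imageI)
  qed
qed

end

section \<open>The asymptotic multiplicities\<close>

text \<open>Exponents do not exceed m, so on a curve with base above m no two monomials fall
  together.\<close>

lemma hom_space_curve:
  assumes F: "F \<in> hom_space p n (\<lambda>_. m)" "F \<noteq> 0" and M: "m < M"
  shows "\<exists>P. P \<noteq> 0 \<and> (\<forall>t. F (curve M (lexpos n) t) = poly P t)"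
proof -
  let ?E = "exps p n (\<lambda>_. m)" and ?w = "wt M (lexpos n) (grid p n)"
  obtain c where c: "F = (\<Sum>a\<in>?E. cscale (c a) (monf (grid p n) a))" by (rule hom_space_expand[OF F(1)])
  have "\<exists>b\<in>?E. c b \<noteq> 0"
  proof (rule ccontr)
    assume "\<not> (\<exists>b\<in>?E. c b \<noteq> 0)"
    then have "F = (\<Sum>a\<in>?E. 0)" unfolding c by (intro sum.cong) simp_all
    then show False using F(2) by simp
  qed
  then obtain b where b: "b \<in> ?E" "c b \<noteq> 0" by blast
  define P where "P = (\<Sum>a\<in>?E. monom (c a) (?w a))"
  have ev: "F (curve M (lexpos n) t) = poly P t" for t
    unfolding c sum_fun_apply cscale_apply P_def poly_sum poly_monom monf_curve ..
  have lt: "x q < M" if x: "x \<in> ?E" and q: "q \<in> grid p n" for x q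
  proof -
    obtain i j where ij: "q = (i, j)" by (cases q)
    have "i \<in> {1..p}" using q by (simp add: ij)
    then have "x (i, j) \<le> m" by (rule expsD(3)[OF x])
    then show ?thesis using M by (simp add: ij)
  qed
  have "coeff P (?w b) = (\<Sum>a\<in>?E. if a = b then c b else 0)"
    unfolding P_def coeff_sum
  proof (rule sum.cong[OF refl])
    fix a assume a: "a \<in> ?E"
    have "a = b" if eq: "?w a = ?w b"
    proof -
      have "\<forall>q\<in>grid p n. a q = b q"
        by (rule wt_inj[OF _ inj_on_lexpos lt[OF a] lt[OF b(1)] eq]) simp_all
      then show ?thesis by (rule exps_eq_on_grid[OF a b(1)])
    qed
    then show "coeff (monom (c a) (?w a)) (?w b) = (if a = b then c b else 0)" unfolding coeff_monom by auto
  qed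
  also have "\<dots> = c b" using b(1) finite_exps by simp
  finally have "P \<noteq> 0" using b(2) by auto
  then show ?thesis using ev by blast
qed

text \<open>A common base above both degrees keeps both factors nonzero on the same curve, where
  polynomials in t have no zero divisors.\<close>

lemma hom_space_domain:
  assumes F: "F \<in> hom_space p n (\<lambda>_. m)" and G: "G \<in> hom_space p n (\<lambda>_. m')" and FG: "F * G = 0"
  shows "F = 0 \<or> G = 0"
proof (rule ccontr)
  assume n: "\<not> (F = 0 \<or> G = 0)"
  define M where "M = Suc (m + m')"
  have "m < M" "m' < M" by (simp_all add: M_def)
  obtain P where P: "P \<noteq> 0" "\<forall>t. F (curve M (lexpos n) t) = poly P t" using hom_space_curve[OF F _ \<open>m < M\<close>] n by blast
  obtain Q where Q: "Q \<noteq> 0" "\<forall>t. G (curve M (lexpos n) t) = poly Q t" using hom_space_curve[OF G _ \<open>m' < M\<close>] n by blast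
  have "poly (P * Q) t = 0" for t
  proof -
    have "poly (P * Q) t = (F * G) (curve M (lexpos n) t)" using P(2) Q(2) by simp
    then show ?thesis unfolding FG by simp
  qed
  then have "P * Q = 0" by (rule poly_eq_0_everywhere)
  then show False using P(1) Q(1) by simp
qed

lemma basis_of_image:
  assumes f: "clinear f" "inj_on f W" and B: "basis_of W B"
  shows "basis_of (f ` W) (f ` B)"
proof -
  note D = basis_ofD[OF B]
  have "cfun.independent (f ` B)"
    by (rule cpair.linear_independent_injective_image[OF f(1) D(2)]) (use f(2) D(3) in simp)
  moreover have "cfun.span (f ` B) = f ` W" unfolding cpair.linear_span_image[OF f(1)] D(3) ..
  ultimately show ?thesis using D(1) by (simp add: basis_of_def)
qed

lemma left_act_gl_act: "gl_act g (left_act \<sigma> F) = left_act \<sigma> (gl_act g F)"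
  by (rule ext) (simp add: gl_act_def left_act_def right_act_def comp_def)

lemma left_act_A_space:
  assumes s: "\<sigma> \<in> carrier (sym_group p)" and F: "F \<in> A_space scale p k d"
  shows "left_act \<sigma> F \<in> A_space scale p k d"
proof -
  let ?S = "{tensor p x | x. \<forall>i\<in>{1..p}. x i \<in> sym_power scale (d * k)}"
  have perm: "\<sigma> permutes {1..p}" using s by (simp add: sym_group_carrier)
  have "left_act \<sigma> F \<in> left_act \<sigma> ` cfun.span ?S"
    using F unfolding A_space_def tensor_power_def by (rule imageI)
  also have "left_act \<sigma> ` cfun.span ?S = cfun.span (left_act \<sigma> ` ?S)"
    by (rule cpair.linear_span_image[OF clinear_left_act, symmetric])
  also have "\<dots> \<subseteq> cfun.span ?S"
  proof (rule cfun.span_mono, rule image_subsetI)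
    fix F assume "F \<in> ?S"
    then obtain x where x: "F = tensor p x" "\<forall>i\<in>{1..p}. x i \<in> sym_power scale (d * k)" by blast
    have "(x \<circ> inv' \<sigma>) i \<in> sym_power scale (d * k)" if i: "i \<in> {1..p}" for i
    proof -
      have "inv' \<sigma> i \<in> {1..p}" using permutes_in_image[OF permutes_inv[OF perm], of i] i by blast
      then show ?thesis unfolding comp_def by (rule bspec[OF x(2)])
    qed
    then show "left_act \<sigma> F \<in> ?S" unfolding x(1) left_act_tensor[OF perm] by (intro CollectI exI[of _ "x \<circ> inv' \<sigma>"]) simp
  qed
  finally show ?thesis unfolding A_space_def tensor_power_def .
qed

lemma left_act_B_space:
  assumes s: "\<sigma> \<in> carrier (sym_group p)" and F: "F \<in> B_space scale p k U Tla d"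
  shows "left_act \<sigma> F \<in> B_space scale p k U Tla d"
proof -
  have "F \<in> A_space scale p k d" "\<forall>h\<in>U. gl_act h F = F" "\<forall>h\<in>Tla. gl_act h F = F"
    using F by (simp_all add: B_space_def invariants_def)
  then show ?thesis
    using left_act_A_space[OF s, of F scale k d] by (simp add: B_space_def invariants_def left_act_gl_act)
qed

lemma left_act_finite_order:
  assumes s: "\<sigma> \<in> carrier (sym_group p)"
  shows "\<exists>M>0. \<forall>F :: (nat \<Rightarrow> 'y) \<Rightarrow> complex. (left_act \<sigma> ^^ M) F = F"
proof -
  have "permutation \<sigma>" using s permutes_imp_permutation[of "{1..p}" \<sigma>] by (simp add: sym_group_carrier)
  then obtain M where M: "\<sigma> ^^ M = id" "M > 0" using permutation_is_nilpotent by blast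
  have "(left_act \<sigma> ^^ j) F \<phi> = F (\<phi> \<circ> \<sigma> ^^ j)" for j \<phi> and F :: "(nat \<Rightarrow> 'y) \<Rightarrow> complex"
  proof (induction j arbitrary: \<phi>)
    case (Suc j)
    have "(left_act \<sigma> ^^ Suc j) F \<phi> = (left_act \<sigma> ^^ j) F (\<phi> \<circ> \<sigma>)"
      by (simp add: left_act_apply[OF s])
    also have "\<dots> = F (\<phi> \<circ> \<sigma> \<circ> \<sigma> ^^ j)" by (rule Suc.IH)
    finally show ?case by (simp only: funpow.simps(2) comp_assoc)
  qed simp
  then have "(left_act \<sigma> ^^ M) F = F" for F :: "(nat \<Rightarrow> 'y) \<Rightarrow> complex" using M(1) by (intro ext) simp
  then show ?thesis using M(2) by blast
qed

context flagged_space
begin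

lemma pullback_hwv_basics:
  fixes p m w
  defines "W \<equiv> pb ` hwv_space p n m w"
  shows "fin_dim W" "cfun.dim W = card (gt_patterns p n m w)" "cfun.subspace W"
proof -
  obtain B where B: "basis_of (hwv_space p n m w) B" by (rule fin_dim_basis[OF fin_dim_hwv_space])
  have inj: "inj_on pb (hwv_space p n m w)"
  proof (rule inj_onI)
    fix F G assume "F \<in> hwv_space p n m w" "G \<in> hwv_space p n m w" and eq: "pb F = pb G"
    then have "F \<in> hom_space p n (\<lambda>_. m)" "G \<in> hom_space p n (\<lambda>_. m)" by (simp_all add: hwv_space_def)
    then show "F = G" using eq by (rule pullback_eqD)
  qed
  have b: "basis_of W (pb ` B)" unfolding W_def by (rule basis_of_image[OF clinear_pullback inj B])
  show "fin_dim W" by (rule basis_of_fin_dim[OF b])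
  then show "cfun.subspace W" by (simp add: fin_dim_def)
  have "card (pb ` B) = card B" by (rule card_image[OF inj_on_subset[OF inj basis_ofD(4)[OF B]]])
  then show "cfun.dim W = card (gt_patterns p n m w)"
    unfolding basis_of_card[OF b, symmetric] dim_hwv_space[symmetric] basis_of_card[OF B, symmetric] .
qed

lemma pullback_hwv_times:
  assumes "F \<in> pb ` hwv_space p n (d * k) (\<lambda>j. d * \<nu> j)" "G \<in> pb ` hwv_space p n (d' * k) (\<lambda>j. d' * \<nu> j)"
  shows "F * G \<in> pb ` hwv_space p n ((d + d') * k) (\<lambda>j. (d + d') * \<nu> j)" "F * G = 0 \<Longrightarrow> F = 0 \<or> G = 0"
proof -
  obtain f where F: "F = pb f" and f: "f \<in> hwv_space p n (d * k) (\<lambda>j. d * \<nu> j)" using assms(1) by (rule imageE)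
  obtain g where G: "G = pb g" and g: "g \<in> hwv_space p n (d' * k) (\<lambda>j. d' * \<nu> j)" using assms(2) by (rule imageE)
  have f': "f \<in> hom_space p n (\<lambda>_. d * k)" "unip_inv n f" "has_weight n (\<lambda>j. d * \<nu> j) f"
    and g': "g \<in> hom_space p n (\<lambda>_. d' * k)" "unip_inv n g" "has_weight n (\<lambda>j. d' * \<nu> j) g"
    using f g by (simp_all add: hwv_space_def)
  have h: "f * g \<in> hom_space p n (\<lambda>_. (d + d') * k)"
    using hom_space_times[OF f'(1) g'(1)] by (simp only: add_mult_distrib)
  have "has_weight n (\<lambda>j. (d + d') * \<nu> j) (f * g)"
    using has_weight_times[OF f'(3) g'(3)] by (simp only: add_mult_distrib)
  then have "f * g \<in> hwv_space p n ((d + d') * k) (\<lambda>j. (d + d') * \<nu> j)"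
    using h unip_inv_times[OF f'(2) g'(2)] by (simp add: hwv_space_def)
  then show "F * G \<in> pb ` hwv_space p n ((d + d') * k) (\<lambda>j. (d + d') * \<nu> j)"
    unfolding F G pullback_times[symmetric] by (rule imageI)
  have pb0: "pb 0 = 0" by (rule cpair.linear_0[OF clinear_pullback])
  show "F = 0 \<or> G = 0" if "F * G = 0"
  proof -
    have "pb (f * g) = pb 0" using that unfolding F G pullback_times pb0 .
    then have "f * g = 0" by (rule pullback_eqD[OF h cfun.subspace_0[OF subspace_hom_space]])
    then have "f = 0 \<or> g = 0" by (rule hom_space_domain[OF f'(1) g'(1)])
    then show ?thesis unfolding F G using pb0 by blast
  qed
qed

lemma one_in_pullback_hwv: "1 \<in> pb ` hwv_space p n (0 * k) (\<lambda>j. 0 * \<nu> j)"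
proof (rule image_eqI)
  show "1 = pb 1" by (rule ext) (simp add: pullback_def)
  have one: "1 = monf (grid p n) (\<lambda>_. 0)" by (rule ext) (simp add: monf_def)
  have "1 \<in> hom_space p n (\<lambda>_. 0)" unfolding one by (rule monf_in_hom_space) simp
  then show "1 \<in> hwv_space p n (0 * k) (\<lambda>j. 0 * \<nu> j)"
    by (simp add: hwv_space_def unip_inv_def has_weight_def)
qed

lemma character_ratio_tendsto_0:
  fixes p k :: nat and la :: "nat list"
  defines "W \<equiv> \<lambda>d. pb ` hwv_space p n (d * k) (\<lambda>j. d * part la j)"
  assumes la: "partition_of (p * k) la" "length la \<le> p" and pn: "p \<le> n"
    and inv: "\<And>d F. F \<in> W d \<Longrightarrow> left_act \<sigma> F \<in> W d"
    and s: "\<sigma> \<in> carrier (sym_group p)" and ns: "\<forall>c. c \<noteq> 0 \<longrightarrow> (\<exists>F\<in>W d0. left_act \<sigma> F \<noteq> cscale c F)"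
  shows "(\<lambda>d. character (W d) \<sigma> / of_nat (cfun.dim (W d))) \<longlonglongrightarrow> 0"
proof -
  obtain M where M: "M > 0" "\<forall>F :: (nat \<Rightarrow> 'v \<Rightarrow> complex) \<Rightarrow> complex. (left_act \<sigma> ^^ M) F = F"
    using left_act_finite_order[OF s] by blast
  have dimW: "cfun.dim (W d) = card (gt_patterns p n (d * k) (\<lambda>j. d * part la j))" for d
    unfolding W_def by (rule pullback_hwv_basics(2))
  interpret graded_domain "left_act \<sigma> :: ((nat \<Rightarrow> 'v \<Rightarrow> complex) \<Rightarrow> complex) \<Rightarrow> _" M W
  proof (intro graded_domain.intro finite_order_operator.intro graded_domain_axioms.intro)
    show "clinear (left_act \<sigma>)" by (rule clinear_left_act)
    show "0 < M" by (rule M(1))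
    show "(left_act \<sigma> ^^ M) F = F" for F :: "(nat \<Rightarrow> 'v \<Rightarrow> complex) \<Rightarrow> complex" using M(2) by blast
    show "fin_dim (W d)" for d unfolding W_def by (rule pullback_hwv_basics(1))
    show "left_act \<sigma> ` W d \<subseteq> W d" for d by (rule image_subsetI) (rule inv)
    show "F * G \<in> W (d + d')" if "F \<in> W d" "G \<in> W d'" for d d' F G
      using that unfolding W_def by (rule pullback_hwv_times(1))
    show "F = 0 \<or> G = 0" if "F \<in> W d" "G \<in> W d'" "F * G = 0" for d d' F G
      using that unfolding W_def by (rule pullback_hwv_times(2))
    show "1 \<in> W 0" unfolding W_def by (rule one_in_pullback_hwv)
    show "left_act \<sigma> (F * G) = left_act \<sigma> F * left_act \<sigma> G" for F G :: "(nat \<Rightarrow> 'v \<Rightarrow> complex) \<Rightarrow> complex"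
      by (rule ext) (simp add: left_act_def right_act_def)
    show "left_act \<sigma> (1 :: (nat \<Rightarrow> 'v \<Rightarrow> complex) \<Rightarrow> complex) = 1"
      by (rule ext) (simp add: left_act_def right_act_def)
    show "(\<lambda>d. real (cfun.dim (W (d + D))) / real (cfun.dim (W d))) \<longlonglongrightarrow> 1" for D
      unfolding dimW by (rule gt_ratio_tendsto_1(1)[OF la pn])
    show "0 < cfun.dim (W d)" for d unfolding dimW by (rule gt_ratio_tendsto_1(2)[OF la pn])
  qed
  show ?thesis unfolding character_def by (rule trace_ratio_tendsto_0[of d0]) (use ns in blast)
qed

end

text \<open>In the character formula divided by the dimension only the identity survives in the
  limit; its normalized character on \<open>Bd d\<close> is 1 and its character on the Specht module
  is the dimension.\<close>

lemma multiplicity_ratio_limit: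
  fixes Bd :: "nat \<Rightarrow> ((nat \<Rightarrow> 'y) \<Rightarrow> complex) set"
  assumes mu: "partition_of p mu" and rep: "\<And>d. sym_subrep p (Bd d)" and fd: "\<And>d. fin_dim (Bd d)"
    and pos: "\<And>d. 0 < cfun.dim (Bd d)"
    and char0: "\<And>\<sigma>. \<sigma> \<in> carrier (sym_group p) \<Longrightarrow> \<sigma> \<noteq> id \<Longrightarrow>
      (\<lambda>d. character (Bd d) \<sigma> / of_nat (cfun.dim (Bd d))) \<longlonglongrightarrow> 0"
  shows "(\<lambda>d. real (multiplicity_in p (specht p mu) (Bd d)) / real (cfun.dim (Bd d)))
    \<longlonglongrightarrow> real (cfun.dim (specht p mu)) / fact p"
proof -
  let ?S = "specht p mu" and ?G = "carrier (sym_group p)"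
  have idG: "id \<in> ?G" by (simp add: sym_group_carrier permutes_id)
  have lim: "(\<lambda>d. character (Bd d) (inv' \<sigma>) / of_nat (cfun.dim (Bd d))) \<longlonglongrightarrow> (if \<sigma> = id then 1 else 0)" if s: "\<sigma> \<in> ?G" for \<sigma>
  proof (cases "\<sigma> = id")
    case True
    have "character (Bd d) (inv' \<sigma>) / of_nat (cfun.dim (Bd d)) = 1" for d
    proof -
      have "inv' \<sigma> = id" unfolding True by (rule inv_id)
      then have "character (Bd d) (inv' \<sigma>) = trace_on (Bd d) (left_act id)" by (simp only: character_def)
      also have "\<dots> = 1 * of_nat (cfun.dim (Bd d))"
        by (rule trace_on_scalar[OF fd clinear_left_act]) (simp add: left_act_id)
      finally have e: "character (Bd d) (inv' \<sigma>) = 1 * of_nat (cfun.dim (Bd d))" .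
      have "(of_nat (cfun.dim (Bd d)) :: complex) \<noteq> 0" using pos[of d] by simp
      then show ?thesis unfolding e by simp
    qed
    then have one: "(\<lambda>d. character (Bd d) (inv' \<sigma>) / of_nat (cfun.dim (Bd d))) = (\<lambda>_. 1)" by (rule ext)
    show ?thesis unfolding one unfolding True by (simp only: if_True tendsto_const simp_thms)
  next
    case False
    have "inv' \<sigma> \<noteq> id"
    proof
      assume "inv' \<sigma> = id"
      moreover have "\<sigma> \<circ> inv' \<sigma> = id" using s by (simp add: sym_group_carrier permutes_inv_o)
      ultimately show False using False by simp
    qed
    then show ?thesis using char0[OF sym_group_inv_closed[OF s]] False by simp
  qed
  have "(\<lambda>d. (\<Sum>\<sigma>\<in>?G. character ?S \<sigma> * (character (Bd d) (inv' \<sigma>) / of_nat (cfun.dim (Bd d)))) / fact p)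
      \<longlonglongrightarrow> (\<Sum>\<sigma>\<in>?G. character ?S \<sigma> * (if \<sigma> = id then 1 else 0)) / fact p"
    by (intro tendsto_divide tendsto_sum tendsto_mult tendsto_const lim) simp_all
  moreover have "(\<Sum>\<sigma>\<in>?G. character ?S \<sigma> * (if \<sigma> = id then 1 else 0)) = of_nat (cfun.dim ?S)"
  proof -
    have "(\<Sum>\<sigma>\<in>?G. character ?S \<sigma> * (if \<sigma> = id then 1 else 0)) = (\<Sum>\<sigma>\<in>?G. if \<sigma> = id then character ?S id else 0)"
      by (rule sum.cong) simp_all
    also have "\<dots> = character ?S id" using idG finite_sym_group by simp
    also have "\<dots> = 1 * of_nat (cfun.dim ?S)"
      unfolding character_def by (rule trace_on_scalar[OF fin_dim_specht clinear_left_act]) (simp add: left_act_id)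
    finally show ?thesis by simp
  qed
  moreover have "(\<Sum>\<sigma>\<in>?G. character ?S \<sigma> * (character (Bd d) (inv' \<sigma>) / of_nat (cfun.dim (Bd d)))) / fact p =
      of_real (real (multiplicity_in p ?S (Bd d)) / real (cfun.dim (Bd d)))" for d
  proof -
    have m: "of_nat (multiplicity_in p ?S (Bd d)) = character_product p ?S (Bd d)"
      by (rule multiplicity_eq_character_product[OF irreducible_specht[OF mu] fin_dim_specht scalar_endomorphisms_specht[OF mu] rep fd])
    have a: "(\<Sum>\<sigma>\<in>?G. character ?S \<sigma> * (character (Bd d) (inv' \<sigma>) / of_nat (cfun.dim (Bd d)))) =
        (\<Sum>\<sigma>\<in>?G. character ?S \<sigma> * character (Bd d) (inv' \<sigma>)) / of_nat (cfun.dim (Bd d))"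
      by (simp only: sum_divide_distrib times_divide_eq_right)
    have b: "of_real (real (multiplicity_in p ?S (Bd d)) / real (cfun.dim (Bd d))) =
        (of_nat (multiplicity_in p ?S (Bd d)) / of_nat (cfun.dim (Bd d)) :: complex)" by simp
    show ?thesis unfolding a b m character_product_def by (simp only: divide_divide_eq_left mult.commute)
  qed
  ultimately have "(\<lambda>d. of_real (real (multiplicity_in p ?S (Bd d)) / real (cfun.dim (Bd d))) :: complex)
      \<longlonglongrightarrow> of_real (real (cfun.dim ?S) / fact p)" by simp
  then show ?thesis by (simp only: tendsto_of_real_iff)
qed

theorem theorem4:
  fixes scale :: "complex \<Rightarrow> 'v::ab_group_add \<Rightarrow> 'v"
    and p k n :: nat
    and la :: "nat list"
    and B T U :: "('v \<Rightarrow> 'v) set"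
    and e :: "nat \<Rightarrow> 'v"
    and Bd :: "nat \<Rightarrow> ((nat \<Rightarrow> 'v \<Rightarrow> complex) \<Rightarrow> complex) set"
  assumes "1 \<le> p" and "1 \<le> k"
    and "partition_of (p * k) la" and "length la \<le> p"
    and "\<exists>basis. finite_dimensional_vector_space scale basis"
    and "n = vector_space.dim scale (UNIV :: 'v set)" and "p \<le> n"
    and "borel_subgroup scale B"
    and "maximal_torus scale B T"
    and "maximal_unipotent_subgroup scale B U"
    and "B = T <#>\<^bsub>GL scale\<^esub> U"
    and "adapted_basis scale n B T e"
    and "Bd = B_space scale p k U (T_kernel scale n e T la)"
    and "PK p Bd = {id}"
  shows "\<forall>mu. partition_of p mu \<longrightarrow>
    ((\<lambda>d. real (multiplicity_in p (specht p mu) (Bd d)) / real (cfun.dim (Bd d)))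
       \<longlonglongrightarrow> real (cfun.dim (specht p mu)) / fact p)"
proof (intro allI impI)
  fix mu assume mu: "partition_of p mu"
  note la = assms(3,4) and pn = assms(7)
  have vs: "vector_space scale" using assms(5) by (auto simp: finite_dimensional_vector_space_def)
  interpret flagged_space scale n e
    by (intro flagged_space.intro flagged_space_axioms.intro vs) (use assms(12) in \<open>simp_all add: adapted_basis_def\<close>)
  note TU = adapted_groups[OF assms(8-10,12)]
  define W where "W d = pb ` hwv_space p n (d * k) (\<lambda>j. d * part la j)" for d
  have tot: "(\<Sum>j<n. part la j) = p * k" by (rule sum_part[OF la(1)]) (use la(2) pn in simp)
  have pk: "0 < p * k" using assms(1,2) by simp
  have BdW: "Bd = W"
    unfolding assms(13) TU by (rule ext) (simp only: B_space_eq[OF tot pk] W_def)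
  have inv: "left_act \<sigma> F \<in> W d" if "\<sigma> \<in> carrier (sym_group p)" "F \<in> W d" for \<sigma> F d
    using that unfolding BdW[symmetric] assms(13) by (rule left_act_B_space)
  have sub: "cfun.subspace (W d)" and fd: "fin_dim (W d)"
    and dimW: "cfun.dim (W d) = card (gt_patterns p n (d * k) (\<lambda>j. d * part la j))" for d
    unfolding W_def by (rule pullback_hwv_basics)+
  have rep: "sym_subrep p (W d)" for d unfolding sym_subrep_def using sub inv by blast
  have pos: "0 < cfun.dim (W d)" for d unfolding dimW by (rule gt_ratio_tendsto_1(2)[OF la pn])
  have char0: "(\<lambda>d. character (W d) \<sigma> / of_nat (cfun.dim (W d))) \<longlonglongrightarrow> 0"
    if s: "\<sigma> \<in> carrier (sym_group p)" "\<sigma> \<noteq> id" for \<sigma>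
  proof -
    \<comment> \<open>Outside \<open>PK\<close> there is a degree in which \<sigma> is no nonzero
      scalar, which is what the estimate for graded domains starts from.\<close>
    have "\<sigma> \<notin> PK p W" using assms(14) s(2) unfolding BdW by simp
    then have "\<exists>d0. \<forall>c. c \<noteq> 0 \<longrightarrow> (\<exists>F\<in>W d0. left_act \<sigma> F \<noteq> cscale c F)"
      using s(1) unfolding PK_def by simp blast
    then obtain d0 where d0: "\<forall>c. c \<noteq> 0 \<longrightarrow> (\<exists>F\<in>W d0. left_act \<sigma> F \<noteq> cscale c F)" ..
    show ?thesis
      unfolding W_def
      by (rule character_ratio_tendsto_0[OF la pn _ s(1) d0[unfolded W_def]]) (rule inv[OF s(1), unfolded W_def])
  qed
  show "(\<lambda>d. real (multiplicity_in p (specht p mu) (Bd d)) / real (cfun.dim (Bd d)))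
      \<longlonglongrightarrow> real (cfun.dim (specht p mu)) / fact p"
    unfolding BdW by (rule multiplicity_ratio_limit[OF mu rep fd pos char0])
qed

end
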